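(* Let $1<p<\infty$, $p'=p/(p-1)$, and let $\phi,\psi,\psi_h,I,D,I_h$ be as in the context (in particular, strong duality $\inf I=\sup D$ holds, and $I_h$ satisfies the strong coercivity property with the functional $\sigma_{I_h}$). Let $u\in W^{1,p}_D(\Omega)$ and $u_h\in\mathcal{S}^{1,cr}_D(\mathcal{T}_h)$ be minimizers of $I$ and $I_h$, respectively, and let $z$ be a solution of the dual problem (a maximizer of $D$ in $W^{p'}_N(\operatorname{div};\Omega)$) with $z\in W^1_N(\operatorname{div};\Omega)\cap W^{1,1}(\Omega;\mathbb{R}^d)$. Then $$\begin{aligned}\sigma_{I_h}^2(u_h,\mathcal{I}_{cr}u)\le{}&\int_\Omega\big(D\phi^*(z)-D\phi^*(\Pi_{h,0}\mathcal{I}_{RT}z)\big)\cdot(z-\Pi_{h,0}\mathcal{I}_{RT}z)\,dx\\&+\int_\Omega\big(D\psi(\cdot,u)-D\psi_h(\cdot,\Pi_{h,0}\mathcal{I}_{cr}u)\big)(u-\Pi_{h,0}\mathcal{I}_{cr}u)\,dx\\&+\int_\Omega\psi_h(\cdot,u)-\psi(\cdot,u)\,dx+\int_\Omega\psi_h^*(\cdot,\Pi_{h,0}\operatorname{div}z)-\psi^*(\cdot,\operatorname{div}z)\,dx.\end{aligned}$$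
   Context: Let $d\in\{2,3\}$ and let $\Omega\subset\mathbb{R}^d$ be a bounded polyhedral Lipschitz domain, $\Gamma_D\subset\partial\Omega$, $\Gamma_N=\partial\Omega\setminus\Gamma_D$. $\mathcal{T}_h$ is a regular (conforming) triangulation of $\Omega$ into triangles ($d=2$) or tetrahedra ($d=3$), with set of sides (edges/faces) $\mathcal{S}_h$; every boundary side belongs to $\Gamma_D$ or to $\Gamma_N$ (up to null sets). $x_S,x_T$ denote barycenters of sides $S$ and elements $T$; $n$ is the outer unit normal on $\partial\Omega$, $n_S$ a fixed unit normal on each side. $W^{1,p}_D(\Omega)=\{v\in W^{1,p}(\Omega): v|_{\Gamma_D}=0\}$; $W^{q}_N(\operatorname{div};\Omega)=\{y\in L^q(\Omega;\mathbb{R}^d):\operatorname{div}y\in L^q(\Omega),\ y\cdot n=0\text{ on }\Gamma_N\}$, the boundary condition being understood weakly, i.e. $\int_\Omega y\cdot\nabla v+v\operatorname{div}y\,dx=0$ for all $v\in W^{1,q'}_D(\Omega)$. $\mathcal{L}^k(\mathcal{T}_h)^\ell$: elementwise polynomials of total degree at most $k$ with values in $\mathbb{R}^\ell$. $\Pi_{h,0}$: $L^2$ projection onto $\mathcal{L}^0(\mathcal{T}_h)^\ell$ (elementwise averaging). Crouzeix--Raviart space: $\mathcal{S}^{1,cr}(\mathcal{T}_h)=\{v_h\in\mathcal{L}^1(\mathcal{T}_h): v_h\text{ continuous at }x_S\ \forall S\in\mathcal{S}_h\}$; $\mathcal{S}^{1,cr}_D(\mathcal{T}_h)$: those with $v_h(x_S)=0$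 for sides $S\subset\Gamma_D$; $\nabla_h$: elementwise gradient; $\mathcal{I}_{cr}v\in\mathcal{S}^{1,cr}(\mathcal{T}_h)$ is determined by $(\mathcal{I}_{cr}v)(x_S)=|S|^{-1}\int_Sv\,ds$ for all $S$. Raviart--Thomas space $\mathcal{RT}^0(\mathcal{T}_h)$: fields $y_h\in L^1(\Omega;\mathbb{R}^d)$ with $\operatorname{div}y_h\in L^1(\Omega)$ and $y_h|_T(x)=a_T+b_T(x-x_T)$, $a_T\in\mathbb{R}^d,b_T\in\mathbb{R}$; for $z\in W^{1,1}(\Omega;\mathbb{R}^d)$, $\mathcal{I}_{RT}z\in\mathcal{RT}^0(\mathcal{T}_h)$ is determined by $(\mathcal{I}_{RT}z)|_S\cdot n_S=|S|^{-1}\int_Sz\cdot n_S\,ds$ for all $S$. Continuous problems: $\phi:\mathbb{R}^d\to\mathbb{R}$ and $\psi:\Omega\times\mathbb{R}\to\mathbb{R}\cup\{+\infty\}$ are measurable and convex ($\psi$ in its second argument), such that $$I(u)=\int_\Omega\phi(\nabla u)\,dx+\int_\Omega\psi(x,u)\,dx$$ on $W^{1,p}_D(\Omega)$ is bounded from below, coercive, weakly lower semicontinuous and not identically $+\infty$. The dual problem is to maximize $$D(z)=-\int_\Omega\phi^*(z)\,dx-\int_\Omega\psi^*(x,\operatorname{div}z)\,dx$$ over $W^{p'}_N(\operatorname{div};\Omega)$; a solution is assumed to exist, and strong duality $\inf_{W^{1,p}_D(\Omega)}I=\sup_{W^{p'}_N(\operatorname{div};\Omega)}D$ is assumed. Then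 solutions satisfy $z=D\phi(\nabla u)$ (equivalently $\nabla u=D\phi^*(z)$) and $\operatorname{div}z=D\psi(\cdot,u)$. Conjugates: $\phi^*(t)=\sup_{s\in\mathbb{R}^d}t\cdot s-\phi(s)$, $\psi^*(x,t)=\sup_{s\in\mathbb{R}}ts-\psi(x,s)$, and likewise $\psi_h^*$. $D\psi,D\psi_h$ are derivatives with respect to the second argument. Discrete problem: $\psi_h:\Omega\times\mathbb{R}\to\mathbb{R}\cup\{+\infty\}$ is convex in the second argument, elementwise constant in the first, and $$I_h(u_h)=\int_\Omega\phi(\nabla_hu_h)\,dx+\int_\Omega\psi_h(x,\Pi_{h,0}u_h)\,dx,\quad u_h\in\mathcal{S}^{1,cr}_D(\mathcal{T}_h).$$ Strong coercivity: with the variational derivative $\delta I_h$, $$I_h(v_h)+\delta I_h(v_h)[w_h-v_h]+\sigma_{I_h}^2(v_h,w_h)\le I_h(w_h)\quad\text{for all }v_h,w_h\in\mathcal{S}^{1,cr}_D(\mathcal{T}_h),$$ with a definite functional $\sigma_{I_h}$ ($\sigma_{I_h}\ge0$, vanishing only if $v_h=w_h$). The functions $\phi,\phi^*,\psi(x,\cdot),\psi_h(x,\cdot)$ are assumed differentiable so that the derivatives appearing are defined, and all integrals in the estimate are assumed to be well defined. *)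

theory Defs
  imports "HOL-Analysis.Analysis"
begin

text \<open>
  Functions on \<open>\<Omega>\<close> are represented by functions on the whole space; only their values almost
  everywhere in \<open>\<Omega>\<close> matter.  The space \<open>\<real>\<^sup>d\<close> is a type of class \<open>euclidean_space\<close>.
\<close>

section \<open>Calculus and extended-real convex analysis\<close>

definition grad :: "('a::euclidean_space \<Rightarrow> real) \<Rightarrow> 'a \<Rightarrow> 'a" where
  "grad f x = (\<Sum>i\<in>Basis. frechet_derivative f (at x) i *\<^sub>R i)"

definition C1_fun :: "('a::euclidean_space \<Rightarrow> real) \<Rightarrow> bool" where
  "C1_fun f \<longleftrightarrow> (\<forall>x. f differentiable (at x)) \<and> continuous_on UNIV (grad f)"

text \<open>
  Differentiability of an extended-real function at a point includes finiteness nearby.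
\<close>

definition ediff_at :: "('a::euclidean_space \<Rightarrow> ereal) \<Rightarrow> 'a \<Rightarrow> bool" where
  "ediff_at f x \<longleftrightarrow>
     (\<forall>\<^sub>F y in nhds x. \<bar>f y\<bar> \<noteq> \<infinity>) \<and> (\<lambda>y. real_of_ereal (f y)) differentiable (at x)"

definition egrad :: "('a::euclidean_space \<Rightarrow> ereal) \<Rightarrow> 'a \<Rightarrow> 'a" where
  "egrad f x = grad (\<lambda>y. real_of_ereal (f y)) x"

definition ederiv :: "(real \<Rightarrow> ereal) \<Rightarrow> real \<Rightarrow> real" where
  "ederiv f s = deriv (\<lambda>r. real_of_ereal (f r)) s"

definition econvex :: "('a::real_vector \<Rightarrow> ereal) \<Rightarrow> bool" where
  "econvex f \<longleftrightarrow> (\<forall>s t. \<forall>c\<in>{0..1::real}.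
     f ((1 - c) *\<^sub>R s + c *\<^sub>R t) \<le> ereal (1 - c) * f s + ereal c * f t)"

definition conjugate :: "('a::real_inner \<Rightarrow> ereal) \<Rightarrow> 'a \<Rightarrow> ereal" where
  "conjugate f t = (SUP s. ereal (t \<bullet> s) - f s)"

text \<open>
  Integral with values in the extended reals, meaningful for quasi-integrable integrands.
  In the remaining case \<open>\<infinity> - \<infinity>\<close> it has the value \<open>\<infinity>\<close>.
\<close>

definition qint :: "'a measure \<Rightarrow> ('a \<Rightarrow> ereal) \<Rightarrow> ereal" where
  "qint M f = enn2ereal (\<integral>\<^sup>+x. e2ennreal (f x) \<partial>M) - enn2ereal (\<integral>\<^sup>+x. e2ennreal (- f x) \<partial>M)"

definition quasi_integrable :: "'a measure \<Rightarrow> ('a \<Rightarrow> ereal) \<Rightarrow> bool" where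
  "quasi_integrable M f \<longleftrightarrow> f \<in> borel_measurable M \<and>
     ((\<integral>\<^sup>+x. e2ennreal (f x) \<partial>M) < \<infinity> \<or> (\<integral>\<^sup>+x. e2ennreal (- f x) \<partial>M) < \<infinity>)"

text \<open>
  The variational derivative \<open>\<delta>F(v)[w]\<close>, as the limit from the right: for convex \<open>F\<close> with \<open>F v\<close>
  finite it always exists in the extended reals, and it is the Gateaux derivative wherever \<open>F\<close>
  is Gateaux differentiable.
\<close>

definition variational_derivative ::
    "(('a \<Rightarrow> real) \<Rightarrow> ereal) \<Rightarrow> ('a \<Rightarrow> real) \<Rightarrow> ('a \<Rightarrow> real) \<Rightarrow> ereal" where
  "variational_derivative F v w = Lim (at_right 0) (\<lambda>t. (F (\<lambda>x. v x + t * w x) - F v) / ereal t)"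

definition minimizer_on :: "'a set \<Rightarrow> ('a \<Rightarrow> ereal) \<Rightarrow> 'a \<Rightarrow> bool" where
  "minimizer_on X F x \<longleftrightarrow> x \<in> X \<and> (\<forall>y\<in>X. F x \<le> F y)"

definition maximizer_on :: "'a set \<Rightarrow> ('a \<Rightarrow> ereal) \<Rightarrow> 'a \<Rightarrow> bool" where
  "maximizer_on X F x \<longleftrightarrow> x \<in> X \<and> (\<forall>y\<in>X. F y \<le> F x)"


section \<open>Domains and surface measure\<close>

text \<open>
  Near each boundary point, \<open>\<Omega>\<close> lies strictly on one side of a Lipschitz graph over the hyperplane
  orthogonal to \<open>e\<close>; invariance of \<open>\<gamma>\<close> along \<open>e\<close> makes it a function on that hyperplane.
\<close>

definition Lipschitz_domain :: "'a::euclidean_space set \<Rightarrow> bool" where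
  "Lipschitz_domain \<Omega> \<longleftrightarrow> open \<Omega> \<and> connected \<Omega> \<and> \<Omega> \<noteq> {} \<and>
     (\<forall>x\<in>frontier \<Omega>. \<exists>U e L \<gamma>. open U \<and> x \<in> U \<and> norm e = 1 \<and> L-lipschitz_on UNIV \<gamma> \<and>
        (\<forall>y t. \<gamma> (y + t *\<^sub>R e) = \<gamma> y) \<and> \<Omega> \<inter> U = {y \<in> U. \<gamma> y < y \<bullet> e})"

definition bounded_polyhedral_Lipschitz_domain :: "'a::euclidean_space set \<Rightarrow> bool" where
  "bounded_polyhedral_Lipschitz_domain \<Omega> \<longleftrightarrow> Lipschitz_domain \<Omega> \<and> bounded \<Omega> \<and>
     (\<exists>\<P>. finite \<P> \<and> (\<forall>P\<in>\<P>. polytope P) \<and> closure \<Omega> = \<Union>\<P>)"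

text \<open>
  The \<open>(d - 1)\<close>-dimensional Lebesgue measure on the hyperplane through \<open>a\<close> with unit normal \<open>n\<close>
  (as a Borel measure on the whole space): the image of the Lebesgue measure on a slab of
  thickness 1 under the orthogonal projection.
\<close>

definition plane_measure :: "'a::euclidean_space \<Rightarrow> 'a \<Rightarrow> 'a measure" where
  "plane_measure a n =
     distr (restrict_space lborel {x. (x - a) \<bullet> n \<in> {0..1}}) borel (\<lambda>x. x - ((x - a) \<bullet> n) *\<^sub>R n)"


section \<open>Sobolev spaces and traces\<close>

definition Lp :: "ereal \<Rightarrow> 'a::euclidean_space set \<Rightarrow> ('a \<Rightarrow> 'b::euclidean_space) set" where
  "Lp q \<Omega> = {f \<in> borel_measurable (lebesgue_on \<Omega>).
     if q = \<infinity> then \<exists>C. AE x in lebesgue_on \<Omega>. norm (f x) \<le> C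
     else integrable (lebesgue_on \<Omega>) (\<lambda>x. norm (f x) powr real_of_ereal q)}"

definition L1_loc :: "'a::euclidean_space set \<Rightarrow> ('a \<Rightarrow> 'b::euclidean_space) set" where
  "L1_loc \<Omega> = {f. \<forall>K. compact K \<and> K \<subseteq> \<Omega> \<longrightarrow> set_integrable lebesgue K f}"

text \<open>
  Test functions are of class \<open>C\<^sup>1\<close>, with compact support in \<open>\<Omega>\<close>; by mollification they define the
  same weak derivatives as smooth test functions.
\<close>

definition test_fun :: "'a::euclidean_space set \<Rightarrow> ('a \<Rightarrow> real) set" where
  "test_fun \<Omega> = {\<eta>. C1_fun \<eta> \<and> (\<exists>K. compact K \<and> K \<subseteq> \<Omega> \<and> (\<forall>x. x \<notin> K \<longrightarrow> \<eta> x = 0))}"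

definition has_weak_grad ::
    "'a::euclidean_space set \<Rightarrow> ('a \<Rightarrow> real) \<Rightarrow> ('a \<Rightarrow> 'a) \<Rightarrow> bool" where
  "has_weak_grad \<Omega> v g \<longleftrightarrow> v \<in> L1_loc \<Omega> \<and> g \<in> L1_loc \<Omega> \<and>
     (\<forall>\<eta>\<in>test_fun \<Omega>. (LINT x|lebesgue_on \<Omega>. v x *\<^sub>R grad \<eta> x) = - (LINT x|lebesgue_on \<Omega>. \<eta> x *\<^sub>R g x))"

text \<open>The weak gradient and divergence are unique up to null sets; a representative is chosen.\<close>

definition wgrad :: "'a::euclidean_space set \<Rightarrow> ('a \<Rightarrow> real) \<Rightarrow> 'a \<Rightarrow> 'a" where
  "wgrad \<Omega> v = (SOME g. has_weak_grad \<Omega> v g)"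

definition has_weak_div ::
    "'a::euclidean_space set \<Rightarrow> ('a \<Rightarrow> 'a) \<Rightarrow> ('a \<Rightarrow> real) \<Rightarrow> bool" where
  "has_weak_div \<Omega> y w \<longleftrightarrow> y \<in> L1_loc \<Omega> \<and> w \<in> L1_loc \<Omega> \<and>
     (\<forall>\<eta>\<in>test_fun \<Omega>. (LINT x|lebesgue_on \<Omega>. y x \<bullet> grad \<eta> x) = - (LINT x|lebesgue_on \<Omega>. \<eta> x * w x))"

definition wdiv :: "'a::euclidean_space set \<Rightarrow> ('a \<Rightarrow> 'a) \<Rightarrow> 'a \<Rightarrow> real" where
  "wdiv \<Omega> y = (SOME w. has_weak_div \<Omega> y w)"

definition W1 :: "ereal \<Rightarrow> 'a::euclidean_space set \<Rightarrow> ('a \<Rightarrow> real) set" where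
  "W1 q \<Omega> = {v \<in> Lp q \<Omega>. (\<exists>g. has_weak_grad \<Omega> v g) \<and> wgrad \<Omega> v \<in> Lp q \<Omega>}"

definition W1_vec :: "ereal \<Rightarrow> 'a::euclidean_space set \<Rightarrow> ('a \<Rightarrow> 'a) set" where
  "W1_vec q \<Omega> = {z. \<forall>i\<in>Basis. (\<lambda>x. z x \<bullet> i) \<in> W1 q \<Omega>}"

definition W1_norm :: "real \<Rightarrow> 'a::euclidean_space set \<Rightarrow> ('a \<Rightarrow> real) \<Rightarrow> real" where
  "W1_norm p \<Omega> v = ((LINT x|lebesgue_on \<Omega>. \<bar>v x\<bar> powr p) +
     (LINT x|lebesgue_on \<Omega>. norm (wgrad \<Omega> v x) powr p)) powr (1 / p)"

text \<open>
  Trace of \<open>v \<in> W\<^sup>1\<^sup>,\<^sup>1(\<Omega>)\<close> on a subset \<open>A\<close> of the closure of \<open>\<Omega>\<close> that is contained in a finite union of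
  hyperplanes (a side, or the boundary of a polyhedral domain): the limit in \<open>L\<^sup>1(A)\<close> of the
  restrictions of \<open>C\<^sup>1\<close> functions converging to \<open>v\<close> in \<open>W\<^sup>1\<^sup>,\<^sup>1(\<Omega>)\<close>.  Convergence in \<open>L\<^sup>1(A)\<close> is
  convergence on each hyperplane; those meeting \<open>A\<close> in a null set impose nothing.
  Bounded domains have \<open>W\<^sup>1\<^sup>,\<^sup>p \<subseteq> W\<^sup>1\<^sup>,\<^sup>1\<close>, so that the case of exponent 1 covers all exponents,
  including \<open>\<infinity>\<close>, where \<open>C\<^sup>1\<close> functions are not dense.
\<close>

definition has_trace ::
    "'a::euclidean_space set \<Rightarrow> 'a set \<Rightarrow> ('a \<Rightarrow> real) \<Rightarrow> ('a \<Rightarrow> real) \<Rightarrow> bool" where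
  "has_trace \<Omega> A v g \<longleftrightarrow> v \<in> W1 1 \<Omega> \<and>
     (\<exists>V. (\<forall>k::nat. C1_fun (V k)) \<and>
        (\<lambda>k. LINT x|lebesgue_on \<Omega>. \<bar>V k x - v x\<bar>) \<longlonglongrightarrow> 0 \<and>
        (\<lambda>k. LINT x|lebesgue_on \<Omega>. norm (grad (V k) x - wgrad \<Omega> v x)) \<longlonglongrightarrow> 0 \<and>
        (\<forall>a n. norm n = 1 \<longrightarrow> set_integrable (plane_measure a n) A g \<and>
           (\<lambda>k. LINT x:A|plane_measure a n. \<bar>V k x - g x\<bar>) \<longlonglongrightarrow> 0))"

definition W1_D :: "ereal \<Rightarrow> 'a::euclidean_space set \<Rightarrow> 'a set \<Rightarrow> ('a \<Rightarrow> real) set" where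
  "W1_D q \<Omega> \<Gamma>\<^sub>D = {v \<in> W1 q \<Omega>. \<exists>g. has_trace \<Omega> (frontier \<Omega>) v g \<and>
     (\<forall>a n. norm n = 1 \<longrightarrow> (AE x in plane_measure a n. x \<in> \<Gamma>\<^sub>D \<longrightarrow> g x = 0))}"

definition conj_exponent :: "ereal \<Rightarrow> ereal" where
  "conj_exponent q = (if q = 1 then \<infinity> else if q = \<infinity> then 1 else q / (q - 1))"

definition W_div_N :: "ereal \<Rightarrow> 'a::euclidean_space set \<Rightarrow> 'a set \<Rightarrow> ('a \<Rightarrow> 'a) set" where
  "W_div_N q \<Omega> \<Gamma>\<^sub>D = {y \<in> Lp q \<Omega>. (\<exists>w. has_weak_div \<Omega> y w) \<and> wdiv \<Omega> y \<in> Lp q \<Omega> \<and>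
     (\<forall>v\<in>W1_D (conj_exponent q) \<Omega> \<Gamma>\<^sub>D.
        (LINT x|lebesgue_on \<Omega>. y x \<bullet> wgrad \<Omega> v x + v x * wdiv \<Omega> y x) = 0)}"

definition W1_dual :: "real \<Rightarrow> 'a::euclidean_space set \<Rightarrow> (('a \<Rightarrow> real) \<Rightarrow> real) set" where
  "W1_dual p \<Omega> = {l.
     (\<forall>v\<in>W1 (ereal p) \<Omega>. \<forall>w\<in>W1 (ereal p) \<Omega>. \<forall>a b. l (\<lambda>x. a * v x + b * w x) = a * l v + b * l w) \<and>
     (\<exists>C. \<forall>v\<in>W1 (ereal p) \<Omega>. \<bar>l v\<bar> \<le> C * W1_norm p \<Omega> v)}"

definition coercive_on ::
    "real \<Rightarrow> 'a::euclidean_space set \<Rightarrow> ('a \<Rightarrow> real) set \<Rightarrow> (('a \<Rightarrow> real) \<Rightarrow> ereal) \<Rightarrow> bool" where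
  "coercive_on p \<Omega> X F \<longleftrightarrow> (\<forall>M::real. \<exists>R. \<forall>v\<in>X. R \<le> W1_norm p \<Omega> v \<longrightarrow> ereal M \<le> F v)"

definition weakly_lsc_on ::
    "real \<Rightarrow> 'a::euclidean_space set \<Rightarrow> ('a \<Rightarrow> real) set \<Rightarrow> (('a \<Rightarrow> real) \<Rightarrow> ereal) \<Rightarrow> bool" where
  "weakly_lsc_on p \<Omega> X F \<longleftrightarrow> (\<forall>V v. (\<forall>k::nat. V k \<in> X) \<and> v \<in> X \<and>
     (\<forall>l\<in>W1_dual p \<Omega>. (\<lambda>k. l (V k)) \<longlonglongrightarrow> l v) \<longrightarrow> F v \<le> liminf (\<lambda>k. F (V k)))"


section \<open>Triangulations and finite element spaces\<close>

definition regular_triangulation :: "'a::euclidean_space set \<Rightarrow> 'a set set \<Rightarrow> bool" where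
  "regular_triangulation \<Omega> \<T> \<longleftrightarrow>
     triangulation \<T> \<and> (\<forall>T\<in>\<T>. int DIM('a) simplex T) \<and> \<Union>\<T> = closure \<Omega>"

definition sides :: "'a::euclidean_space set set \<Rightarrow> 'a set set" where
  "sides \<T> = {S. \<exists>T\<in>\<T>. S facet_of T}"

definition barycenter :: "'a::euclidean_space set \<Rightarrow> 'a" where
  "barycenter S = (1 / real (card {x. x extreme_point_of S})) *\<^sub>R (\<Sum>x | x extreme_point_of S. x)"

definition side_normal :: "'a::euclidean_space set \<Rightarrow> 'a" where
  "side_normal S = (SOME n. norm n = 1 \<and> (\<forall>x\<in>S. \<forall>y\<in>S. n \<bullet> (x - y) = 0))"

definition side_measure :: "'a::euclidean_space set \<Rightarrow> 'a measure" where
  "side_measure S = plane_measure (barycenter S) (side_normal S)"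

definition side_mean :: "'a::euclidean_space set \<Rightarrow> ('a \<Rightarrow> real) \<Rightarrow> real" where
  "side_mean S g = (LINT x:S|side_measure S. g x) / measure (side_measure S) S"

text \<open>\<open>S\<close> is a boundary side contained, up to a null set, in \<open>\<Gamma>\<close>.\<close>

definition boundary_side_in :: "'a::euclidean_space set \<Rightarrow> 'a set \<Rightarrow> 'a set \<Rightarrow> bool" where
  "boundary_side_in \<Omega> \<Gamma> S \<longleftrightarrow> S \<subseteq> frontier \<Omega> \<and> (AE x in side_measure S. x \<in> S \<longrightarrow> x \<in> \<Gamma>)"

text \<open>
  Elementwise conditions are imposed on the interiors of the (closed) elements only, since the values
  from different elements compete on the common sides, which form a null set.
\<close>

definition proj0 :: "'a::euclidean_space set set \<Rightarrow> ('a \<Rightarrow> 'b::euclidean_space) \<Rightarrow> 'a \<Rightarrow> 'b" where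
  "proj0 \<T> v x = (\<Sum>T\<in>\<T>. indicator (interior T) x *\<^sub>R
     ((1 / measure lebesgue T) *\<^sub>R (LINT y:T|lebesgue. v y)))"

definition grad_h :: "'a::euclidean_space set set \<Rightarrow> ('a \<Rightarrow> real) \<Rightarrow> 'a \<Rightarrow> 'a" where
  "grad_h \<T> v x = (if x \<in> (\<Union>T\<in>\<T>. interior T) then grad v x else 0)"

definition pw_affine :: "'a::euclidean_space set set \<Rightarrow> ('a \<Rightarrow> real) set" where
  "pw_affine \<T> = {v. \<forall>T\<in>\<T>. \<exists>c g. \<forall>x\<in>interior T. v x = c + g \<bullet> x}"

definition CR :: "'a::euclidean_space set set \<Rightarrow> ('a \<Rightarrow> real) set" where
  "CR \<T> = {v \<in> pw_affine \<T>. \<forall>S\<in>sides \<T>. continuous (at (barycenter S) within \<Union>\<T>) v}"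

definition CR_D ::
    "'a::euclidean_space set \<Rightarrow> 'a set \<Rightarrow> 'a set set \<Rightarrow> ('a \<Rightarrow> real) set" where
  "CR_D \<Omega> \<Gamma>\<^sub>D \<T> = {v \<in> CR \<T>. \<forall>S\<in>sides \<T>. boundary_side_in \<Omega> \<Gamma>\<^sub>D S \<longrightarrow> v (barycenter S) = 0}"

text \<open>
  The interpolants are described by the conditions that determine them (up to null sets);
  they are unique and exist for all \<open>v \<in> W\<^sup>1\<^sup>,\<^sup>1(\<Omega>)\<close> and \<open>z \<in> W\<^sup>1\<^sup>,\<^sup>1(\<Omega>; \<real>\<^sup>d)\<close> by the trace theorem.
\<close>

definition is_CR_interpolant ::
    "'a::euclidean_space set \<Rightarrow> 'a set set \<Rightarrow> ('a \<Rightarrow> real) \<Rightarrow> ('a \<Rightarrow> real) \<Rightarrow> bool" where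
  "is_CR_interpolant \<Omega> \<T> v w \<longleftrightarrow> w \<in> CR \<T> \<and>
     (\<forall>S\<in>sides \<T>. \<exists>g. has_trace \<Omega> S v g \<and> w (barycenter S) = side_mean S g)"

definition RT :: "'a::euclidean_space set \<Rightarrow> 'a set set \<Rightarrow> ('a \<Rightarrow> 'a) set" where
  "RT \<Omega> \<T> = {y \<in> Lp 1 \<Omega>. (\<exists>w. has_weak_div \<Omega> y w) \<and> wdiv \<Omega> y \<in> Lp 1 \<Omega> \<and>
     (\<forall>T\<in>\<T>. \<exists>a b. \<forall>x\<in>interior T. y x = a + b *\<^sub>R (x - barycenter T))}"

text \<open>The normal component on a side is the limit from within each adjacent element.\<close>

definition is_RT_interpolant ::
    "'a::euclidean_space set \<Rightarrow> 'a set set \<Rightarrow> ('a \<Rightarrow> 'a) \<Rightarrow> ('a \<Rightarrow> 'a) \<Rightarrow> bool" where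
  "is_RT_interpolant \<Omega> \<T> z y \<longleftrightarrow> y \<in> RT \<Omega> \<T> \<and>
     (\<forall>S\<in>sides \<T>. \<exists>g. (\<forall>i\<in>Basis. has_trace \<Omega> S (\<lambda>x. z x \<bullet> i) (\<lambda>x. g x \<bullet> i)) \<and>
        (\<forall>T\<in>\<T>. S facet_of T \<longrightarrow> (\<forall>x\<in>S.
           ((\<lambda>x'. y x' \<bullet> side_normal S) \<longlongrightarrow> side_mean S (\<lambda>x'. g x' \<bullet> side_normal S))
             (at x within interior T))))"


section \<open>Energy functionals\<close>

definition energy :: "'a::euclidean_space set \<Rightarrow> ('a \<Rightarrow> real) \<Rightarrow> ('a \<Rightarrow> real \<Rightarrow> ereal) \<Rightarrow>
    ('a \<Rightarrow> real) \<Rightarrow> ereal" where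
  "energy \<Omega> \<phi> \<psi> v = qint (lebesgue_on \<Omega>) (\<lambda>x. ereal (\<phi> (wgrad \<Omega> v x))) +
     qint (lebesgue_on \<Omega>) (\<lambda>x. \<psi> x (v x))"

text \<open>The minus sign is in front of the sum, so that \<open>\<infinity> - \<infinity>\<close> counts as \<open>-\<infinity>\<close> in a maximization.\<close>

definition dual_energy :: "'a::euclidean_space set \<Rightarrow> ('a \<Rightarrow> real) \<Rightarrow> ('a \<Rightarrow> real \<Rightarrow> ereal) \<Rightarrow>
    ('a \<Rightarrow> 'a) \<Rightarrow> ereal" where
  "dual_energy \<Omega> \<phi> \<psi> y = - (qint (lebesgue_on \<Omega>) (\<lambda>x. conjugate (\<lambda>s. ereal (\<phi> s)) (y x)) +
     qint (lebesgue_on \<Omega>) (\<lambda>x. conjugate (\<psi> x) (wdiv \<Omega> y x)))"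

definition energy_h :: "'a::euclidean_space set \<Rightarrow> 'a set set \<Rightarrow> ('a \<Rightarrow> real) \<Rightarrow>
    ('a \<Rightarrow> real \<Rightarrow> ereal) \<Rightarrow> ('a \<Rightarrow> real) \<Rightarrow> ereal" where
  "energy_h \<Omega> \<T> \<phi> \<psi>\<^sub>h v = qint (lebesgue_on \<Omega>) (\<lambda>x. ereal (\<phi> (grad_h \<T> v x))) +
     qint (lebesgue_on \<Omega>) (\<lambda>x. \<psi>\<^sub>h x (proj0 \<T> v x))"

text \<open>Strong coercivity is required at all \<open>v\<close> of finite energy, where \<open>\<delta>F(v)\<close> makes sense.\<close>

definition strongly_coercive :: "'a::euclidean_space set \<Rightarrow> ('a \<Rightarrow> real) set \<Rightarrow>
    (('a \<Rightarrow> real) \<Rightarrow> ereal) \<Rightarrow> (('a \<Rightarrow> real) \<Rightarrow> ('a \<Rightarrow> real) \<Rightarrow> real) \<Rightarrow> bool" where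
  "strongly_coercive \<Omega> X F \<sigma> \<longleftrightarrow>
     (\<forall>v\<in>X. \<forall>w\<in>X. 0 \<le> \<sigma> v w \<and> (\<sigma> v w = 0 \<longrightarrow> (AE x in lebesgue_on \<Omega>. v x = w x))) \<and>
     (\<forall>v\<in>X. \<forall>w\<in>X. F v < \<infinity> \<longrightarrow>
        F v + variational_derivative F v (\<lambda>x. w x - v x) + ereal ((\<sigma> v w)\<^sup>2) \<le> F w)"

end

theory Submission
  imports Defs
begin

text \<open>
  Minimality of \<open>u\<^sub>h\<close> and strong coercivity bound \<open>\<sigma>\<^sup>2\<close> by \<open>I\<^sub>h(I\<^sub>c\<^sub>r u) - I\<^sub>h(u\<^sub>h)\<close>, and the discrete weak
  duality, tested with \<open>I\<^sub>R\<^sub>T z\<close>, bounds \<open>- I\<^sub>h(u\<^sub>h)\<close> by the conjugate functionals.  Since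
  \<open>\<nabla>\<^sub>h I\<^sub>c\<^sub>r u\<close> and \<open>div I\<^sub>R\<^sub>T z\<close> are the elementwise means of \<open>\<nabla>u\<close> and \<open>div z\<close>, Jensen's inequality removes
  the interpolant from \<open>\<phi>\<close>; the Fenchel equalities for the pair \<open>(u, z)\<close>, which hold almost everywhere by
  strong duality, and the subgradient inequalities for \<open>\<phi>\<^sup>*\<close> and \<open>\<psi>\<^sub>h\<close> then give the four terms.

  Instead of a divergence theorem, only one formula is needed on a simplex \<open>T\<close> with vertex \<open>a\<close> and
  opposite side \<open>S\<close>: the mean of \<open>w\<close> over \<open>S\<close> is \<open>(d |T|)\<^sup>-\<^sup>1 \<integral>\<^sub>T d w + \<nabla>w \<bullet> (x - a)\<close>.  It follows by
  differentiating the integral of \<open>w\<close> over the shrinking cones \<open>a + t (T - a)\<close> at \<open>t = 1\<close>, and it passes to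
  the limit of smooth approximations, so that it holds for the traces of Sobolev functions.
\<close>

section \<open>Linear images of Lebesgue measure\<close>

text \<open>The cone formula suffices because the gradients g_a of the barycentric coordinates
  satisfy \<Sum> g_a = 0 and \<Sum> (g_a \<bullet> v) a = v. Weighting the side means of a field
  with g_a and summing over the vertices removes everything that does not depend on a and leaves the
  divergence; this yields Gauss' identity on a simplex and the divergence of the Raviart-Thomas
  interpolant. Differences of side means yield the gradient of the Crouzeix-Raviart interpolant.

  Surface measure is given as the projection of a slab, so Lebesgue measure has to be understood
  first under stretching along an arbitrary normal. A second obstacle is the weak form of the
  condition z \<bullet> n = 0 on \<Gamma>_N: the discrete integration by parts needs the mean normal
  trace of z to vanish on each single side, so the condition must be localized to one side. Finally,
  the four integrals may be infinite. The whole chain of estimates is therefore gathered in one real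
  integrable function \<open>l\<close> that is a pointwise lower bound of the sum of the four
  integrands.\<close>

lemma nn_integral_lborel_translate:
  fixes f :: "'a::euclidean_space \<Rightarrow> ennreal"
  assumes [measurable]: "f \<in> borel_measurable borel"
  shows "(\<integral>\<^sup>+y. f (x + y) \<partial>lborel) = (\<integral>\<^sup>+y. f y \<partial>lborel)"
proof -
  have "(\<integral>\<^sup>+y. f y \<partial>lborel) = (\<integral>\<^sup>+y. f y \<partial>distr lborel borel ((+) x))"
    by (simp add: lborel_distr_plus)
  also have "\<dots> = (\<integral>\<^sup>+y. f (x + y) \<partial>lborel)"
    by (subst nn_integral_distr) auto
  finally show ?thesis by simp
qed

lemma nn_integral_lborel_reflect:
  fixes f :: "'a::euclidean_space \<Rightarrow> ennreal"
  assumes [measurable]: "f \<in> borel_measurable borel"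
  shows "(\<integral>\<^sup>+y. f (x - y) \<partial>lborel) = (\<integral>\<^sup>+y. f y \<partial>lborel)"
proof -
  have "(\<integral>\<^sup>+y. f y \<partial>lborel) = (\<integral>\<^sup>+y. f y \<partial>density (distr lborel borel (\<lambda>y. x + (-1) *\<^sub>R y)) (\<lambda>_. \<bar>-1::real\<bar>^DIM('a)))"
    using lborel_affine[of "-1" x] by simp
  also have "\<dots> = (\<integral>\<^sup>+y. f (x - y) \<partial>lborel)"
    by (simp add: nn_integral_density nn_integral_distr)
  finally show ?thesis by simp
qed

text \<open>Uniqueness of translation-invariant measures by Fubini: the double integral of 1_A(x)
  1_B(x + y) is evaluated in both orders. The invariance of Lebesgue measure gives the left-hand
  side; the invariance of \<open>M\<close>, followed by the reflection y \<mapsto> x - y, gives the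
  right-hand side. The product form needs no division by measures that may be 0 or
  \<infinity>.\<close>

lemma translation_invariant_measure_eq:
  fixes M :: "'a::euclidean_space measure"
  assumes sets [measurable_cong]: "sets M = sets borel" and "sigma_finite_measure M"
    and inv: "\<And>c. distr M borel ((+) c) = M"
    and [measurable]: "A \<in> sets borel" "B \<in> sets borel"
  shows "emeasure M A * emeasure lborel B = emeasure M B * emeasure lborel A"
proof -
  interpret sigma_finite_measure M by fact
  interpret P: pair_sigma_finite M "lborel :: 'a measure" ..
  let ?I = "\<lambda>A. indicator A :: 'a \<Rightarrow> ennreal"
  have M_trans: "(\<integral>\<^sup>+x. f (x - y) \<partial>M) = (\<integral>\<^sup>+x. f x \<partial>M)"
    if [measurable]: "f \<in> borel_measurable borel" for f y
  proof -
    have "(\<integral>\<^sup>+x. f x \<partial>M) = (\<integral>\<^sup>+x. f x \<partial>distr M borel ((+) (-y)))"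
      by (simp add: inv)
    also have "\<dots> = (\<integral>\<^sup>+x. f (x - y) \<partial>M)"
      by (subst nn_integral_distr) auto
    finally show ?thesis by simp
  qed
  have "emeasure M A * emeasure lborel B = (\<integral>\<^sup>+x. ?I A x * (\<integral>\<^sup>+y. ?I B y \<partial>lborel) \<partial>M)"
    by (simp add: nn_integral_multc)
  also have "\<dots> = (\<integral>\<^sup>+x. ?I A x * (\<integral>\<^sup>+y. ?I B (x + y) \<partial>lborel) \<partial>M)"
    by (subst nn_integral_lborel_translate) auto
  also have "\<dots> = (\<integral>\<^sup>+x. (\<integral>\<^sup>+y. ?I A x * ?I B (x + y) \<partial>lborel) \<partial>M)"
    by (subst nn_integral_cmult) auto
  also have "\<dots> = (\<integral>\<^sup>+y. (\<integral>\<^sup>+x. ?I A x * ?I B (x + y) \<partial>M) \<partial>lborel)"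
    by (rule P.Fubini'[symmetric]) measurable
  also have "\<dots> = (\<integral>\<^sup>+y. (\<integral>\<^sup>+x. ?I A (x - y) * ?I B x \<partial>M) \<partial>lborel)"
  proof (rule nn_integral_cong)
    fix y
    show "(\<integral>\<^sup>+x. ?I A x * ?I B (x + y) \<partial>M) = (\<integral>\<^sup>+x. ?I A (x - y) * ?I B x \<partial>M)"
      using M_trans[of "\<lambda>x. ?I A x * ?I B (x + y)" y] by simp
  qed
  also have "\<dots> = (\<integral>\<^sup>+x. (\<integral>\<^sup>+y. ?I A (x - y) * ?I B x \<partial>lborel) \<partial>M)"
    by (rule P.Fubini') measurable
  also have "\<dots> = (\<integral>\<^sup>+x. (\<integral>\<^sup>+y. ?I A (x - y) \<partial>lborel) * ?I B x \<partial>M)"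
    by (subst nn_integral_multc) auto
  also have "\<dots> = (\<integral>\<^sup>+x. emeasure lborel A * ?I B x \<partial>M)"
    by (subst nn_integral_lborel_reflect) auto
  also have "\<dots> = emeasure M B * emeasure lborel A"
    by (subst nn_integral_cmult) (auto simp: mult.commute)
  finally show ?thesis .
qed

text \<open>The image measure is again translation invariant, since c + f(x) = f(x + inv f c), and
  \<sigma>-finite, since preimages of balls are bounded. Uniqueness then makes it a multiple of
  Lebesgue measure. The factor is left unidentified; where it matters, it is read off from a set
  that \<open>f\<close> leaves invariant.\<close>

lemma linear_vimage_lborel:
  fixes f :: "'a::euclidean_space \<Rightarrow> 'a"
  assumes f: "linear f" "bij f"
  obtains k where "\<And>A. A \<in> sets borel \<Longrightarrow> emeasure lborel (f -` A) = k * emeasure lborel A"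
proof -
  have [measurable]: "f \<in> borel_measurable borel"
    using f(1) by (intro borel_measurable_continuous_onI linear_continuous_on linear_conv_bounded_linear[THEN iffD1])
  define M where "M = distr lborel borel f"
  have sets_M: "sets M = sets borel" by (simp add: M_def)
  have em: "emeasure M A = emeasure lborel (f -` A)" if "A \<in> sets borel" for A
    using that by (simp add: M_def emeasure_distr)
  have lin_inv: "linear (inv f)"
    using f by (simp add: bij_def inj_linear_imp_inv_linear)
  have sfin: "sigma_finite_measure M"
  proof
    have "emeasure M (cball 0 (real n)) \<noteq> \<infinity>" for n
    proof -
      have "f -` cball 0 (real n) = inv f ` cball 0 (real n)"
        using f(2) by (simp add: bij_vimage_eq_inv_image)
      moreover have "bounded (inv f ` cball 0 (real n))"
        using lin_inv by (intro bounded_linear_image) (auto simp: linear_conv_bounded_linear)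
      ultimately show ?thesis
        using emeasure_bounded_finite[of "f -` cball 0 (real n)"] by (simp add: em)
    qed
    then show "\<exists>A. countable A \<and> A \<subseteq> sets M \<and> \<Union>A = space M \<and> (\<forall>a\<in>A. emeasure M a \<noteq> \<infinity>)"
      by (intro exI[of _ "range (\<lambda>n. cball 0 (real n))"])
         (auto simp: sets_M M_def real_arch_simple)
  qed
  have trans: "distr M borel ((+) c) = M" for c
  proof -
    have "distr M borel ((+) c) = distr lborel borel (\<lambda>x. c + f x)"
      by (simp add: M_def distr_distr comp_def)
    also have "(\<lambda>x. c + f x) = f \<circ> (+) (inv f c)"
      using f by (auto simp: linear_add bij_is_surj surj_f_inv_f)
    also have "distr lborel borel \<dots> = distr (distr lborel borel ((+) (inv f c))) borel f"
      by (simp add: distr_distr)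
    finally show ?thesis by (simp add: lborel_distr_plus M_def)
  qed
  have "emeasure lborel (cbox (0::'a) One) = (\<Prod>b\<in>Basis. (One - (0::'a)) \<bullet> b)"
    by (rule emeasure_lborel_cbox) simp
  then have one: "emeasure lborel (cbox (0::'a) One) = 1" by simp
  show thesis
  proof (rule that)
    fix A :: "'a set" assume A: "A \<in> sets borel"
    have "emeasure M A * emeasure lborel (cbox (0::'a) One) = emeasure M (cbox 0 One) * emeasure lborel A"
      by (rule translation_invariant_measure_eq[OF sets_M sfin trans A]) simp
    then show "emeasure lborel (f -` A) = emeasure M (cbox 0 One) * emeasure lborel A"
      unfolding one em[OF A] by simp
  qed
qed

text \<open>The unit ball is invariant and has finite positive measure, so the factor is 1.\<close>

lemma lborel_distr_orthogonal:
  fixes f :: "'a::euclidean_space \<Rightarrow> 'a"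
  assumes f: "orthogonal_transformation f"
  shows "distr lborel borel f = lborel"
proof -
  have lin: "linear f" and bij: "bij f"
    using f by (auto simp: orthogonal_transformation_linear orthogonal_transformation_bij)
  obtain k where k: "\<And>A. A \<in> sets borel \<Longrightarrow> emeasure lborel (f -` A) = k * emeasure lborel A"
    using linear_vimage_lborel[OF lin bij] by blast
  have "f -` ball 0 1 = ball 0 1"
    using orthogonal_transformation_norm[OF f] by auto
  then have "emeasure lborel (ball (0::'a) 1) = k * emeasure lborel (ball (0::'a) 1)"
    using k[of "ball 0 1"] by simp
  moreover have "emeasure lborel (ball (0::'a) 1) \<noteq> 0" "emeasure lborel (ball (0::'a) 1) \<noteq> \<infinity>"
    using emeasure_bounded_finite[of "ball (0::'a) 1"]
    using open_not_negligible[of "ball (0::'a) 1"]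
    by (auto simp: negligible_iff_null_sets null_sets_def)
  ultimately have "k = 1"
    by (metis ennreal_mult_cancel_left mult.commute mult.right_neutral infinity_ennreal_def)
  have [measurable]: "f \<in> borel_measurable borel"
    using lin by (intro borel_measurable_continuous_onI linear_continuous_on linear_conv_bounded_linear[THEN iffD1])
  show ?thesis
    by (rule measure_eqI) (auto simp: emeasure_distr k \<open>k = 1\<close>)
qed

text \<open>For m \<noteq> n this is the Householder reflection in the hyperplane orthogonal to m -
  n.\<close>

lemma orthogonal_involution_exists:
  fixes m n :: "'a::euclidean_space"
  assumes "norm m = norm n"
  obtains R where "orthogonal_transformation R" "R m = n" "\<And>x. R (R x) = x"
proof (cases "m = n")
  case True
  then show ?thesis by (intro that[of id]) (auto simp: id_def)
next
  case False
  define w where "w = m - n"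
  define R where "R x = x - (2 * (x \<bullet> w) / (w \<bullet> w)) *\<^sub>R w" for x
  have ww: "w \<bullet> w > 0" using False by (simp add: w_def)
  have mm: "m \<bullet> m = n \<bullet> n" using assms by (simp add: dot_square_norm)
  have lin: "linear R"
    unfolding R_def by (rule linearI) (auto simp: algebra_simps add_divide_distrib)
  have "w \<bullet> w = 2 * (m \<bullet> w)"
    using mm by (simp add: w_def algebra_simps inner_commute)
  then have "R m = n" using ww by (simp add: R_def) (simp add: w_def)
  moreover have "orthogonal_transformation R"
    unfolding orthogonal_transformation_def
  proof (intro conjI lin allI)
    fix v u show "R v \<bullet> R u = v \<bullet> u"
      using ww by (simp add: R_def inner_diff_left inner_diff_right inner_commute field_simps)
  qed
  moreover have "R (R x) = x" for x
    using ww by (simp add: R_def inner_diff_left field_simps)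
  ultimately show ?thesis by (intro that)
qed

text \<open>For a unit vector \<open>n\<close>: multiplication by \<open>c\<close> along
  \<open>n\<close> and the identity on the orthogonal complement, hence of determinant
  \<open>c\<close>.\<close>

definition stretch :: "'a::euclidean_space \<Rightarrow> real \<Rightarrow> 'a \<Rightarrow> 'a" where
  "stretch n c x = x + ((c - 1) * (x \<bullet> n)) *\<^sub>R n"

lemma stretch_measurable [measurable]: "stretch n c \<in> borel_measurable borel"
  unfolding stretch_def by measurable

text \<open>Along a coordinate axis the stretching is diagonal and the scaling rule for coordinates
  applies. Conjugation with a measure-preserving reflection that exchanges the axis \<open>e\<close>
  and \<open>n\<close> carries the rule over to an arbitrary direction.\<close>

lemma lborel_stretch:
  fixes n :: "'a::euclidean_space"
  assumes n: "norm n = 1" and c: "c > 0"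
  shows "lborel = density (distr lborel borel (stretch n c)) (\<lambda>_. ennreal c)"
proof -
  obtain e :: 'a where e: "e \<in> Basis" using nonempty_Basis by blast
  obtain R where R: "orthogonal_transformation R" "R e = n" "\<And>x. R (R x) = x"
    using orthogonal_involution_exists[of e n] n e by auto
  have linR: "linear R" using R(1) by (simp add: orthogonal_transformation_linear)
  have [measurable]: "R \<in> borel_measurable borel"
    using linR by (intro borel_measurable_continuous_onI linear_continuous_on linear_conv_bounded_linear[THEN iffD1])
  have emR: "emeasure lborel (R -` A) = emeasure lborel A" if "A \<in> sets borel" for A
    using arg_cong[OF lborel_distr_orthogonal[OF R(1)], of "\<lambda>M. emeasure M A"] that
    by (simp add: emeasure_distr)
  define c' where "c' j = (if j = e then c else 1)" for j
  have "(\<Sum>j\<in>Basis. (c' j * (x \<bullet> j)) *\<^sub>R j) = stretch e c x" for x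
  proof -
    have "(\<Sum>j\<in>Basis. (c' j * (x \<bullet> j)) *\<^sub>R j) =
       (\<Sum>j\<in>Basis. (x \<bullet> j) *\<^sub>R j + (if j = e then ((c - 1) * (x \<bullet> e)) *\<^sub>R e else 0))"
      by (intro sum.cong) (auto simp: c'_def algebra_simps)
    also have "\<dots> = stretch e c x"
      using e by (simp add: sum.distrib euclidean_representation stretch_def)
    finally show ?thesis .
  qed
  moreover have "(\<Prod>j\<in>Basis. \<bar>c' j\<bar>) = c"
  proof -
    have "(\<Prod>j\<in>Basis. \<bar>c' j\<bar>) = (\<Prod>j\<in>Basis. if j = e then c else 1)"
      using c by (intro prod.cong) (auto simp: c'_def)
    then show ?thesis using e by simp
  qed
  ultimately have eq: "lborel = density (distr lborel borel (stretch e c)) (\<lambda>_. ennreal c)"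
    using lborel_affine_euclidean[of c' 0] c by (simp add: c'_def)
  have em_e: "emeasure lborel A = ennreal c * emeasure lborel (stretch e c -` A)" if "A \<in> sets borel" for A
    using arg_cong[OF eq, of "\<lambda>M. emeasure M A"] that
    by (simp add: emeasure_density nn_integral_cmult emeasure_distr)
  have sn: "stretch n c x = R (stretch e c (R x))" for x
  proof -
    have "R x \<bullet> e = R (R x) \<bullet> R e"
      using R(1) unfolding orthogonal_transformation_def by metis
    then show ?thesis
      using linR by (simp add: stretch_def linear_add linear_scale R)
  qed
  show ?thesis
  proof (rule measure_eqI)
    fix A :: "'a set" assume "A \<in> sets lborel"
    then have A: "A \<in> sets borel" by simp
    have RA: "R -` A \<in> sets borel" using measurable_sets_borel[of R borel A] A by simp
    have sRA: "stretch e c -` (R -` A) \<in> sets borel"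
      using measurable_sets_borel[of "stretch e c" borel "R -` A"] RA by simp
    have "emeasure (density (distr lborel borel (stretch n c)) (\<lambda>_. ennreal c)) A
       = ennreal c * emeasure lborel (stretch n c -` A)"
      using A by (simp add: emeasure_density nn_integral_cmult emeasure_distr)
    also have "stretch n c -` A = R -` (stretch e c -` (R -` A))"
      by (auto simp: sn)
    also have "emeasure lborel \<dots> = emeasure lborel (stretch e c -` (R -` A))"
      by (rule emR[OF sRA])
    also have "ennreal c * \<dots> = emeasure lborel (R -` A)"
      using em_e[OF RA] by simp
    also have "\<dots> = emeasure lborel A" by (rule emR[OF A])
    finally show "emeasure lborel A =
      emeasure (density (distr lborel borel (stretch n c)) (\<lambda>_. ennreal c)) A" by simp
  qed simp
qed

lemma lborel_integral_stretch:
  fixes f :: "'a::euclidean_space \<Rightarrow> real"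
  assumes n: "norm n = 1" and c: "c > 0" and [measurable]: "f \<in> borel_measurable borel"
  shows "(LINT x|lborel. f x) = c * (LINT x|lborel. f (stretch n c x))"
proof -
  have "(LINT x|lborel. f x) = (LINT x|density (distr lborel borel (stretch n c)) (\<lambda>_. ennreal c). f x)"
    using lborel_stretch[OF n c] by simp
  also have "\<dots> = c * (LINT x|lborel. f (stretch n c x))"
    using c by (simp add: integral_density integral_distr)
  finally show ?thesis .
qed

section \<open>Hyperplane measures\<close>

lemma has_derivative_grad:
  assumes "f differentiable (at x)"
  shows "(f has_derivative (\<lambda>h. grad f x \<bullet> h)) (at x)"
proof -
  let ?f' = "frechet_derivative f (at x)"
  have d: "(f has_derivative ?f') (at x)" using assms frechet_derivative_works by blast
  then have lin: "linear ?f'" by (rule has_derivative_linear)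
  have "?f' h = grad f x \<bullet> h" for h
  proof -
    have "?f' h = ?f' (\<Sum>i\<in>Basis. (h \<bullet> i) *\<^sub>R i)" by (simp add: euclidean_representation)
    also have "\<dots> = (\<Sum>i\<in>Basis. (h \<bullet> i) * ?f' i)"
      using lin by (simp add: linear_sum linear_scale)
    also have "\<dots> = grad f x \<bullet> h"
      by (simp add: grad_def inner_sum_left inner_sum_right inner_commute[of _ h] mult.commute)
    finally show ?thesis .
  qed
  then have "?f' = (\<lambda>h. grad f x \<bullet> h)" by (rule ext)
  with d show ?thesis by simp
qed

lemma grad_eqI:
  assumes "(f has_derivative (\<lambda>h. g \<bullet> h)) (at x)"
  shows "grad f x = g"
proof -
  have "frechet_derivative f (at x) = (\<lambda>h. g \<bullet> h)"
    using frechet_derivative_at[OF assms] by simp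
  then show ?thesis by (simp add: grad_def euclidean_representation)
qed

lemma C1_fun_continuous: "C1_fun f \<Longrightarrow> continuous_on A f"
  unfolding C1_fun_def by (meson continuous_at_imp_continuous_on differentiable_imp_continuous_within)

lemma C1_fun_grad_continuous: "C1_fun f \<Longrightarrow> continuous_on A (grad f)"
  unfolding C1_fun_def using continuous_on_subset by blast

lemma C1_funI:
  assumes "\<And>x. (f has_derivative (\<lambda>h. g x \<bullet> h)) (at x)" "continuous_on UNIV g"
  shows "C1_fun f" "grad f = g"
proof -
  show g: "grad f = g" using assms(1) by (intro ext grad_eqI)
  show "C1_fun f" unfolding C1_fun_def g using assms differentiable_def by blast
qed

section \<open>Orthogonal projection onto a hyperplane and its image measure\<close>

definition foot :: "'a::euclidean_space \<Rightarrow> 'a \<Rightarrow> 'a \<Rightarrow> 'a" where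
  "foot a n x = x - ((x - a) \<bullet> n) *\<^sub>R n"

lemma foot_measurable [measurable]: "foot a n \<in> borel_measurable borel"
  unfolding foot_def by measurable

lemma plane_measure_alt:
  "plane_measure a n = distr (restrict_space lborel {x. (x - a) \<bullet> n \<in> {0..1}}) borel (foot a n)"
  by (simp add: plane_measure_def foot_def[abs_def])

lemma sets_plane_measure [simp, measurable_cong]: "sets (plane_measure a n) = sets borel"
  by (simp add: plane_measure_def)

lemma space_plane_measure [simp]: "space (plane_measure a n) = UNIV"
  by (simp add: plane_measure_def)

lemma foot_measurable_restrict:
  "foot a n \<in> restrict_space lborel {x. (x - a) \<bullet> n \<in> {0..1}} \<rightarrow>\<^sub>M borel"
  by (intro measurable_restrict_space1) simp

lemma emeasure_plane_measure:
  fixes a n :: "'a::euclidean_space"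
  assumes "A \<in> sets borel"
  shows "emeasure (plane_measure a n) A = emeasure lborel {x. (x - a) \<bullet> n \<in> {0..1} \<and> foot a n x \<in> A}"
proof -
  let ?S = "{x. (x - a) \<bullet> n \<in> {0..1}}"
  have "emeasure (plane_measure a n) A =
      emeasure (restrict_space lborel ?S) (foot a n -` A \<inter> ?S)"
    unfolding plane_measure_alt using assms foot_measurable_restrict
    by (subst emeasure_distr) (auto simp: space_restrict_space)
  also have "\<dots> = emeasure lborel (foot a n -` A \<inter> ?S)"
    by (intro emeasure_restrict_space) auto
  also have "foot a n -` A \<inter> ?S = {x. (x - a) \<bullet> n \<in> {0..1} \<and> foot a n x \<in> A}" by auto
  finally show ?thesis .
qed

lemma set_lebesgue_integral_plane_measure:
  fixes f :: "'a::euclidean_space \<Rightarrow> real"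
  assumes [measurable]: "A \<in> sets borel" "f \<in> borel_measurable borel"
  shows "(LINT x:A|plane_measure a n. f x) =
    (LINT x|lborel. indicator {x. (x - a) \<bullet> n \<in> {0..1} \<and> foot a n x \<in> A} x * f (foot a n x))"
proof -
  let ?S = "{x. (x - a) \<bullet> n \<in> {0..1}}"
  have "(LINT x:A|plane_measure a n. f x) =
     (LINT x|restrict_space lborel ?S. indicator A (foot a n x) * f (foot a n x))"
    unfolding set_lebesgue_integral_def plane_measure_alt
    using foot_measurable_restrict by (subst integral_distr) auto
  also have "\<dots> = (LINT x|lborel. indicator ?S x * (indicator A (foot a n x) * f (foot a n x)))"
    by (subst integral_restrict_space) auto
  also have "\<dots> = (LINT x|lborel. indicator {x. (x - a) \<bullet> n \<in> {0..1} \<and> foot a n x \<in> A} x * f (foot a n x))"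
    by (intro Bochner_Integration.integral_cong) (auto simp: indicator_def)
  finally show ?thesis .
qed

lemma plane_measure_base:
  assumes "(a - b) \<bullet> n = 0"
  shows "plane_measure a n = plane_measure b n"
proof -
  have "(x - a) \<bullet> n = (x - b) \<bullet> n" for x using assms by (simp add: inner_diff_left)
  then show ?thesis by (simp add: plane_measure_def)
qed

text \<open>Reversing the normal moves the unit slab to the other side of the hyperplane.
  Translation by \<open>n\<close> exchanges the two slabs and does not change the feet of the
  points.\<close>

lemma plane_measure_minus:
  fixes a n :: "'a::euclidean_space"
  assumes n: "norm n = 1"
  shows "plane_measure a (- n) = plane_measure a n"
proof (rule measure_eqI)
  fix A assume "A \<in> sets (plane_measure a (- n))"
  then have A [measurable]: "A \<in> sets borel" by simp
  let ?X = "{x. (x - a) \<bullet> n \<in> {0..1} \<and> foot a n x \<in> A}"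
  have nn: "n \<bullet> n = 1" using n by (simp add: dot_square_norm)
  have eq: "{x. (x - a) \<bullet> (- n) \<in> {0..1} \<and> foot a (- n) x \<in> A} = (+) n -` ?X"
    using nn by (auto simp: foot_def inner_diff_left inner_add_left algebra_simps)
  have "emeasure lborel ?X = emeasure (distr lborel borel ((+) n)) ?X"
    by (simp add: lborel_distr_plus)
  also have "\<dots> = emeasure lborel ((+) n -` ?X)"
    by (subst emeasure_distr) auto
  finally show "emeasure (plane_measure a (- n)) A = emeasure (plane_measure a n) A"
    by (simp only: emeasure_plane_measure[OF A] eq)
qed simp

lemma plane_measure_bounded_finite:
  fixes a n :: "'a::euclidean_space"
  assumes n: "norm n = 1" and "bounded A" and A: "A \<in> sets borel"
  shows "emeasure (plane_measure a n) A < \<infinity>"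
proof -
  obtain B where B: "\<And>x. x \<in> A \<Longrightarrow> norm x \<le> B" using \<open>bounded A\<close> bounded_iff by blast
  have "norm x \<le> B + 1" if "(x - a) \<bullet> n \<in> {0..1}" "foot a n x \<in> A" for x
  proof -
    have "norm x = norm (foot a n x + ((x - a) \<bullet> n) *\<^sub>R n)" by (simp add: foot_def)
    also have "\<dots> \<le> norm (foot a n x) + norm (((x - a) \<bullet> n) *\<^sub>R n)" by (rule norm_triangle_ineq)
    also have "\<dots> \<le> B + 1" using that B n by (intro add_mono) auto
    finally show ?thesis .
  qed
  then have "bounded {x. (x - a) \<bullet> n \<in> {0..1} \<and> foot a n x \<in> A}"
    unfolding bounded_iff by blast
  then show ?thesis
    using emeasure_bounded_finite by (simp add: emeasure_plane_measure[OF A])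
qed

lemma lborel_null_hyperplane:
  fixes k :: "'a::euclidean_space"
  assumes "k \<noteq> 0"
  shows "emeasure lborel {x. k \<bullet> x = c} = 0"
proof -
  have "negligible {x. k \<bullet> x = c}" using assms negligible_hyperplane by blast
  then have "emeasure lebesgue {x. k \<bullet> x = c} = 0"
    by (simp add: negligible_iff_null_sets null_sets_def)
  then show ?thesis by simp
qed

text \<open>Two hyperplanes either coincide, and then carry the same measure whatever the sign of
  their normals, or one is a null set for the measure of the other. Conditions on traces range over
  all hyperplanes; this reduces them on a side to the one hyperplane that contains the side.\<close>

lemma plane_measure_cases:
  fixes a b m n :: "'a::euclidean_space"
  assumes m: "norm m = 1" and n: "norm n = 1"
  shows "plane_measure a n = plane_measure b m \<or> emeasure (plane_measure a n) {y. (y - b) \<bullet> m = 0} = 0"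
proof -
  \<comment> \<open>The part of \<open>m\<close> tangential to the first hyperplane. If it is
    nonzero, the points whose foot lies on the second hyperplane form a subset of a hyperplane with
    normal \<open>k\<close>; if it is zero, the two hyperplanes are parallel.\<close>
  define k where "k = m - (m \<bullet> n) *\<^sub>R n"
  have nn: "n \<bullet> n = 1" using n by (simp add: dot_square_norm)
  have em: "emeasure (plane_measure a n) {y. (y - b) \<bullet> m = 0} =
       emeasure lborel {x. (x - a) \<bullet> n \<in> {0..1} \<and> foot a n x \<in> {y. (y - b) \<bullet> m = 0}}" (is "_ = emeasure lborel ?X")
    by (rule emeasure_plane_measure) measurable
  show ?thesis
  proof (cases "k = 0")
    case False
    have "?X \<subseteq> {x. k \<bullet> x = b \<bullet> m - (a \<bullet> n) * (n \<bullet> m)}"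
      by (auto simp: foot_def k_def inner_diff_left inner_commute algebra_simps)
    then have "emeasure lborel ?X \<le> emeasure lborel {x. k \<bullet> x = b \<bullet> m - (a \<bullet> n) * (n \<bullet> m)}"
      by (intro emeasure_mono) auto
    then show ?thesis using em lborel_null_hyperplane[OF False] by simp
  next
    case True
    then have mk: "m = (m \<bullet> n) *\<^sub>R n" by (simp add: k_def)
    then have "\<bar>m \<bullet> n\<bar> = 1" using m n by (metis norm_scaleR mult.right_neutral)
    then have mn: "m = n \<or> m = - n" using mk by (auto simp: abs_if split: if_splits)
    show ?thesis
    proof (cases "(a - b) \<bullet> n = 0")
      case True
      then have "plane_measure a n = plane_measure b n" by (rule plane_measure_base)
      then show ?thesis using mn plane_measure_minus[OF n, of b] by auto
    next
      case False
      have "(foot a n x - b) \<bullet> m \<noteq> 0" for x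
      proof -
        have "(foot a n x - b) \<bullet> n = (a - b) \<bullet> n"
          using nn by (simp add: foot_def inner_diff_left algebra_simps)
        then show ?thesis using mn False by auto
      qed
      then have "?X = {}" by auto
      then show ?thesis using em by (metis emeasure_empty)
    qed
  qed
qed

lemma lborel_integral_translate:
  fixes f :: "'a::euclidean_space \<Rightarrow> real"
  assumes [measurable]: "f \<in> borel_measurable borel"
  shows "(LINT x|lborel. f (c + x)) = (LINT x|lborel. f x)"
proof -
  have "(LINT x|lborel. f x) = (LINT x|distr lborel borel ((+) c). f x)"
    by (simp add: lborel_distr_plus)
  also have "\<dots> = (LINT x|lborel. f (c + x))"
    by (subst integral_distr) auto
  finally show ?thesis by simp
qed

text \<open>
  Stretching by \<open>1 / \<epsilon>\<close> maps the layer of thickness \<open>\<epsilon>\<close> to the unit slab of which \<open>plane_measure\<close> is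
  the projection.
\<close>

lemma layer_limit:
  fixes n s0 :: "'a::euclidean_space" and w :: "'a \<Rightarrow> real" and \<epsilon> :: "nat \<Rightarrow> real"
  assumes n: "norm n = 1" and T: "compact T"
    and pos: "\<And>x. x \<in> T \<Longrightarrow> 0 \<le> (x - s0) \<bullet> n"
    and w: "continuous_on UNIV w" and \<epsilon>: "\<And>k. 0 < \<epsilon> k" "\<And>k. \<epsilon> k \<le> 1" "\<epsilon> \<longlonglongrightarrow> 0"
    and ev: "AE x in lborel. 0 \<le> (x - s0) \<bullet> n \<longrightarrow> foot s0 n x \<in> T \<longrightarrow>
      (\<forall>\<^sub>F k in sequentially. foot s0 n x + (\<epsilon> k * ((x - s0) \<bullet> n)) *\<^sub>R n \<in> T)"
  shows "(\<lambda>k. (1 / \<epsilon> k) * (LINT x|lborel. indicator {x\<in>T. (x - s0) \<bullet> n \<le> \<epsilon> k} x * w x))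
      \<longlonglongrightarrow> (LINT x:{x\<in>T. (x - s0) \<bullet> n = 0}|plane_measure s0 n. w x)"
proof -
  let ?l = "\<lambda>x. (x - s0) \<bullet> n"
  \<comment> \<open>The point of the thin layer that corresponds to the point \<open>x\<close> of
    the unit slab: it has the same foot, and its height is multiplied by
    \<open>\<epsilon> k\<close>. The factor \<open>1 / \<epsilon> k\<close> in the claim is exactly
    cancelled by this change of variables.\<close>
  define xk where "xk k x = s0 + stretch n (\<epsilon> k) (x - s0)" for k x
  have nn: "n \<bullet> n = 1" using n by (simp add: dot_square_norm)
  have xk: "xk k x = foot s0 n x + (\<epsilon> k * ?l x) *\<^sub>R n" for k x
    by (simp add: xk_def stretch_def foot_def algebra_simps)
  have lxk: "?l (xk k x) = \<epsilon> k * ?l x" for k x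
    by (simp add: xk foot_def inner_diff_left inner_add_left nn algebra_simps)
  have T' [measurable]: "T \<in> sets borel" using T by (simp add: borel_compact)
  have [measurable]: "w \<in> borel_measurable borel"
    using w by (simp add: borel_measurable_continuous_onI)
  have [measurable]: "xk k \<in> borel_measurable borel" for k
    unfolding xk_def by measurable
  obtain B where B: "\<And>x. x \<in> T \<Longrightarrow> norm x \<le> B"
    using compact_imp_bounded[OF T] bounded_iff by blast
  obtain M where M: "\<And>x. x \<in> T \<Longrightarrow> \<bar>w x\<bar> \<le> M"
    using compact_imp_bounded[OF compact_continuous_image[OF continuous_on_subset[OF w] T]]
    by (auto simp: bounded_iff)
  define F where "F k x = indicator {x\<in>T. ?l x \<le> \<epsilon> k} (xk k x) * w (xk k x)" for k x
  define F0 where "F0 x = indicator {x. ?l x \<in> {0..1} \<and> foot s0 n x \<in> {x\<in>T. ?l x = 0}} x * w (foot s0 n x)" for x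
  have lf: "?l (foot s0 n x) = 0" for x
    by (simp add: foot_def inner_diff_left nn algebra_simps)
  have [measurable]: "F k \<in> borel_measurable borel" for k unfolding F_def by measurable
  have [measurable]: "F0 \<in> borel_measurable borel" unfolding F0_def by measurable
  have eq: "(1 / \<epsilon> k) * (LINT x|lborel. indicator {x\<in>T. ?l x \<le> \<epsilon> k} x * w x) = (LINT x|lborel. F k x)" for k
  proof -
    let ?f = "\<lambda>x. indicator {x\<in>T. ?l x \<le> \<epsilon> k} x * w x"
    have "(LINT x|lborel. ?f x) = (LINT x|lborel. ?f (s0 + x))"
      by (subst lborel_integral_translate) auto
    also have "\<dots> = \<epsilon> k * (LINT x|lborel. ?f (s0 + stretch n (\<epsilon> k) x))"
      by (subst lborel_integral_stretch[OF n \<epsilon>(1)]) auto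
    also have "(LINT x|lborel. ?f (s0 + stretch n (\<epsilon> k) x)) = (LINT x|lborel. ?f (s0 + stretch n (\<epsilon> k) (-s0 + x)))"
      by (subst lborel_integral_translate[of "\<lambda>x. ?f (s0 + stretch n (\<epsilon> k) x)"]) auto
    finally show ?thesis using \<epsilon>(1)[of k] by (simp add: F_def xk_def)
  qed
  have "(\<lambda>k. LINT x|lborel. F k x) \<longlonglongrightarrow> (LINT x|lborel. F0 x)"
  proof (rule integral_dominated_convergence)
    show "integrable lborel (\<lambda>x. \<bar>M\<bar> * indicator (cball (0::'a) (B + 1)) x)"
      using emeasure_lborel_cball_finite by (intro integrable_mult_right integrable_real_indicator) auto
    show "AE x in lborel. norm (F k x) \<le> \<bar>M\<bar> * indicator (cball 0 (B + 1)) x" for k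
    proof (intro AE_I2)
      fix x
      show "norm (F k x) \<le> \<bar>M\<bar> * indicator (cball 0 (B + 1)) x"
      proof (cases "xk k x \<in> T \<and> ?l (xk k x) \<le> \<epsilon> k")
        case True
        then have "0 \<le> \<epsilon> k * ?l x" "\<epsilon> k * ?l x \<le> \<epsilon> k" using pos lxk by metis+
        then have l: "0 \<le> ?l x" "?l x \<le> 1" using \<epsilon>(1)[of k]
          by (simp_all add: zero_le_mult_iff not_le[symmetric])
        \<comment> \<open>Going back from the layer to the slab shifts a point by at most 1, whence
          the radius \<open>B + 1\<close> of the dominating ball.\<close>
        have "x = xk k x + ((1 - \<epsilon> k) * ?l x) *\<^sub>R n"
          by (simp add: xk foot_def algebra_simps)
        then have "norm x \<le> norm (xk k x) + norm (((1 - \<epsilon> k) * ?l x) *\<^sub>R n)"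
          by (metis norm_triangle_ineq)
        also have "norm (((1 - \<epsilon> k) * ?l x) *\<^sub>R n) = (1 - \<epsilon> k) * ?l x"
          using n l \<epsilon>(2)[of k] by simp
        also have "(1 - \<epsilon> k) * ?l x \<le> 1" using l \<epsilon>(1,2)[of k] by (intro mult_le_one) auto
        finally have "norm x \<le> B + 1" using B True by (metis add_mono order_trans order_refl)
        moreover have "\<bar>w (xk k x)\<bar> \<le> \<bar>M\<bar>" using M True abs_ge_self order_trans by blast
        ultimately show ?thesis using True by (simp add: F_def)
      qed (auto simp: F_def)
    qed
    show "AE x in lborel. (\<lambda>k. F k x) \<longlonglongrightarrow> F0 x"
      using ev
    proof eventually_elim
      fix x assume evx: "0 \<le> ?l x \<longrightarrow> foot s0 n x \<in> T \<longrightarrow>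
         (\<forall>\<^sub>F k in sequentially. foot s0 n x + (\<epsilon> k * ?l x) *\<^sub>R n \<in> T)"
      have lim: "(\<lambda>k. xk k x) \<longlonglongrightarrow> foot s0 n x"
        unfolding xk by (rule tendsto_eq_intros \<epsilon>(3) refl)+ simp
      have Fk: "F k x = (if xk k x \<in> T \<and> 0 \<le> ?l x \<and> ?l x \<le> 1 then w (xk k x) else 0)" for k
      proof -
        have "(?l (xk k x) \<le> \<epsilon> k) = (?l x \<le> 1)" unfolding lxk using \<epsilon>(1)[of k] by simp
        moreover have "xk k x \<in> T \<Longrightarrow> 0 \<le> ?l x"
          using pos[of "xk k x"] \<epsilon>(1)[of k] unfolding lxk by (simp add: zero_le_mult_iff)
        ultimately show ?thesis by (auto simp: F_def)
      qed
      have F0: "F0 x = (if foot s0 n x \<in> T \<and> 0 \<le> ?l x \<and> ?l x \<le> 1 then w (foot s0 n x) else 0)"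
        by (auto simp: F0_def lf)
      show "(\<lambda>k. F k x) \<longlonglongrightarrow> F0 x"
      proof (cases "0 \<le> ?l x \<and> ?l x \<le> 1")
        case False
        then show ?thesis unfolding Fk F0 by auto
      next
        case l: True
        show ?thesis
        \<comment> \<open>If the foot lies in \<open>T\<close>, hypothesis \<open>ev\<close> keeps
          the points of the layer in \<open>T\<close>; if not, they eventually leave
          \<open>T\<close> because \<open>T\<close> is closed.\<close>
        proof (cases "foot s0 n x \<in> T")
          case True
          have "\<forall>\<^sub>F k in sequentially. w (xk k x) = F k x"
            using evx l True unfolding xk[symmetric] Fk by (auto elim: eventually_mono)
          moreover have "(\<lambda>k. w (xk k x)) \<longlonglongrightarrow> w (foot s0 n x)"
            using continuous_on_tendsto_compose[OF w lim] by simp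
          ultimately show ?thesis using F0 l True Lim_transform_eventually by fastforce
        next
          case False
          have "open (- T)" using T by (simp add: compact_imp_closed open_Compl)
          then have "\<forall>\<^sub>F k in sequentially. xk k x \<in> - T"
            using lim False by (auto simp: tendsto_def)
          then have "\<forall>\<^sub>F k in sequentially. F k x = 0" unfolding Fk by (auto elim: eventually_mono)
          then show ?thesis using F0 False by (simp add: tendsto_eventually)
        qed
      qed
    qed
  qed auto
  also have "(LINT x|lborel. F0 x) = (LINT x:{x\<in>T. ?l x = 0}|plane_measure s0 n. w x)"
    unfolding F0_def by (subst set_lebesgue_integral_plane_measure) auto
  finally show ?thesis by (simp only: eq)
qed

section \<open>Simplices and barycentric coordinates\<close>

lemma lborel_integral_cone_scale:
  fixes w :: "'a::euclidean_space \<Rightarrow> real" and a :: 'a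
  assumes [measurable]: "w \<in> borel_measurable borel" and T: "compact T" and c: "0 < c"
  shows "(LINT x|lborel. indicator T x * (c ^ DIM('a) * w (a + c *\<^sub>R (x - a)))) =
    (LINT x|lborel. indicator ((\<lambda>y. a + c *\<^sub>R (y - a)) ` T) x * w x)"
proof -
  let ?g = "\<lambda>y. a + c *\<^sub>R (y - a)"
  let ?F = "\<lambda>x. indicator (?g ` T) x * w x"
  have [measurable]: "T \<in> sets borel" using T by (simp add: borel_compact)
  have "compact (?g ` T)"
    using T by (intro compact_continuous_image continuous_intros)
  then have [measurable]: "?g ` T \<in> sets borel" by (simp add: borel_compact)
  have g: "?g x = (a - c *\<^sub>R a) + c *\<^sub>R x" for x by (simp add: algebra_simps)
  have ind: "indicator (?g ` T) (?g x) = (indicator T x :: real)" for x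
    using c by (auto simp: indicator_def)
  have "(LINT x|lborel. ?F x) =
     (LINT x|density (distr lborel borel (\<lambda>x. (a - c *\<^sub>R a) + c *\<^sub>R x)) (\<lambda>_. \<bar>c\<bar>^DIM('a)). ?F x)"
    using lborel_affine[of c "a - c *\<^sub>R a"] c by simp
  also have "\<dots> = (LINT x|lborel. c ^ DIM('a) * ?F ((a - c *\<^sub>R a) + c *\<^sub>R x))"
    using c by (subst integral_density) (auto simp: integral_distr)
  also have "\<dots> = (LINT x|lborel. indicator T x * (c ^ DIM('a) * w (?g x)))"
    unfolding g[symmetric] ind by (simp add: ac_simps)
  finally show ?thesis by simp
qed

lemma C1_fun_has_derivative:
  "C1_fun f \<Longrightarrow> (f has_derivative (\<lambda>h. grad f x \<bullet> h)) (at x)"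
  using has_derivative_grad by (auto simp: C1_fun_def)

text \<open>For fixed x the integrand is a difference quotient at \<tau> = 1 of \<tau>^d w(a +
  \<tau> (x - a)), whose derivative there is d w(x) + \<nabla>w(x) \<bullet> (x - a). The mean value
  theorem bounds the quotients uniformly on the compact set \<open>T\<close>, so dominated
  convergence applies.\<close>

lemma cone_derivative:
  fixes w :: "'a::euclidean_space \<Rightarrow> real" and a :: 'a and \<delta> :: "nat \<Rightarrow> real"
  assumes w: "C1_fun w" and T: "compact T"
    and \<delta>: "\<And>k. 0 < \<delta> k" "\<And>k. \<delta> k \<le> 1" "\<delta> \<longlonglongrightarrow> 0"
  shows "(\<lambda>k. LINT x|lborel. indicator T x *
        ((w x - (1 - \<delta> k) ^ DIM('a) * w (a + (1 - \<delta> k) *\<^sub>R (x - a))) / \<delta> k))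
    \<longlonglongrightarrow> (LINT x|lborel. indicator T x * (real DIM('a) * w x + grad w x \<bullet> (x - a)))"
proof -
  let ?d = "DIM('a)"
  have [measurable]: "T \<in> sets borel" using T by (simp add: borel_compact)
  have contw: "continuous_on UNIV w" using w by (rule C1_fun_continuous)
  have contg: "continuous_on UNIV (grad w)" using w by (rule C1_fun_grad_continuous)
  have [measurable]: "w \<in> borel_measurable borel" "grad w \<in> borel_measurable borel"
    using contw contg by (auto intro: borel_measurable_continuous_onI)
  define f where "f x \<tau> = \<tau> ^ ?d * w (a + \<tau> *\<^sub>R (x - a))" for x \<tau>
  define f' where "f' x \<tau> = real ?d * \<tau> ^ (?d - 1) * w (a + \<tau> *\<^sub>R (x - a))
      + \<tau> ^ ?d * (grad w (a + \<tau> *\<^sub>R (x - a)) \<bullet> (x - a))" for x \<tau>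
  have der: "(f x has_real_derivative f' x \<tau>) (at \<tau>)" for x \<tau>
  proof -
    have "((\<lambda>\<tau>. w (a + \<tau> *\<^sub>R (x - a))) has_derivative (\<lambda>h. grad w (a + \<tau> *\<^sub>R (x - a)) \<bullet> (h *\<^sub>R (x - a)))) (at \<tau>)"
      by (rule has_derivative_compose[OF _ C1_fun_has_derivative[OF w]]) (auto intro!: derivative_eq_intros)
    then have "((\<lambda>\<tau>. w (a + \<tau> *\<^sub>R (x - a))) has_real_derivative grad w (a + \<tau> *\<^sub>R (x - a)) \<bullet> (x - a)) (at \<tau>)"
      by (simp add: has_field_derivative_def mult.commute[of _ "_ \<bullet> _"])
    then show ?thesis unfolding f_def f'_def
      by (auto intro!: derivative_eq_intros simp: algebra_simps)
  qed
  obtain B0 where B0: "\<And>x. x \<in> T \<Longrightarrow> norm x \<le> B0"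
    using compact_imp_bounded[OF T] bounded_iff by blast
  define B where "B = \<bar>B0\<bar>"
  have B: "norm x \<le> B" if "x \<in> T" for x using B0[OF that] by (simp add: B_def)
  \<comment> \<open>The ball of radius \<open>R\<close> contains all segments from \<open>a\<close>
    to points of \<open>T\<close>, on which \<open>w\<close> and its gradient have to be
    bounded.\<close>
  define R where "R = norm a + (B + norm a)"
  have in_ball: "norm (a + \<tau> *\<^sub>R (x - a)) \<le> R" if "x \<in> T" "0 \<le> \<tau>" "\<tau> \<le> 1" for x \<tau>
  proof -
    have "norm (a + \<tau> *\<^sub>R (x - a)) \<le> norm a + \<tau> * norm (x - a)"
      using norm_triangle_ineq[of a "\<tau> *\<^sub>R (x - a)"] that by simp
    also have "\<tau> * norm (x - a) \<le> 1 * (B + norm a)"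
      using that B[OF that(1)] norm_triangle_ineq4[of x a] by (intro mult_mono) auto
    finally show ?thesis by (simp add: R_def)
  qed
  obtain M1 where M1: "\<And>y. norm y \<le> R \<Longrightarrow> \<bar>w y\<bar> \<le> M1"
    using compact_imp_bounded[OF compact_continuous_image[OF continuous_on_subset[OF contw] compact_cball[of 0 R]]]
    by (fastforce simp: bounded_iff)
  obtain M2 where M2: "\<And>y. norm y \<le> R \<Longrightarrow> norm (grad w y) \<le> M2"
    using compact_imp_bounded[OF compact_continuous_image[OF continuous_on_subset[OF contg] compact_cball[of 0 R]]]
    by (fastforce simp: bounded_iff)
  define M where "M = real ?d * \<bar>M1\<bar> + \<bar>M2\<bar> * (B + norm a)"
  have bound: "\<bar>f' x \<tau>\<bar> \<le> M" if "x \<in> T" "0 \<le> \<tau>" "\<tau> \<le> 1" for x \<tau>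
  proof -
    let ?y = "a + \<tau> *\<^sub>R (x - a)"
    have y: "norm ?y \<le> R" by (rule in_ball[OF that])
    have p: "\<bar>\<tau> ^ n\<bar> \<le> 1" for n using that by (simp add: power_le_one)
    have "\<bar>real ?d * \<tau> ^ (?d - 1) * w ?y\<bar> = real ?d * (\<bar>\<tau> ^ (?d - 1)\<bar> * \<bar>w ?y\<bar>)"
      by (simp add: abs_mult)
    also have "\<dots> \<le> real ?d * (1 * \<bar>M1\<bar>)"
      using p M1[OF y] by (intro mult_left_mono mult_mono) auto
    finally have 1: "\<bar>real ?d * \<tau> ^ (?d - 1) * w ?y\<bar> \<le> real ?d * \<bar>M1\<bar>" by simp
    have "\<bar>\<tau> ^ ?d * (grad w ?y \<bullet> (x - a))\<bar> = \<bar>\<tau> ^ ?d\<bar> * \<bar>grad w ?y \<bullet> (x - a)\<bar>"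
      by (simp add: abs_mult)
    also have "\<dots> \<le> 1 * (norm (grad w ?y) * norm (x - a))"
      using p Cauchy_Schwarz_ineq2 by (intro mult_mono) auto
    also have "\<dots> \<le> 1 * (\<bar>M2\<bar> * (B + norm a))"
      using M2[OF y] B[OF that(1)] norm_triangle_ineq4[of x a]
      by (intro mult_left_mono mult_mono) auto
    finally show ?thesis using 1 unfolding f'_def M_def
      by (intro order_trans[OF abs_triangle_ineq]) linarith
  qed
  have f1: "f x 1 = w x" for x by (simp add: f_def)
  show ?thesis
  proof (rule integral_dominated_convergence)
    show "integrable lborel (\<lambda>x. \<bar>M\<bar> * indicator (cball (0::'a) B) x)"
      using emeasure_lborel_cball_finite by (intro integrable_mult_right integrable_real_indicator) auto
    show "AE x in lborel. norm (indicator T x *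
        ((w x - (1 - \<delta> k) ^ DIM('a) * w (a + (1 - \<delta> k) *\<^sub>R (x - a))) / \<delta> k)) \<le> \<bar>M\<bar> * indicator (cball 0 B) x" for k
    proof (rule AE_I2)
      fix x
      show "norm (indicator T x * ((w x - (1 - \<delta> k) ^ DIM('a) * w (a + (1 - \<delta> k) *\<^sub>R (x - a))) / \<delta> k))
        \<le> \<bar>M\<bar> * indicator (cball 0 B) x"
      proof (cases "x \<in> T")
        case True
        have "norm (f x 1 - f x (1 - \<delta> k)) \<le> M * norm (1 - (1 - \<delta> k))"
        proof (rule field_differentiable_bound[of "{0..1}"])
          show "(f x has_field_derivative f' x z) (at z within {0..1})" for z
            using der has_field_derivative_at_within by blast
        qed (use \<delta>(1,2)[of k] bound[OF True] in auto)
        then have "\<bar>(f x 1 - f x (1 - \<delta> k)) / \<delta> k\<bar> \<le> M"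
          using \<delta>(1)[of k] by (simp add: field_simps)
        then show ?thesis using B[OF True] True by (auto simp: f_def)
      qed auto
    qed
    show "AE x in lborel. (\<lambda>k. indicator T x *
        ((w x - (1 - \<delta> k) ^ DIM('a) * w (a + (1 - \<delta> k) *\<^sub>R (x - a))) / \<delta> k)) \<longlonglongrightarrow>
        indicator T x * (real DIM('a) * w x + grad w x \<bullet> (x - a))"
    proof (rule AE_I2, rule tendsto_mult_left)
      fix x
      have "((\<lambda>h. (f x (1 + h) - f x 1) / h) \<longlongrightarrow> f' x 1) (at 0)"
        using der[of x 1] by (simp add: DERIV_def)
      moreover have "filterlim (\<lambda>k. - \<delta> k) (at 0) sequentially"
        unfolding filterlim_at using tendsto_minus[OF \<delta>(3)] \<delta>(1) by (auto simp: less_imp_neq[symmetric])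
      ultimately have "(\<lambda>k. (f x (1 + - \<delta> k) - f x 1) / (- \<delta> k)) \<longlonglongrightarrow> f' x 1"
        by (rule filterlim_compose)
      moreover have "(f x (1 + - \<delta> k) - f x 1) / (- \<delta> k) =
         (w x - (1 - \<delta> k) ^ DIM('a) * w (a + (1 - \<delta> k) *\<^sub>R (x - a))) / \<delta> k" for k
        using \<delta>(1)[of k] by (simp add: f_def field_simps)
      ultimately show "(\<lambda>k. (w x - (1 - \<delta> k) ^ DIM('a) * w (a + (1 - \<delta> k) *\<^sub>R (x - a))) / \<delta> k)
          \<longlonglongrightarrow> real DIM('a) * w x + grad w x \<bullet> (x - a)"
        by (simp add: f'_def)
    qed
  qed auto
qed

text \<open>
  The gradient of the barycentric coordinate of the vertex \<open>a\<close>: an inner normal of the opposite side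
  whose length is the inverse of the height.
\<close>

definition bgrad :: "'a::euclidean_space set \<Rightarrow> 'a \<Rightarrow> 'a" where
  "bgrad C a = (SOME g. \<forall>b\<in>C - {a}. g \<bullet> (b - a) = -1)"

definition bary :: "'a::euclidean_space set \<Rightarrow> 'a \<Rightarrow> 'a \<Rightarrow> real" where
  "bary C a x = 1 + bgrad C a \<bullet> (x - a)"

lemma bary_add: "bary C a (x + v) = bary C a x + bgrad C a \<bullet> v"
  by (simp add: bary_def algebra_simps)

lemma bary_diff: "bary C a y - bary C a x = bgrad C a \<bullet> (y - x)"
  by (simp add: bary_def algebra_simps)

lemma continuous_bary: "continuous_on A (bary C a)"
  unfolding bary_def by (intro continuous_intros)

lemma bary_measurable [measurable]: "bary C a \<in> borel_measurable borel"
  unfolding bary_def by measurable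

section \<open>Full-dimensional simplices in barycentric coordinates\<close>

locale full_simplex =
  fixes C :: "'a::euclidean_space set"
  assumes indep: "\<not> affine_dependent C" and cardC: "card C = Suc DIM('a)" and dim2: "2 \<le> DIM('a)"
begin

abbreviation "T \<equiv> convex hull C"

lemma finC: "finite C" using cardC card_ge_0_finite by force

text \<open>Justifies the choice in \<open>bgrad\<close>: the edges issuing from \<open>a\<close>
  are linearly independent, so some linear functional takes the value -1 on all of them, and the
  vector representing it is a witness.\<close>

lemma bgrad_vertex:
  assumes "a \<in> C" "b \<in> C" "b \<noteq> a"
  shows "bgrad C a \<bullet> (b - a) = -1"
proof -
  let ?B = "(\<lambda>x. - a + x) ` (C - {a})"
  have "independent ?B"
    using indep affine_dependent_iff_dependent2[OF assms(1)] by simp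
  then obtain f :: "'a \<Rightarrow> real" where f: "linear f" "\<And>x. x \<in> ?B \<Longrightarrow> f x = -1"
    using linear_independent_extend[of ?B "\<lambda>_. -1"] by auto
  define g where "g = (\<Sum>i\<in>Basis. f i *\<^sub>R i)"
  have fg: "g \<bullet> v = f v" for v
  proof -
    have "f v = f (\<Sum>i\<in>Basis. (v \<bullet> i) *\<^sub>R i)" by (simp add: euclidean_representation)
    also have "\<dots> = g \<bullet> v"
      using f(1) by (simp add: linear_sum linear_scale g_def inner_sum_left inner_commute[of v] mult.commute)
    finally show ?thesis by simp
  qed
  have "\<forall>b\<in>C - {a}. g \<bullet> (b - a) = -1" using f(2) by (auto simp: fg)
  then have "\<forall>b\<in>C - {a}. bgrad C a \<bullet> (b - a) = -1"
    unfolding bgrad_def by (rule someI)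
  then show ?thesis using assms by auto
qed

lemma bary_vertex: "a \<in> C \<Longrightarrow> b \<in> C \<Longrightarrow> bary C a b = (if a = b then 1 else 0)"
  using bgrad_vertex by (auto simp: bary_def)

lemma bary_combination:
  assumes "a \<in> C" "sum u C = 1"
  shows "bary C a (\<Sum>b\<in>C. u b *\<^sub>R b) = u a"
proof -
  have "bary C a (\<Sum>b\<in>C. u b *\<^sub>R b) = sum u C * (1 - bgrad C a \<bullet> a) + (\<Sum>b\<in>C. u b * (bgrad C a \<bullet> b))"
    using assms by (simp add: bary_def inner_diff_right inner_sum_right)
  also have "\<dots> = (\<Sum>b\<in>C. u b * bary C a b)"
    by (simp add: bary_def sum_distrib_right sum.distrib[symmetric] algebra_simps)
  also have "\<dots> = (\<Sum>b\<in>C. if b = a then u b else 0)"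
    using assms by (intro sum.cong) (auto simp: bary_vertex)
  also have "\<dots> = u a" using assms finC by simp
  finally show ?thesis .
qed

lemma bary_repr: "(\<Sum>a\<in>C. bary C a x *\<^sub>R a) = x" and bary_sum: "(\<Sum>a\<in>C. bary C a x) = 1"
proof -
  have "affine hull C = UNIV" using affine_independent_span_eq indep cardC by blast
  then obtain u where u: "sum u C = 1" "(\<Sum>b\<in>C. u b *\<^sub>R b) = x"
    using affine_hull_finite[OF finC] by auto
  then have "\<And>a. a \<in> C \<Longrightarrow> bary C a x = u a" using bary_combination by blast
  then show "(\<Sum>a\<in>C. bary C a x *\<^sub>R a) = x" "(\<Sum>a\<in>C. bary C a x) = 1" using u by auto
qed

lemma bgrad_sum: "(\<Sum>a\<in>C. bgrad C a) = 0"
proof -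
  have "(\<Sum>a\<in>C. bgrad C a) \<bullet> v = 0" for v
    using bary_sum[of v] bary_sum[of 0] by (simp add: inner_sum_left bary_def inner_diff_right sum_subtractf sum.distrib)
  then show ?thesis by (metis inner_eq_zero_iff)
qed

text \<open>The derivative of \<open>bary_repr\<close>, just as \<open>bgrad_sum\<close> is the
  derivative of \<open>bary_sum\<close>. These two identities are what makes the sums over vertices
  or facets collapse later on.\<close>

lemma bgrad_repr: "(\<Sum>a\<in>C. (bgrad C a \<bullet> v) *\<^sub>R a) = v"
proof -
  have "(\<Sum>a\<in>C. (bgrad C a \<bullet> v) *\<^sub>R a) = (\<Sum>a\<in>C. bary C a v *\<^sub>R a) - (\<Sum>a\<in>C. bary C a 0 *\<^sub>R a)"
    by (simp add: sum_subtractf[symmetric] scaleR_diff_left[symmetric] bary_diff)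
  then show ?thesis by (simp add: bary_repr)
qed

lemma mem_T_iff: "x \<in> T \<longleftrightarrow> (\<forall>a\<in>C. 0 \<le> bary C a x)"
proof
  assume "x \<in> T"
  then obtain u where "\<forall>a\<in>C. 0 \<le> u a" "sum u C = 1" "(\<Sum>a\<in>C. u a *\<^sub>R a) = x"
    using convex_hull_finite[OF finC] by auto
  then show "\<forall>a\<in>C. 0 \<le> bary C a x" using bary_combination by metis
next
  assume "\<forall>a\<in>C. 0 \<le> bary C a x"
  then show "x \<in> T" unfolding convex_hull_finite[OF finC]
    using bary_repr bary_sum by (intro CollectI exI[of _ "\<lambda>a. bary C a x"]) auto
qed

lemma mem_interior_iff: "x \<in> interior T \<longleftrightarrow> (\<forall>a\<in>C. 0 < bary C a x)"
proof -
  have eq: "interior T = {y. \<exists>u. (\<forall>x\<in>C. 0 < u x) \<and> sum u C = 1 \<and> (\<Sum>x\<in>C. u x *\<^sub>R x) = y}"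
    using interior_convex_hull_explicit_minimal[OF indep] cardC by simp
  show ?thesis
  proof
    assume "x \<in> interior T"
    then obtain u where "\<forall>a\<in>C. 0 < u a" "sum u C = 1" "(\<Sum>a\<in>C. u a *\<^sub>R a) = x"
      unfolding eq by auto
    then show "\<forall>a\<in>C. 0 < bary C a x" using bary_combination by metis
  next
    assume "\<forall>a\<in>C. 0 < bary C a x"
    then show "x \<in> interior T" unfolding eq
      using bary_repr bary_sum by (intro CollectI exI[of _ "\<lambda>a. bary C a x"]) auto
  qed
qed

lemma mem_facet_iff:
  assumes a: "a \<in> C"
  shows "x \<in> convex hull (C - {a}) \<longleftrightarrow> x \<in> T \<and> bary C a x = 0"
proof
  assume "x \<in> convex hull (C - {a})"
  then obtain u where u: "\<forall>b\<in>C-{a}. 0 \<le> u b" "sum u (C - {a}) = 1" "(\<Sum>b\<in>C-{a}. u b *\<^sub>R b) = x"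
    using convex_hull_finite[of "C - {a}"] finC by auto
  define u' where "u' b = (if b = a then 0 else u b)" for b
  have "sum u' C = sum u (C - {a})"
    using finC a by (simp add: sum.remove u'_def)
  moreover have "(\<Sum>b\<in>C. u' b *\<^sub>R b) = (\<Sum>b\<in>C-{a}. u b *\<^sub>R b)"
    using finC a by (simp add: sum.remove u'_def)
  ultimately have "bary C b x = u' b" if "b \<in> C" for b
    using bary_combination[OF that, of u'] u by simp
  then show "x \<in> T \<and> bary C a x = 0"
    using u(1) a by (auto simp: mem_T_iff u'_def)
next
  assume x: "x \<in> T \<and> bary C a x = 0"
  have "(\<Sum>b\<in>C-{a}. bary C b x) = 1" "(\<Sum>b\<in>C-{a}. bary C b x *\<^sub>R b) = x"
    using bary_sum[of x] bary_repr[of x] x a finC by (simp_all add: sum.remove)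
  then show "x \<in> convex hull (C - {a})"
    unfolding convex_hull_finite[OF finite_Diff[OF finC]]
    using x mem_T_iff by (intro CollectI exI[of _ "\<lambda>b. bary C b x"]) auto
qed

lemma compact_T: "compact T"
  using finC by (simp add: finite_imp_compact_convex_hull)

lemma other_vertex:
  assumes "a \<in> C" obtains b where "b \<in> C" "b \<noteq> a"
proof -
  have "C \<noteq> {a}" using cardC dim2 by auto
  then show ?thesis using that assms by blast
qed

lemma bgrad_nonzero: assumes "a \<in> C" shows "bgrad C a \<noteq> 0"
proof -
  obtain b where "b \<in> C" "b \<noteq> a" using other_vertex[OF assms] .
  then show ?thesis using bgrad_vertex[OF assms] by force
qed

text \<open>A vector v orthogonal to \<open>bgrad C a\<close> has no component at \<open>a\<close>
  in \<open>bgrad_repr\<close>, so it is a combination of edges of the facet and is orthogonal to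
  \<open>n\<close>. Applied to the part of \<open>n\<close> orthogonal to \<open>bgrad C a\<close>,
  this shows that this part vanishes.\<close>

lemma orthogonal_facet:
  assumes a: "a \<in> C" and n: "\<And>b b'. b \<in> C - {a} \<Longrightarrow> b' \<in> C - {a} \<Longrightarrow> n \<bullet> (b - b') = 0"
  obtains c where "n = c *\<^sub>R bgrad C a"
proof -
  let ?g = "bgrad C a"
  obtain b0 where b0: "b0 \<in> C" "b0 \<noteq> a" using other_vertex[OF a] .
  have orth: "n \<bullet> v = 0" if v: "?g \<bullet> v = 0" for v
  proof -
    have "(\<Sum>b\<in>C. bgrad C b \<bullet> v) = 0" using arg_cong[OF bgrad_sum, of "\<lambda>g. g \<bullet> v"] by (simp add: inner_sum_left)
    then have "n \<bullet> v = n \<bullet> (\<Sum>b\<in>C. (bgrad C b \<bullet> v) *\<^sub>R b) - (\<Sum>b\<in>C. bgrad C b \<bullet> v) * (n \<bullet> b0)"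
      by (simp add: bgrad_repr)
    also have "\<dots> = (\<Sum>b\<in>C. (bgrad C b \<bullet> v) * (n \<bullet> (b - b0)))"
      by (simp add: inner_sum_right sum_distrib_right inner_diff_right right_diff_distrib sum_subtractf)
    also have "\<dots> = 0"
    proof (rule sum.neutral, rule ballI)
      fix b assume "b \<in> C"
      then show "(bgrad C b \<bullet> v) * (n \<bullet> (b - b0)) = 0"
        using v n[of b b0] b0 by (cases "b = a") auto
    qed
    finally show ?thesis .
  qed
  define v where "v = n - (n \<bullet> ?g / (?g \<bullet> ?g)) *\<^sub>R ?g"
  have "?g \<bullet> v = 0" using bgrad_nonzero[OF a] by (simp add: v_def inner_diff_right inner_commute)
  moreover from this have "n \<bullet> v = 0" by (rule orth)
  ultimately have "v \<bullet> v = 0" by (simp add: v_def inner_diff_left)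
  then show thesis using that by (simp add: v_def)
qed

text \<open>The normal of a side is a choice between two opposite unit vectors and knows nothing of
  the adjacent elements. Its orientation relative to the simplex is therefore recorded by the number
  \<open>bgrad C a \<bullet> side_normal S\<close>, whose modulus is the length of
  \<open>bgrad C a\<close>.\<close>

lemma side_normal:
  assumes a: "a \<in> C"
  shows "norm (side_normal (convex hull (C - {a}))) = 1"
    and "bgrad C a = (bgrad C a \<bullet> side_normal (convex hull (C - {a}))) *\<^sub>R side_normal (convex hull (C - {a}))"
    and "norm (bgrad C a) = \<bar>bgrad C a \<bullet> side_normal (convex hull (C - {a}))\<bar>"
    and "side_normal (convex hull (C - {a})) = bgrad C a /\<^sub>R norm (bgrad C a) \<or>
      side_normal (convex hull (C - {a})) = - (bgrad C a /\<^sub>R norm (bgrad C a))"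
proof -
  let ?g = "bgrad C a" and ?S = "convex hull (C - {a})"
  let ?P = "\<lambda>n. norm n = 1 \<and> (\<forall>x\<in>?S. \<forall>y\<in>?S. n \<bullet> (x - y) = 0)"
  have "?P (?g /\<^sub>R norm ?g)"
  proof (intro conjI ballI)
    show "norm (?g /\<^sub>R norm ?g) = 1" using bgrad_nonzero[OF a] by simp
    fix x y assume "x \<in> ?S" "y \<in> ?S"
    then have "?g \<bullet> (x - y) = 0" unfolding bary_diff[symmetric] by (simp add: mem_facet_iff[OF a])
    then show "(?g /\<^sub>R norm ?g) \<bullet> (x - y) = 0" by simp
  qed
  then have P: "?P (side_normal ?S)" unfolding side_normal_def by (rule someI)
  then show n1: "norm (side_normal ?S) = 1" by blast
  let ?n = "side_normal ?S"
  obtain c where c: "?n = c *\<^sub>R ?g"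
  proof (rule orthogonal_facet[OF a, of ?n])
    fix b b' assume "b \<in> C - {a}" "b' \<in> C - {a}"
    then show "?n \<bullet> (b - b') = 0" using P hull_inc[of _ "C - {a}" convex] by blast
  qed
  have c0: "c \<noteq> 0" using c n1 by auto
  have "?g = (1/c) *\<^sub>R ?n" using c c0 by simp
  moreover have "?g \<bullet> ?n = 1/c"
    using calculation n1 by (metis inner_scaleR_left dot_square_norm mult.right_neutral power_one)
  ultimately show "?g = (?g \<bullet> ?n) *\<^sub>R ?n" by simp
  then show "norm ?g = \<bar>?g \<bullet> ?n\<bar>" using n1 by (metis norm_scaleR mult.right_neutral)
  have "\<bar>c\<bar> * norm ?g = 1" using c n1 by (metis norm_scaleR)
  then have "\<bar>c\<bar> = inverse (norm ?g)" using bgrad_nonzero[OF a] by (simp add: field_simps)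
  then show "?n = ?g /\<^sub>R norm ?g \<or> ?n = - (?g /\<^sub>R norm ?g)"
    using c by (auto simp: abs_if split: if_splits) (metis minus_minus scaleR_minus_left)
qed

end

section \<open>Integrability of continuous functions and limits in L1\<close>

lemma set_integrable_plane_continuous:
  fixes w :: "'a::euclidean_space \<Rightarrow> real"
  assumes n: "norm n = 1" and A: "compact A" and w: "continuous_on UNIV w"
  shows "set_integrable (plane_measure a n) A w"
proof -
  have [measurable]: "A \<in> sets borel" using A by (simp add: borel_compact)
  have [measurable]: "w \<in> borel_measurable borel"
    using w by (simp add: borel_measurable_continuous_onI)
  obtain M where M: "\<And>x. x \<in> A \<Longrightarrow> \<bar>w x\<bar> \<le> M"
    using compact_imp_bounded[OF compact_continuous_image[OF continuous_on_subset[OF w] A]]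
    by (auto simp: bounded_iff)
  have fin: "emeasure (plane_measure a n) A < \<infinity>"
    using plane_measure_bounded_finite[OF n compact_imp_bounded[OF A]] by simp
  show ?thesis unfolding set_integrable_def
  proof (rule Bochner_Integration.integrable_bound)
    show "integrable (plane_measure a n) (\<lambda>x. \<bar>M\<bar> * indicator A x)"
      using fin by (intro integrable_mult_right integrable_real_indicator) auto
    show "AE x in plane_measure a n. norm (indicat_real A x *\<^sub>R w x) \<le> norm (\<bar>M\<bar> * indicat_real A x)"
      using M by (intro AE_I2) (force simp: indicator_def)
  qed measurable
qed

lemma set_integrable_lebesgue_continuous:
  fixes w :: "'a::euclidean_space \<Rightarrow> 'b::euclidean_space"
  assumes "compact A" "continuous_on A w"
  shows "set_integrable lebesgue A w"
  unfolding set_integrable_def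
  using borel_integrable_compact[OF assms]
  by (subst integrable_completion) auto

lemma abs_set_integral_diff_le:
  fixes f g :: "'a \<Rightarrow> real"
  assumes "set_integrable M A f" "set_integrable M A g"
  shows "\<bar>(LINT x:A|M. f x) - (LINT x:A|M. g x)\<bar> \<le> (LINT x:A|M. \<bar>f x - g x\<bar>)"
proof -
  have "\<bar>(LINT x:A|M. f x) - (LINT x:A|M. g x)\<bar> = \<bar>LINT x:A|M. f x - g x\<bar>"
    using assms by (simp add: set_integral_diff)
  also have "\<dots> \<le> (LINT x:A|M. \<bar>f x - g x\<bar>)"
    unfolding set_lebesgue_integral_def
    by (rule order_trans[OF integral_abs_bound]) (simp add: abs_mult)
  finally show ?thesis .
qed

lemma set_integral_L1_tendsto:
  fixes f :: "nat \<Rightarrow> 'a \<Rightarrow> real"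
  assumes f: "\<And>k. set_integrable M A (f k)" and g: "set_integrable M A g"
    and lim: "(\<lambda>k. LINT x:A|M. \<bar>f k x - g x\<bar>) \<longlonglongrightarrow> 0"
  shows "(\<lambda>k. LINT x:A|M. f k x) \<longlonglongrightarrow> (LINT x:A|M. g x)"
proof (rule Lim_transform2[OF tendsto_const], rule Lim_null_comparison[OF _ lim])
  show "\<forall>\<^sub>F k in sequentially. norm ((LINT x:A|M. g x) - (LINT x:A|M. f k x)) \<le> (LINT x:A|M. \<bar>f k x - g x\<bar>)"
    using abs_set_integral_diff_le[OF f g] by (simp add: abs_minus_commute)
qed

section \<open>Barycenters and measures of a simplex and its facets; the cone formula\<close>

context full_simplex
begin

lemma facet_extreme_points:
  "{x. x extreme_point_of (convex hull (C - {a}))} = C - {a}"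
  "{x. x extreme_point_of T} = C"
  using extreme_point_of_convex_hull_affine_independent[OF affine_independent_Diff[OF indep, of "{a}"]]
    extreme_point_of_convex_hull_affine_independent[OF indep] by auto

lemma barycenter_T: "barycenter T = (1 / (real DIM('a) + 1)) *\<^sub>R (\<Sum>a\<in>C. a)"
  by (simp add: barycenter_def facet_extreme_points cardC add.commute)

text \<open>The median from \<open>a\<close> leaves the simplex at the barycenter of the opposite
  facet. With the barycenter of the simplex as base point, affine functions and Raviart-Thomas
  fields are evaluated at once at the facet.\<close>

lemma barycenter_facet:
  assumes a: "a \<in> C"
  shows "barycenter (convex hull (C - {a})) = barycenter T + (1 / real DIM('a)) *\<^sub>R (barycenter T - a)"
proof -
  define s where "s = (\<Sum>a\<in>C. a)"
  have s: "(\<Sum>b\<in>C - {a}. b) = s - a"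
    unfolding s_def using a finC by (simp add: sum.remove)
  have card: "card (C - {a}) = DIM('a)" using a cardC by simp
  have d: "real DIM('a) > 0" by simp
  have "barycenter (convex hull (C - {a})) = (1 / real DIM('a)) *\<^sub>R (s - a)"
    by (simp only: barycenter_def facet_extreme_points s card)
  also have "\<dots> = barycenter T + (1 / real DIM('a)) *\<^sub>R (barycenter T - a)"
  proof -
    have "1 / (real DIM('a) + 1) + (1 / real DIM('a)) * (1 / (real DIM('a) + 1)) = 1 / real DIM('a)"
    proof -
      have "1 / (D + 1) + (1 / D) * (1 / (D + 1)) = 1 / D" if "D > 0" for D :: real
      proof -
        have "(D + 1) * (1 / (D + 1)) = 1" "(1 / D) * D = 1" using that by simp_all
        then show ?thesis by algebra
      qed
      then show ?thesis using d by blast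
    qed
    then have "(1 / real DIM('a)) *\<^sub>R s = (1 / (real DIM('a) + 1)) *\<^sub>R s + (1 / real DIM('a)) *\<^sub>R ((1 / (real DIM('a) + 1)) *\<^sub>R s)"
      by (metis scaleR_add_left scaleR_scaleR)
    then show ?thesis unfolding barycenter_T s_def[symmetric] by (simp add: scaleR_diff_right)
  qed
  finally show ?thesis .
qed

lemma bary_barycenter_T:
  assumes "a \<in> C" shows "bary C a (barycenter T) = 1 / (real DIM('a) + 1)"
proof -
  have "barycenter T = (\<Sum>b\<in>C. (1 / (real DIM('a) + 1)) *\<^sub>R b)"
    by (simp add: barycenter_T scaleR_sum_right)
  then show ?thesis using bary_combination[OF assms, of "\<lambda>_. 1 / (real DIM('a) + 1)"]
    by (simp add: cardC divide_simps)
qed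

lemma bgrad_barycenter_vertex:
  assumes "a \<in> C" shows "bgrad C a \<bullet> (barycenter T - a) = - real DIM('a) / (real DIM('a) + 1)"
proof -
  have "1 + bgrad C a \<bullet> (barycenter T - a) = 1 / (real DIM('a) + 1)"
    using bary_barycenter_T[OF assms] by (simp add: bary_def)
  then show ?thesis by (simp add: field_simps)
qed

lemma bary_barycenter_facet:
  assumes a: "a \<in> C" and b: "b \<in> C"
  shows "bary C b (barycenter (convex hull (C - {a}))) = (if b = a then 0 else 1 / real DIM('a))"
proof -
  let ?d = "real DIM('a)"
  define A where "A = 1 / (?d + 1)"
  have A: "A * ?d + A = 1" by (simp add: A_def add_divide_distrib[symmetric])
  have "bary C b (barycenter (convex hull (C - {a}))) = A + (1 / ?d) * (bgrad C b \<bullet> (barycenter T - a))"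
    unfolding barycenter_facet[OF a] bary_add using b by (simp add: bary_barycenter_T A_def)
  also have "bgrad C b \<bullet> (barycenter T - a) = A - (if b = a then 1 else 0)"
    using a b by (simp add: bary_diff[symmetric] bary_barycenter_T bary_vertex A_def)
  also have "A + (1 / ?d) * (A - (if b = a then 1 else 0)) = (A * ?d + A - (if b = a then 1 else 0)) / ?d"
    by (simp add: add_divide_distrib diff_divide_distrib)
  also have "\<dots> = (if b = a then 0 else 1 / ?d)" unfolding A by simp
  finally show ?thesis .
qed

lemma barycenter_facet_mem: "a \<in> C \<Longrightarrow> barycenter (convex hull (C - {a})) \<in> convex hull (C - {a})"
  by (simp add: mem_facet_iff mem_T_iff bary_barycenter_facet)

lemma barycenter_T_interior: "barycenter T \<in> interior T"
  by (simp add: mem_interior_iff bary_barycenter_T)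

lemma T_borel [measurable]: "T \<in> sets borel"
  using compact_T borel_compact by blast

lemma T_measure_pos: "0 < measure lebesgue T"
proof -
  have "interior T \<noteq> {}" using barycenter_T_interior by blast
  then have "\<not> negligible T"
    using negligible_subset interior_subset open_not_negligible open_interior by blast
  moreover have "T \<in> lmeasurable" using compact_T by (rule lmeasurable_compact)
  ultimately show ?thesis
    by (metis negligible_iff_measure0 zero_less_measure_iff emeasure_eq_measure2 measure_nonneg less_le)
qed

lemma compact_facet: "compact (convex hull (C - {a}))"
  using finC by (simp add: finite_imp_compact_convex_hull)

text \<open>The homothety with centre \<open>a\<close> and factor 1 - \<delta> multiplies all
  barycentric coordinates by 1 - \<delta> and adds \<delta> to the one of \<open>a\<close>. The rest
  of the simplex is thus a layer along the facet opposite to \<open>a\<close>.\<close>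

lemma cone_image:
  assumes a: "a \<in> C" and \<delta>: "0 < \<delta>" "\<delta> < 1"
  shows "(\<lambda>y. a + (1 - \<delta>) *\<^sub>R (y - a)) ` T = {x\<in>T. \<delta> \<le> bary C a x}"
proof -
  let ?g = "\<lambda>y. a + (1 - \<delta>) *\<^sub>R (y - a)"
  have bg: "bary C b (?g y) = (if b = a then \<delta> else 0) + (1 - \<delta>) * bary C b y" if "b \<in> C" for b y
  proof -
    have "bary C b (?g y) = bary C b a + (1 - \<delta>) * (bary C b y - bary C b a)"
      unfolding bary_add by (simp add: bary_diff)
    then show ?thesis using bary_vertex[OF that a] by (simp add: algebra_simps)
  qed
  show ?thesis
  proof (intro equalityI subsetI)
    fix x assume "x \<in> ?g ` T"
    then obtain y where y: "y \<in> T" "x = ?g y" by blast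
    then show "x \<in> {x\<in>T. \<delta> \<le> bary C a x}"
      using bg a \<delta> by (auto simp: mem_T_iff)
  next
    fix x assume x: "x \<in> {x\<in>T. \<delta> \<le> bary C a x}"
    define y where "y = a + (1 / (1 - \<delta>)) *\<^sub>R (x - a)"
    have gy: "?g y = x" using \<delta> by (simp add: y_def)
    have "y \<in> T" unfolding mem_T_iff
    proof
      fix b assume b: "b \<in> C"
      have "bary C b x = (if b = a then \<delta> else 0) + (1 - \<delta>) * bary C b y"
        using bg[OF b, of y] gy by simp
      moreover have "(if b = a then \<delta> else 0) \<le> bary C b x" using x b by (auto simp: mem_T_iff)
      ultimately have "0 \<le> (1 - \<delta>) * bary C b y" by linarith
      then show "0 \<le> bary C b y" using \<delta> by (simp add: zero_le_mult_iff)
    qed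
    then show "x \<in> ?g ` T" using gy by (metis imageI)
  qed
qed

lemma third_vertex:
  obtains c where "c \<in> C" "c \<noteq> a" "c \<noteq> b"
proof -
  have "\<not> C \<subseteq> {a, b}" using cardC dim2 card_mono[of "{a,b}" C] card_insert_le_m1[of 2 "{b}" a] by fastforce
  then show ?thesis using that by blast
qed

text \<open>The coordinate of \<open>b\<close> at the foot of x is an affine function of x whose
  gradient \<open>?k\<close> is the part of \<open>bgrad C b\<close> tangential to the facet. It is
  nonzero: dimension at least 2 supplies a third vertex \<open>c\<close>, and along the edge c - b,
  which lies in the facet, the coordinate of \<open>b\<close> has slope -1. The exceptional points
  therefore form a hyperplane.\<close>

lemma AE_foot_facet_interior:
  assumes a: "a \<in> C" and n: "n = bgrad C a /\<^sub>R norm (bgrad C a)"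
  shows "AE x in lborel. \<forall>b\<in>C - {a}. bary C b (foot s0 n x) \<noteq> 0"
proof -
  have "AE x in lborel. bary C b (foot s0 n x) \<noteq> 0" if b: "b \<in> C - {a}" for b
  proof -
    let ?k = "bgrad C b - (bgrad C b \<bullet> n) *\<^sub>R n"
    obtain c where c: "c \<in> C" "c \<noteq> a" "c \<noteq> b" using third_vertex .
    have "bgrad C a \<bullet> (c - b) = bary C a c - bary C a b" by (simp add: bary_diff)
    then have "n \<bullet> (c - b) = 0" using c a b by (auto simp: bary_vertex n)
    moreover have "bgrad C b \<bullet> (c - b) = -1" using c b bgrad_vertex by auto
    ultimately have "?k \<bullet> (c - b) = -1" by (simp add: inner_diff_left)
    then have k: "?k \<noteq> 0" by force
    have "bary C b (foot s0 n x) = 1 + bgrad C b \<bullet> ((s0 \<bullet> n) *\<^sub>R n - b) + ?k \<bullet> x" for x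
      by (simp add: bary_def foot_def inner_diff_left inner_diff_right inner_commute[of n x] algebra_simps)
    then have "{x. bary C b (foot s0 n x) = 0} = {x. ?k \<bullet> x = - (1 + bgrad C b \<bullet> ((s0 \<bullet> n) *\<^sub>R n - b))}"
      by auto
    then have "emeasure lborel {x. bary C b (foot s0 n x) = 0} = 0"
      using lborel_null_hyperplane[OF k] by simp
    then show ?thesis by (intro AE_I[where N = "{x. bary C b (foot s0 n x) = 0}"]) auto
  qed
  then show ?thesis using finC by (intro AE_finite_allI) auto
qed

lemma lborel_null_bary:
  assumes "a \<in> C" shows "emeasure lborel {x. bary C a x = c} = 0"
proof -
  have "{x. bary C a x = c} = {x. bgrad C a \<bullet> x = c - 1 + bgrad C a \<bullet> a}"
    by (auto simp: bary_def inner_diff_right)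
  then show ?thesis using lborel_null_hyperplane[OF bgrad_nonzero[OF assms]] by simp
qed

lemma side_measure_facet:
  assumes a: "a \<in> C"
  shows "side_measure (convex hull (C - {a})) =
    plane_measure (barycenter (convex hull (C - {a}))) (bgrad C a /\<^sub>R norm (bgrad C a))"
  using side_normal(4)[OF a] plane_measure_minus[of "bgrad C a /\<^sub>R norm (bgrad C a)"] bgrad_nonzero[OF a]
  by (auto simp: side_measure_def)

text \<open>The integral over the layer of thickness \<open>\<epsilon> k\<close> along the facet is
  computed twice. Divided by the thickness, it tends to the facet integral by
  \<open>layer_limit\<close>; as the difference between the simplex and a homothetic copy of it, it
  is governed by \<open>cone_derivative\<close>. The factor \<open>norm (bgrad C a)\<close> converts
  thickness into barycentric coordinate.\<close>

lemma cone_formula: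
  assumes a: "a \<in> C" and w: "C1_fun w"
  shows "(LINT x:convex hull (C - {a})|side_measure (convex hull (C - {a})). w x) =
    norm (bgrad C a) * (LINT x:T|lebesgue. real DIM('a) * w x + grad w x \<bullet> (x - a))"
proof -
  let ?S = "convex hull (C - {a})"
  define g where "g = norm (bgrad C a)"
  define n where "n = bgrad C a /\<^sub>R g"
  define s0 where "s0 = barycenter ?S"
  have g: "g > 0" using bgrad_nonzero[OF a] by (simp add: g_def)
  have n1: "norm n = 1" using g by (simp add: n_def g_def)
  have gn: "bgrad C a \<bullet> n = g" using g by (simp add: n_def g_def dot_square_norm power2_eq_square field_simps)
  have b0: "bary C a s0 = 0" using bary_barycenter_facet[OF a a] by (simp add: s0_def)
  have l: "(x - s0) \<bullet> n = bary C a x / g" for x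
  proof -
    have "bgrad C a \<bullet> (x - s0) = bary C a x - bary C a s0" by (simp add: bary_diff)
    then show ?thesis using b0 by (simp add: n_def inner_commute field_simps)
  qed
  \<comment> \<open>A null sequence chosen such that both \<open>\<epsilon> k \<le> 1\<close>,
    required by the unit slab, and \<open>\<delta> k < 1\<close>, required for a homothety with
    positive factor, hold from the start. \<open>\<delta> k\<close> is the thickness
    \<open>\<epsilon> k\<close> measured in the barycentric coordinate of \<open>a\<close>.\<close>
  define \<epsilon> where "\<epsilon> k = 1 / ((real k + 2) * (1 + g))" for k :: nat
  define \<delta> where "\<delta> k = \<epsilon> k * g" for k
  have \<epsilon>: "0 < \<epsilon> k" "\<epsilon> k \<le> 1" for k
  proof -
    have "1 * 1 \<le> (real k + 2) * (1 + g)" using g by (intro mult_mono) auto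
    then show "0 < \<epsilon> k" "\<epsilon> k \<le> 1" by (simp_all add: \<epsilon>_def)
  qed
  have \<epsilon>0: "\<epsilon> \<longlonglongrightarrow> 0"
  proof -
    have "(\<lambda>k. inverse (real (Suc (Suc k))) * (1 / (1 + g))) \<longlonglongrightarrow> 0 * (1 / (1 + g))"
      using LIMSEQ_Suc[OF LIMSEQ_inverse_real_of_nat] by (intro tendsto_mult tendsto_const)
    moreover have "\<epsilon> = (\<lambda>k. inverse (real (Suc (Suc k))) * (1 / (1 + g)))"
      by (rule ext) (simp add: \<epsilon>_def field_simps)
    ultimately show ?thesis by simp
  qed
  have \<delta>: "0 < \<delta> k" "\<delta> k < 1" for k
  proof -
    show "0 < \<delta> k" using g \<epsilon> by (simp add: \<delta>_def)
    have "g * 1 < (1 + g) * (real k + 2)" using g by (intro mult_strict_mono) auto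
    then show "\<delta> k < 1" using g by (simp add: \<delta>_def \<epsilon>_def mult.commute)
  qed
  have \<delta>0: "\<delta> \<longlonglongrightarrow> 0" unfolding \<delta>_def using tendsto_mult_right[OF \<epsilon>0, of g] by simp
  have contw: "continuous_on UNIV w" using w by (rule C1_fun_continuous)
  have contg: "continuous_on UNIV (grad w)" using w by (rule C1_fun_grad_continuous)
  have [measurable]: "w \<in> borel_measurable borel" "grad w \<in> borel_measurable borel"
    using contw contg by (auto intro: borel_measurable_continuous_onI)
  let ?L = "\<lambda>k. LINT x|lborel. indicator {x\<in>T. (x - s0) \<bullet> n \<le> \<epsilon> k} x * w x"
  have lim1: "(\<lambda>k. (1 / \<epsilon> k) * ?L k) \<longlonglongrightarrow> (LINT x:{x\<in>T. (x - s0) \<bullet> n = 0}|plane_measure s0 n. w x)"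
  proof (rule layer_limit[OF n1 compact_T _ contw \<epsilon> \<epsilon>0])
    show "0 \<le> (x - s0) \<bullet> n" if "x \<in> T" for x
      using that a g unfolding l by (simp add: mem_T_iff)
    show "AE x in lborel. 0 \<le> (x - s0) \<bullet> n \<longrightarrow> foot s0 n x \<in> T \<longrightarrow>
      (\<forall>\<^sub>F k in sequentially. foot s0 n x + (\<epsilon> k * ((x - s0) \<bullet> n)) *\<^sub>R n \<in> T)"
      using AE_foot_facet_interior[OF a n_def[unfolded g_def], of s0]
    proof eventually_elim
      fix x assume nz: "\<forall>b\<in>C - {a}. bary C b (foot s0 n x) \<noteq> 0"
      show "0 \<le> (x - s0) \<bullet> n \<longrightarrow> foot s0 n x \<in> T \<longrightarrow>
        (\<forall>\<^sub>F k in sequentially. foot s0 n x + (\<epsilon> k * ((x - s0) \<bullet> n)) *\<^sub>R n \<in> T)"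
      proof (intro impI)
        assume pos: "0 \<le> (x - s0) \<bullet> n" and fT: "foot s0 n x \<in> T"
        let ?y = "\<lambda>k. foot s0 n x + (\<epsilon> k * ((x - s0) \<bullet> n)) *\<^sub>R n"
        have "\<forall>\<^sub>F k in sequentially. 0 \<le> bary C b (?y k)" if b: "b \<in> C" for b
        \<comment> \<open>Along \<open>n\<close> the coordinate of \<open>a\<close> does not
          decrease; the other coordinates are positive at almost every foot in \<open>T\<close> and
          stay so for small displacements.\<close>
        proof (cases "b = a")
          case True
          have "0 \<le> bary C a (?y k)" for k
            using fT a pos \<epsilon>(1)[of k] g by (simp add: bary_add gn mem_T_iff)
          then show ?thesis using True by simp
        next
          case False
          have "0 < bary C b (foot s0 n x)"
            using nz fT b False by (force simp: mem_T_iff less_le)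
          moreover have "(\<lambda>k. bary C b (?y k)) \<longlonglongrightarrow> bary C b (foot s0 n x)"
            unfolding bary_add by (rule tendsto_eq_intros \<epsilon>0 refl)+ simp
          ultimately have "\<forall>\<^sub>F k in sequentially. 0 < bary C b (?y k)"
            by (simp add: order_tendstoD(1))
          then show ?thesis by (rule eventually_mono) simp
        qed
        then show "\<forall>\<^sub>F k in sequentially. ?y k \<in> T"
          unfolding mem_T_iff using finC by (simp add: eventually_ball_finite)
      qed
    qed
  qed
  let ?D = "\<lambda>k. LINT x|lborel. indicator T x * ((w x - (1 - \<delta> k) ^ DIM('a) * w (a + (1 - \<delta> k) *\<^sub>R (x - a))) / \<delta> k)"
  have lim2: "?D \<longlonglongrightarrow> (LINT x|lborel. indicator T x * (real DIM('a) * w x + grad w x \<bullet> (x - a)))"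
    using \<delta> by (intro cone_derivative[OF w compact_T _ _ \<delta>0]) (auto intro: less_imp_le)
  \<comment> \<open>The layer is the simplex without its homothetic copy, up to the null set on
    which the coordinate of \<open>a\<close> equals \<open>\<delta> k\<close>.\<close>
  have eqk: "(1 / \<epsilon> k) * ?L k = g * ?D k" for k
  proof -
    let ?w' = "\<lambda>x. (1 - \<delta> k) ^ DIM('a) * w (a + (1 - \<delta> k) *\<^sub>R (x - a))"
    let ?T' = "{x\<in>T. \<delta> k \<le> bary C a x}"
    have "continuous_on T (\<lambda>x. w (a + (1 - \<delta> k) *\<^sub>R (x - a)))"
      by (rule continuous_on_compose2[OF contw]) (auto intro!: continuous_intros)
    then have "continuous_on T ?w'" by (intro continuous_intros)
    then have int1: "integrable lborel (\<lambda>x. indicator T x * w x)" "integrable lborel (\<lambda>x. indicator T x * ?w' x)"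
      using borel_integrable_compact[OF compact_T continuous_on_subset[OF contw]]
        borel_integrable_compact[OF compact_T, of ?w']
      by auto
    have intT': "integrable lborel (\<lambda>x. indicator ?T' x * w x)"
    proof -
      have "integrable lborel (\<lambda>x. indicator {x. \<delta> k \<le> bary C a x} x *\<^sub>R (indicator T x * w x))"
        by (intro integrable_mult_indicator int1) measurable
      then show ?thesis
        by (rule Bochner_Integration.integrable_cong[THEN iffD1, rotated 2]) (auto simp: indicator_def)
    qed
    have "?D k = (LINT x|lborel. (1 / \<delta> k) * (indicator T x * w x - indicator T x * ?w' x))"
      by (intro Bochner_Integration.integral_cong) (auto simp: right_diff_distrib diff_divide_distrib)
    also have "\<dots> = (1 / \<delta> k) * (LINT x|lborel. indicator T x * w x - indicator T x * ?w' x)"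
      by (rule integral_mult_right_zero)
    also have "(LINT x|lborel. indicator T x * w x - indicator T x * ?w' x) =
        (LINT x|lborel. indicator T x * w x) - (LINT x|lborel. indicator T x * ?w' x)"
      by (rule Bochner_Integration.integral_diff[OF int1])
    also have "(LINT x|lborel. indicator T x * ?w' x) = (LINT x|lborel. indicator ?T' x * w x)"
      using \<delta>[of k] by (subst lborel_integral_cone_scale[OF _ compact_T]) (auto simp: cone_image[OF a])
    also have "(LINT x|lborel. indicator T x * w x) - \<dots> = (LINT x|lborel. indicator T x * w x - indicator ?T' x * w x)"
      using int1 intT' by simp
    also have "\<dots> = ?L k"
    proof (rule integral_cong_AE)
      have "AE x in lborel. bary C a x \<noteq> \<delta> k"
        using lborel_null_bary[OF a, of "\<delta> k"] by (intro AE_I[where N = "{x. bary C a x = \<delta> k}"]) auto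
      then show "AE x in lborel. indicator T x * w x - indicator ?T' x * w x
          = indicator {x\<in>T. (x - s0) \<bullet> n \<le> \<epsilon> k} x * w x"
      proof eventually_elim
        fix x assume "bary C a x \<noteq> \<delta> k"
        then have "(x - s0) \<bullet> n \<le> \<epsilon> k \<longleftrightarrow> \<not> \<delta> k \<le> bary C a x"
          unfolding l \<delta>_def using g by (auto simp: field_simps)
        then show "indicator T x * w x - indicator ?T' x * w x
          = indicator {x\<in>T. (x - s0) \<bullet> n \<le> \<epsilon> k} x * w x" by (auto simp: indicator_def)
      qed
    qed measurable
    finally show ?thesis using g \<epsilon>(1)[of k] by (simp add: \<delta>_def)
  qed
  have "(\<lambda>k. g * ?D k) \<longlonglongrightarrow> g * (LINT x|lborel. indicator T x * (real DIM('a) * w x + grad w x \<bullet> (x - a)))"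
    by (intro tendsto_mult_left lim2)
  with lim1 have "(LINT x:{x\<in>T. (x - s0) \<bullet> n = 0}|plane_measure s0 n. w x) =
      g * (LINT x|lborel. indicator T x * (real DIM('a) * w x + grad w x \<bullet> (x - a)))"
    unfolding eqk by (rule LIMSEQ_unique)
  moreover have "{x\<in>T. (x - s0) \<bullet> n = 0} = ?S"
    using g unfolding l by (auto simp: mem_facet_iff[OF a])
  moreover have "plane_measure s0 n = side_measure ?S"
    by (simp add: side_measure_facet[OF a] n_def g_def s0_def)
  moreover have "(LINT x|lborel. indicator T x * (real DIM('a) * w x + grad w x \<bullet> (x - a))) =
     (LINT x:T|lebesgue. real DIM('a) * w x + grad w x \<bullet> (x - a))"
    unfolding set_lebesgue_integral_def by (subst integral_completion) auto
  ultimately show ?thesis by (simp add: g_def)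
qed

text \<open>The cone formula for w = 1. It is the rule that the volume is the product of base and
  height divided by d, the height being \<open>1 / norm (bgrad C a)\<close>.\<close>

lemma facet_measure:
  assumes a: "a \<in> C"
  shows "measure (side_measure (convex hull (C - {a}))) (convex hull (C - {a})) =
    norm (bgrad C a) * (real DIM('a) * measure lebesgue T)"
proof -
  let ?S = "convex hull (C - {a})"
  have c: "C1_fun (\<lambda>x::'a. 1::real)" "grad (\<lambda>x::'a. 1::real) = (\<lambda>x. 0)"
    by (rule C1_funI[where g = "\<lambda>x. 0"]; simp)+
  have "measure (side_measure ?S) ?S = (LINT x:?S|side_measure ?S. 1)"
    by (simp add: set_lebesgue_integral_def side_measure_def)
  also have "\<dots> = norm (bgrad C a) * (LINT x:T|lebesgue. real DIM('a))"
    using cone_formula[OF a c(1)] by (simp add: c(2))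
  also have "(LINT x:T|lebesgue. real DIM('a)) = real DIM('a) * measure lebesgue T"
    by (simp add: set_lebesgue_integral_def)
  finally show ?thesis .
qed

lemma facet_measure_pos:
  assumes a: "a \<in> C"
  shows "0 < measure (side_measure (convex hull (C - {a}))) (convex hull (C - {a}))"
  unfolding facet_measure[OF a] using bgrad_nonzero[OF a] T_measure_pos by simp

lemma side_mean_C1:
  assumes a: "a \<in> C" and w: "C1_fun w"
  shows "side_mean (convex hull (C - {a})) w =
    (LINT x:T|lebesgue. real DIM('a) * w x + grad w x \<bullet> (x - a)) / (real DIM('a) * measure lebesgue T)"
  unfolding side_mean_def cone_formula[OF a w] facet_measure[OF a]
  using bgrad_nonzero[OF a] by simp

end

section \<open>Local identities on a simplex\<close>

lemma set_integrable_bilinear_continuous: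
  fixes h :: "'a::euclidean_space \<Rightarrow> 'b::euclidean_space" and G :: "'a \<Rightarrow> 'c::euclidean_space"
    and prod :: "'b \<Rightarrow> 'c \<Rightarrow> 'd::euclidean_space"
  assumes "bounded_bilinear prod" "S \<in> sets lebesgue" "bounded S" "continuous_on UNIV h"
    "set_integrable lebesgue S G"
  shows "set_integrable lebesgue S (\<lambda>x. prod (h x) (G x))"
proof (rule absolutely_integrable_bounded_measurable_product[where h = prod, OF _ _ assms(2) _ assms(5)])
  show "bilinear prod" using assms(1) by (simp add: bilinear_conv_bounded_bilinear)
  show "h \<in> borel_measurable (lebesgue_on S)"
    using assms(2,4) continuous_imp_measurable_on_sets_lebesgue continuous_on_subset by blast
  have "compact (h ` closure S)"
    using assms(3,4) by (intro compact_continuous_image) (auto intro: continuous_on_subset)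
  then show "bounded (h ` S)"
    by (rule bounded_subset[OF compact_imp_bounded]) (use closure_subset in blast)
qed

lemma set_integrable_continuous_bounded:
  fixes h :: "'a::euclidean_space \<Rightarrow> 'b::euclidean_space"
  assumes "S \<in> sets lebesgue" "bounded S" "continuous_on UNIV h"
  shows "set_integrable lebesgue S h"
proof -
  have "set_integrable lebesgue S (\<lambda>x. 1::real)"
    using bounded_set_imp_lmeasurable[OF assms(2,1)]
    unfolding set_integrable_def by (auto simp: fmeasurable_def intro!: integrable_real_indicator)
  then show ?thesis
    using set_integrable_bilinear_continuous[OF bounded_bilinear.flip[OF bounded_bilinear_scaleR] assms, of "\<lambda>x. 1"]
    by simp
qed

lemma set_integral_finite_sum:
  fixes f :: "'i \<Rightarrow> 'a \<Rightarrow> 'b::{banach, second_countable_topology}"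
  assumes "\<And>i. i \<in> I \<Longrightarrow> set_integrable M A (f i)"
  shows "(LINT x:A|M. (\<Sum>i\<in>I. f i x)) = (\<Sum>i\<in>I. LINT x:A|M. f i x)"
    and "set_integrable M A (\<lambda>x. \<Sum>i\<in>I. f i x)"
  using assms unfolding set_lebesgue_integral_def set_integrable_def
  by (simp_all add: scaleR_sum_right)

context full_simplex
begin

lemma T_lebesgue: "T \<in> sets lebesgue"
  by simp

lemma bounded_T: "bounded T"
  using compact_T compact_imp_bounded by blast

lemma set_integrable_cone_integrand:
  assumes v: "set_integrable lebesgue T v" and G: "set_integrable lebesgue T G"
  shows "set_integrable lebesgue T (\<lambda>x. real DIM('a) * v x + G x \<bullet> (x - a))"
proof -
  have "set_integrable lebesgue T (\<lambda>x. (x - a) \<bullet> G x)"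
    by (rule set_integrable_bilinear_continuous[OF bounded_bilinear_inner T_lebesgue bounded_T _ G])
       (intro continuous_intros)
  then show ?thesis using v by (intro set_integral_add set_integrable_mult_right) (auto simp: inner_commute)
qed

text \<open>Both sides of the cone formula are continuous for the convergence that defines traces,
  since x - a is bounded on \<open>T\<close>. Functions and gradients enter separately, so that the
  result also serves for products whose trace is built by hand.\<close>

lemma side_mean_limit:
  assumes a: "a \<in> C" and V: "\<And>k::nat. C1_fun (V k)"
    and v: "set_integrable lebesgue T v" and G: "set_integrable lebesgue T G"
    and g: "set_integrable (side_measure (convex hull (C - {a}))) (convex hull (C - {a})) g"
    and lim_v: "(\<lambda>k. LINT x:T|lebesgue. \<bar>V k x - v x\<bar>) \<longlonglongrightarrow> 0"
    and lim_G: "(\<lambda>k. LINT x:T|lebesgue. norm (grad (V k) x - G x)) \<longlonglongrightarrow> 0"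
    and lim_g: "(\<lambda>k. LINT x:convex hull (C - {a})|side_measure (convex hull (C - {a})). \<bar>V k x - g x\<bar>) \<longlonglongrightarrow> 0"
  shows "side_mean (convex hull (C - {a})) g =
    (LINT x:T|lebesgue. real DIM('a) * v x + G x \<bullet> (x - a)) / (real DIM('a) * measure lebesgue T)"
proof -
  let ?S = "convex hull (C - {a})" and ?d = "real DIM('a)"
  have contV: "continuous_on UNIV (V k)" for k using V by (rule C1_fun_continuous)
  have contgV: "continuous_on UNIV (grad (V k))" for k using V by (rule C1_fun_grad_continuous)
  have intV: "set_integrable lebesgue T (V k)" for k
    by (rule set_integrable_lebesgue_continuous[OF compact_T continuous_on_subset[OF contV]]) simp
  have intgV: "set_integrable lebesgue T (grad (V k))" for k
    by (rule set_integrable_lebesgue_continuous[OF compact_T continuous_on_subset[OF contgV]]) simp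
  have intSV: "set_integrable (side_measure ?S) ?S (V k)" for k
    unfolding side_measure_def
    by (rule set_integrable_plane_continuous[OF side_normal(1)[OF a] compact_facet contV])
  have lim1: "(\<lambda>k. side_mean ?S (V k)) \<longlonglongrightarrow> side_mean ?S g"
    unfolding side_mean_def using facet_measure_pos[OF a]
    by (intro tendsto_divide tendsto_const set_integral_L1_tendsto[OF intSV g lim_g]) simp
  obtain B where B: "\<And>x. x \<in> T \<Longrightarrow> norm (x - a) \<le> B"
    using bounded_T bounded_translation[of T "-a"] by (auto simp: bounded_iff)
  let ?f = "\<lambda>k x. ?d * V k x + grad (V k) x \<bullet> (x - a)"
  let ?F = "\<lambda>x. ?d * v x + G x \<bullet> (x - a)"
  have lim2: "(\<lambda>k. LINT x:T|lebesgue. ?f k x) \<longlonglongrightarrow> (LINT x:T|lebesgue. ?F x)"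
  proof (rule set_integral_L1_tendsto)
    show intf: "set_integrable lebesgue T (?f k)" for k
      by (rule set_integrable_cone_integrand[OF intV intgV])
    show intF: "set_integrable lebesgue T ?F"
      by (rule set_integrable_cone_integrand[OF v G])
    have i1: "set_integrable lebesgue T (\<lambda>x. \<bar>V k x - v x\<bar>)" for k
      by (intro set_integrable_abs set_integral_diff intV v)
    have i2: "set_integrable lebesgue T (\<lambda>x. norm (grad (V k) x - G x))" for k
      by (intro set_integrable_norm set_integral_diff intgV G)
    have "(\<lambda>k. ?d * (LINT x:T|lebesgue. \<bar>V k x - v x\<bar>) + B * (LINT x:T|lebesgue. norm (grad (V k) x - G x)))
        \<longlonglongrightarrow> ?d * 0 + B * 0"
      by (intro tendsto_intros lim_v lim_G)
    then show "(\<lambda>k. LINT x:T|lebesgue. \<bar>?f k x - ?F x\<bar>) \<longlonglongrightarrow> 0"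
    proof (rule Lim_null_comparison[rotated, OF tendsto_eq_rhs], simp, intro always_eventually allI)
      fix k
      have "(LINT x:T|lebesgue. \<bar>?f k x - ?F x\<bar>) \<le>
         (LINT x:T|lebesgue. ?d * \<bar>V k x - v x\<bar> + B * norm (grad (V k) x - G x))"
      proof (rule set_integral_mono)
        show "set_integrable lebesgue T (\<lambda>x. \<bar>?f k x - ?F x\<bar>)"
          by (intro set_integrable_abs set_integral_diff intf intF)
        show "set_integrable lebesgue T (\<lambda>x. ?d * \<bar>V k x - v x\<bar> + B * norm (grad (V k) x - G x))"
          using i1 i2 by (intro set_integral_add set_integrable_mult_right) auto
        fix x assume x: "x \<in> T"
        have "?f k x - ?F x = ?d * (V k x - v x) + (grad (V k) x - G x) \<bullet> (x - a)"
          by (simp add: algebra_simps)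
        also have "\<bar>\<dots>\<bar> \<le> \<bar>?d * (V k x - v x)\<bar> + \<bar>(grad (V k) x - G x) \<bullet> (x - a)\<bar>"
          by (rule abs_triangle_ineq)
        also have "\<dots> \<le> ?d * \<bar>V k x - v x\<bar> + norm (grad (V k) x - G x) * B"
          using B[OF x] by (intro add_mono order_trans[OF Cauchy_Schwarz_ineq2] mult_left_mono) (auto simp: abs_mult)
        finally show "\<bar>?f k x - ?F x\<bar> \<le> ?d * \<bar>V k x - v x\<bar> + B * norm (grad (V k) x - G x)"
          by (simp add: mult.commute)
      qed
      also have "\<dots> = ?d * (LINT x:T|lebesgue. \<bar>V k x - v x\<bar>) + B * (LINT x:T|lebesgue. norm (grad (V k) x - G x))"
        using i1 i2 by (subst set_integral_add) (auto simp: set_integrable_mult_right)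
      moreover have "0 \<le> (LINT x:T|lebesgue. \<bar>?f k x - ?F x\<bar>)"
        unfolding set_lebesgue_integral_def by (intro Bochner_Integration.integral_nonneg) simp
      ultimately show "norm (LINT x:T|lebesgue. \<bar>?f k x - ?F x\<bar>) \<le> ?d * (LINT x:T|lebesgue. \<bar>V k x - v x\<bar>) + B * (LINT x:T|lebesgue. norm (grad (V k) x - G x))"
        by simp
    qed
  qed
  have "(\<lambda>k. side_mean ?S (V k)) \<longlonglongrightarrow> (LINT x:T|lebesgue. ?F x) / (?d * measure lebesgue T)"
    unfolding side_mean_C1[OF a V] using T_measure_pos by (intro tendsto_divide lim2 tendsto_const) auto
  with lim1 show ?thesis by (rule LIMSEQ_unique)
qed

text \<open>The divergence theorem on a simplex, with \<open>G i\<close> as the gradient of the i-th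
  component. Up to the factor d |T|, \<open>bgrad C a\<close> is the inner normal of the facet times
  the facet area, so the left-hand side is the total inward flux. In the sum,
  \<open>bgrad_sum\<close> cancels all terms independent of \<open>a\<close> and
  \<open>bgrad_repr\<close> reduces the rest to the divergence.\<close>

lemma gauss_identity:
  assumes v: "\<And>i. i \<in> Basis \<Longrightarrow> set_integrable lebesgue T (\<lambda>x. v x \<bullet> i)"
    and G: "\<And>i. i \<in> Basis \<Longrightarrow> set_integrable lebesgue T (G i)"
  shows "(\<Sum>a\<in>C. \<Sum>i\<in>Basis. (bgrad C a \<bullet> i) * (LINT x:T|lebesgue. real DIM('a) * (v x \<bullet> i) + G i x \<bullet> (x - a)))
    = - (LINT x:T|lebesgue. (\<Sum>i\<in>Basis. G i x \<bullet> i))"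
proof -
  let ?d = "real DIM('a)"
  let ?f = "\<lambda>a i x. (bgrad C a \<bullet> i) * (?d * (v x \<bullet> i) + G i x \<bullet> (x - a))"
  have int: "set_integrable lebesgue T (?f a i)" if "i \<in> Basis" for a i
    using that by (intro set_integrable_mult_right set_integrable_cone_integrand v G)
  have "(\<Sum>a\<in>C. \<Sum>i\<in>Basis. (bgrad C a \<bullet> i) * (LINT x:T|lebesgue. ?d * (v x \<bullet> i) + G i x \<bullet> (x - a)))
    = (\<Sum>a\<in>C. \<Sum>i\<in>Basis. (LINT x:T|lebesgue. ?f a i x))" by simp
  also have "\<dots> = (\<Sum>a\<in>C. (LINT x:T|lebesgue. \<Sum>i\<in>Basis. ?f a i x))"
    using int by (intro sum.cong refl set_integral_finite_sum(1)[symmetric])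
  also have "\<dots> = (LINT x:T|lebesgue. \<Sum>a\<in>C. \<Sum>i\<in>Basis. ?f a i x)"
    using int by (intro set_integral_finite_sum(1)[symmetric]) (auto intro!: set_integral_finite_sum(2))
  also have "\<dots> = (LINT x:T|lebesgue. - (\<Sum>i\<in>Basis. G i x \<bullet> i))"
  proof (rule set_lebesgue_integral_cong[OF T_lebesgue], intro allI impI)
    fix x
    have sum0: "(\<Sum>a\<in>C. bgrad C a \<bullet> i) = 0" for i
      using arg_cong[OF bgrad_sum, of "\<lambda>g. g \<bullet> i"] by (simp add: inner_sum_left)
    have "(\<Sum>a\<in>C. \<Sum>i\<in>Basis. ?f a i x) = (\<Sum>i\<in>Basis. \<Sum>a\<in>C. ?f a i x)" by (rule sum.swap)
    also have "\<dots> = (\<Sum>i\<in>Basis. - (G i x \<bullet> i))"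
    proof (rule sum.cong[OF refl])
      fix i :: 'a
      have "?f a i x = (bgrad C a \<bullet> i) * (?d * (v x \<bullet> i) + G i x \<bullet> x) - G i x \<bullet> ((bgrad C a \<bullet> i) *\<^sub>R a)" for a
        by (simp add: inner_diff_right algebra_simps)
      then have "(\<Sum>a\<in>C. ?f a i x) = (\<Sum>a\<in>C. bgrad C a \<bullet> i) * (?d * (v x \<bullet> i) + G i x \<bullet> x) - G i x \<bullet> (\<Sum>a\<in>C. (bgrad C a \<bullet> i) *\<^sub>R a)"
        by (simp only: sum_subtractf sum_distrib_right inner_sum_right)
      then show "(\<Sum>a\<in>C. ?f a i x) = - (G i x \<bullet> i)" by (simp add: sum0 bgrad_repr)
    qed
    finally show "(\<Sum>a\<in>C. \<Sum>i\<in>Basis. ?f a i x) = - (\<Sum>i\<in>Basis. G i x \<bullet> i)" by (simp add: sum_negf)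
  qed
  also have "\<dots> = - (LINT x:T|lebesgue. (\<Sum>i\<in>Basis. G i x \<bullet> i))"
    by (simp add: set_lebesgue_integral_def)
  finally show ?thesis .
qed

lemma bgrad_sum_inner: "(\<Sum>a\<in>C. bgrad C a \<bullet> v) = 0"
  using arg_cong[OF bgrad_sum, of "\<lambda>g. g \<bullet> v"] by (simp add: inner_sum_left)

lemma bgrad_RT_facet:
  assumes a: "a \<in> C"
  shows "bgrad C a \<bullet> (\<alpha> + \<beta> *\<^sub>R (barycenter (convex hull (C - {a})) - barycenter T))
    = bgrad C a \<bullet> \<alpha> - \<beta> / (real DIM('a) + 1)"
proof -
  let ?d = "real DIM('a)"
  have "bgrad C a \<bullet> (\<alpha> + \<beta> *\<^sub>R (barycenter (convex hull (C - {a})) - barycenter T))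
     = bgrad C a \<bullet> \<alpha> + \<beta> * ((1 / ?d) * (bgrad C a \<bullet> (barycenter T - a)))"
    unfolding barycenter_facet[OF a] by (simp only: add_diff_cancel_left' inner_add_right inner_scaleR_right)
  also have "(1 / ?d) * (bgrad C a \<bullet> (barycenter T - a)) = - (1 / (?d + 1))"
    unfolding bgrad_barycenter_vertex[OF a] by simp
  finally show ?thesis by simp
qed

lemma RT_facet_sum:
  "(\<Sum>a\<in>C. bgrad C a \<bullet> (\<alpha> + \<beta> *\<^sub>R (barycenter (convex hull (C - {a})) - barycenter T))) = - \<beta>"
proof -
  have "(\<Sum>a\<in>C. bgrad C a \<bullet> (\<alpha> + \<beta> *\<^sub>R (barycenter (convex hull (C - {a})) - barycenter T)))
    = (\<Sum>a\<in>C. bgrad C a \<bullet> \<alpha> - \<beta> / (real DIM('a) + 1))"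
    by (intro sum.cong refl bgrad_RT_facet)
  also have "\<dots> = - (real (card C) * (\<beta> / (real DIM('a) + 1)))"
    by (simp add: sum_subtractf bgrad_sum_inner)
  also have "\<dots> = - \<beta>" by (simp add: cardC add.commute)
  finally show ?thesis .
qed

text \<open>Integration by parts on one element, divided by |T|, for an affine function against a
  Raviart-Thomas field of divergence d \<beta>. The normal component of the field is constant on
  each facet and the mean of an affine function is its value at the barycenter, so facet integrals
  become point values and the proof is pure algebra.\<close>

lemma discrete_ibp:
  "(g \<bullet> \<alpha> + (c + g \<bullet> barycenter T) * (real DIM('a) * \<beta>)) =
   - real DIM('a) * (\<Sum>a\<in>C. (c + g \<bullet> barycenter (convex hull (C - {a}))) *
       (bgrad C a \<bullet> (\<alpha> + \<beta> *\<^sub>R (barycenter (convex hull (C - {a})) - barycenter T))))"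
proof -
  let ?d = "real DIM('a)" and ?b = "barycenter T"
  define B where "B = \<beta> / (?d + 1)"
  have B: "(?d + 1) * B = \<beta>" by (simp add: B_def)
  have sb: "(\<Sum>a\<in>C. g \<bullet> (?b - a)) = 0"
  proof -
    have "(\<Sum>a\<in>C. g \<bullet> (?b - a)) = g \<bullet> (real (card C) *\<^sub>R ?b - (\<Sum>a\<in>C. a))"
      by (simp add: inner_sum_right inner_diff_right sum_subtractf)
    also have "real (card C) *\<^sub>R ?b = (\<Sum>a\<in>C. a)"
    proof -
      have "1 + ?d \<noteq> 0" by (simp add: add_nonneg_eq_0_iff)
      then show ?thesis by (simp add: barycenter_T cardC add.commute)
    qed
    finally show ?thesis by simp
  qed
  have ga: "(\<Sum>a\<in>C. (g \<bullet> (?b - a)) * (bgrad C a \<bullet> \<alpha>)) = - (g \<bullet> \<alpha>)"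
  proof -
    have "(\<Sum>a\<in>C. (g \<bullet> (?b - a)) * (bgrad C a \<bullet> \<alpha>)) =
       (g \<bullet> ?b) * (\<Sum>a\<in>C. bgrad C a \<bullet> \<alpha>) - g \<bullet> (\<Sum>a\<in>C. (bgrad C a \<bullet> \<alpha>) *\<^sub>R a)"
      by (simp add: inner_sum_right sum_distrib_left sum_subtractf inner_diff_right left_diff_distrib right_diff_distrib mult.commute)
    then show ?thesis by (simp add: bgrad_sum_inner bgrad_repr)
  qed
  have summand: "(c + g \<bullet> barycenter (convex hull (C - {a}))) *
       (bgrad C a \<bullet> (\<alpha> + \<beta> *\<^sub>R (barycenter (convex hull (C - {a})) - ?b))) =
     (c + g \<bullet> ?b) * (bgrad C a \<bullet> \<alpha>) - (c + g \<bullet> ?b) * B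
      + (1 / ?d) * ((g \<bullet> (?b - a)) * (bgrad C a \<bullet> \<alpha>)) - (B / ?d) * (g \<bullet> (?b - a))" if a: "a \<in> C" for a
  proof -
    have *: "c + g \<bullet> barycenter (convex hull (C - {a})) = (c + g \<bullet> ?b) + (1 / ?d) * (g \<bullet> (?b - a))"
      unfolding barycenter_facet[OF a] by (simp only: inner_add_right inner_scaleR_right)
    show ?thesis unfolding bgrad_RT_facet[OF a] * B_def[symmetric]
      by (simp add: divide_inverse algebra_simps)
  qed
  have "(\<Sum>a\<in>C. (c + g \<bullet> barycenter (convex hull (C - {a}))) *
       (bgrad C a \<bullet> (\<alpha> + \<beta> *\<^sub>R (barycenter (convex hull (C - {a})) - ?b)))) =
     (\<Sum>a\<in>C. (c + g \<bullet> ?b) * (bgrad C a \<bullet> \<alpha>) - (c + g \<bullet> ?b) * B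
      + (1 / ?d) * ((g \<bullet> (?b - a)) * (bgrad C a \<bullet> \<alpha>)) - (B / ?d) * (g \<bullet> (?b - a)))"
    by (intro sum.cong refl summand)
  also have "\<dots> = (c + g \<bullet> ?b) * (\<Sum>a\<in>C. bgrad C a \<bullet> \<alpha>) - real (card C) * ((c + g \<bullet> ?b) * B)
     + (1 / ?d) * (\<Sum>a\<in>C. (g \<bullet> (?b - a)) * (bgrad C a \<bullet> \<alpha>)) - (B / ?d) * (\<Sum>a\<in>C. g \<bullet> (?b - a))"
    by (simp add: sum.distrib sum_subtractf sum_distrib_left[symmetric] sum_divide_distrib[symmetric])
  also have "\<dots> = - (c + g \<bullet> ?b) * ((?d + 1) * B) - (1 / ?d) * (g \<bullet> \<alpha>)"
    unfolding bgrad_sum_inner ga sb cardC by (simp add: algebra_simps)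
  also have "\<dots> = - (c + g \<bullet> ?b) * \<beta> - (1 / ?d) * (g \<bullet> \<alpha>)" unfolding B ..
  finally have sum: "(\<Sum>a\<in>C. (c + g \<bullet> barycenter (convex hull (C - {a}))) *
       (bgrad C a \<bullet> (\<alpha> + \<beta> *\<^sub>R (barycenter (convex hull (C - {a})) - ?b))))
     = - (c + g \<bullet> ?b) * \<beta> - (1 / ?d) * (g \<bullet> \<alpha>)" .
  show ?thesis unfolding sum by (simp add: algebra_simps)
qed

lemma side_mean_inner:
  fixes g :: "'a \<Rightarrow> 'a"
  assumes "\<And>i. i \<in> Basis \<Longrightarrow> set_integrable (side_measure S) S (\<lambda>x. g x \<bullet> i)"
  shows "side_mean S (\<lambda>x. g x \<bullet> n) = (\<Sum>i\<in>Basis. (n \<bullet> i) * side_mean S (\<lambda>x. g x \<bullet> i))"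
proof -
  have "(LINT x:S|side_measure S. g x \<bullet> n) = (LINT x:S|side_measure S. \<Sum>i\<in>Basis. (n \<bullet> i) * (g x \<bullet> i))"
    by (subst euclidean_inner) (simp add: mult.commute)
  also have "\<dots> = (\<Sum>i\<in>Basis. (n \<bullet> i) * (LINT x:S|side_measure S. g x \<bullet> i))"
    using assms by (subst set_integral_finite_sum) auto
  finally show ?thesis by (simp add: side_mean_def sum_divide_distrib)
qed

text \<open>The interpolant has the same mean normal component as the field on every facet. Summing
  the fluxes gives d \<beta> |T| on the one hand and, by \<open>gauss_identity\<close>, the integral
  of the divergence on the other. Multiplication by \<open>?\<kappa>\<close> replaces the
  arbitrarily oriented \<open>side_normal\<close> by \<open>bgrad\<close>.\<close>

lemma RT_divergence:
  assumes v: "\<And>i. i \<in> Basis \<Longrightarrow> set_integrable lebesgue T (\<lambda>x. v x \<bullet> i)"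
    and G: "\<And>i. i \<in> Basis \<Longrightarrow> set_integrable lebesgue T (G i)"
    and g: "\<And>a i. a \<in> C \<Longrightarrow> i \<in> Basis \<Longrightarrow>
      set_integrable (side_measure (convex hull (C - {a}))) (convex hull (C - {a})) (\<lambda>x. g a x \<bullet> i)"
    and tr: "\<And>a i. a \<in> C \<Longrightarrow> i \<in> Basis \<Longrightarrow> side_mean (convex hull (C - {a})) (\<lambda>x. g a x \<bullet> i) =
      (LINT x:T|lebesgue. real DIM('a) * (v x \<bullet> i) + G i x \<bullet> (x - a)) / (real DIM('a) * measure lebesgue T)"
    and RT: "\<And>a. a \<in> C \<Longrightarrow>
      (\<alpha> + \<beta> *\<^sub>R (barycenter (convex hull (C - {a})) - barycenter T)) \<bullet> side_normal (convex hull (C - {a})) =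
      side_mean (convex hull (C - {a})) (\<lambda>x. g a x \<bullet> side_normal (convex hull (C - {a})))"
  shows "real DIM('a) * \<beta> * measure lebesgue T = (LINT x:T|lebesgue. (\<Sum>i\<in>Basis. G i x \<bullet> i))"
proof -
  let ?d = "real DIM('a)" and ?S = "\<lambda>a. convex hull (C - {a})" and ?m = "measure lebesgue T"
  let ?L = "\<lambda>a i. LINT x:T|lebesgue. ?d * (v x \<bullet> i) + G i x \<bullet> (x - a)"
  have "bgrad C a \<bullet> (\<alpha> + \<beta> *\<^sub>R (barycenter (?S a) - barycenter T)) =
      (\<Sum>i\<in>Basis. (bgrad C a \<bullet> i) * ?L a i) / (?d * ?m)" if a: "a \<in> C" for a
  proof -
    let ?n = "side_normal (?S a)" and ?\<kappa> = "bgrad C a \<bullet> side_normal (?S a)"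
    have gn: "bgrad C a = ?\<kappa> *\<^sub>R ?n" by (rule side_normal(2)[OF a])
    have "bgrad C a \<bullet> (\<alpha> + \<beta> *\<^sub>R (barycenter (?S a) - barycenter T)) =
        ?\<kappa> * ((\<alpha> + \<beta> *\<^sub>R (barycenter (?S a) - barycenter T)) \<bullet> ?n)"
      using gn by (metis inner_scaleR_left inner_commute)
    also have "\<dots> = ?\<kappa> * (\<Sum>i\<in>Basis. (?n \<bullet> i) * (?L a i / (?d * ?m)))"
      unfolding RT[OF a]
      by (subst side_mean_inner[OF g[OF a]], assumption) (intro arg_cong2[where f = "(*)"] refl sum.cong, simp add: tr[OF a])
    also have "\<dots> = (\<Sum>i\<in>Basis. ((?\<kappa> *\<^sub>R ?n) \<bullet> i) * ?L a i) / (?d * ?m)"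
      by (simp add: sum_distrib_left sum_divide_distrib mult.assoc)
    finally show ?thesis using gn by simp
  qed
  then have "(\<Sum>a\<in>C. bgrad C a \<bullet> (\<alpha> + \<beta> *\<^sub>R (barycenter (?S a) - barycenter T))) =
     (\<Sum>a\<in>C. \<Sum>i\<in>Basis. (bgrad C a \<bullet> i) * ?L a i) / (?d * ?m)"
    by (simp add: sum_divide_distrib)
  then have "- \<beta> = - (LINT x:T|lebesgue. (\<Sum>i\<in>Basis. G i x \<bullet> i)) / (?d * ?m)"
    by (simp add: RT_facet_sum gauss_identity[OF v G])
  then show ?thesis using T_measure_pos by (simp add: field_simps)
qed

lemma vector_zero_by_edges:
  assumes a: "a \<in> C" and "\<And>b. b \<in> C \<Longrightarrow> v \<bullet> (b - a) = 0"
  shows "v = 0"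
proof -
  have "v \<bullet> w = 0" for w
  proof -
    have "v \<bullet> w = v \<bullet> (\<Sum>b\<in>C. (bgrad C b \<bullet> w) *\<^sub>R b) - (\<Sum>b\<in>C. bgrad C b \<bullet> w) * (v \<bullet> a)"
      by (simp add: bgrad_sum_inner bgrad_repr)
    also have "\<dots> = (\<Sum>b\<in>C. (bgrad C b \<bullet> w) * (v \<bullet> (b - a)))"
      by (simp add: inner_sum_right sum_distrib_right inner_diff_right right_diff_distrib sum_subtractf)
    finally show ?thesis using assms(2) by simp
  qed
  then show ?thesis by (metis inner_eq_zero_iff)
qed

text \<open>In the difference of two facet means the function itself cancels: what remains is (b -
  a) tested with the mean of \<open>G\<close>, just as the difference of the two values of the
  affine function is (b - a) tested with \<open>g\<close>. Both vectors hence agree on all edges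
  issuing from one vertex.\<close>

lemma CR_gradient:
  fixes G :: "'a \<Rightarrow> 'a"
  assumes v: "set_integrable lebesgue T v" and G: "set_integrable lebesgue T G"
    and CR: "\<And>a. a \<in> C \<Longrightarrow> c + g \<bullet> barycenter (convex hull (C - {a})) =
      (LINT x:T|lebesgue. real DIM('a) * v x + G x \<bullet> (x - a)) / (real DIM('a) * measure lebesgue T)"
  shows "g = (LINT x:T|lebesgue. G x) /\<^sub>R measure lebesgue T"
proof -
  let ?d = "real DIM('a)" and ?m = "measure lebesgue T" and ?I = "LINT x:T|lebesgue. G x"
  have m: "?m > 0" by (rule T_measure_pos)
  obtain a where a: "a \<in> C" using cardC by (metis card.empty ex_in_conv nat.distinct(1))
  have "(g - ?I /\<^sub>R ?m) \<bullet> (b - a) = 0" if b: "b \<in> C" for b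
  proof -
    have "(c + g \<bullet> barycenter (convex hull (C - {a}))) - (c + g \<bullet> barycenter (convex hull (C - {b})))
       = (1 / ?d) * (g \<bullet> (b - a))"
      unfolding barycenter_facet[OF a] barycenter_facet[OF b]
      by (simp add: inner_add_right inner_diff_right diff_divide_distrib)
    moreover have "(LINT x:T|lebesgue. ?d * v x + G x \<bullet> (x - a)) - (LINT x:T|lebesgue. ?d * v x + G x \<bullet> (x - b))
       = (LINT x:T|lebesgue. G x \<bullet> (b - a))"
      using set_integral_diff(2)[OF set_integrable_cone_integrand[OF v G, of a] set_integrable_cone_integrand[OF v G, of b]]
      by (simp add: inner_diff_right)
    moreover have "(LINT x:T|lebesgue. G x \<bullet> (b - a)) = ?I \<bullet> (b - a)"
      using integral_inner_left[of "b - a" lebesgue "\<lambda>x. indicator T x *\<^sub>R G x"] G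
      unfolding set_lebesgue_integral_def set_integrable_def by simp
    ultimately have "(1 / ?d) * (g \<bullet> (b - a)) = (?I \<bullet> (b - a)) / (?d * ?m)"
      unfolding CR[OF a] CR[OF b] by (simp add: diff_divide_distrib[symmetric])
    then have "g \<bullet> (b - a) = (?I \<bullet> (b - a)) / ?m" using m by (simp add: field_simps)
    then show ?thesis by (simp add: inner_diff_left divide_inverse_commute)
  qed
  then have "g - ?I /\<^sub>R ?m = 0" by (rule vector_zero_by_edges[OF a])
  then show ?thesis by simp
qed

text \<open>The affine map \<open>f\<close> exchanges the vertices \<open>a\<close> and
  \<open>b\<close> and fixes the others. It maps \<open>T\<close> onto itself, so the factor by
  which it changes Lebesgue measure is 1, and it exchanges the two barycentric coordinates. The
  linear part \<open>L\<close> is an involution and therefore bijective.\<close>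

lemma integral_bary_swap:
  assumes a: "a \<in> C" and b: "b \<in> C" and ab: "a \<noteq> b"
  shows "(LINT x:T|lebesgue. bary C a x) = (LINT x:T|lebesgue. bary C b x)"
proof -
  define L where "L v = v + ((bgrad C a - bgrad C b) \<bullet> v) *\<^sub>R (b - a)" for v
  define f where "f x = x + (bary C a x - bary C b x) *\<^sub>R (b - a)" for x
  have gab: "bgrad C c \<bullet> (b - a) = (if c = a then -1 else if c = b then 1 else 0)" if "c \<in> C" for c
    using a b ab that by (simp add: bary_diff[symmetric] bary_vertex)
  have LL: "L (L v) = v" for v
  proof -
    let ?g = "bgrad C a - bgrad C b"
    have "?g \<bullet> (b - a) = -2" unfolding inner_diff_left using gab[OF a] gab[OF b] ab by simp
    then have "?g \<bullet> L v = - (?g \<bullet> v)" by (simp only: L_def inner_add_right inner_scaleR_right)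
    then have "L (L v) = L v - (?g \<bullet> v) *\<^sub>R (b - a)" by (simp add: L_def[of "L v"])
    then show ?thesis by (simp add: L_def[of v])
  qed
  have linL: "linear L" unfolding L_def by (rule linearI) (auto simp: algebra_simps)
  have bijL: "bij L" using LL by (metis bij_betw_def inj_on_def surj_def)
  have bf: "bary C c (f x) = (if c = a then bary C b x else if c = b then bary C a x else bary C c x)" if "c \<in> C" for c x
    unfolding f_def bary_add using gab[OF that] ab by simp
  have fT: "f x \<in> T \<longleftrightarrow> x \<in> T" for x
    unfolding mem_T_iff using bf a b by (metis)
  have fL: "f x = L x + f 0" for x
    by (simp add: f_def L_def bary_def inner_diff_left algebra_simps)
  have [measurable]: "L \<in> borel_measurable borel" "f \<in> borel_measurable borel"
    using linL unfolding f_def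
    by (auto intro!: borel_measurable_continuous_onI linear_continuous_on simp: linear_conv_bounded_linear)
  obtain k where k: "\<And>A. A \<in> sets borel \<Longrightarrow> emeasure lborel (L -` A) = k * emeasure lborel A"
    using linear_vimage_lborel[OF linL bijL] by blast
  have kf: "emeasure lborel (f -` A) = k * emeasure lborel A" if [measurable]: "A \<in> sets borel" for A
  proof -
    have t: "emeasure lborel ((+) (f 0) -` A) = emeasure lborel A"
    proof -
      have "emeasure (distr lborel borel ((+) (f 0))) A = emeasure lborel ((+) (f 0) -` A)"
        using that by (subst emeasure_distr) auto
      then show ?thesis unfolding lborel_distr_plus by (rule sym)
    qed
    have "f x \<in> A \<longleftrightarrow> f 0 + L x \<in> A" for x by (subst fL) (simp only: add.commute)
    then have "f -` A = L -` ((+) (f 0) -` A)" by (simp only: vimage_def mem_Collect_eq)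
    also have "emeasure lborel (L -` ((+) (f 0) -` A)) = k * emeasure lborel ((+) (f 0) -` A)"
      using measurable_sets_borel[of "(+) (f 0)" borel A] by (intro k) simp
    finally show ?thesis by (simp add: t)
  qed
  have "f -` T = T" using fT by auto
  then have "emeasure lborel T = k * emeasure lborel T" using kf[OF T_borel] by simp
  moreover have "emeasure lborel T \<noteq> \<infinity>"
    using emeasure_bounded_finite[OF bounded_T] by simp
  moreover have "emeasure lborel T \<noteq> 0" using T_measure_pos by (auto simp: measure_def)
  ultimately have "k = 1"
    by (metis ennreal_mult_cancel_left mult.commute mult.right_neutral infinity_ennreal_def)
  then have distr: "distr lborel borel f = lborel"
    by (intro measure_eqI) (auto simp: emeasure_distr kf)
  have "(LINT x|lborel. indicator T x * bary C a x) = (LINT x|distr lborel borel f. indicator T x * bary C a x)"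
    by (simp add: distr)
  also have "\<dots> = (LINT x|lborel. indicator T (f x) * bary C a (f x))"
    by (subst integral_distr) auto
  also have "\<dots> = (LINT x|lborel. indicator T x * bary C b x)"
    using fT bf[OF a] by (simp add: indicator_def)
  finally show ?thesis unfolding set_lebesgue_integral_def
    by (simp add: integral_completion)
qed

lemma integral_bary:
  assumes a: "a \<in> C"
  shows "(LINT x:T|lebesgue. bary C a x) = measure lebesgue T / (real DIM('a) + 1)"
proof -
  have int: "set_integrable lebesgue T (bary C b)" for b
    by (rule set_integrable_lebesgue_continuous[OF compact_T continuous_bary])
  have "measure lebesgue T = (LINT x:T|lebesgue. (\<Sum>b\<in>C. bary C b x))"
    by (simp add: bary_sum set_lebesgue_integral_def)
  also have "\<dots> = (\<Sum>b\<in>C. LINT x:T|lebesgue. bary C b x)"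
    by (rule set_integral_finite_sum[OF int])
  also have "\<dots> = (\<Sum>b\<in>C. LINT x:T|lebesgue. bary C a x)"
    using integral_bary_swap a by (intro sum.cong refl) metis
  finally show ?thesis by (simp add: cardC field_simps)
qed

lemma integral_affine:
  "(LINT x:T|lebesgue. c + g \<bullet> x) = measure lebesgue T * (c + g \<bullet> barycenter T)"
proof -
  have int: "set_integrable lebesgue T (bary C b)" for b
    by (rule set_integrable_lebesgue_continuous[OF compact_T continuous_bary])
  have repr: "c + g \<bullet> x = (\<Sum>b\<in>C. bary C b x * (c + g \<bullet> b))" for x
  proof -
    have "(\<Sum>b\<in>C. bary C b x * (c + g \<bullet> b)) = (\<Sum>b\<in>C. bary C b x) * c + g \<bullet> (\<Sum>b\<in>C. bary C b x *\<^sub>R b)"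
      by (simp add: distrib_left sum.distrib sum_distrib_right inner_sum_right)
    then show ?thesis by (simp add: bary_sum bary_repr)
  qed
  have "(LINT x:T|lebesgue. c + g \<bullet> x) = (LINT x:T|lebesgue. \<Sum>b\<in>C. bary C b x * (c + g \<bullet> b))"
    by (rule arg_cong[where f = "set_lebesgue_integral lebesgue T"], rule ext, rule repr)
  also have "\<dots> = (\<Sum>b\<in>C. LINT x:T|lebesgue. bary C b x * (c + g \<bullet> b))"
    using int by (intro set_integral_finite_sum(1)) auto
  also have "\<dots> = (\<Sum>b\<in>C. (measure lebesgue T / (real DIM('a) + 1)) * (c + g \<bullet> b))"
    by (intro sum.cong refl) (simp add: integral_bary)
  also have "\<dots> = measure lebesgue T * (\<Sum>b\<in>C. bary C b (barycenter T) * (c + g \<bullet> b))"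
    by (simp add: bary_barycenter_T sum_distrib_left)
  also have "(\<Sum>b\<in>C. bary C b (barycenter T) * (c + g \<bullet> b)) = c + g \<bullet> barycenter T"
    by (rule repr[symmetric])
  finally show ?thesis .
qed

lemma integral_RT_field:
  "(LINT x:T|lebesgue. \<alpha> + \<beta> *\<^sub>R (x - barycenter T)) = measure lebesgue T *\<^sub>R \<alpha>"
proof (rule euclidean_eqI)
  fix i :: 'a assume "i \<in> Basis"
  have int: "set_integrable lebesgue T (\<lambda>x. \<alpha> + \<beta> *\<^sub>R (x - barycenter T))"
    by (rule set_integrable_lebesgue_continuous[OF compact_T]) (intro continuous_intros)
  have "(LINT x:T|lebesgue. \<alpha> + \<beta> *\<^sub>R (x - barycenter T)) \<bullet> i =
      (LINT x:T|lebesgue. (\<alpha> + \<beta> *\<^sub>R (x - barycenter T)) \<bullet> i)"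
    using integral_inner_left[of i lebesgue "\<lambda>x. indicator T x *\<^sub>R (\<alpha> + \<beta> *\<^sub>R (x - barycenter T))"] int
    unfolding set_lebesgue_integral_def set_integrable_def by simp
  also have "\<dots> = (LINT x:T|lebesgue. (\<alpha> \<bullet> i - \<beta> * (barycenter T \<bullet> i)) + (\<beta> *\<^sub>R i) \<bullet> x)"
    by (simp add: inner_add_left inner_diff_left inner_commute algebra_simps)
  also have "\<dots> = (measure lebesgue T *\<^sub>R \<alpha>) \<bullet> i"
    unfolding integral_affine by (simp add: inner_commute)
  finally show "(LINT x:T|lebesgue. \<alpha> + \<beta> *\<^sub>R (x - barycenter T)) \<bullet> i = (measure lebesgue T *\<^sub>R \<alpha>) \<bullet> i" .
qed

end

section \<open>Weak derivatives\<close>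

lemma C1_fun_const: "C1_fun (\<lambda>x::'a::euclidean_space. c)" "grad (\<lambda>x::'a. c) = (\<lambda>x. 0)"
  by (rule C1_funI[where g = "\<lambda>x. 0"]; simp)+

lemma C1_fun_add:
  assumes "C1_fun f" "C1_fun g"
  shows "C1_fun (\<lambda>x. f x + g x)" "grad (\<lambda>x. f x + g x) = (\<lambda>x. grad f x + grad g x)"
proof -
  have "((\<lambda>x. f x + g x) has_derivative (\<lambda>h. (grad f x + grad g x) \<bullet> h)) (at x)" for x
    using has_derivative_add[OF C1_fun_has_derivative[OF assms(1)] C1_fun_has_derivative[OF assms(2)], of x]
    by (simp add: inner_add_left)
  moreover have "continuous_on UNIV (\<lambda>x. grad f x + grad g x)"
    using assms by (intro continuous_intros C1_fun_grad_continuous)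
  ultimately show "C1_fun (\<lambda>x. f x + g x)" "grad (\<lambda>x. f x + g x) = (\<lambda>x. grad f x + grad g x)"
    using C1_funI[of "\<lambda>x. f x + g x" "\<lambda>x. grad f x + grad g x"] by blast+
qed

lemma C1_fun_mult:
  assumes "C1_fun f" "C1_fun g"
  shows "C1_fun (\<lambda>x. f x * g x)" "grad (\<lambda>x. f x * g x) = (\<lambda>x. f x *\<^sub>R grad g x + g x *\<^sub>R grad f x)"
proof -
  have "((\<lambda>x. f x * g x) has_derivative (\<lambda>h. (f x *\<^sub>R grad g x + g x *\<^sub>R grad f x) \<bullet> h)) (at x)" for x
    using has_derivative_mult[OF C1_fun_has_derivative[OF assms(1)] C1_fun_has_derivative[OF assms(2)], of x]
    by (simp add: inner_add_left mult.commute)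
  moreover have "continuous_on UNIV (\<lambda>x. f x *\<^sub>R grad g x + g x *\<^sub>R grad f x)"
    using assms by (intro continuous_intros C1_fun_grad_continuous C1_fun_continuous)
  ultimately show "C1_fun (\<lambda>x. f x * g x)" "grad (\<lambda>x. f x * g x) = (\<lambda>x. f x *\<^sub>R grad g x + g x *\<^sub>R grad f x)"
    using C1_funI[of "\<lambda>x. f x * g x" "\<lambda>x. f x *\<^sub>R grad g x + g x *\<^sub>R grad f x"] by blast+
qed

lemma C1_fun_sum:
  assumes "\<And>i. i \<in> I \<Longrightarrow> C1_fun (f i)"
  shows "C1_fun (\<lambda>x::'a::euclidean_space. \<Sum>i\<in>I. f i x)"
  using assms
proof (induction I rule: infinite_finite_induct)
  case (insert i I)
  then have "C1_fun (\<lambda>x. f i x + (\<Sum>i\<in>I. f i x))" by (intro C1_fun_add) auto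
  then show ?case using insert by simp
qed (simp_all add: C1_fun_const)

lemma C1_fun_compose:
  assumes f: "C1_fun f" and \<phi>: "\<And>s::real. (\<phi> has_real_derivative \<phi>' s) (at s)" "continuous_on UNIV \<phi>'"
  shows "C1_fun (\<lambda>x. \<phi> (f x))"
proof (rule C1_funI(1))
  show "((\<lambda>x. \<phi> (f x)) has_derivative (\<lambda>h. (\<phi>' (f x) *\<^sub>R grad f x) \<bullet> h)) (at x)" for x
    using has_derivative_compose[OF C1_fun_has_derivative[OF f, of x] \<phi>(1)[of "f x", unfolded has_field_derivative_def]]
    by simp
  show "continuous_on UNIV (\<lambda>x. \<phi>' (f x) *\<^sub>R grad f x)"
    using f by (intro continuous_intros C1_fun_grad_continuous continuous_on_compose2[OF \<phi>(2)] C1_fun_continuous) auto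
qed

text \<open>Squaring removes the kink of the positive part, so that cut-offs built from it are of
  class C1.\<close>

lemma DERIV_max_0_square: "((\<lambda>s::real. (max 0 s)\<^sup>2) has_real_derivative 2 * max 0 s) (at s)"
proof -
  consider "s < 0" | "s = 0" | "s > 0" by linarith
  then show ?thesis
  proof cases
    case 1
    have "((\<lambda>s::real. 0) has_real_derivative 2 * max 0 s) (at s)" using 1 by simp
    then show ?thesis
      by (rule has_field_derivative_transform_within_open[of _ _ _ "{..<0}"]) (use 1 in auto)
  next
    case 3
    have "((\<lambda>s::real. s\<^sup>2) has_real_derivative 2 * max 0 s) (at s)"
      using 3 by (auto intro!: derivative_eq_intros)
    then show ?thesis
      by (rule has_field_derivative_transform_within_open[of _ _ _ "{0<..}"]) (use 3 in auto)
  next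
    case 2
    have "(\<lambda>h::real. (max 0 h)\<^sup>2 / h) \<midarrow>0\<rightarrow> 0"
    proof (rule Lim_null_comparison)
      show "\<forall>\<^sub>F h in at 0. norm ((max 0 h)\<^sup>2 / h) \<le> \<bar>h\<bar>"
        by (rule always_eventually) (auto simp: max_def power2_eq_square)
      show "((\<lambda>h::real. \<bar>h\<bar>) \<longlongrightarrow> 0) (at 0)"
        by (rule tendsto_rabs_zero) (rule tendsto_ident_at)
    qed
    then show ?thesis using 2 by (simp add: DERIV_def)
  qed
qed

text \<open>The square of the positive part of r^2 - |x - c|^2.\<close>

lemma ball_bump:
  fixes c :: "'a::euclidean_space"
  obtains w where "C1_fun w" "\<And>x. 0 \<le> w x" "\<And>x. 0 < w x \<longleftrightarrow> x \<in> ball c r"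
proof (cases "r > 0")
  case True
  define q where "q x = r\<^sup>2 - (x - c) \<bullet> (x - c)" for x
  have "C1_fun q"
  proof (rule C1_funI(1))
    show "(q has_derivative (\<lambda>h. (- 2 *\<^sub>R (x - c)) \<bullet> h)) (at x)" for x
      unfolding q_def by (rule derivative_eq_intros refl | simp add: inner_commute)+
  qed (intro continuous_intros)
  then have "C1_fun (\<lambda>x. (max 0 (q x))\<^sup>2)"
    by (rule C1_fun_compose[OF _ DERIV_max_0_square]) (intro continuous_intros)
  moreover have "0 < q x \<longleftrightarrow> x \<in> ball c r" for x
  proof -
    have "0 < q x \<longleftrightarrow> (norm (x - c))\<^sup>2 < r\<^sup>2" by (simp add: q_def dot_square_norm)
    also have "\<dots> \<longleftrightarrow> norm (x - c) < r" using True by (metis norm_ge_zero less_imp_le power2_less_imp_less power_strict_mono pos2)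
    finally show ?thesis by (simp add: dist_norm norm_minus_commute)
  qed
  moreover have "0 < (max 0 s)\<^sup>2 \<longleftrightarrow> 0 < s" for s :: real
    by (cases "0 < s") (auto simp: max_def)
  ultimately show ?thesis by (intro that[of "\<lambda>x. (max 0 (q x))\<^sup>2"]) auto
next
  case False
  then have empty: "ball c r = {}" by simp
  show ?thesis
  proof (rule that[of "\<lambda>x. 0"])
    show "(0::real) < 0 \<longleftrightarrow> x \<in> ball c r" for x using empty by blast
  qed (simp_all add: C1_fun_const)
qed

text \<open>By Lindelof's theorem an open set is a countable union of balls. The partial sums
  \<open>s k\<close> of the corresponding bumps are eventually bounded below by a positive number at
  each point of \<open>U\<close> and vanish outside; \<open>1 - exp (- (k * s k))\<close> then
  increases to 1 in \<open>U\<close> and keeps all values in the unit interval.\<close>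

lemma bump_sequence:
  fixes U :: "'a::euclidean_space set"
  assumes "open U"
  obtains v :: "nat \<Rightarrow> 'a \<Rightarrow> real" where "\<And>k. C1_fun (v k)" "\<And>k x. 0 \<le> v k x" "\<And>k x. v k x \<le> 1"
    "\<And>k x. x \<notin> U \<Longrightarrow> v k x = 0" "\<And>x. x \<in> U \<Longrightarrow> (\<lambda>k. v k x) \<longlonglongrightarrow> 1"
proof -
  let ?F = "{ball c r | c r. ball c r \<subseteq> U}"
  obtain F' where F': "F' \<subseteq> ?F" "countable F'" "\<Union>F' = \<Union>?F"
    using Lindelof[of ?F] by blast
  have UF: "\<Union>?F = U"
    using assms unfolding open_contains_ball by (auto, metis centre_in_ball)
  \<comment> \<open>The empty ball is added so that the family is nonempty and can be enumerated
    also when \<open>U\<close> is empty.\<close>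
  have F0: "insert {} F' \<noteq> {}" "countable (insert {} F')" using F' by auto
  obtain B :: "nat \<Rightarrow> 'a set" where B: "range B = insert {} F'" by (rule that[OF range_from_nat_into[OF F0]])
  have "\<exists>w. C1_fun w \<and> (\<forall>x. 0 \<le> w x) \<and> (\<forall>x. 0 < w x \<longleftrightarrow> x \<in> B n)" for n :: nat
  proof -
    have "B n \<in> insert {} F'" using B by blast
    moreover have "{} = ball undefined (0::real)" by simp
    ultimately obtain c r where "B n = ball c r" using F'(1) by blast
    then show ?thesis using ball_bump[of c r] by metis
  qed
  then obtain w where w: "\<And>n. C1_fun (w n)" "\<And>n x. 0 \<le> w n x" "\<And>n x. 0 < w n x \<longleftrightarrow> x \<in> B n"
    by metis
  have BU: "(\<Union>n. B n) = U" using B F' UF by auto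
  define s where "s k x = (\<Sum>n<k. w n x)" for k x
  define v where "v k x = 1 - exp (- (real k * s k x))" for k x
  have s0: "0 \<le> s k x" for k x by (simp add: s_def w sum_nonneg)
  have C1s: "C1_fun (s k)" for k unfolding s_def by (intro C1_fun_sum w)
  show thesis
  proof (rule that)
    show "C1_fun (v k)" for k
      unfolding v_def
      by (rule C1_fun_compose[OF C1s, of "\<lambda>s. 1 - exp (- (real k * s))" "\<lambda>s. real k * exp (- (real k * s))"])
         (auto intro!: derivative_eq_intros continuous_intros)
    show "0 \<le> v k x" "v k x \<le> 1" for k x
      using s0 by (simp_all add: v_def)
    show "v k x = 0" if "x \<notin> U" for k x
    proof -
      have "w n x = 0" for n using w(2)[of n x] w(3)[of n x] that BU by (auto simp: less_le)
      then show ?thesis by (simp add: v_def s_def)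
    qed
    show "(\<lambda>k. v k x) \<longlonglongrightarrow> 1" if xU: "x \<in> U" for x
    proof -
      obtain m where "x \<in> B m" using xU BU by auto
      then have m: "0 < w m x" using w(3) by blast
      have "filterlim (\<lambda>k. real k * w m x) at_top sequentially"
        using filterlim_tendsto_pos_mult_at_top[OF tendsto_const m filterlim_real_sequentially] by (simp add: mult.commute)
      moreover have "\<forall>\<^sub>F k in sequentially. real k * w m x \<le> real k * s k x"
      proof (rule eventually_sequentiallyI)
        fix k assume "Suc m \<le> k"
        then have "w m x \<le> s k x" unfolding s_def using w(2) by (intro member_le_sum) auto
        then show "real k * w m x \<le> real k * s k x" by (simp add: mult_left_mono)
      qed
      ultimately have "filterlim (\<lambda>k. real k * s k x) at_top sequentially"
        by (rule filterlim_at_top_mono)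
      then have "filterlim (\<lambda>k. - (real k * s k x)) at_bot sequentially"
        by (simp add: filterlim_uminus_at_bot)
      then have "(\<lambda>k. exp (- (real k * s k x))) \<longlonglongrightarrow> 0"
        by (rule filterlim_compose[OF exp_at_bot])
      then have "(\<lambda>k. 1 - exp (- (real k * s k x))) \<longlonglongrightarrow> 1 - 0" by (intro tendsto_diff tendsto_const)
      then show ?thesis by (simp add: v_def)
    qed
  qed
qed

lemma grad_zero_outside:
  assumes "open U" "x \<in> U" "\<And>y. y \<in> U \<Longrightarrow> f y = 0"
  shows "grad f x = 0"
proof (rule grad_eqI)
  have "((\<lambda>y. 0) has_derivative (\<lambda>h. 0 \<bullet> h)) (at x)" by simp
  then show "(f has_derivative (\<lambda>h. 0 \<bullet> h)) (at x)"
    by (rule has_derivative_transform_within_open[OF _ assms(1,2)]) (simp add: assms(3))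
qed

text \<open>By translation invariance every difference quotient has integral zero, and the quotients
  in a fixed direction converge dominatedly to the directional derivative. This replaces the
  divergence theorem on the whole space.\<close>

lemma integral_grad_compact_support:
  fixes f :: "'a::euclidean_space \<Rightarrow> real"
  assumes f: "C1_fun f" and K: "compact K" and supp: "\<And>x. x \<notin> K \<Longrightarrow> f x = 0"
  shows "(LINT x|lborel. grad f x) = 0"
proof -
  have contf: "continuous_on UNIV f" and contg: "continuous_on UNIV (grad f)"
    using f by (auto intro: C1_fun_continuous C1_fun_grad_continuous)
  have [measurable]: "f \<in> borel_measurable borel" "grad f \<in> borel_measurable borel"
    using contf contg by (auto intro: borel_measurable_continuous_onI)
  have g0: "grad f x = 0" if "x \<notin> K" for x
    by (rule grad_zero_outside[of "- K"]) (use that K supp in \<open>auto simp: compact_imp_closed\<close>)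
  obtain B where B: "\<And>x. x \<in> K \<Longrightarrow> norm x \<le> B" using compact_imp_bounded[OF K] bounded_iff by blast
  obtain M0 where M0: "\<And>x. x \<in> K \<Longrightarrow> norm (grad f x) \<le> M0"
    using compact_imp_bounded[OF compact_continuous_image[OF continuous_on_subset[OF contg] K]]
    by (fastforce simp: bounded_iff)
  define M where "M = \<bar>M0\<bar>"
  have M: "norm (grad f x) \<le> M" for x
    using M0[of x] g0[of x] by (cases "x \<in> K") (auto simp: M_def)
  have int_f: "integrable lborel f"
  proof -
    have "integrable lborel (\<lambda>x. indicator K x *\<^sub>R f x)"
      by (rule borel_integrable_compact[OF K continuous_on_subset[OF contf]]) simp
    then show ?thesis
      by (rule Bochner_Integration.integrable_cong[THEN iffD1, rotated 2]) (auto simp: indicator_def supp)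
  qed
  have int_g: "integrable lborel (grad f)"
  proof -
    have "integrable lborel (\<lambda>x. indicator K x *\<^sub>R grad f x)"
      by (rule borel_integrable_compact[OF K continuous_on_subset[OF contg]]) simp
    then show ?thesis
      by (rule Bochner_Integration.integrable_cong[THEN iffD1, rotated 2]) (auto simp: indicator_def g0)
  qed
  have "(LINT x|lborel. grad f x \<bullet> e) = 0" if e: "norm e = 1" for e :: 'a
  proof -
    define t where "t k = inverse (real (Suc k))" for k
    have t: "0 < t k" "t k \<le> 1" for k by (simp_all add: t_def inverse_le_1_iff)
    have t0: "t \<longlonglongrightarrow> 0" unfolding t_def by (rule LIMSEQ_inverse_real_of_nat)
    define F where "F k x = (f (t k *\<^sub>R e + x) - f x) / t k" for k x
    have [measurable]: "F k \<in> borel_measurable borel" for k unfolding F_def by measurable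
    have int_tr: "integrable lborel (\<lambda>x. f (c + x))" for c
    proof -
      have "integrable (distr lborel borel ((+) c)) f" by (simp add: lborel_distr_plus int_f)
      then show ?thesis by (subst (asm) integrable_distr_eq) auto
    qed
    have F0: "(LINT x|lborel. F k x) = 0" for k
      unfolding F_def using int_f int_tr[of "t k *\<^sub>R e"]
      by (simp add: lborel_integral_translate)
    have der: "((\<lambda>\<tau>. f (\<tau> *\<^sub>R e + x)) has_real_derivative (grad f (\<tau> *\<^sub>R e + x) \<bullet> e)) (at \<tau>)" for x \<tau>
    proof -
      have "((\<lambda>\<tau>. f (\<tau> *\<^sub>R e + x)) has_derivative (\<lambda>h. grad f (\<tau> *\<^sub>R e + x) \<bullet> (h *\<^sub>R e))) (at \<tau>)"
        by (rule has_derivative_compose[OF _ C1_fun_has_derivative[OF f]]) (auto intro!: derivative_eq_intros)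
      then show ?thesis by (simp add: has_field_derivative_def mult.commute[of _ "_ \<bullet> _"])
    qed
    have "(\<lambda>k. LINT x|lborel. F k x) \<longlonglongrightarrow> (LINT x|lborel. grad f x \<bullet> e)"
    proof (rule integral_dominated_convergence)
      show "integrable lborel (\<lambda>x. M * indicator (cball (0::'a) (B + 1)) x)"
        using emeasure_lborel_cball_finite by (intro integrable_mult_right integrable_real_indicator) auto
      show "AE x in lborel. norm (F k x) \<le> M * indicator (cball 0 (B + 1)) x" for k
      proof (rule AE_I2)
        fix x
        show "norm (F k x) \<le> M * indicator (cball 0 (B + 1)) x"
        proof (cases "norm x \<le> B + 1")
          case True
          have "norm (f (t k *\<^sub>R e + x) - f (0 *\<^sub>R e + x)) \<le> M * norm (t k - 0)"
          proof (rule field_differentiable_bound[of "{0..1}" "\<lambda>\<tau>. f (\<tau> *\<^sub>R e + x)"])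
            show "((\<lambda>\<tau>. f (\<tau> *\<^sub>R e + x)) has_field_derivative (grad f (z *\<^sub>R e + x) \<bullet> e)) (at z within {0..1})" for z
              using der has_field_derivative_at_within by blast
            show "norm (grad f (z *\<^sub>R e + x) \<bullet> e) \<le> M" for z
              using Cauchy_Schwarz_ineq2[of "grad f (z *\<^sub>R e + x)" e] M[of "z *\<^sub>R e + x"] e by simp
          qed (use t[of k] in auto)
          then have "norm (F k x) \<le> M" using t[of k] by (simp add: F_def field_simps)
          then show ?thesis using True by simp
        next
          case False
          have "t k *\<^sub>R e + x \<notin> K"
          proof
            assume "t k *\<^sub>R e + x \<in> K"
            then have "norm (t k *\<^sub>R e + x) \<le> B" by (rule B)
            moreover have "norm x \<le> norm (t k *\<^sub>R e + x) + norm (t k *\<^sub>R e)"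
              using norm_triangle_ineq4[of "t k *\<^sub>R e + x" "t k *\<^sub>R e"] by simp
            moreover have "norm (t k *\<^sub>R e) \<le> 1" using t[of k] e by simp
            ultimately show False using False by linarith
          qed
          moreover have "x \<notin> K" using B False by force
          ultimately show ?thesis by (simp add: F_def supp M_def)
        qed
      qed
      show "AE x in lborel. (\<lambda>k. F k x) \<longlonglongrightarrow> grad f x \<bullet> e"
      proof (rule AE_I2)
        fix x
        have "((\<lambda>h. (f ((0 + h) *\<^sub>R e + x) - f (0 *\<^sub>R e + x)) / h) \<longlongrightarrow> grad f (0 *\<^sub>R e + x) \<bullet> e) (at 0)"
          using der[of x 0] by (simp add: DERIV_def)
        moreover have "filterlim t (at 0) sequentially"
          unfolding filterlim_at using t0 t(1) by (auto simp: less_imp_neq[symmetric])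
        ultimately have "(\<lambda>k. (f ((0 + t k) *\<^sub>R e + x) - f (0 *\<^sub>R e + x)) / t k) \<longlonglongrightarrow> grad f (0 *\<^sub>R e + x) \<bullet> e"
          by (rule filterlim_compose)
        then show "(\<lambda>k. F k x) \<longlonglongrightarrow> grad f x \<bullet> e" by (simp add: F_def)
      qed
    qed auto
    then show ?thesis by (simp add: F0 LIMSEQ_const_iff)
  qed
  then have zero: "(LINT x|lborel. grad f x \<bullet> i) = 0" if "i \<in> Basis" for i
    using that norm_Basis by blast
  show ?thesis
  proof (rule euclidean_eqI)
    fix i :: 'a assume i: "i \<in> Basis"
    have "(LINT x|lborel. grad f x) \<bullet> i = (LINT x|lborel. grad f x \<bullet> i)"
      by (rule integral_inner_left[symmetric]) (rule int_g)
    then show "(LINT x|lborel. grad f x) \<bullet> i = 0 \<bullet> i" by (simp only: zero[OF i] inner_zero_left)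
  qed
qed

section \<open>Test functions and classical gradients as weak gradients\<close>

lemma test_funE:
  assumes "\<eta> \<in> test_fun \<Omega>"
  obtains K where "C1_fun \<eta>" "compact K" "K \<subseteq> \<Omega>" "\<And>x. x \<notin> K \<Longrightarrow> \<eta> x = 0" "\<And>x. x \<notin> K \<Longrightarrow> grad \<eta> x = 0"
proof -
  obtain K where K: "C1_fun \<eta>" "compact K" "K \<subseteq> \<Omega>" "\<And>x. x \<notin> K \<Longrightarrow> \<eta> x = 0"
    using assms by (auto simp: test_fun_def)
  have "grad \<eta> x = 0" if "x \<notin> K" for x
    by (rule grad_zero_outside[of "- K"]) (use that K in \<open>auto simp: compact_imp_closed\<close>)
  with K show ?thesis using that by blast
qed

lemma lebesgue_on_integral:
  fixes f :: "'a::euclidean_space \<Rightarrow> 'b::euclidean_space"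
  assumes "\<Omega> \<in> sets lebesgue"
  shows "(LINT x|lebesgue_on \<Omega>. f x) = (LINT x:\<Omega>|lebesgue. f x)"
    and "integrable (lebesgue_on \<Omega>) f \<longleftrightarrow> set_integrable lebesgue \<Omega> f"
  using assms unfolding set_lebesgue_integral_def set_integrable_def
  by (simp_all add: integral_restrict_space integrable_restrict_space)

lemma set_integrable_compact_support:
  fixes f :: "'a::euclidean_space \<Rightarrow> 'b::euclidean_space"
  assumes "set_integrable lebesgue K f" "K \<subseteq> \<Omega>" "\<And>x. x \<notin> K \<Longrightarrow> f x = 0"
  shows "set_integrable lebesgue \<Omega> f" "(LINT x:\<Omega>|lebesgue. f x) = (LINT x:K|lebesgue. f x)"
proof -
  have "(\<lambda>x. indicator \<Omega> x *\<^sub>R f x) = (\<lambda>x. indicator K x *\<^sub>R f x)"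
    using assms(2,3) by (intro ext) (auto simp: indicator_def)
  then show "set_integrable lebesgue \<Omega> f" "(LINT x:\<Omega>|lebesgue. f x) = (LINT x:K|lebesgue. f x)"
    using assms(1) by (simp_all add: set_integrable_def set_lebesgue_integral_def)
qed

lemma L1_loc_continuous:
  fixes f :: "'a::euclidean_space \<Rightarrow> 'b::euclidean_space"
  shows "continuous_on UNIV f \<Longrightarrow> f \<in> L1_loc \<Omega>"
  unfolding L1_loc_def by (auto intro: set_integrable_lebesgue_continuous continuous_on_subset)

lemma C1_has_weak_grad:
  fixes v :: "'a::euclidean_space \<Rightarrow> real"
  assumes \<Omega>: "open \<Omega>" and v: "C1_fun v"
  shows "has_weak_grad \<Omega> v (grad v)"
  unfolding has_weak_grad_def
proof (intro conjI ballI L1_loc_continuous C1_fun_continuous C1_fun_grad_continuous v)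
  fix \<eta> assume "\<eta> \<in> test_fun \<Omega>"
  then obtain K where K: "C1_fun \<eta>" "compact K" "K \<subseteq> \<Omega>" "\<And>x. x \<notin> K \<Longrightarrow> \<eta> x = 0" "\<And>x. x \<notin> K \<Longrightarrow> grad \<eta> x = 0"
    using test_funE by metis
  have \<Omega>': "\<Omega> \<in> sets lebesgue" using \<Omega> by (simp add: borel_open)
  have c: "continuous_on K v" "continuous_on K \<eta>" "continuous_on K (grad v)" "continuous_on K (grad \<eta>)"
    using v K(1) by (auto intro: C1_fun_continuous C1_fun_grad_continuous)
  have i: "set_integrable lebesgue K (\<lambda>x. v x *\<^sub>R grad \<eta> x)" "set_integrable lebesgue K (\<lambda>x. \<eta> x *\<^sub>R grad v x)"
    using c by (auto intro!: set_integrable_lebesgue_continuous[OF K(2)] continuous_intros)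
  have "(LINT x:K|lebesgue. v x *\<^sub>R grad \<eta> x) + (LINT x:K|lebesgue. \<eta> x *\<^sub>R grad v x)
     = (LINT x:K|lebesgue. grad (\<lambda>x. v x * \<eta> x) x)"
    using i by (simp add: C1_fun_mult(2)[OF v K(1)])
  also have "\<dots> = (LINT x|lborel. grad (\<lambda>x. v x * \<eta> x) x)"
  proof -
    have "indicator K x *\<^sub>R grad (\<lambda>x. v x * \<eta> x) x = grad (\<lambda>x. v x * \<eta> x) x" for x
      using K(4,5) by (cases "x \<in> K") (simp_all add: C1_fun_mult(2)[OF v K(1)])
    moreover have "continuous_on UNIV (grad (\<lambda>x. v x * \<eta> x))"
      by (intro C1_fun_grad_continuous C1_fun_mult(1) v K(1))
    ultimately show ?thesis unfolding set_lebesgue_integral_def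
      by (simp add: integral_completion borel_measurable_continuous_onI)
  qed
  also have "\<dots> = 0"
    by (rule integral_grad_compact_support[OF C1_fun_mult(1)[OF v K(1)] K(2)]) (simp add: K(4))
  finally have "(LINT x:K|lebesgue. v x *\<^sub>R grad \<eta> x) = - (LINT x:K|lebesgue. \<eta> x *\<^sub>R grad v x)"
    by (simp add: eq_neg_iff_add_eq_0)
  then show "(LINT x|lebesgue_on \<Omega>. v x *\<^sub>R grad \<eta> x) = - (LINT x|lebesgue_on \<Omega>. \<eta> x *\<^sub>R grad v x)"
    using set_integrable_compact_support(2)[OF i(1) K(3)] set_integrable_compact_support(2)[OF i(2) K(3)] K(4,5)
    by (simp add: lebesgue_on_integral[OF \<Omega>'])
qed

section \<open>Uniqueness of weak derivatives\<close>

lemma sigma_finite_lebesgue: "sigma_finite_measure (lebesgue :: 'a::euclidean_space measure)"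
proof
  have "emeasure lebesgue (cball (0::'a) (real n)) \<noteq> \<infinity>" for n
    using emeasure_lborel_cball_finite[of "0::'a" "real n"] by simp
  then show "\<exists>A::'a set set. countable A \<and> A \<subseteq> sets lebesgue \<and> \<Union>A = space lebesgue \<and> (\<forall>a\<in>A. emeasure lebesgue a \<noteq> \<infinity>)"
    by (intro exI[of _ "range (\<lambda>n. cball 0 (real n))"]) (auto simp: real_arch_simple)
qed

text \<open>Open sets are stable under intersection and generate the Borel sets, so vanishing of the
  integrals extends to all Borel sets by Dynkin's argument and to Lebesgue sets by removing a null
  set.\<close>

lemma AE_zero_of_open_integrals:
  fixes f :: "'a::euclidean_space \<Rightarrow> 'b::euclidean_space"
  assumes f: "integrable lebesgue f" and zero: "\<And>U. open U \<Longrightarrow> (LINT x:U|lebesgue. f x) = 0"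
  shows "AE x in lebesgue. f x = 0"
proof (rule sigma_finite_measure.density_zero[OF sigma_finite_lebesgue f])
  have si: "set_integrable lebesgue A f" if "A \<in> sets lebesgue" for A
    unfolding set_integrable_def using f that by (rule integrable_mult_indicator[rotated])
  have borel0: "(LINT x:A|lebesgue. f x) = 0" if "A \<in> sigma_sets UNIV {S. open S}" for A
  proof -
    have stable: "Int_stable {S :: 'a set. open S}" "{S :: 'a set. open S} \<subseteq> Pow UNIV"
      by (auto simp: Int_stable_def)
    from stable that show ?thesis
    proof (induction A rule: sigma_sets_induct_disjoint)
      case (compl A)
      then have "A \<in> sets borel" by (simp add: borel_def)
      then have A: "A \<in> sets lebesgue" by simp
      have "(LINT x:UNIV|lebesgue. f x) = (LINT x:(UNIV - A)|lebesgue. f x) + (LINT x:A|lebesgue. f x)"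
      proof -
        have "UNIV - A \<in> sets lebesgue" "(UNIV - A) \<inter> A = {}" "(UNIV - A) \<union> A = UNIV" using A by auto
        then show ?thesis using set_integral_Un[of "UNIV - A" A lebesgue f] si[OF A] si[of "UNIV - A"] by simp
      qed
      then show ?case using compl zero[of UNIV] by simp
    next
      case (union A)
      then have "A i \<in> sets borel" for i by (auto simp: borel_def)
      then have A: "A i \<in> sets lebesgue" for i by simp
      have "(LINT x:(\<Union>i. A i)|lebesgue. f x) = (\<Sum>i. (LINT x:(A i)|lebesgue. f x))"
        using A union(1) by (intro lebesgue_integral_countable_add si) (auto simp: disjoint_family_on_def)
      then show ?case using union by simp
    qed (auto simp: zero)
  qed
  fix A :: "'a set" assume A: "A \<in> sets lebesgue"
  then obtain S N N' where S: "A = S \<union> N" "N \<subseteq> N'" "N' \<in> null_sets lborel" "S \<in> sets lborel"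
    by (rule sets_completionE)
  have S': "S \<in> sets lebesgue" using S(4) by simp
  have "(LINT x:A|lebesgue. f x) = (LINT x:S|lebesgue. f x)"
  proof (rule set_integral_cong_set)
    show "set_borel_measurable lebesgue S f" "set_borel_measurable lebesgue A f"
      using si[OF A] si[OF S'] by (auto simp: set_integrable_def set_borel_measurable_def)
    have "N' \<in> null_sets lebesgue" using S(3) by (rule null_sets_completionI)
    then show "AE x in lebesgue. x \<in> S \<longleftrightarrow> x \<in> A"
      by (rule AE_I') (use S in auto)
  qed
  also have "\<dots> = 0" using borel0[of S] S(4) by (simp add: borel_def)
  finally show "(LINT x:A|lebesgue. f x) = 0" .
qed

lemma AE_lebesgue_on_balls:
  assumes \<Omega>: "open \<Omega>"
    and P: "\<And>c r. cball c r \<subseteq> \<Omega> \<Longrightarrow> AE x in lebesgue. x \<in> ball c r \<longrightarrow> P x"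
  shows "AE x in lebesgue_on (\<Omega> :: 'a::euclidean_space set). P x"
proof -
  let ?F = "{ball c r | c r. cball c r \<subseteq> \<Omega>}"
  obtain F' where F': "F' \<subseteq> ?F" "countable F'" "\<Union>F' = \<Union>?F"
    using Lindelof[of ?F] by blast
  have UF: "\<Omega> \<subseteq> \<Union>F'"
  proof
    fix x assume "x \<in> \<Omega>"
    then obtain e where "e > 0" "cball x e \<subseteq> \<Omega>" using \<Omega> open_contains_cball by blast
    then show "x \<in> \<Union>F'" unfolding F'(3) by (auto intro!: exI[of _ "ball x e"])
  qed
  have "AE x in lebesgue. \<forall>B\<in>F'. x \<in> B \<longrightarrow> P x"
    unfolding AE_ball_countable[OF F'(2)] using F'(1) P by blast
  then have "AE x in lebesgue. x \<in> \<Omega> \<longrightarrow> P x"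
    by eventually_elim (use UF in blast)
  then show ?thesis using \<Omega> by (subst AE_restrict_space_iff) (auto simp: borel_open)
qed

text \<open>The function is integrable only locally, so the claim is reduced to balls with closure
  in \<Omega>. There the indicator of an open subset is the bounded pointwise limit of admissible
  test functions from \<open>bump_sequence\<close>, and all integrals over open sets vanish.\<close>

lemma fundamental_lemma:
  fixes f :: "'a::euclidean_space \<Rightarrow> 'b::euclidean_space"
  assumes \<Omega>: "open \<Omega>" and f: "f \<in> L1_loc \<Omega>"
    and zero: "\<And>\<eta>. \<eta> \<in> test_fun \<Omega> \<Longrightarrow> (LINT x|lebesgue_on \<Omega>. \<eta> x *\<^sub>R f x) = 0"
  shows "AE x in lebesgue_on \<Omega>. f x = 0"
proof (rule AE_lebesgue_on_balls[OF \<Omega>])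
  fix c :: 'a and r assume cb: "cball c r \<subseteq> \<Omega>"
  have \<Omega>': "\<Omega> \<in> sets lebesgue" using \<Omega> by (simp add: borel_open)
  have fK: "set_integrable lebesgue (cball c r) f" using f cb by (simp add: L1_loc_def)
  have fB: "set_integrable lebesgue (ball c r) f"
    by (rule set_integrable_subset[OF fK]) auto
  have "AE x in lebesgue. indicator (ball c r) x *\<^sub>R f x = 0"
  proof (rule AE_zero_of_open_integrals)
    show "integrable lebesgue (\<lambda>x. indicator (ball c r) x *\<^sub>R f x)" using fB by (simp add: set_integrable_def)
    fix V :: "'a set" assume V: "open V"
    define U where "U = V \<inter> ball c r"
    have "open U" using V by (simp add: U_def open_Int)
    then obtain v where v: "\<And>k::nat. C1_fun (v k)" "\<And>k x. 0 \<le> v k x" "\<And>k x. v k x \<le> 1"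
      "\<And>k x. x \<notin> U \<Longrightarrow> v k x = 0" "\<And>x. x \<in> U \<Longrightarrow> (\<lambda>k. v k x) \<longlonglongrightarrow> 1"
      using bump_sequence by metis
    have supp: "v k x = 0" if "x \<notin> cball c r" for k x
      using that by (intro v(4)) (auto simp: U_def)
    have tf: "v k \<in> test_fun \<Omega>" for k
      unfolding test_fun_def using v(1) cb supp by (intro CollectI conjI exI[of _ "cball c r"]) auto
    have vm: "v k \<in> borel_measurable lebesgue" for k
      using C1_fun_continuous[OF v(1)] by (intro measurable_completion) (simp add: borel_measurable_continuous_onI)
    have f_m: "(\<lambda>x. indicator (ball c r) x *\<^sub>R f x) \<in> borel_measurable lebesgue"
      using fB by (auto simp: set_integrable_def)
    have eq: "indicator \<Omega> x *\<^sub>R (v k x *\<^sub>R f x) = v k x *\<^sub>R (indicator (ball c r) x *\<^sub>R f x)" for k x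
    proof (cases "x \<in> ball c r")
      case True
      then show ?thesis using cb by (auto simp: indicator_def)
    next
      case False
      then have "v k x = 0" by (intro v(4)) (auto simp: U_def)
      then show ?thesis by simp
    qed
    have "(\<lambda>k. LINT x|lebesgue. v k x *\<^sub>R (indicator (ball c r) x *\<^sub>R f x)) \<longlonglongrightarrow>
        (LINT x|lebesgue. indicator V x *\<^sub>R (indicator (ball c r) x *\<^sub>R f x))"
    proof (rule integral_dominated_convergence)
      show "integrable lebesgue (\<lambda>x. norm (indicator (ball c r) x *\<^sub>R f x))"
        using fB unfolding set_integrable_def by (rule integrable_norm)
      show "AE x in lebesgue. norm (v k x *\<^sub>R (indicator (ball c r) x *\<^sub>R f x)) \<le> norm (indicator (ball c r) x *\<^sub>R f x)" for k
        using v(2,3) by (intro AE_I2) (simp only: norm_scaleR[of "v k _"], rule mult_left_le_one_le, auto)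
      show "(\<lambda>x. v k x *\<^sub>R (indicator (ball c r) x *\<^sub>R f x)) \<in> borel_measurable lebesgue" for k
        using vm f_m by measurable
      show "(\<lambda>x. indicator V x *\<^sub>R (indicator (ball c r) x *\<^sub>R f x)) \<in> borel_measurable lebesgue"
        using V by (intro borel_measurable_scaleR f_m borel_measurable_indicator) (simp add: borel_open)
      show "AE x in lebesgue. (\<lambda>k. v k x *\<^sub>R (indicator (ball c r) x *\<^sub>R f x)) \<longlonglongrightarrow> indicator V x *\<^sub>R (indicator (ball c r) x *\<^sub>R f x)"
      proof (rule AE_I2)
        fix x
        show "(\<lambda>k. v k x *\<^sub>R (indicator (ball c r) x *\<^sub>R f x)) \<longlonglongrightarrow> indicator V x *\<^sub>R (indicator (ball c r) x *\<^sub>R f x)"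
        proof (cases "x \<in> U")
          case True
          have "(\<lambda>k. v k x *\<^sub>R (indicator (ball c r) x *\<^sub>R f x)) \<longlonglongrightarrow> 1 *\<^sub>R (indicator (ball c r) x *\<^sub>R f x)"
            by (intro tendsto_scaleR tendsto_const v(5) True)
          then show ?thesis using True by (simp add: U_def)
        next
          case False
          then have z: "indicator V x *\<^sub>R (indicator (ball c r) x *\<^sub>R f x) = 0" by (auto simp: U_def indicator_def)
          show ?thesis unfolding z v(4)[OF False] by simp
        qed
      qed
    qed
    moreover have "(LINT x|lebesgue. v k x *\<^sub>R (indicator (ball c r) x *\<^sub>R f x)) = 0" for k
      using zero[OF tf[of k]] unfolding lebesgue_on_integral(1)[OF \<Omega>'] set_lebesgue_integral_def eq .
    ultimately show "(LINT x:V|lebesgue. indicator (ball c r) x *\<^sub>R f x) = 0"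
      by (simp add: set_lebesgue_integral_def LIMSEQ_const_iff)
  qed
  then show "AE x in lebesgue. x \<in> ball c r \<longrightarrow> f x = 0"
    by eventually_elim (auto simp: indicator_def)
qed

lemma test_fun_integrable:
  fixes f :: "'a::euclidean_space \<Rightarrow> 'b::euclidean_space"
  assumes \<Omega>: "open \<Omega>" and \<eta>: "\<eta> \<in> test_fun \<Omega>" and f: "f \<in> L1_loc \<Omega>"
  shows "integrable (lebesgue_on \<Omega>) (\<lambda>x. \<eta> x *\<^sub>R f x)"
proof -
  obtain K where K: "C1_fun \<eta>" "compact K" "K \<subseteq> \<Omega>" "\<And>x. x \<notin> K \<Longrightarrow> \<eta> x = 0" "\<And>x. x \<notin> K \<Longrightarrow> grad \<eta> x = 0"
    using test_funE[OF \<eta>] by metis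
  have "set_integrable lebesgue K (\<lambda>x. \<eta> x *\<^sub>R f x)"
    using f K(3) by (intro set_integrable_bilinear_continuous[OF bounded_bilinear_scaleR _ compact_imp_bounded[OF K(2)] C1_fun_continuous[OF K(1)]])
      (auto simp: L1_loc_def K(2) borel_compact)
  then have "set_integrable lebesgue \<Omega> (\<lambda>x. \<eta> x *\<^sub>R f x)"
    by (rule set_integrable_compact_support[OF _ K(3)]) (simp add: K(4))
  then show ?thesis using \<Omega> by (simp add: lebesgue_on_integral borel_open)
qed

lemma grad_test_fun_integrable:
  fixes f :: "'a::euclidean_space \<Rightarrow> 'b::euclidean_space" and prod :: "'a \<Rightarrow> 'b \<Rightarrow> 'c::euclidean_space"
  assumes prod: "bounded_bilinear prod" and \<Omega>: "open \<Omega>" and \<eta>: "\<eta> \<in> test_fun \<Omega>" and f: "f \<in> L1_loc \<Omega>"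
  shows "integrable (lebesgue_on \<Omega>) (\<lambda>x. prod (grad \<eta> x) (f x))"
proof -
  obtain K where K: "C1_fun \<eta>" "compact K" "K \<subseteq> \<Omega>" "\<And>x. x \<notin> K \<Longrightarrow> \<eta> x = 0" "\<And>x. x \<notin> K \<Longrightarrow> grad \<eta> x = 0"
    using test_funE[OF \<eta>] by metis
  have "set_integrable lebesgue K (\<lambda>x. prod (grad \<eta> x) (f x))"
    using f K(3) by (intro set_integrable_bilinear_continuous[OF prod _ compact_imp_bounded[OF K(2)] C1_fun_grad_continuous[OF K(1)]])
      (auto simp: L1_loc_def K(2) borel_compact)
  then have "set_integrable lebesgue \<Omega> (\<lambda>x. prod (grad \<eta> x) (f x))"
    by (rule set_integrable_compact_support[OF _ K(3)]) (simp add: K(5) bounded_bilinear.zero_left[OF prod])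
  then show ?thesis using \<Omega> by (simp add: lebesgue_on_integral borel_open)
qed

lemma L1_loc_diff:
  assumes "f \<in> L1_loc \<Omega>" "g \<in> L1_loc \<Omega>" shows "(\<lambda>x. f x - g x) \<in> L1_loc \<Omega>"
  using assms by (auto simp: L1_loc_def)

lemma AE_eq_of_test_funs:
  fixes f g :: "'a::euclidean_space \<Rightarrow> 'b::euclidean_space"
  assumes \<Omega>: "open \<Omega>" and fg: "f \<in> L1_loc \<Omega>" "g \<in> L1_loc \<Omega>"
    and eq: "\<And>\<eta>. \<eta> \<in> test_fun \<Omega> \<Longrightarrow> (LINT x|lebesgue_on \<Omega>. \<eta> x *\<^sub>R f x) = (LINT x|lebesgue_on \<Omega>. \<eta> x *\<^sub>R g x)"
  shows "AE x in lebesgue_on \<Omega>. f x = g x"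
proof -
  have "AE x in lebesgue_on \<Omega>. f x - g x = 0"
  proof (rule fundamental_lemma[OF \<Omega> L1_loc_diff[OF fg]])
    fix \<eta> assume \<eta>: "\<eta> \<in> test_fun \<Omega>"
    show "(LINT x|lebesgue_on \<Omega>. \<eta> x *\<^sub>R (f x - g x)) = 0"
      using eq[OF \<eta>] test_fun_integrable[OF \<Omega> \<eta> fg(1)] test_fun_integrable[OF \<Omega> \<eta> fg(2)]
      by (simp add: scaleR_diff_right)
  qed
  then show ?thesis by simp
qed

lemma wgrad:
  assumes \<Omega>: "open \<Omega>" and v: "has_weak_grad \<Omega> v g"
  shows "has_weak_grad \<Omega> v (wgrad \<Omega> v)" "AE x in lebesgue_on \<Omega>. wgrad \<Omega> v x = g x"
proof -
  show w: "has_weak_grad \<Omega> v (wgrad \<Omega> v)" unfolding wgrad_def using v by (rule someI[of "has_weak_grad \<Omega> v"])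
  show "AE x in lebesgue_on \<Omega>. wgrad \<Omega> v x = g x"
    using w v by (intro AE_eq_of_test_funs[OF \<Omega>]) (auto simp: has_weak_grad_def)
qed

lemma wdiv:
  assumes \<Omega>: "open \<Omega>" and y: "has_weak_div \<Omega> y w"
  shows "has_weak_div \<Omega> y (wdiv \<Omega> y)" "AE x in lebesgue_on \<Omega>. wdiv \<Omega> y x = w x"
proof -
  show v: "has_weak_div \<Omega> y (wdiv \<Omega> y)" unfolding wdiv_def using y by (rule someI[of "has_weak_div \<Omega> y"])
  show "AE x in lebesgue_on \<Omega>. wdiv \<Omega> y x = w x"
    using v y by (intro AE_eq_of_test_funs[OF \<Omega>]) (auto simp: has_weak_div_def)
qed

text \<open>Connects the componentwise W^{1,1} regularity of the dual solution with the weak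
  divergence in which the dual problem is stated.\<close>

lemma has_weak_div_components:
  fixes z :: "'a::euclidean_space \<Rightarrow> 'a"
  assumes \<Omega>: "open \<Omega>" and z: "\<And>i. i \<in> Basis \<Longrightarrow> has_weak_grad \<Omega> (\<lambda>x. z x \<bullet> i) (G i)"
    and zL: "z \<in> L1_loc \<Omega>"
  shows "has_weak_div \<Omega> z (\<lambda>x. \<Sum>i\<in>Basis. G i x \<bullet> i)"
  unfolding has_weak_div_def
proof (intro conjI ballI zL)
  have GL: "G i \<in> L1_loc \<Omega>" "(\<lambda>x. z x \<bullet> i) \<in> L1_loc \<Omega>" if "i \<in> Basis" for i using z[OF that] by (auto simp: has_weak_grad_def)
  have GiL: "(\<lambda>x. G i x \<bullet> i) \<in> L1_loc \<Omega>" if "i \<in> Basis" for i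
    using GL(1)[OF that] unfolding L1_loc_def set_integrable_def
    by (auto simp flip: inner_scaleR_left)
  then show "(\<lambda>x. \<Sum>i\<in>Basis. G i x \<bullet> i) \<in> L1_loc \<Omega>"
    unfolding L1_loc_def by (auto intro!: set_integral_finite_sum(2))
  fix \<eta> assume \<eta>: "\<eta> \<in> test_fun \<Omega>"
  have eq: "(LINT x|lebesgue_on \<Omega>. (z x \<bullet> i) * (grad \<eta> x \<bullet> i)) = - (LINT x|lebesgue_on \<Omega>. \<eta> x * (G i x \<bullet> i))" if i: "i \<in> Basis" for i
  proof -
    have "(LINT x|lebesgue_on \<Omega>. (z x \<bullet> i) *\<^sub>R grad \<eta> x) \<bullet> i = - (LINT x|lebesgue_on \<Omega>. \<eta> x *\<^sub>R G i x) \<bullet> i"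
      using z[OF i] \<eta> by (simp add: has_weak_grad_def)
    moreover have "(LINT x|lebesgue_on \<Omega>. (z x \<bullet> i) *\<^sub>R grad \<eta> x) \<bullet> i = (LINT x|lebesgue_on \<Omega>. ((z x \<bullet> i) *\<^sub>R grad \<eta> x) \<bullet> i)"
      using grad_test_fun_integrable[OF bounded_bilinear.flip[OF bounded_bilinear_scaleR] \<Omega> \<eta> GL(2)[OF i]]
      by (intro integral_inner_left[symmetric]) simp
    moreover have "(LINT x|lebesgue_on \<Omega>. \<eta> x *\<^sub>R G i x) \<bullet> i = (LINT x|lebesgue_on \<Omega>. (\<eta> x *\<^sub>R G i x) \<bullet> i)"
      using test_fun_integrable[OF \<Omega> \<eta> GL(1)[OF i]] by (intro integral_inner_left[symmetric]) simp
    ultimately show ?thesis by simp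
  qed
  have "(LINT x|lebesgue_on \<Omega>. z x \<bullet> grad \<eta> x) = (LINT x|lebesgue_on \<Omega>. (\<Sum>i\<in>Basis. (z x \<bullet> i) * (grad \<eta> x \<bullet> i)))"
    by (subst euclidean_inner) simp
  also have "\<dots> = (\<Sum>i\<in>Basis. (LINT x|lebesgue_on \<Omega>. (z x \<bullet> i) * (grad \<eta> x \<bullet> i)))"
  proof (rule Bochner_Integration.integral_sum)
    fix i :: 'a assume i: "i \<in> Basis"
    have "bounded_bilinear (\<lambda>(g::'a) (s::real). s * (g \<bullet> i))"
      by (rule bounded_bilinear.comp1[OF bounded_bilinear.flip[OF bounded_bilinear_mult] bounded_linear_inner_left])
    from grad_test_fun_integrable[OF this \<Omega> \<eta> GL(2)[OF i]]
    show "integrable (lebesgue_on \<Omega>) (\<lambda>x. (z x \<bullet> i) * (grad \<eta> x \<bullet> i))" by simp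
  qed
  also have "\<dots> = - (\<Sum>i\<in>Basis. (LINT x|lebesgue_on \<Omega>. \<eta> x * (G i x \<bullet> i)))"
    by (simp add: eq sum_negf)
  also have "(\<Sum>i\<in>Basis. (LINT x|lebesgue_on \<Omega>. \<eta> x * (G i x \<bullet> i))) = (LINT x|lebesgue_on \<Omega>. (\<Sum>i\<in>Basis. \<eta> x * (G i x \<bullet> i)))"
    using test_fun_integrable[OF \<Omega> \<eta> GiL] by (intro Bochner_Integration.integral_sum[symmetric]) simp
  finally show "(LINT x|lebesgue_on \<Omega>. z x \<bullet> grad \<eta> x) = - (LINT x|lebesgue_on \<Omega>. \<eta> x * (\<Sum>i\<in>Basis. G i x \<bullet> i))"
    by (simp add: sum_distrib_left)
qed

section \<open>Triangulated domains\<close>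

text \<open>A domain below or above a graph near each boundary point has no slits. This is what
  places the interiors of elements, a priori only in the closure of \<Omega>, inside
  \<Omega>.\<close>

lemma Lipschitz_domain_interior_closure:
  assumes "Lipschitz_domain \<Omega>"
  shows "interior (closure \<Omega>) = \<Omega>"
proof
  have "open \<Omega>" using assms by (simp add: Lipschitz_domain_def)
  then show "\<Omega> \<subseteq> interior (closure \<Omega>)" by (simp add: interior_maximal closure_subset)
  show "interior (closure \<Omega>) \<subseteq> \<Omega>"
  proof (rule subsetI, rule ccontr)
    fix x assume x: "x \<in> interior (closure \<Omega>)" "x \<notin> \<Omega>"
    then have "x \<in> frontier \<Omega>" using \<open>open \<Omega>\<close> interior_subset by (auto simp: frontier_def interior_open)
    then obtain U e L \<gamma> where U: "open U" "x \<in> U" "norm e = 1" "L-lipschitz_on UNIV \<gamma>"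
      "\<And>y t. \<gamma> (y + t *\<^sub>R e) = \<gamma> y" "\<Omega> \<inter> U = {y \<in> U. \<gamma> y < y \<bullet> e}"
      using assms unfolding Lipschitz_domain_def by meson
    define V where "V = U \<inter> interior (closure \<Omega>)"
    have V: "open V" "x \<in> V" using U x by (auto simp: V_def open_Int)
    then obtain r where r: "r > 0" "ball x r \<subseteq> V" using open_contains_ball by blast
    \<comment> \<open>Moving from x against \<open>e\<close> leaves \<gamma> unchanged and lowers
      the height, so y lies strictly on the wrong side of the graph, with a whole neighbourhood of
      points that cannot belong to \<Omega>.\<close>
    define y where "y = x + (- (r/2)) *\<^sub>R e"
    have "y \<in> ball x r" using r U(3) by (simp add: y_def dist_norm)
    then have "y \<in> V" using r by blast
    have "x \<bullet> e \<le> \<gamma> x" using U(2,6) x(2) by force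
    moreover have "y \<bullet> e = x \<bullet> e - r/2"
      using U(3) by (simp add: y_def inner_diff_left dot_square_norm)
    ultimately have "y \<bullet> e < \<gamma> y" using r(1) by (simp add: y_def U(5) del: scaleR_minus_left)
    have cont: "continuous_on UNIV \<gamma>" using U(4) by (rule lipschitz_on_continuous_on)
    have "open {w. w \<bullet> e < \<gamma> w}" by (intro open_Collect_less cont continuous_intros)
    then have "open (V \<inter> {w. w \<bullet> e < \<gamma> w})" using V by (intro open_Int)
    moreover have "y \<in> V \<inter> {w. w \<bullet> e < \<gamma> w}" using \<open>y \<in> V\<close> \<open>y \<bullet> e < \<gamma> y\<close> by blast
    moreover have "y \<in> closure \<Omega>" using \<open>y \<in> V\<close> interior_subset by (auto simp: V_def)
    ultimately obtain w where "w \<in> \<Omega>" "w \<in> V \<inter> {w. w \<bullet> e < \<gamma> w}"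
      using open_Int_closure_eq_empty[of "V \<inter> {w. w \<bullet> e < \<gamma> w}" \<Omega>] by blast
    then show False using U(6) by (force simp: V_def)
  qed
qed

context full_simplex
begin

lemma aff_dim_T: "aff_dim T = int DIM('a)"
  using aff_dim_affine_independent[OF indep] cardC by (simp add: aff_dim_convex_hull)

lemma facet_iff: "S facet_of T \<longleftrightarrow> (\<exists>a\<in>C. S = convex hull (C - {a}))"
  unfolding facet_of_convex_hull_affine_independent_alt[OF indep] Bex_def using cardC dim2 by simp

lemma facet_inj:
  assumes "a \<in> C" "b \<in> C" "convex hull (C - {a}) = convex hull (C - {b})"
  shows "a = b"
proof -
  have "C - {a} = {x. x extreme_point_of (convex hull (C - {a}))}" by (rule facet_extreme_points(1)[symmetric])
  also have "\<dots> = {x. x extreme_point_of (convex hull (C - {b}))}" by (simp only: assms(3))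
  also have "\<dots> = C - {b}" by (rule facet_extreme_points(1))
  finally have "C - {a} = C - {b}" .
  then show ?thesis using assms by blast
qed

lemma rel_interior_facet:
  assumes a: "a \<in> C" shows "rel_interior (convex hull (C - {a})) = {x \<in> T. bary C a x = 0 \<and> (\<forall>b\<in>C - {a}. 0 < bary C b x)}"
proof -
  have ind: "\<not> affine_dependent (C - {a})" using affine_independent_Diff[OF indep] by blast
  have eq: "rel_interior (convex hull (C - {a})) =
     {y. \<exists>u. (\<forall>x\<in>C - {a}. 0 < u x) \<and> sum u (C - {a}) = 1 \<and> (\<Sum>x\<in>C - {a}. u x *\<^sub>R x) = y}"
    by (rule rel_interior_convex_hull_explicit[OF ind])
  show ?thesis unfolding eq
  proof (intro equalityI subsetI)
    fix x assume "x \<in> {y. \<exists>u. (\<forall>x\<in>C - {a}. 0 < u x) \<and> sum u (C - {a}) = 1 \<and> (\<Sum>x\<in>C - {a}. u x *\<^sub>R x) = y}"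
    then obtain u where u: "\<forall>x\<in>C - {a}. 0 < u x" "sum u (C - {a}) = 1" "(\<Sum>x\<in>C - {a}. u x *\<^sub>R x) = x" by blast
    define u' where "u' b = (if b = a then 0 else u b)" for b
    have "sum u' C = 1" using finC a u by (simp add: sum.remove u'_def)
    moreover have "(\<Sum>b\<in>C. u' b *\<^sub>R b) = x" using finC a u by (simp add: sum.remove u'_def)
    ultimately have "bary C b x = u' b" if "b \<in> C" for b using bary_combination[OF that] by metis
    then show "x \<in> {x \<in> T. bary C a x = 0 \<and> (\<forall>b\<in>C - {a}. 0 < bary C b x)}"
      using u(1) a by (auto simp: mem_T_iff u'_def less_imp_le)
  next
    fix x assume x: "x \<in> {x \<in> T. bary C a x = 0 \<and> (\<forall>b\<in>C - {a}. 0 < bary C b x)}"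
    have "(\<Sum>b\<in>C-{a}. bary C b x) = 1" "(\<Sum>b\<in>C-{a}. bary C b x *\<^sub>R b) = x"
      using bary_sum[of x] bary_repr[of x] x a finC by (simp_all add: sum.remove)
    then show "x \<in> {y. \<exists>u. (\<forall>x\<in>C - {a}. 0 < u x) \<and> sum u (C - {a}) = 1 \<and> (\<Sum>x\<in>C - {a}. u x *\<^sub>R x) = y}"
      using x by (intro CollectI exI[of _ "\<lambda>b. bary C b x"]) auto
  qed
qed

lemma barycenter_facet_rel_interior:
  "a \<in> C \<Longrightarrow> barycenter (convex hull (C - {a})) \<in> rel_interior (convex hull (C - {a}))"
  using barycenter_facet_mem[of a] by (auto simp: rel_interior_facet bary_barycenter_facet mem_facet_iff)

lemma move_into_interior:
  assumes a: "a \<in> C" and x: "x \<in> rel_interior (convex hull (C - {a}))" and e: "0 < bgrad C a \<bullet> e"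
  shows "\<forall>\<^sub>F t in at_right 0. x + t *\<^sub>R e \<in> interior T"
proof -
  have "\<forall>\<^sub>F t in at_right 0. 0 < bary C b (x + t *\<^sub>R e)" if b: "b \<in> C" for b
  proof (cases "b = a")
    case True
    show ?thesis unfolding eventually_at_right_field
      using x e a by (intro exI[of _ 1]) (auto simp: bary_add rel_interior_facet True)
  next
    case False
    have "((\<lambda>t. bary C b (x + t *\<^sub>R e)) \<longlongrightarrow> bary C b (x + 0 *\<^sub>R e)) (at_right 0)"
      unfolding bary_add by (intro tendsto_intros)
    moreover have "0 < bary C b (x + 0 *\<^sub>R e)" using x a b False by (auto simp: rel_interior_facet)
    ultimately show ?thesis by (simp add: order_tendstoD(1))
  qed
  then show ?thesis unfolding mem_interior_iff using finC by (simp add: eventually_ball_finite)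
qed

lemma closure_interior_T: "closure (interior T) = T"
proof -
  have "interior T \<noteq> {}" using barycenter_T_interior by blast
  then have "closure (interior T) = closure T" by (rule convex_closure_interior[OF convex_convex_hull])
  then show ?thesis using compact_imp_closed[OF compact_T] by (simp only: closure_closed)
qed

lemma facet_not_interior: "a \<in> C \<Longrightarrow> x \<in> convex hull (C - {a}) \<Longrightarrow> x \<notin> interior T"
  by (force simp: mem_facet_iff mem_interior_iff)

lemma at_within_interior_nontrivial:
  assumes "a \<in> C" "x \<in> convex hull (C - {a})"
  shows "at x within interior T \<noteq> bot"
proof -
  have "x \<in> closure (interior T)" using assms by (simp add: closure_interior_T mem_facet_iff)
  then have "x islimpt interior T" using facet_not_interior[OF assms] by (simp add: closure_def)
  then show ?thesis by (simp add: trivial_limit_within)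
qed

end

text \<open>Recovers the vertex set from the element itself, so that \<open>full_simplex\<close> can
  be instantiated without carrying a choice of vertices along with the triangulation.\<close>

definition verts :: "'a::euclidean_space set \<Rightarrow> 'a set" where
  "verts T = {x. x extreme_point_of T}"

section \<open>Elements and sides of a conforming triangulation\<close>

locale triangulated_domain =
  fixes \<Omega> :: "'a::euclidean_space set" and \<T> :: "'a set set"
  assumes dim2: "2 \<le> DIM('a)" and domain: "bounded_polyhedral_Lipschitz_domain \<Omega>"
    and tri: "regular_triangulation \<Omega> \<T>"
begin

lemma open_\<Omega>: "open \<Omega>" and bounded_\<Omega>: "bounded \<Omega>" and interior_closure: "interior (closure \<Omega>) = \<Omega>"
  using domain Lipschitz_domain_interior_closure
  by (auto simp: bounded_polyhedral_Lipschitz_domain_def Lipschitz_domain_def)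

lemma \<Omega>_lebesgue: "\<Omega> \<in> sets lebesgue"
  using open_\<Omega> by (simp add: borel_open)

lemma fin\<T>: "finite \<T>" and Union\<T>: "\<Union>\<T> = closure \<Omega>"
  using tri by (auto simp: regular_triangulation_def triangulation_def)

lemma element:
  assumes "T \<in> \<T>"
  shows "full_simplex (verts T)" "convex hull (verts T) = T"
proof -
  obtain C where C: "\<not> affine_dependent C" "int (card C) = int DIM('a) + 1" "T = convex hull C"
    using assms tri by (auto simp: regular_triangulation_def simplex_def)
  have "verts T = C"
    using extreme_point_of_convex_hull_affine_independent[OF C(1)] by (auto simp: verts_def C(3))
  then show "full_simplex (verts T)" "convex hull (verts T) = T"
    using C dim2 by (auto simp: full_simplex_def)
qed

lemma face_Int: "T \<in> \<T> \<Longrightarrow> T' \<in> \<T> \<Longrightarrow> (T \<inter> T') face_of T"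
  using tri by (auto simp: regular_triangulation_def triangulation_def)

lemma element_interior_nonempty: "T \<in> \<T> \<Longrightarrow> interior T \<noteq> {}"
  using full_simplex.barycenter_T_interior[OF element(1)] element(2) by auto

lemma element_compact: "T \<in> \<T> \<Longrightarrow> compact T"
  using full_simplex.compact_T[OF element(1)] element(2) by simp

lemma element_convex: "T \<in> \<T> \<Longrightarrow> convex T"
  using element(2) convex_convex_hull by metis

lemma element_measure_pos: "T \<in> \<T> \<Longrightarrow> 0 < measure lebesgue T"
  using full_simplex.T_measure_pos[OF element(1)] element(2) by simp

text \<open>A proper face of a convex set misses its interior. The common face of the two elements
  meets the interior of \<open>T\<close> and is therefore all of \<open>T\<close>; the resulting
  inclusion allows the same argument with the roles exchanged.\<close>

lemma elements_eq:
  assumes T: "T \<in> \<T>" "T' \<in> \<T>" and "T' \<inter> interior T \<noteq> {}"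
  shows "T = T'"
proof -
  have full: "T1 \<inter> T2 = T1" if "T1 \<in> \<T>" "T2 \<in> \<T>" "T2 \<inter> interior T1 \<noteq> {}" for T1 T2
    using face_of_disjoint_interior[OF face_Int[OF that(1,2)]] that(3) interior_subset[of T1] by blast
  have "T \<subseteq> T'" using full[OF T assms(3)] by blast
  then have "interior T \<subseteq> interior T'" by (rule interior_mono)
  then have "T \<inter> interior T' \<noteq> {}" using element_interior_nonempty[OF T(1)] interior_subset by blast
  then have "T' \<subseteq> T" using full[OF T(2,1)] by blast
  with \<open>T \<subseteq> T'\<close> show ?thesis by simp
qed

lemma interiors_disjoint:
  "T \<in> \<T> \<Longrightarrow> T' \<in> \<T> \<Longrightarrow> x \<in> interior T \<Longrightarrow> x \<in> interior T' \<Longrightarrow> T = T'"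
  using elements_eq interior_subset by blast

lemma interior_element: "T \<in> \<T> \<Longrightarrow> interior T \<subseteq> \<Omega>"
  using interior_mono[of T "closure \<Omega>"] Union\<T> interior_closure by auto

lemma element_subset: "T \<in> \<T> \<Longrightarrow> T \<subseteq> closure \<Omega>"
  using Union\<T> by blast

lemma negligible_element_frontier: "T \<in> \<T> \<Longrightarrow> negligible (T - interior T)"
proof -
  assume T: "T \<in> \<T>"
  have "negligible (frontier T)" using negligible_convex_frontier element_convex[OF T] by blast
  then show ?thesis by (rule negligible_subset) (use closure_subset in \<open>auto simp: frontier_def\<close>)
qed

lemma AE_interior_element: "T \<in> \<T> \<Longrightarrow> AE x in lebesgue. x \<in> T \<longrightarrow> x \<in> interior T"
proof -
  assume T: "T \<in> \<T>"
  then have "T - interior T \<in> null_sets lebesgue"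
    using negligible_element_frontier by (simp add: negligible_iff_null_sets)
  then show ?thesis by (rule AE_I') auto
qed

lemma AE_interiors: "AE x in lebesgue. \<forall>T\<in>\<T>. x \<in> T \<longrightarrow> x \<in> interior T"
  using AE_interior_element fin\<T> by (intro AE_finite_allI) auto

lemma AE_lebesgue_on: "(AE x in lebesgue_on \<Omega>. P x) \<longleftrightarrow> (AE x in lebesgue. x \<in> \<Omega> \<longrightarrow> P x)"
  using \<Omega>_lebesgue by (subst AE_restrict_space_iff) auto

lemma AE_element: "AE x in lebesgue_on \<Omega>. \<exists>T\<in>\<T>. x \<in> interior T"
  unfolding AE_lebesgue_on using AE_interiors
proof eventually_elim
  fix x assume "\<forall>T\<in>\<T>. x \<in> T \<longrightarrow> x \<in> interior T"
  then show "x \<in> \<Omega> \<longrightarrow> (\<exists>T\<in>\<T>. x \<in> interior T)"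
    using Union\<T> closure_subset by blast
qed

lemma set_integrable_element:
  fixes f :: "'a \<Rightarrow> 'b::euclidean_space"
  assumes T: "T \<in> \<T>" and f: "set_integrable lebesgue \<Omega> f"
  shows "set_integrable lebesgue T f"
proof -
  have i: "set_integrable lebesgue (interior T) f"
    by (rule set_integrable_subset[OF f _ interior_element[OF T]]) simp
  have ae: "AE x in lebesgue. indicator (interior T) x *\<^sub>R f x = indicator T x *\<^sub>R f x"
    using AE_interior_element[OF T]
  proof eventually_elim
    fix x assume "x \<in> T \<longrightarrow> x \<in> interior T"
    then show "indicator (interior T) x *\<^sub>R f x = indicator T x *\<^sub>R f x"
      using interior_subset[of T] by (auto simp: indicator_def)
  qed
  have m: "(\<lambda>x. indicator T x *\<^sub>R f x) \<in> borel_measurable lebesgue"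
    by (rule borel_measurable_AE[OF _ ae]) (use i in \<open>auto simp: set_integrable_def\<close>)
  show ?thesis unfolding set_integrable_def
    by (rule integrable_cong_AE_imp[OF i[unfolded set_integrable_def] m]) (use ae in \<open>auto elim: eventually_mono\<close>)
qed

lemma AE_indicator_sum: "AE x in lebesgue. indicator \<Omega> x = (\<Sum>T\<in>\<T>. indicator T x :: real)"
  using AE_interiors
proof eventually_elim
  fix x assume x: "\<forall>T\<in>\<T>. x \<in> T \<longrightarrow> x \<in> interior T"
  show "indicator \<Omega> x = (\<Sum>T\<in>\<T>. indicator T x :: real)"
  proof (cases "\<exists>T\<in>\<T>. x \<in> T")
    case True
    then obtain T where T: "T \<in> \<T>" "x \<in> T" by blast
    then have "x \<in> interior T" using x by blast
    then have "x \<in> \<Omega>" using interior_element T by blast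
    have "(\<Sum>T'\<in>\<T>. indicator T' x :: real) = (\<Sum>T'\<in>\<T>. if T' = T then 1 else 0)"
    proof (rule sum.cong[OF refl])
      fix T' assume T': "T' \<in> \<T>"
      have "T' = T" if "x \<in> T'"
        using interiors_disjoint[OF T' T(1) _ \<open>x \<in> interior T\<close>] x T' that by blast
      then show "(indicator T' x :: real) = (if T' = T then 1 else 0)"
        using T(2) by (cases "T' = T") (auto simp: indicator_def)
    qed
    then show ?thesis using T \<open>x \<in> \<Omega>\<close> fin\<T> by simp
  next
    case False
    then have "x \<notin> \<Omega>" using Union\<T> closure_subset by blast
    then show ?thesis using False by (simp add: indicator_def)
  qed
qed

lemma integral_elements:
  fixes f :: "'a \<Rightarrow> 'b::euclidean_space"
  assumes f: "set_integrable lebesgue \<Omega> f"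
  shows "(LINT x:\<Omega>|lebesgue. f x) = (\<Sum>T\<in>\<T>. LINT x:T|lebesgue. f x)"
proof -
  have i: "integrable lebesgue (\<lambda>x. indicator T x *\<^sub>R f x)" if "T \<in> \<T>" for T
    using set_integrable_element[OF that f] by (simp add: set_integrable_def)
  have "(LINT x:\<Omega>|lebesgue. f x) = (LINT x|lebesgue. (\<Sum>T\<in>\<T>. indicator T x *\<^sub>R f x))"
    unfolding set_lebesgue_integral_def
  proof (rule integral_cong_AE)
    show "AE x in lebesgue. indicat_real \<Omega> x *\<^sub>R f x = (\<Sum>T\<in>\<T>. indicat_real T x *\<^sub>R f x)"
      using AE_indicator_sum by eventually_elim (simp add: scaleR_sum_left)
  qed (use f i in \<open>auto simp: set_integrable_def\<close>)
  also have "\<dots> = (\<Sum>T\<in>\<T>. LINT x:T|lebesgue. f x)"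
    unfolding set_lebesgue_integral_def using i by (rule Bochner_Integration.integral_sum)
  finally show ?thesis .
qed

lemma facet_of_element_iff:
  "T \<in> \<T> \<Longrightarrow> S facet_of T \<longleftrightarrow> (\<exists>a\<in>verts T. S = convex hull (verts T - {a}))"
  using full_simplex.facet_iff[OF element(1)] element(2) by auto

definition facet :: "'a set \<Rightarrow> 'a \<Rightarrow> 'a set" where
  "facet T a = convex hull (verts T - {a})"

lemma facet_of_element: "T \<in> \<T> \<Longrightarrow> a \<in> verts T \<Longrightarrow> facet T a facet_of T"
  by (auto simp: facet_of_element_iff facet_def)

lemma facet_side: "T \<in> \<T> \<Longrightarrow> a \<in> verts T \<Longrightarrow> facet T a \<in> sides \<T>"
  using facet_of_element by (auto simp: sides_def)

text \<open>If both signs agreed, a short step from the barycenter of the side in the direction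
  \<open>?k *\<^sub>R ?n\<close> would enter the interiors of both elements, which are
  disjoint.\<close>

lemma opposite_normals:
  assumes T: "T \<in> \<T>" "T' \<in> \<T>" "T \<noteq> T'" and a: "a \<in> verts T" "a' \<in> verts T'"
    and S: "facet T a = facet T' a'"
  shows "(bgrad (verts T) a \<bullet> side_normal (facet T a)) * (bgrad (verts T') a' \<bullet> side_normal (facet T a)) < 0"
proof (rule ccontr)
  interpret A: full_simplex "verts T" by (rule element[OF T(1)])
  interpret B: full_simplex "verts T'" by (rule element[OF T(2)])
  let ?n = "side_normal (facet T a)" and ?x = "barycenter (facet T a)"
  let ?k = "bgrad (verts T) a \<bullet> ?n" and ?k' = "bgrad (verts T') a' \<bullet> ?n"
  assume "\<not> ?k * ?k' < 0"
  moreover have "?k \<noteq> 0" using A.side_normal(3)[OF a(1)] A.bgrad_nonzero[OF a(1)] by (auto simp: facet_def)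
  moreover have "?k' \<noteq> 0" using B.side_normal(3)[OF a(2)] B.bgrad_nonzero[OF a(2)] unfolding S by (auto simp: facet_def)
  ultimately have "0 < ?k * ?k'" by (simp add: not_less less_le)
  then have pos: "0 < bgrad (verts T) a \<bullet> (?k *\<^sub>R ?n)" "0 < bgrad (verts T') a' \<bullet> (?k *\<^sub>R ?n)"
    using \<open>?k \<noteq> 0\<close> by (auto simp: zero_less_mult_iff)
  have "\<forall>\<^sub>F t in at_right 0. ?x + t *\<^sub>R (?k *\<^sub>R ?n) \<in> interior T"
    using A.move_into_interior[OF a(1) A.barycenter_facet_rel_interior[OF a(1)] pos(1)]
    by (simp add: facet_def element(2)[OF T(1)])
  moreover have "\<forall>\<^sub>F t in at_right 0. ?x + t *\<^sub>R (?k *\<^sub>R ?n) \<in> interior T'"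
    using B.move_into_interior[OF a(2) B.barycenter_facet_rel_interior[OF a(2)] pos(2)]
    unfolding S by (simp add: facet_def element(2)[OF T(2)])
  ultimately have "\<forall>\<^sub>F t in at_right 0. ?x + t *\<^sub>R (?k *\<^sub>R ?n) \<in> interior T \<inter> interior T'"
    by eventually_elim blast
  then obtain t :: real where "?x + t *\<^sub>R (?k *\<^sub>R ?n) \<in> interior T \<inter> interior T'"
    by (metis (no_types, lifting) eventually_False eventually_mono trivial_limit_at_right_real)
  then show False using interiors_disjoint T by blast
qed

text \<open>Here conformity enters. The common face of \<open>T\<close> and \<open>T'\<close> would
  contain a point of the relative interior of the facet and hence the whole facet. It is a proper
  face of \<open>T\<close>, so by dimension it is a facet, namely the given one, and this would also
  be a facet of \<open>T'\<close>.\<close>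

lemma rel_interior_unique_side:
  assumes T: "T \<in> \<T>" "T' \<in> \<T>" "T' \<noteq> T" and a: "a \<in> verts T"
    and unique: "\<not> facet T a facet_of T'" and x: "x \<in> rel_interior (facet T a)"
  shows "x \<notin> T'"
proof
  interpret A: full_simplex "verts T" by (rule element[OF T(1)])
  interpret B: full_simplex "verts T'" by (rule element[OF T(2)])
  assume xT': "x \<in> T'"
  have hullA: "convex hull (verts T) = T" and hullB: "convex hull (verts T') = T'" using element T by auto
  let ?F = "T \<inter> T'" and ?S = "facet T a"
  have S: "?S facet_of T" by (rule facet_of_element[OF T(1) a])
  have ST: "?S \<subseteq> T" using facet_of_imp_subset[OF S] .
  have SF: "?S \<subseteq> ?F"
    using subset_of_face_of[OF face_Int[OF T(1,2)] ST] x xT' rel_interior_subset[of ?S] ST by blast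
  have "?F \<noteq> T"
  proof
    assume "?F = T"
    then have "interior T \<subseteq> T'" using interior_subset by blast
    then have "T' \<inter> interior T \<noteq> {}" using element_interior_nonempty[OF T(1)] by blast
    then show False using elements_eq T by blast
  qed
  then have "aff_dim ?F < aff_dim T"
    using face_of_aff_dim_lt[OF element_convex[OF T(1)] face_Int[OF T(1,2)]] by blast
  moreover have "aff_dim ?S \<le> aff_dim ?F" using SF by (rule aff_dim_subset)
  moreover have "aff_dim ?S = aff_dim T - 1" using S by (simp add: facet_of_def)
  ultimately have dimF: "aff_dim ?F = aff_dim T - 1" by linarith
  have dimT: "aff_dim T = aff_dim T'" using A.aff_dim_T B.aff_dim_T hullA hullB by simp
  have Fne: "?F \<noteq> {}" using x xT' rel_interior_subset[of ?S] ST by blast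
  have "?F facet_of T" unfolding facet_of_def using face_Int[OF T(1,2)] Fne dimF by blast
  then obtain b where b: "b \<in> verts T" "?F = convex hull (verts T - {b})"
    using facet_of_element_iff[OF T(1)] by blast
  have "b = a"
  proof (rule ccontr)
    assume "b \<noteq> a"
    then have "b \<in> ?S" using b(1) by (simp add: facet_def hull_inc)
    then have "b \<in> convex hull (verts T - {b})" using SF b(2) by blast
    then show False using A.mem_facet_iff[OF b(1)] A.bary_vertex[OF b(1) b(1)] by simp
  qed
  then have "?F = ?S" using b by (simp add: facet_def)
  moreover have "?F face_of T'" using face_Int[OF T(2,1)] by (simp add: Int_commute)
  ultimately have "?S facet_of T'"
    unfolding facet_of_def using Fne dimF dimT by metis
  then show False using unique by blast
qed

lemma unique_side_neighbourhood:
  assumes T: "T \<in> \<T>" and a: "a \<in> verts T" and unique: "\<And>T'. T' \<in> \<T> \<Longrightarrow> facet T a facet_of T' \<Longrightarrow> T' = T"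
  shows "open (- \<Union>(\<T> - {T}))" "rel_interior (facet T a) \<subseteq> - \<Union>(\<T> - {T})"
proof -
  show "open (- \<Union>(\<T> - {T}))"
    using fin\<T> element_compact by (intro open_Compl closed_Union) (auto intro: compact_imp_closed)
  show "rel_interior (facet T a) \<subseteq> - \<Union>(\<T> - {T})"
    using rel_interior_unique_side[OF T _ _ a] unique by blast
qed

text \<open>A point of the relative interior of the side has a neighbourhood that meets no other
  element. If the point belonged to \<Omega>, it would be interior to \<open>T\<close>, although it
  lies on a facet of \<open>T\<close>. The frontier is closed, so the whole side follows.\<close>

lemma unique_side_frontier:
  assumes T: "T \<in> \<T>" and a: "a \<in> verts T" and unique: "\<And>T'. T' \<in> \<T> \<Longrightarrow> facet T a facet_of T' \<Longrightarrow> T' = T"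
  shows "facet T a \<subseteq> frontier \<Omega>"
proof -
  interpret A: full_simplex "verts T" by (rule element[OF T(1)])
  let ?S = "facet T a"
  have ST: "?S \<subseteq> T" using facet_of_imp_subset[OF facet_of_element[OF T a]] .
  note U = unique_side_neighbourhood[OF T a unique]
  have "x \<in> frontier \<Omega>" if x: "x \<in> rel_interior ?S" for x
  proof -
    have xS: "x \<in> ?S" using x rel_interior_subset by blast
    have "x \<in> closure \<Omega>" using xS ST element_subset[OF T] by blast
    moreover have "x \<notin> \<Omega>"
    proof
      assume "x \<in> \<Omega>"
      have "\<Omega> \<inter> - \<Union>(\<T> - {T}) \<subseteq> T" using Union\<T> closure_subset by blast
      moreover have "open (\<Omega> \<inter> - \<Union>(\<T> - {T}))" using U(1) open_\<Omega> by (intro open_Int)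
      ultimately have "\<Omega> \<inter> - \<Union>(\<T> - {T}) \<subseteq> interior T" by (intro interior_maximal)
      moreover have "x \<in> - \<Union>(\<T> - {T})" using U(2) x by (rule subsetD)
      ultimately have "x \<in> interior T" using \<open>x \<in> \<Omega>\<close> by (metis IntI subsetD)
      then show False using A.facet_not_interior[OF a, of x] xS element(2)[OF T] by (simp add: facet_def)
    qed
    ultimately show ?thesis using open_\<Omega> by (simp add: frontier_def interior_open)
  qed
  then have "closure (rel_interior ?S) \<subseteq> frontier \<Omega>" by (intro closure_minimal) auto
  moreover have "?S \<subseteq> closure (rel_interior ?S)"
    using convex_closure_rel_interior[of ?S] closure_subset[of ?S] by (simp add: facet_def)
  ultimately show ?thesis by blast
qed

end

section \<open>Traces and interpolants\<close>

lemma (in full_simplex) AE_side_measure_rel_interior: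
  assumes a: "a \<in> C"
  shows "AE x in side_measure (convex hull (C - {a})). \<forall>b\<in>C - {a}. bary C b x \<noteq> 0"
proof -
  let ?n = "bgrad C a /\<^sub>R norm (bgrad C a)" and ?s = "barycenter (convex hull (C - {a}))"
  have "AE x in restrict_space lborel {x. (x - ?s) \<bullet> ?n \<in> {0..1}}. \<forall>b\<in>C - {a}. bary C b (foot ?s ?n x) \<noteq> 0"
    using AE_foot_facet_interior[OF a refl, of ?s]
    by (subst AE_restrict_space_iff) (auto elim: eventually_mono)
  moreover have "{x. \<forall>b\<in>C - {a}. bary C b x \<noteq> 0} \<in> sets borel"
  proof -
    have "open (\<Inter>b\<in>C - {a}. {x. bary C b x \<noteq> 0})"
      using finC by (intro open_INT ballI open_Collect_neq continuous_bary continuous_on_const) auto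
    moreover have "(\<Inter>b\<in>C - {a}. {x. bary C b x \<noteq> 0}) = {x. \<forall>b\<in>C - {a}. bary C b x \<noteq> 0}" by auto
    ultimately show ?thesis by (simp add: borel_open)
  qed
  ultimately show ?thesis
    unfolding side_measure_facet[OF a] plane_measure_alt
    by (subst AE_distr_iff[OF foot_measurable_restrict]) auto
qed

lemma (in full_simplex) facet_in_plane:
  assumes a: "a \<in> C" and x: "x \<in> convex hull (C - {a})"
  shows "(x - barycenter (convex hull (C - {a}))) \<bullet> side_normal (convex hull (C - {a})) = 0"
proof -
  let ?S = "convex hull (C - {a})"
  have "bgrad C a \<bullet> (x - barycenter ?S) = 0"
    unfolding bary_diff[symmetric] using x by (simp add: mem_facet_iff[OF a] bary_barycenter_facet[OF a a])
  then have "(bgrad C a \<bullet> side_normal ?S) * (side_normal ?S \<bullet> (x - barycenter ?S)) = 0"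
    using side_normal(2)[OF a] by (metis inner_scaleR_left)
  moreover have "bgrad C a \<bullet> side_normal ?S \<noteq> 0"
    using side_normal(3)[OF a] bgrad_nonzero[OF a] by auto
  ultimately show ?thesis by (simp add: inner_commute)
qed

context triangulated_domain
begin

lemma Lp1_set_integrable:
  fixes v :: "'a \<Rightarrow> 'b::euclidean_space"
  assumes "v \<in> Lp 1 \<Omega>" shows "set_integrable lebesgue \<Omega> v"
proof -
  have "v \<in> borel_measurable (lebesgue_on \<Omega>)" "integrable (lebesgue_on \<Omega>) (\<lambda>x. norm (v x))"
    using assms by (simp_all add: Lp_def)
  then have "integrable (lebesgue_on \<Omega>) v" by (simp add: integrable_norm_iff)
  then show ?thesis using lebesgue_on_integral(2)[OF \<Omega>_lebesgue] by blast
qed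

lemma tendsto_L1_element:
  fixes f :: "nat \<Rightarrow> 'a \<Rightarrow> 'b::euclidean_space"
  assumes T: "T \<in> \<T>" and f: "\<And>k. set_integrable lebesgue \<Omega> (f k)" and g: "set_integrable lebesgue \<Omega> g"
    and lim: "(\<lambda>k. LINT x|lebesgue_on \<Omega>. norm (f k x - g x)) \<longlonglongrightarrow> 0"
  shows "(\<lambda>k. LINT x:T|lebesgue. norm (f k x - g x)) \<longlonglongrightarrow> 0"
proof (rule Lim_null_comparison[OF _ lim], intro always_eventually allI)
  fix k
  have i: "set_integrable lebesgue \<Omega> (\<lambda>x. norm (f k x - g x))"
    by (intro set_integrable_norm set_integral_diff f g)
  have nn: "0 \<le> (LINT x:T'|lebesgue. norm (f k x - g x))" for T'
    unfolding set_lebesgue_integral_def by (intro Bochner_Integration.integral_nonneg) simp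
  have "(LINT x:T|lebesgue. norm (f k x - g x)) \<le> (\<Sum>T\<in>\<T>. LINT x:T|lebesgue. norm (f k x - g x))"
    using T nn fin\<T> by (intro member_le_sum) auto
  then show "norm (LINT x:T|lebesgue. norm (f k x - g x)) \<le> (LINT x|lebesgue_on \<Omega>. norm (f k x - g x))"
    using nn[of T] by (simp add: integral_elements[OF i, symmetric] lebesgue_on_integral(1)[OF \<Omega>_lebesgue])
qed

lemma C1_set_integrable:
  assumes "C1_fun V"
  shows "set_integrable lebesgue \<Omega> V" "set_integrable lebesgue \<Omega> (grad V)"
  using assms by (auto intro!: set_integrable_continuous_bounded \<Omega>_lebesgue bounded_\<Omega> C1_fun_continuous C1_fun_grad_continuous)

lemma W1_integrable:
  assumes "v \<in> W1 1 \<Omega>"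
  shows "set_integrable lebesgue \<Omega> v" "set_integrable lebesgue \<Omega> (wgrad \<Omega> v)"
  using assms by (auto simp: W1_def intro!: Lp1_set_integrable)

lemma trace_approximation:
  assumes T: "T \<in> \<T>" and a: "a \<in> verts T" and tr: "has_trace \<Omega> (facet T a) v g"
  obtains V where "\<And>k::nat. C1_fun (V k)"
    "(\<lambda>k. LINT x:T|lebesgue. \<bar>V k x - v x\<bar>) \<longlonglongrightarrow> 0"
    "(\<lambda>k. LINT x:T|lebesgue. norm (grad (V k) x - wgrad \<Omega> v x)) \<longlonglongrightarrow> 0"
    "(\<lambda>k. LINT x:facet T a|side_measure (facet T a). \<bar>V k x - g x\<bar>) \<longlonglongrightarrow> 0"
proof -
  interpret A: full_simplex "verts T" by (rule element[OF T])
  obtain V where V: "\<And>k::nat. C1_fun (V k)"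
        "(\<lambda>k. LINT x|lebesgue_on \<Omega>. \<bar>V k x - v x\<bar>) \<longlonglongrightarrow> 0"
        "(\<lambda>k. LINT x|lebesgue_on \<Omega>. norm (grad (V k) x - wgrad \<Omega> v x)) \<longlonglongrightarrow> 0"
        "\<And>b n. norm n = 1 \<Longrightarrow> (\<lambda>k. LINT x:facet T a|plane_measure b n. \<bar>V k x - g x\<bar>) \<longlonglongrightarrow> 0"
    using tr unfolding has_trace_def by blast
  have "v \<in> W1 1 \<Omega>" using tr by (simp add: has_trace_def)
  note v = W1_integrable[OF this]
  show ?thesis
  proof (rule that[of V])
    show "(\<lambda>k. LINT x:T|lebesgue. \<bar>V k x - v x\<bar>) \<longlonglongrightarrow> 0"
      using tendsto_L1_element[OF T C1_set_integrable(1)[OF V(1)] v(1)] V(2) by simp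
    show "(\<lambda>k. LINT x:T|lebesgue. norm (grad (V k) x - wgrad \<Omega> v x)) \<longlonglongrightarrow> 0"
      by (rule tendsto_L1_element[OF T C1_set_integrable(2)[OF V(1)] v(2) V(3)])
    show "(\<lambda>k. LINT x:facet T a|side_measure (facet T a). \<bar>V k x - g x\<bar>) \<longlonglongrightarrow> 0"
      unfolding side_measure_def facet_def
      by (rule V(4)[unfolded facet_def]) (rule A.side_normal(1)[OF a])
  qed (rule V(1))
qed

lemma trace_side_integrable:
  assumes T: "T \<in> \<T>" and a: "a \<in> verts T" and tr: "has_trace \<Omega> (facet T a) v g"
  shows "set_integrable (side_measure (facet T a)) (facet T a) g"
proof -
  interpret A: full_simplex "verts T" by (rule element[OF T])
  show ?thesis using tr A.side_normal(1)[OF a] unfolding has_trace_def side_measure_def facet_def by blast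
qed

text \<open>The cone formula for Sobolev functions. Since \<open>g\<close> does not occur on the
  right-hand side, the mean of a trace over a side is independent of the trace chosen.\<close>

lemma trace_side_mean:
  assumes T: "T \<in> \<T>" and a: "a \<in> verts T" and tr: "has_trace \<Omega> (facet T a) v g"
  shows "side_mean (facet T a) g =
    (LINT x:T|lebesgue. real DIM('a) * v x + wgrad \<Omega> v x \<bullet> (x - a)) / (real DIM('a) * measure lebesgue T)"
proof -
  interpret A: full_simplex "verts T" by (rule element[OF T])
  have TT: "convex hull (verts T) = T" by (rule element(2)[OF T])
  have "v \<in> W1 1 \<Omega>" using tr by (simp add: has_trace_def)
  note v = W1_integrable[OF this]
  obtain V where V: "\<And>k::nat. C1_fun (V k)"
    "(\<lambda>k. LINT x:T|lebesgue. \<bar>V k x - v x\<bar>) \<longlonglongrightarrow> 0"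
    "(\<lambda>k. LINT x:T|lebesgue. norm (grad (V k) x - wgrad \<Omega> v x)) \<longlonglongrightarrow> 0"
    "(\<lambda>k. LINT x:facet T a|side_measure (facet T a). \<bar>V k x - g x\<bar>) \<longlonglongrightarrow> 0"
    using trace_approximation[OF assms] by blast
  show ?thesis
    by (rule A.side_mean_limit[where V = V, OF a V(1), unfolded TT, folded facet_def,
          OF set_integrable_element[OF T v(1)] set_integrable_element[OF T v(2)] trace_side_integrable[OF assms] V(2-4)])
qed

text \<open>The affine formula is known only in the interior of the element, whereas the barycenter
  lies on its boundary. Continuity at the barycenter carries the formula over, and it does so for
  every element adjacent to the side.\<close>

lemma CR_barycenter_side:
  assumes w: "w \<in> CR \<T>" and T: "T \<in> \<T>" and a: "a \<in> verts T"
    and aff: "\<And>x. x \<in> interior T \<Longrightarrow> w x = c + g \<bullet> x"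
  shows "w (barycenter (facet T a)) = c + g \<bullet> barycenter (facet T a)"
proof -
  interpret A: full_simplex "verts T" by (rule element[OF T])
  have TT: "convex hull (verts T) = T" by (rule element(2)[OF T])
  let ?x = "barycenter (facet T a)"
  have nt: "at ?x within interior T \<noteq> bot"
    using A.at_within_interior_nontrivial[OF a A.barycenter_facet_mem[OF a]] TT by (simp add: facet_def)
  have "continuous (at ?x within \<Union>\<T>) w"
    using w facet_side[OF T a] by (simp add: CR_def)
  then have "(w \<longlongrightarrow> w ?x) (at ?x within \<Union>\<T>)" by (simp add: continuous_within)
  then have "(w \<longlongrightarrow> w ?x) (at ?x within interior T)"
    by (rule tendsto_within_subset) (use T interior_subset in blast)
  moreover have "(w \<longlongrightarrow> c + g \<bullet> ?x) (at ?x within interior T)"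
  proof (rule Lim_transform_eventually)
    show "((\<lambda>x. c + g \<bullet> x) \<longlongrightarrow> c + g \<bullet> ?x) (at ?x within interior T)"
      by (intro tendsto_intros)
    show "\<forall>\<^sub>F x in at ?x within interior T. c + g \<bullet> x = w x"
      using aff by (simp add: eventually_at_filter)
  qed
  ultimately show ?thesis by (rule tendsto_unique[OF nt])
qed

lemma CR_interpolant_gradient:
  assumes Icr: "is_CR_interpolant \<Omega> \<T> u w" and T: "T \<in> \<T>"
    and aff: "\<And>x. x \<in> interior T \<Longrightarrow> w x = c + g \<bullet> x"
  shows "g = (LINT x:T|lebesgue. wgrad \<Omega> u x) /\<^sub>R measure lebesgue T"
proof -
  interpret A: full_simplex "verts T" by (rule element[OF T])
  have TT: "convex hull (verts T) = T" by (rule element(2)[OF T])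
  have w: "w \<in> CR \<T>" using Icr by (simp add: is_CR_interpolant_def)
  have tr: "\<exists>g. has_trace \<Omega> (facet T a) u g \<and> w (barycenter (facet T a)) = side_mean (facet T a) g"
    if "a \<in> verts T" for a
    using Icr facet_side[OF T that] by (simp add: is_CR_interpolant_def)
  obtain a where a: "a \<in> verts T" using A.cardC by (metis card.empty ex_in_conv nat.distinct(1))
  then have "u \<in> W1 1 \<Omega>" using tr by (auto simp: has_trace_def)
  note u = W1_integrable[OF this]
  have cr: "c + g \<bullet> barycenter (facet T b) =
    (LINT x:T|lebesgue. real DIM('a) * u x + wgrad \<Omega> u x \<bullet> (x - b)) / (real DIM('a) * measure lebesgue T)"
    if b: "b \<in> verts T" for b
  proof -
    obtain \<gamma> where \<gamma>: "has_trace \<Omega> (facet T b) u \<gamma>" "w (barycenter (facet T b)) = side_mean (facet T b) \<gamma>"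
      using tr[OF b] by blast
    show ?thesis using CR_barycenter_side[OF w T b aff] trace_side_mean[OF T b \<gamma>(1)] \<gamma>(2) by simp
  qed
  show ?thesis
    by (rule A.CR_gradient[unfolded TT, where v = u and c = c])
       (use set_integrable_element[OF T u(1)] set_integrable_element[OF T u(2)] cr in \<open>simp_all add: facet_def\<close>)
qed

text \<open>Two traces have to be compared: one on the whole boundary, which vanishes on the
  Dirichlet part, and the one on the single side that defines the interpolant. Restricted to the
  side, the former is a trace there too, and by \<open>trace_side_mean\<close> both have the same
  mean.\<close>

lemma trace_zero_side_mean:
  assumes T: "T \<in> \<T>" and a: "a \<in> verts T" and u: "u \<in> W1_D q \<Omega> \<Gamma>\<^sub>D"
    and S: "boundary_side_in \<Omega> \<Gamma>\<^sub>D (facet T a)" and tr: "has_trace \<Omega> (facet T a) u g"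
  shows "side_mean (facet T a) g = 0"
proof -
  interpret A: full_simplex "verts T" by (rule element[OF T])
  let ?S = "facet T a"
  have [measurable]: "?S \<in> sets borel" using A.compact_facet[of a] by (simp add: facet_def borel_compact)
  have Sf: "?S \<subseteq> frontier \<Omega>" using S by (simp add: boundary_side_in_def)
  obtain g0 where g0: "has_trace \<Omega> (frontier \<Omega>) u g0"
    "\<And>b n. norm n = 1 \<Longrightarrow> AE x in plane_measure b n. x \<in> \<Gamma>\<^sub>D \<longrightarrow> g0 x = 0"
    using u by (auto simp: W1_D_def)
  have tr0: "has_trace \<Omega> ?S u g0"
  proof -
    obtain V where V: "\<And>k::nat. C1_fun (V k)"
        "(\<lambda>k. LINT x|lebesgue_on \<Omega>. \<bar>V k x - u x\<bar>) \<longlonglongrightarrow> 0"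
        "(\<lambda>k. LINT x|lebesgue_on \<Omega>. norm (grad (V k) x - wgrad \<Omega> u x)) \<longlonglongrightarrow> 0"
        "\<And>b n. norm n = 1 \<Longrightarrow> set_integrable (plane_measure b n) (frontier \<Omega>) g0"
        "\<And>b n. norm n = 1 \<Longrightarrow> (\<lambda>k. LINT x:frontier \<Omega>|plane_measure b n. \<bar>V k x - g0 x\<bar>) \<longlonglongrightarrow> 0"
      using g0(1) unfolding has_trace_def by blast
    have cf: "compact (frontier \<Omega>)" using bounded_\<Omega> by (simp add: compact_frontier_bounded)
    have "(\<lambda>k. LINT x:?S|plane_measure b n. \<bar>V k x - g0 x\<bar>) \<longlonglongrightarrow> 0" if n: "norm n = 1" for b n
    proof (rule Lim_null_comparison[OF _ V(5)[OF n]], intro always_eventually allI)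
      fix k
      have i: "set_integrable (plane_measure b n) (frontier \<Omega>) (\<lambda>x. \<bar>V k x - g0 x\<bar>)"
        by (intro set_integrable_abs set_integral_diff V(4)[OF n] set_integrable_plane_continuous[OF n cf] C1_fun_continuous V(1))
      have iS: "set_integrable (plane_measure b n) ?S (\<lambda>x. \<bar>V k x - g0 x\<bar>)"
        by (rule set_integrable_subset[OF i _ Sf]) simp
      have "(LINT x:?S|plane_measure b n. \<bar>V k x - g0 x\<bar>) \<le> (LINT x:frontier \<Omega>|plane_measure b n. \<bar>V k x - g0 x\<bar>)"
        using i iS Sf unfolding set_lebesgue_integral_def set_integrable_def
        by (intro integral_mono) (auto simp: indicator_def)
      moreover have "0 \<le> (LINT x:?S|plane_measure b n. \<bar>V k x - g0 x\<bar>)"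
        unfolding set_lebesgue_integral_def by (intro Bochner_Integration.integral_nonneg) simp
      ultimately show "norm (LINT x:?S|plane_measure b n. \<bar>V k x - g0 x\<bar>) \<le> (LINT x:frontier \<Omega>|plane_measure b n. \<bar>V k x - g0 x\<bar>)"
        by simp
    qed
    moreover have "set_integrable (plane_measure b n) ?S g0" if n: "norm n = 1" for b n
      by (rule set_integrable_subset[OF V(4)[OF n] _ Sf]) simp
    ultimately show ?thesis using g0(1) V(1-3) unfolding has_trace_def by blast
  qed
  have n: "norm (side_normal ?S) = 1" using A.side_normal(1)[OF a] by (simp add: facet_def)
  have "AE x in side_measure ?S. x \<in> \<Gamma>\<^sub>D \<longrightarrow> g0 x = 0"
    unfolding side_measure_def by (rule g0(2)[OF n])
  moreover have "AE x in side_measure ?S. x \<in> ?S \<longrightarrow> x \<in> \<Gamma>\<^sub>D"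
    using S by (simp add: boundary_side_in_def)
  ultimately have ae: "AE x in side_measure ?S. indicator ?S x *\<^sub>R g0 x = 0"
    by eventually_elim (auto simp: indicator_def)
  have "(LINT x:?S|side_measure ?S. g0 x) = 0"
    unfolding set_lebesgue_integral_def by (rule integral_eq_zero_AE) (rule ae)
  then have "side_mean ?S g0 = 0" by (simp add: side_mean_def)
  then show ?thesis using trace_side_mean[OF T a tr] trace_side_mean[OF T a tr0] by simp
qed

lemma wdiv_components:
  assumes z: "z \<in> W1_vec 1 \<Omega>"
  shows "AE x in lebesgue_on \<Omega>. wdiv \<Omega> z x = (\<Sum>i\<in>Basis. wgrad \<Omega> (\<lambda>x. z x \<bullet> i) x \<bullet> i)"
proof -
  have wg: "has_weak_grad \<Omega> (\<lambda>x. z x \<bullet> i) (wgrad \<Omega> (\<lambda>x. z x \<bullet> i))" if "i \<in> Basis" for i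
    using z that wgrad(1)[OF open_\<Omega>] by (auto simp: W1_vec_def W1_def)
  have zi: "(\<lambda>x. z x \<bullet> i) \<in> L1_loc \<Omega>" if "i \<in> Basis" for i using wg[OF that] by (simp add: has_weak_grad_def)
  have "set_integrable lebesgue K z" if K: "compact K" "K \<subseteq> \<Omega>" for K
  proof -
    have "set_integrable lebesgue K (\<lambda>x. (z x \<bullet> i) *\<^sub>R i)" if "i \<in> Basis" for i
    proof -
      have "integrable lebesgue (\<lambda>x. indicator K x *\<^sub>R (z x \<bullet> i))"
        using zi[OF that] K by (simp add: L1_loc_def set_integrable_def)
      then have "integrable lebesgue (\<lambda>x. (indicator K x *\<^sub>R (z x \<bullet> i)) *\<^sub>R i)"
        by (intro integrable_scaleR_left)
      then show ?thesis by (simp add: set_integrable_def)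
    qed
    then have "set_integrable lebesgue K (\<lambda>x. \<Sum>i\<in>Basis. (z x \<bullet> i) *\<^sub>R i)"
      by (rule set_integral_finite_sum(2))
    then show ?thesis by (simp add: euclidean_representation)
  qed
  then have "z \<in> L1_loc \<Omega>" by (simp add: L1_loc_def)
  then have "has_weak_div \<Omega> z (\<lambda>x. \<Sum>i\<in>Basis. wgrad \<Omega> (\<lambda>x. z x \<bullet> i) x \<bullet> i)"
    using has_weak_div_components[OF open_\<Omega> wg] by blast
  then show ?thesis by (rule wdiv(2)[OF open_\<Omega>])
qed

lemma AE_element_of_AE_\<Omega>:
  assumes T: "T \<in> \<T>" and P: "AE x in lebesgue_on \<Omega>. P x"
  shows "AE x in lebesgue. x \<in> T \<longrightarrow> P x"
  using P[unfolded AE_lebesgue_on] AE_interior_element[OF T]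
  by eventually_elim (use interior_element[OF T] in blast)

lemma set_integral_cong_AE_element:
  fixes f g :: "'a \<Rightarrow> 'b::euclidean_space"
  assumes T: "T \<in> \<T>" and f: "set_integrable lebesgue T f" and g: "set_integrable lebesgue T g"
    and eq: "AE x in lebesgue_on \<Omega>. f x = g x"
  shows "(LINT x:T|lebesgue. f x) = (LINT x:T|lebesgue. g x)"
  unfolding set_lebesgue_integral_def
proof (rule integral_cong_AE)
  show "AE x in lebesgue. indicat_real T x *\<^sub>R f x = indicat_real T x *\<^sub>R g x"
    using AE_element_of_AE_\<Omega>[OF T eq] by eventually_elim (auto simp: indicator_def)
qed (use f g in \<open>auto simp: set_integrable_def\<close>)

lemma W1_vec_integrable:
  assumes "z \<in> W1_vec 1 \<Omega>" "i \<in> Basis"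
  shows "set_integrable lebesgue \<Omega> (\<lambda>x. z x \<bullet> i)" "set_integrable lebesgue \<Omega> (wgrad \<Omega> (\<lambda>x. z x \<bullet> i))"
  using assms W1_integrable by (auto simp: W1_vec_def)

lemma set_integrable_inner_const:
  fixes G :: "'a \<Rightarrow> 'a"
  assumes "set_integrable M A G" shows "set_integrable M A (\<lambda>x. G x \<bullet> i)"
  using integrable_inner_left[of i M "\<lambda>x. indicator A x *\<^sub>R G x"] assms by (simp add: set_integrable_def)

lemma integral_wdiv_element:
  assumes T: "T \<in> \<T>" and z: "z \<in> W1_vec 1 \<Omega>" and d: "set_integrable lebesgue \<Omega> (wdiv \<Omega> z)"
  shows "(LINT x:T|lebesgue. wdiv \<Omega> z x) = (LINT x:T|lebesgue. (\<Sum>i\<in>Basis. wgrad \<Omega> (\<lambda>x. z x \<bullet> i) x \<bullet> i))"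
proof (rule set_integral_cong_AE_element[OF T set_integrable_element[OF T d] _ wdiv_components[OF z]])
  show "set_integrable lebesgue T (\<lambda>x. \<Sum>i\<in>Basis. wgrad \<Omega> (\<lambda>x. z x \<bullet> i) x \<bullet> i)"
    using set_integrable_element[OF T W1_vec_integrable(2)[OF z]]
    by (intro set_integral_finite_sum(2) set_integrable_inner_const)
qed

end

context triangulated_domain
begin

lemma RT_side_value:
  assumes T: "T \<in> \<T>" and a: "a \<in> verts T"
    and y: "\<And>x. x \<in> interior T \<Longrightarrow> y x = \<alpha> + \<beta> *\<^sub>R (x - barycenter T)"
    and x: "x \<in> facet T a" and lim: "((\<lambda>x'. y x' \<bullet> n) \<longlongrightarrow> m) (at x within interior T)"
  shows "(\<alpha> + \<beta> *\<^sub>R (x - barycenter T)) \<bullet> n = m"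
proof -
  interpret A: full_simplex "verts T" by (rule element[OF T])
  have TT: "convex hull (verts T) = T" by (rule element(2)[OF T])
  have nt: "at x within interior T \<noteq> bot"
    using A.at_within_interior_nontrivial[OF a, of x] x TT by (simp add: facet_def)
  have "((\<lambda>x'. y x' \<bullet> n) \<longlongrightarrow> (\<alpha> + \<beta> *\<^sub>R (x - barycenter T)) \<bullet> n) (at x within interior T)"
  proof (rule Lim_transform_eventually)
    show "((\<lambda>x'. (\<alpha> + \<beta> *\<^sub>R (x' - barycenter T)) \<bullet> n) \<longlongrightarrow> (\<alpha> + \<beta> *\<^sub>R (x - barycenter T)) \<bullet> n) (at x within interior T)"
      by (intro tendsto_intros)
    show "\<forall>\<^sub>F x' in at x within interior T. (\<alpha> + \<beta> *\<^sub>R (x' - barycenter T)) \<bullet> n = y x' \<bullet> n"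
      using y by (simp add: eventually_at_filter)
  qed
  then show ?thesis using lim by (rule tendsto_unique[OF nt])
qed

lemma barycenter_facet_in_facet: "T \<in> \<T> \<Longrightarrow> a \<in> verts T \<Longrightarrow> barycenter (facet T a) \<in> facet T a"
  using full_simplex.barycenter_facet_mem[OF element(1)] by (simp add: facet_def)

text \<open>The first claim fixes one trace \<open>g S\<close> for each side, common to all adjacent
  elements; only thus can the fluxes from the two elements cancel later. It says that the normal
  component of the interpolant at the barycenter of the side is the mean of that trace. In the
  second claim, d \<beta> is the divergence of the interpolant on the element.\<close>

lemma RT_interpolant:
  assumes z: "z \<in> W1_vec 1 \<Omega>" and d: "set_integrable lebesgue \<Omega> (wdiv \<Omega> z)" and Irt: "is_RT_interpolant \<Omega> \<T> z y"
  shows "\<exists>g. (\<forall>S\<in>sides \<T>. \<forall>i\<in>Basis. has_trace \<Omega> S (\<lambda>x. z x \<bullet> i) (\<lambda>x. g S x \<bullet> i)) \<and>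
    (\<forall>T\<in>\<T>. \<forall>a\<in>verts T. \<forall>\<alpha> \<beta>. (\<forall>x\<in>interior T. y x = \<alpha> + \<beta> *\<^sub>R (x - barycenter T)) \<longrightarrow>
      (\<alpha> + \<beta> *\<^sub>R (barycenter (facet T a) - barycenter T)) \<bullet> side_normal (facet T a) =
      side_mean (facet T a) (\<lambda>x. g (facet T a) x \<bullet> side_normal (facet T a)))"
    and "\<And>T \<alpha> \<beta>. T \<in> \<T> \<Longrightarrow> (\<And>x. x \<in> interior T \<Longrightarrow> y x = \<alpha> + \<beta> *\<^sub>R (x - barycenter T)) \<Longrightarrow>
      real DIM('a) * \<beta> * measure lebesgue T = (LINT x:T|lebesgue. wdiv \<Omega> z x)"
proof -
  have "\<forall>S\<in>sides \<T>. \<exists>g. (\<forall>i\<in>Basis. has_trace \<Omega> S (\<lambda>x. z x \<bullet> i) (\<lambda>x. g x \<bullet> i)) \<and>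
        (\<forall>T\<in>\<T>. S facet_of T \<longrightarrow> (\<forall>x\<in>S.
           ((\<lambda>x'. y x' \<bullet> side_normal S) \<longlongrightarrow> side_mean S (\<lambda>x'. g x' \<bullet> side_normal S)) (at x within interior T)))"
    using Irt by (simp add: is_RT_interpolant_def)
  then obtain g where "\<forall>S\<in>sides \<T>. (\<forall>i\<in>Basis. has_trace \<Omega> S (\<lambda>x. z x \<bullet> i) (\<lambda>x. g S x \<bullet> i)) \<and>
        (\<forall>T\<in>\<T>. S facet_of T \<longrightarrow> (\<forall>x\<in>S.
           ((\<lambda>x'. y x' \<bullet> side_normal S) \<longlongrightarrow> side_mean S (\<lambda>x'. g S x' \<bullet> side_normal S)) (at x within interior T)))"
    by (rule bchoice[THEN exE])
  then have g1: "\<And>S i. S \<in> sides \<T> \<Longrightarrow> i \<in> Basis \<Longrightarrow> has_trace \<Omega> S (\<lambda>x. z x \<bullet> i) (\<lambda>x. g S x \<bullet> i)"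
    and g2: "\<And>S T x. S \<in> sides \<T> \<Longrightarrow> T \<in> \<T> \<Longrightarrow> S facet_of T \<Longrightarrow> x \<in> S \<Longrightarrow>
      ((\<lambda>x'. y x' \<bullet> side_normal S) \<longlongrightarrow> side_mean S (\<lambda>x'. g S x' \<bullet> side_normal S)) (at x within interior T)"
    by blast+
  have v: "(\<alpha> + \<beta> *\<^sub>R (barycenter (facet T a) - barycenter T)) \<bullet> side_normal (facet T a) =
      side_mean (facet T a) (\<lambda>x. g (facet T a) x \<bullet> side_normal (facet T a))"
    if T: "T \<in> \<T>" and a: "a \<in> verts T" and y: "\<And>x. x \<in> interior T \<Longrightarrow> y x = \<alpha> + \<beta> *\<^sub>R (x - barycenter T)" for T a \<alpha> \<beta>
    by (rule RT_side_value[OF T a y barycenter_facet_in_facet[OF T a]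
        g2[OF facet_side[OF T a] T facet_of_element[OF T a] barycenter_facet_in_facet[OF T a]]])
  have dv: "real DIM('a) * \<beta> * measure lebesgue T = (LINT x:T|lebesgue. wdiv \<Omega> z x)"
    if T: "T \<in> \<T>" and y: "\<And>x. x \<in> interior T \<Longrightarrow> y x = \<alpha> + \<beta> *\<^sub>R (x - barycenter T)" for T \<alpha> \<beta>
  proof -
    interpret A: full_simplex "verts T" by (rule element[OF T])
    have TT: "convex hull (verts T) = T" by (rule element(2)[OF T])
    have "real DIM('a) * \<beta> * measure lebesgue T =
       (LINT x:T|lebesgue. (\<Sum>i\<in>Basis. wgrad \<Omega> (\<lambda>x. z x \<bullet> i) x \<bullet> i))"
    proof (rule A.RT_divergence[unfolded TT, folded facet_def, where v = z and g = "\<lambda>a. g (facet T a)" and \<alpha> = \<alpha>])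
      fix i :: 'a assume i: "i \<in> Basis"
      show "set_integrable lebesgue T (\<lambda>x. z x \<bullet> i)" "set_integrable lebesgue T (wgrad \<Omega> (\<lambda>x. z x \<bullet> i))"
        using set_integrable_element[OF T] W1_vec_integrable[OF z i] by blast+
      fix a assume a: "a \<in> verts T"
      note tr = g1[OF facet_side[OF T a] i]
      show "set_integrable (side_measure (facet T a)) (facet T a) (\<lambda>x. g (facet T a) x \<bullet> i)"
        by (rule trace_side_integrable[OF T a tr])
      show "side_mean (facet T a) (\<lambda>x. g (facet T a) x \<bullet> i) =
        (LINT x:T|lebesgue. real DIM('a) * (z x \<bullet> i) + wgrad \<Omega> (\<lambda>x. z x \<bullet> i) x \<bullet> (x - a)) / (real DIM('a) * measure lebesgue T)"
        by (rule trace_side_mean[OF T a tr])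
    next
      fix a assume a: "a \<in> verts T"
      show "(\<alpha> + \<beta> *\<^sub>R (barycenter (facet T a) - barycenter T)) \<bullet> side_normal (facet T a) =
         side_mean (facet T a) (\<lambda>x. g (facet T a) x \<bullet> side_normal (facet T a))"
        by (rule v[OF T a y])
    qed
    then show ?thesis using integral_wdiv_element[OF T z d] by simp
  qed
  show "real DIM('a) * \<beta> * measure lebesgue T = (LINT x:T|lebesgue. wdiv \<Omega> z x)"
    if "T \<in> \<T>" "\<And>x. x \<in> interior T \<Longrightarrow> y x = \<alpha> + \<beta> *\<^sub>R (x - barycenter T)" for T \<alpha> \<beta>
    by (rule dv) (rule that)+
  show "\<exists>g. (\<forall>S\<in>sides \<T>. \<forall>i\<in>Basis. has_trace \<Omega> S (\<lambda>x. z x \<bullet> i) (\<lambda>x. g S x \<bullet> i)) \<and>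
    (\<forall>T\<in>\<T>. \<forall>a\<in>verts T. \<forall>\<alpha> \<beta>. (\<forall>x\<in>interior T. y x = \<alpha> + \<beta> *\<^sub>R (x - barycenter T)) \<longrightarrow>
      (\<alpha> + \<beta> *\<^sub>R (barycenter (facet T a) - barycenter T)) \<bullet> side_normal (facet T a) =
      side_mean (facet T a) (\<lambda>x. g (facet T a) x \<bullet> side_normal (facet T a)))"
  proof (rule exI[of _ g], intro conjI ballI allI impI)
    fix T a \<alpha> \<beta> assume "T \<in> \<T>" "a \<in> verts T" "\<forall>x\<in>interior T. y x = \<alpha> + \<beta> *\<^sub>R (x - barycenter T)"
    then show "(\<alpha> + \<beta> *\<^sub>R (barycenter (facet T a) - barycenter T)) \<bullet> side_normal (facet T a) =
      side_mean (facet T a) (\<lambda>x. g (facet T a) x \<bullet> side_normal (facet T a))" using v by blast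
  qed (rule g1)
qed

section \<open>C1 functions as admissible functions for the weak boundary condition\<close>

lemma C1_bounded_on_\<Omega>:
  fixes h :: "'a \<Rightarrow> 'b::euclidean_space"
  assumes "continuous_on UNIV h" obtains M where "\<And>x. x \<in> \<Omega> \<Longrightarrow> norm (h x) \<le> M"
proof -
  have "compact (h ` closure \<Omega>)"
    using assms bounded_\<Omega> by (intro compact_continuous_image) (auto intro: continuous_on_subset)
  then obtain M where "\<And>x. x \<in> closure \<Omega> \<Longrightarrow> norm (h x) \<le> M"
    using compact_imp_bounded by (fastforce simp: bounded_iff)
  then show ?thesis using that closure_subset by blast
qed

lemma C1_wgrad:
  assumes "C1_fun \<eta>"
  shows "has_weak_grad \<Omega> \<eta> (grad \<eta>)" "AE x in lebesgue_on \<Omega>. wgrad \<Omega> \<eta> x = grad \<eta> x"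
  using C1_has_weak_grad[OF open_\<Omega> assms] wgrad(2)[OF open_\<Omega>] by blast+

text \<open>Written for the chosen representative \<open>wgrad\<close>, which agrees with the
  classical gradient only almost everywhere; completeness of Lebesgue measure makes it measurable
  all the same.\<close>

lemma Lp_cong_AE:
  fixes h :: "'a \<Rightarrow> 'b::euclidean_space"
  assumes h: "continuous_on UNIV h" and eq: "AE x in lebesgue_on \<Omega>. f x = h x"
  shows "f \<in> Lp 1 \<Omega>" "f \<in> Lp \<infinity> \<Omega>"
proof -
  have hm: "h \<in> borel_measurable (lebesgue_on \<Omega>)"
    using h \<Omega>_lebesgue continuous_imp_measurable_on_sets_lebesgue continuous_on_subset by blast
  have fm: "f \<in> borel_measurable (lebesgue_on \<Omega>)"
  proof -
    have "(\<lambda>x. indicator \<Omega> x *\<^sub>R h x) \<in> borel_measurable lebesgue"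
      using hm \<Omega>_lebesgue by (simp add: borel_measurable_restrict_space_iff)
    moreover have "AE x in lebesgue. indicator \<Omega> x *\<^sub>R h x = indicator \<Omega> x *\<^sub>R f x"
      using eq unfolding AE_lebesgue_on by eventually_elim (auto simp: indicator_def)
    ultimately have "(\<lambda>x. indicator \<Omega> x *\<^sub>R f x) \<in> borel_measurable lebesgue"
      by (rule borel_measurable_AE)
    then show ?thesis using \<Omega>_lebesgue by (simp add: borel_measurable_restrict_space_iff)
  qed
  obtain M where M: "\<And>x. x \<in> \<Omega> \<Longrightarrow> norm (h x) \<le> M" using C1_bounded_on_\<Omega>[OF h] by blast
  have "AE x in lebesgue_on \<Omega>. norm (f x) \<le> M"
    using eq AE_space by eventually_elim (use M in \<open>auto simp: space_restrict_space\<close>)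
  then show "f \<in> Lp \<infinity> \<Omega>" using fm by (auto simp: Lp_def)
  have "integrable (lebesgue_on \<Omega>) h"
    using set_integrable_continuous_bounded[OF \<Omega>_lebesgue bounded_\<Omega> h] lebesgue_on_integral(2)[OF \<Omega>_lebesgue] by blast
  then have "integrable (lebesgue_on \<Omega>) f"
    by (rule integrable_cong_AE_imp[OF _ fm]) (use eq in \<open>auto elim: eventually_mono\<close>)
  then show "f \<in> Lp 1 \<Omega>" using fm by (simp add: Lp_def integrable_norm)
qed

lemma C1_W1:
  assumes "C1_fun \<eta>" shows "\<eta> \<in> W1 1 \<Omega>" "\<eta> \<in> W1 \<infinity> \<Omega>"
  using Lp_cong_AE[OF C1_fun_continuous[OF assms], of \<eta>] Lp_cong_AE[OF C1_fun_grad_continuous[OF assms] C1_wgrad(2)[OF assms]]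
    C1_wgrad(1)[OF assms]
  by (auto simp: W1_def)

lemma C1_trace:
  assumes \<eta>: "C1_fun \<eta>" shows "has_trace \<Omega> (frontier \<Omega>) \<eta> \<eta>"
proof -
  have "(LINT x|lebesgue_on \<Omega>. norm (grad \<eta> x - wgrad \<Omega> \<eta> x)) = 0"
    by (rule integral_eq_zero_AE) (use C1_wgrad(2)[OF \<eta>] in \<open>auto elim: eventually_mono\<close>)
  moreover have "compact (frontier \<Omega>)" using bounded_\<Omega> by (simp add: compact_frontier_bounded)
  ultimately show ?thesis unfolding has_trace_def
    by (intro conjI C1_W1(1)[OF \<eta>] exI[of _ "\<lambda>k. \<eta>"] allI impI set_integrable_plane_continuous C1_fun_continuous)
       (auto simp: \<eta> set_lebesgue_integral_def)
qed

text \<open>On any hyperplane other than that of the facet, the facet is a null set by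
  \<open>plane_measure_cases\<close>.\<close>

lemma AE_plane_facet:
  assumes T: "T \<in> \<T>" and a: "a \<in> verts T" and n: "norm n = 1"
    and P: "AE x in side_measure (facet T a). x \<in> facet T a \<longrightarrow> P x"
  shows "AE x in plane_measure b n. x \<in> facet T a \<longrightarrow> P x"
proof -
  interpret A: full_simplex "verts T" by (rule element[OF T])
  let ?S = "facet T a" let ?c = "barycenter ?S" and ?m = "side_normal ?S"
  have m: "norm ?m = 1" using A.side_normal(1)[OF a] by (simp add: facet_def)
  from plane_measure_cases[OF m n, of b ?c] show ?thesis
  proof
    assume eq: "plane_measure b n = plane_measure ?c ?m"
    show ?thesis unfolding eq using P unfolding side_measure_def .
  next
    assume "emeasure (plane_measure b n) {y. (y - ?c) \<bullet> ?m = 0} = 0"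
    then have "AE x in plane_measure b n. \<not> (x - ?c) \<bullet> ?m = 0"
      by (intro AE_I[where N = "{y. (y - ?c) \<bullet> ?m = 0}"]) auto
    then show ?thesis by eventually_elim (use A.facet_in_plane[OF a] in \<open>auto simp: facet_def\<close>)
  qed
qed

text \<open>
  The weak boundary condition is tested with \<open>C\<^sup>1\<close> functions that increase to the indicator of the
  relative interior of the side.  They can vanish on all other elements because no other element
  contains points of this relative interior.
\<close>

lemma normal_trace_zero:
  assumes T: "T \<in> \<T>" and a: "a \<in> verts T" and unique: "\<And>T'. T' \<in> \<T> \<Longrightarrow> facet T a facet_of T' \<Longrightarrow> T' = T"
    and \<Gamma>\<^sub>D: "\<Gamma>\<^sub>D \<subseteq> frontier \<Omega>" and S: "boundary_side_in \<Omega> (frontier \<Omega> - \<Gamma>\<^sub>D) (facet T a)"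
    and zN: "z \<in> W_div_N 1 \<Omega> \<Gamma>\<^sub>D" and z1: "z \<in> W1_vec 1 \<Omega>"
    and tr: "\<And>i. i \<in> Basis \<Longrightarrow> has_trace \<Omega> (facet T a) (\<lambda>x. z x \<bullet> i) (\<lambda>x. g x \<bullet> i)"
  shows "side_mean (facet T a) (\<lambda>x. g x \<bullet> side_normal (facet T a)) = 0"
proof -
  interpret A: full_simplex "verts T" by (rule element[OF T])
  have TT: "convex hull (verts T) = T" by (rule element(2)[OF T])
  let ?S = "facet T a" let ?n = "side_normal ?S" let ?M = "side_measure ?S" let ?d = "real DIM('a)"
  have facet_compact: "compact (facet T b)" for b using A.compact_facet[of b] by (simp add: facet_def)
  have [measurable]: "?S \<in> sets borel" using facet_compact borel_compact by blast
  have sM: "sets ?M = sets borel" "space ?M = UNIV" by (simp_all add: side_measure_def)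
  \<comment> \<open>Functions vanishing outside \<open>U\<close> are zero on all other elements and
    on all other facets of \<open>T\<close>, so that only the given facet contributes to the
    boundary integral.\<close>
  define U where "U = - \<Union>(\<T> - {T}) \<inter> - (\<Union>b\<in>verts T - {a}. facet T b)"
  have "open U" unfolding U_def using A.finC facet_compact
    by (intro open_Int unique_side_neighbourhood(1)[OF T a unique] open_Compl closed_UN) (auto intro: compact_imp_closed)
  then obtain v where v: "\<And>k::nat. C1_fun (v k)" "\<And>k x. 0 \<le> v k x" "\<And>k x. v k x \<le> 1"
    "\<And>k x. x \<notin> U \<Longrightarrow> v k x = 0" "\<And>x. x \<in> U \<Longrightarrow> (\<lambda>k. v k x) \<longlonglongrightarrow> 1"
    using bump_sequence by metis
  have gi: "set_integrable ?M ?S (\<lambda>x. g x \<bullet> i)" if "i \<in> Basis" for i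
    by (rule trace_side_integrable[OF T a tr[OF that]])
  have gn: "set_integrable ?M ?S (\<lambda>x. g x \<bullet> h)" for h
  proof -
    have "set_integrable ?M ?S (\<lambda>x. \<Sum>i\<in>Basis. (g x \<bullet> i) * (h \<bullet> i))"
      using gi by (intro set_integral_finite_sum(2)) auto
    then show ?thesis by (subst euclidean_inner)
  qed
  have zdiv: "set_integrable lebesgue \<Omega> (wdiv \<Omega> z)" "set_integrable lebesgue \<Omega> z"
    using zN by (auto simp: W_div_N_def intro: Lp1_set_integrable)
  have zero: "(LINT x:?S|?M. v k x * (g x \<bullet> ?n)) = 0" for k
  proof -
    let ?\<eta> = "v k"
    have \<eta>: "C1_fun ?\<eta>" by (rule v(1))
    have c\<eta>: "continuous_on UNIV ?\<eta>" "continuous_on UNIV (grad ?\<eta>)"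
      using \<eta> by (auto intro: C1_fun_continuous C1_fun_grad_continuous)
    \<comment> \<open>The exponent is \<infinity> because it is conjugate to 1. A point of
      \<Gamma>_D at which the test function does not vanish must lie on the facet, but almost no
      point of the facet belongs to \<Gamma>_D.\<close>
    have WD: "?\<eta> \<in> W1_D \<infinity> \<Omega> \<Gamma>\<^sub>D"
    proof -
      have inS: "x \<in> ?S" if x: "x \<in> \<Gamma>\<^sub>D" "?\<eta> x \<noteq> 0" for x
      proof -
        have xU: "x \<in> U" using v(4) x(2) by blast
        have xf: "x \<in> frontier \<Omega>" using x(1) \<Gamma>\<^sub>D by blast
        then have "x \<in> closure \<Omega>" by (simp add: frontier_def)
        then have xT: "x \<in> T" using xU Union\<T> by (auto simp: U_def)
        have "x \<notin> \<Omega>" using xf open_\<Omega> by (simp add: frontier_def interior_open)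
        then have "x \<notin> interior T" using interior_element[OF T] by blast
        then obtain b where b: "b \<in> verts T" "bary (verts T) b x \<le> 0"
          using A.mem_interior_iff[of x] TT by (auto simp: not_less)
        then have "bary (verts T) b x = 0" using xT A.mem_T_iff[of x] TT by (simp add: antisym)
        then have xb: "x \<in> facet T b" using A.mem_facet_iff[OF b(1)] xT TT by (simp add: facet_def)
        then have "b = a" using xU b(1) by (auto simp: U_def)
        then show ?thesis using xb by simp
      qed
      have "AE x in plane_measure b n. x \<in> \<Gamma>\<^sub>D \<longrightarrow> ?\<eta> x = 0" if n: "norm n = 1" for b n
      proof -
        have "AE x in ?M. x \<in> ?S \<longrightarrow> x \<notin> \<Gamma>\<^sub>D" using S by (auto simp: boundary_side_in_def elim: eventually_mono)
        then have "AE x in plane_measure b n. x \<in> ?S \<longrightarrow> x \<notin> \<Gamma>\<^sub>D" by (rule AE_plane_facet[OF T a n])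
        then show ?thesis by eventually_elim (use inS in blast)
      qed
      then show ?thesis using C1_W1(2)[OF \<eta>] C1_trace[OF \<eta>] by (auto simp: W1_D_def)
    qed
    have "(LINT x|lebesgue_on \<Omega>. z x \<bullet> wgrad \<Omega> ?\<eta> x + ?\<eta> x * wdiv \<Omega> z x) = 0"
      using zN WD by (simp add: W_div_N_def conj_exponent_def)
    moreover have ibp_int: "set_integrable lebesgue \<Omega> (\<lambda>x. z x \<bullet> grad ?\<eta> x + ?\<eta> x * wdiv \<Omega> z x)"
      using set_integrable_bilinear_continuous[OF bounded_bilinear_inner \<Omega>_lebesgue bounded_\<Omega> c\<eta>(2) zdiv(2)]
        set_integrable_bilinear_continuous[OF bounded_bilinear_mult \<Omega>_lebesgue bounded_\<Omega> c\<eta>(1) zdiv(1)]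
      by (intro set_integral_add) (auto simp: inner_commute)
    moreover have "(LINT x|lebesgue_on \<Omega>. z x \<bullet> wgrad \<Omega> ?\<eta> x + ?\<eta> x * wdiv \<Omega> z x) =
        (LINT x|lebesgue_on \<Omega>. z x \<bullet> grad ?\<eta> x + ?\<eta> x * wdiv \<Omega> z x)"
    proof (rule integral_cong_AE)
      show "AE x in lebesgue_on \<Omega>. z x \<bullet> wgrad \<Omega> ?\<eta> x + ?\<eta> x * wdiv \<Omega> z x = z x \<bullet> grad ?\<eta> x + ?\<eta> x * wdiv \<Omega> z x"
        using C1_wgrad(2)[OF \<eta>] by eventually_elim simp
      have [measurable]: "z \<in> borel_measurable (lebesgue_on \<Omega>)" "wdiv \<Omega> z \<in> borel_measurable (lebesgue_on \<Omega>)"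
        "?\<eta> \<in> borel_measurable (lebesgue_on \<Omega>)" "wgrad \<Omega> ?\<eta> \<in> borel_measurable (lebesgue_on \<Omega>)"
        "grad ?\<eta> \<in> borel_measurable (lebesgue_on \<Omega>)"
        using zN C1_W1[OF \<eta>] Lp_cong_AE[OF c\<eta>(2), of "grad ?\<eta>"] by (auto simp: W_div_N_def W1_def Lp_def)
      show "(\<lambda>x. z x \<bullet> wgrad \<Omega> ?\<eta> x + ?\<eta> x * wdiv \<Omega> z x) \<in> borel_measurable (lebesgue_on \<Omega>)" by measurable
      show "(\<lambda>x. z x \<bullet> grad ?\<eta> x + ?\<eta> x * wdiv \<Omega> z x) \<in> borel_measurable (lebesgue_on \<Omega>)" by measurable
    qed
    ultimately have "(LINT x:\<Omega>|lebesgue. z x \<bullet> grad ?\<eta> x + ?\<eta> x * wdiv \<Omega> z x) = 0"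
      by (simp add: lebesgue_on_integral(1)[OF \<Omega>_lebesgue])
    then have "(\<Sum>T'\<in>\<T>. LINT x:T'|lebesgue. z x \<bullet> grad ?\<eta> x + ?\<eta> x * wdiv \<Omega> z x) = 0"
      by (simp add: integral_elements[OF ibp_int])
    moreover have "(LINT x:T'|lebesgue. z x \<bullet> grad ?\<eta> x + ?\<eta> x * wdiv \<Omega> z x) = 0" if T': "T' \<in> \<T>" "T' \<noteq> T" for T'
      unfolding set_lebesgue_integral_def
    proof (rule integral_eq_zero_AE)
      show "AE x in lebesgue. indicat_real T' x *\<^sub>R (z x \<bullet> grad ?\<eta> x + ?\<eta> x * wdiv \<Omega> z x) = 0"
        using AE_interior_element[OF T'(1)]
      proof eventually_elim
        fix x assume x: "x \<in> T' \<longrightarrow> x \<in> interior T'"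
        have z0: "?\<eta> y = 0" if "y \<in> interior T'" for y
          using v(4)[of y] T' that interior_subset[of T'] by (auto simp: U_def)
        show "indicat_real T' x *\<^sub>R (z x \<bullet> grad ?\<eta> x + ?\<eta> x * wdiv \<Omega> z x) = 0"
        proof (cases "x \<in> T'")
          case True
          then have "grad ?\<eta> x = 0" "?\<eta> x = 0" using x grad_zero_outside[OF open_interior, of x T' ?\<eta>] z0 by auto
          then show ?thesis by simp
        qed simp
      qed
    qed
    ultimately have ibpT: "(LINT x:T|lebesgue. z x \<bullet> grad ?\<eta> x + ?\<eta> x * wdiv \<Omega> z x) = 0"
      using fin\<T> T by (simp add: sum.remove)
    \<comment> \<open>The product \<eta> z on \<open>T\<close>: \<open>w\<close> is the field
      itself, \<open>G i\<close> the gradient of its i-th component by the product rule, and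
      \<open>\<gamma> b i\<close> the trace of that component on the facet opposite to
      \<open>b\<close>, which is zero unless b = a.\<close>
    define G where "G i x = ?\<eta> x *\<^sub>R wgrad \<Omega> (\<lambda>x. z x \<bullet> i) x + (z x \<bullet> i) *\<^sub>R grad ?\<eta> x" for i x
    define w where "w x = ?\<eta> x *\<^sub>R z x" for x
    define \<gamma> where "\<gamma> b i x = (if b = a then ?\<eta> x * (g x \<bullet> i) else 0)" for b i x
    have zi: "set_integrable lebesgue T (\<lambda>x. z x \<bullet> i)" "set_integrable lebesgue T (wgrad \<Omega> (\<lambda>x. z x \<bullet> i))" if "i \<in> Basis" for i
      using set_integrable_element[OF T] W1_vec_integrable[OF z1 that] by blast+
    have Tl: "T \<in> sets lebesgue" "bounded T" using A.T_lebesgue A.bounded_T TT by auto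
    have wi: "set_integrable lebesgue T (\<lambda>x. w x \<bullet> i)" if "i \<in> Basis" for i
      using set_integrable_bilinear_continuous[OF bounded_bilinear_mult Tl c\<eta>(1) zi(1)[OF that]] by (simp add: w_def)
    have Gi: "set_integrable lebesgue T (G i)" if "i \<in> Basis" for i
      unfolding G_def
      using set_integrable_bilinear_continuous[OF bounded_bilinear_scaleR Tl c\<eta>(1) zi(2)[OF that]]
        set_integrable_bilinear_continuous[OF bounded_bilinear.flip[OF bounded_bilinear_scaleR] Tl c\<eta>(2) zi(1)[OF that]]
      by (intro set_integral_add) auto
    \<comment> \<open>The approximating functions \<open>V\<close> are known to converge only on the
      facet opposite to \<open>a\<close>. Multiplied by \<eta>, they also converge on the other
      facets, where the products vanish identically.\<close>
    have means: "side_mean (facet T b) (\<gamma> b i) =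
        (LINT x:T|lebesgue. ?d * (w x \<bullet> i) + G i x \<bullet> (x - b)) / (?d * measure lebesgue T)"
      if b: "b \<in> verts T" and i: "i \<in> Basis" for b i
    proof -
      obtain V where V: "\<And>k::nat. C1_fun (V k)"
        "(\<lambda>k. LINT x:T|lebesgue. \<bar>V k x - z x \<bullet> i\<bar>) \<longlonglongrightarrow> 0"
        "(\<lambda>k. LINT x:T|lebesgue. norm (grad (V k) x - wgrad \<Omega> (\<lambda>x. z x \<bullet> i) x)) \<longlonglongrightarrow> 0"
        "(\<lambda>k. LINT x:?S|?M. \<bar>V k x - g x \<bullet> i\<bar>) \<longlonglongrightarrow> 0"
        using trace_approximation[OF T a tr[OF i]] by blast
      define W where "W j x = ?\<eta> x * V j x" for j x
      have W: "C1_fun (W j)" "grad (W j) = (\<lambda>x. ?\<eta> x *\<^sub>R grad (V j) x + V j x *\<^sub>R grad ?\<eta> x)" for j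
        unfolding W_def using C1_fun_mult[OF \<eta> V(1)[of j]] by auto
      have VT: "set_integrable lebesgue T (V j)" "set_integrable lebesgue T (grad (V j))" for j
        using set_integrable_element[OF T] C1_set_integrable[OF V(1)] by blast+
      have iv: "set_integrable lebesgue T (\<lambda>x. \<bar>V j x - z x \<bullet> i\<bar>)"
        "set_integrable lebesgue T (\<lambda>x. norm (grad (V j) x - wgrad \<Omega> (\<lambda>x. z x \<bullet> i) x))" for j
        by (intro set_integrable_abs set_integrable_norm set_integral_diff VT zi i)+
      obtain M where M: "\<And>x. x \<in> T \<Longrightarrow> norm (grad ?\<eta> x) \<le> M"
        using compact_imp_bounded[OF compact_continuous_image[OF continuous_on_subset[OF c\<eta>(2)] element_compact[OF T]]]
        by (fastforce simp: bounded_iff)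
      have nonneg: "0 \<le> (LINT x:A|N. f x)" if "\<And>x. 0 \<le> f x" for A and N :: "'a measure" and f :: "'a \<Rightarrow> real"
        unfolding set_lebesgue_integral_def using that by (intro Bochner_Integration.integral_nonneg) simp
      have l1: "(\<lambda>j. LINT x:T|lebesgue. \<bar>W j x - w x \<bullet> i\<bar>) \<longlonglongrightarrow> 0"
      proof (rule Lim_null_comparison[OF _ V(2)], intro always_eventually allI)
        fix j
        have "(LINT x:T|lebesgue. \<bar>W j x - w x \<bullet> i\<bar>) \<le> (LINT x:T|lebesgue. \<bar>V j x - z x \<bullet> i\<bar>)"
        proof (rule set_integral_mono[OF _ iv(1)])
          show "set_integrable lebesgue T (\<lambda>x. \<bar>W j x - w x \<bullet> i\<bar>)"
            using set_integrable_element[OF T C1_set_integrable(1)[OF W(1)]] wi[OF i]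
            by (intro set_integrable_abs set_integral_diff)
          fix x
          have "\<bar>W j x - w x \<bullet> i\<bar> = ?\<eta> x * \<bar>V j x - z x \<bullet> i\<bar>"
            using v(2)[of k x] by (simp add: W_def w_def abs_mult right_diff_distrib[symmetric])
          also have "\<dots> \<le> \<bar>V j x - z x \<bullet> i\<bar>" using v(2,3)[of k x] by (intro mult_left_le_one_le) auto
          finally show "\<bar>W j x - w x \<bullet> i\<bar> \<le> \<bar>V j x - z x \<bullet> i\<bar>" .
        qed
        then show "norm (LINT x:T|lebesgue. \<bar>W j x - w x \<bullet> i\<bar>) \<le> (LINT x:T|lebesgue. \<bar>V j x - z x \<bullet> i\<bar>)"
          using nonneg[of "\<lambda>x. \<bar>W j x - w x \<bullet> i\<bar>" lebesgue T] by simp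
      qed
      have l2: "(\<lambda>j. LINT x:T|lebesgue. norm (grad (W j) x - G i x)) \<longlonglongrightarrow> 0"
      proof (rule Lim_null_comparison, intro always_eventually allI)
        show "(\<lambda>j. (LINT x:T|lebesgue. norm (grad (V j) x - wgrad \<Omega> (\<lambda>x. z x \<bullet> i) x)) + M * (LINT x:T|lebesgue. \<bar>V j x - z x \<bullet> i\<bar>)) \<longlonglongrightarrow> 0"
          using tendsto_add[OF V(3) tendsto_mult_left[OF V(2), of M]] by simp
        fix j
        have "(LINT x:T|lebesgue. norm (grad (W j) x - G i x)) \<le>
           (LINT x:T|lebesgue. norm (grad (V j) x - wgrad \<Omega> (\<lambda>x. z x \<bullet> i) x) + M * \<bar>V j x - z x \<bullet> i\<bar>)"
        proof (rule set_integral_mono)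
          show "set_integrable lebesgue T (\<lambda>x. norm (grad (W j) x - G i x))"
            using set_integrable_element[OF T C1_set_integrable(2)[OF W(1)]] Gi[OF i]
            by (intro set_integrable_norm set_integral_diff)
          show "set_integrable lebesgue T (\<lambda>x. norm (grad (V j) x - wgrad \<Omega> (\<lambda>x. z x \<bullet> i) x) + M * \<bar>V j x - z x \<bullet> i\<bar>)"
            using iv by (intro set_integral_add set_integrable_mult_right)
          fix x assume x: "x \<in> T"
          have "grad (W j) x - G i x = ?\<eta> x *\<^sub>R (grad (V j) x - wgrad \<Omega> (\<lambda>x. z x \<bullet> i) x) + (V j x - z x \<bullet> i) *\<^sub>R grad ?\<eta> x"
            by (simp add: W(2) G_def algebra_simps)
          also have "norm \<dots> \<le> ?\<eta> x * norm (grad (V j) x - wgrad \<Omega> (\<lambda>x. z x \<bullet> i) x) + \<bar>V j x - z x \<bullet> i\<bar> * norm (grad ?\<eta> x)"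
            by (rule order_trans[OF norm_triangle_ineq]) (use v(2)[of k x] in simp)
          also have "\<dots> \<le> norm (grad (V j) x - wgrad \<Omega> (\<lambda>x. z x \<bullet> i) x) + \<bar>V j x - z x \<bullet> i\<bar> * M"
            using v(2,3)[of k x] M[OF x] by (intro add_mono mult_left_le_one_le mult_left_mono) auto
          finally show "norm (grad (W j) x - G i x) \<le> norm (grad (V j) x - wgrad \<Omega> (\<lambda>x. z x \<bullet> i) x) + M * \<bar>V j x - z x \<bullet> i\<bar>"
            by (simp add: mult.commute)
        qed
        also have "\<dots> = (LINT x:T|lebesgue. norm (grad (V j) x - wgrad \<Omega> (\<lambda>x. z x \<bullet> i) x)) + M * (LINT x:T|lebesgue. \<bar>V j x - z x \<bullet> i\<bar>)"
          using iv by (subst set_integral_add) (auto simp: set_integrable_mult_right)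
        finally show "norm (LINT x:T|lebesgue. norm (grad (W j) x - G i x)) \<le> (LINT x:T|lebesgue. norm (grad (V j) x - wgrad \<Omega> (\<lambda>x. z x \<bullet> i) x)) + M * (LINT x:T|lebesgue. \<bar>V j x - z x \<bullet> i\<bar>)"
          using nonneg[of "\<lambda>x. norm (grad (W j) x - G i x)" lebesgue T] by simp
      qed
      have int\<gamma>: "set_integrable (side_measure (facet T b)) (facet T b) (\<gamma> b i)"
      proof (cases "b = a")
        case True
        have "(\<lambda>x. indicator ?S x *\<^sub>R (?\<eta> x * (g x \<bullet> i))) = (\<lambda>x. ?\<eta> x * (indicator ?S x *\<^sub>R (g x \<bullet> i)))"
          by (simp add: ac_simps)
        moreover have "integrable ?M (\<lambda>x. ?\<eta> x * (indicator ?S x *\<^sub>R (g x \<bullet> i)))"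
        proof (rule Bochner_Integration.integrable_bound[OF gi[OF i, unfolded set_integrable_def]])
          show "AE x in ?M. norm (?\<eta> x * (indicator ?S x *\<^sub>R (g x \<bullet> i))) \<le> norm (indicator ?S x *\<^sub>R (g x \<bullet> i))"
            using v(2,3)[of k] by (intro AE_I2) (simp add: abs_mult mult_left_le_one_le)
          have "?\<eta> \<in> borel_measurable ?M"
            using c\<eta>(1) by (simp add: borel_measurable_continuous_onI measurable_cong_sets[OF sM(1) refl])
          then show "(\<lambda>x. ?\<eta> x * (indicator ?S x *\<^sub>R (g x \<bullet> i))) \<in> borel_measurable ?M"
            using gi[OF i] by (intro borel_measurable_times) (auto simp: set_integrable_def)
        qed
        ultimately show ?thesis by (simp add: \<gamma>_def True set_integrable_def)
      next
        case False
        then show ?thesis by (simp add: \<gamma>_def set_integrable_def)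
      qed
      have l3: "(\<lambda>j. LINT x:facet T b|side_measure (facet T b). \<bar>W j x - \<gamma> b i x\<bar>) \<longlonglongrightarrow> 0"
      proof (cases "b = a")
        case True
        have n1: "norm ?n = 1" using A.side_normal(1)[OF a] by (simp add: facet_def)
        show ?thesis unfolding True
        proof (rule Lim_null_comparison[OF _ V(4)], intro always_eventually allI)
          fix j
          have iS: "set_integrable ?M ?S (\<lambda>x. \<bar>V j x - g x \<bullet> i\<bar>)"
            unfolding side_measure_def
            by (intro set_integrable_abs set_integral_diff gi[OF i, unfolded side_measure_def]
                set_integrable_plane_continuous[OF n1 facet_compact] C1_fun_continuous V(1))
          have "(LINT x:?S|?M. \<bar>W j x - \<gamma> a i x\<bar>) \<le> (LINT x:?S|?M. \<bar>V j x - g x \<bullet> i\<bar>)"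
          proof (rule set_integral_mono[OF _ iS])
            show "set_integrable ?M ?S (\<lambda>x. \<bar>W j x - \<gamma> a i x\<bar>)"
              using int\<gamma> unfolding True
              by (intro set_integrable_abs set_integral_diff)
                 (auto simp: side_measure_def intro!: set_integrable_plane_continuous[OF n1 facet_compact] C1_fun_continuous W)
            fix x
            have "\<bar>W j x - \<gamma> a i x\<bar> = ?\<eta> x * \<bar>V j x - g x \<bullet> i\<bar>"
              using v(2)[of k x] by (simp add: W_def \<gamma>_def abs_mult right_diff_distrib[symmetric])
            also have "\<dots> \<le> \<bar>V j x - g x \<bullet> i\<bar>" using v(2,3)[of k x] by (intro mult_left_le_one_le) auto
            finally show "\<bar>W j x - \<gamma> a i x\<bar> \<le> \<bar>V j x - g x \<bullet> i\<bar>" .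
          qed
          then show "norm (LINT x:?S|?M. \<bar>W j x - \<gamma> a i x\<bar>) \<le> (LINT x:?S|?M. \<bar>V j x - g x \<bullet> i\<bar>)"
            using nonneg[of "\<lambda>x. \<bar>W j x - \<gamma> a i x\<bar>" ?M ?S] by simp
        qed
      next
        case False
        have z: "indicator (facet T b) x *\<^sub>R \<bar>W j x - \<gamma> b i x\<bar> = 0" for j x
          using v(4)[of x k] b False by (auto simp: W_def \<gamma>_def U_def indicator_def)
        then have "(LINT x:facet T b|side_measure (facet T b). \<bar>W j x - \<gamma> b i x\<bar>) = 0" for j
          unfolding set_lebesgue_integral_def z by simp
        then show ?thesis by simp
      qed
      show ?thesis
        by (rule A.side_mean_limit[where V = W, OF b W(1), unfolded TT, folded facet_def, OF wi[OF i] Gi[OF i] int\<gamma> l1 l2 l3])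
    qed
    have "(\<Sum>b\<in>verts T. \<Sum>i\<in>Basis. (bgrad (verts T) b \<bullet> i) * (LINT x:T|lebesgue. ?d * (w x \<bullet> i) + G i x \<bullet> (x - b)))
       = - (LINT x:T|lebesgue. (\<Sum>i\<in>Basis. G i x \<bullet> i))"
      by (rule A.gauss_identity[unfolded TT, OF wi Gi])
    moreover have "(LINT x:T|lebesgue. (\<Sum>i\<in>Basis. G i x \<bullet> i)) = (LINT x:T|lebesgue. z x \<bullet> grad ?\<eta> x + ?\<eta> x * wdiv \<Omega> z x)"
    proof (rule set_integral_cong_AE_element[OF T])
      show "set_integrable lebesgue T (\<lambda>x. \<Sum>i\<in>Basis. G i x \<bullet> i)"
        by (intro set_integral_finite_sum(2) set_integrable_inner_const Gi)
      show "set_integrable lebesgue T (\<lambda>x. z x \<bullet> grad ?\<eta> x + ?\<eta> x * wdiv \<Omega> z x)"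
        by (rule set_integrable_element[OF T ibp_int])
      show "AE x in lebesgue_on \<Omega>. (\<Sum>i\<in>Basis. G i x \<bullet> i) = z x \<bullet> grad ?\<eta> x + ?\<eta> x * wdiv \<Omega> z x"
        using wdiv_components[OF z1]
      proof eventually_elim
        fix x assume x: "wdiv \<Omega> z x = (\<Sum>i\<in>Basis. wgrad \<Omega> (\<lambda>x. z x \<bullet> i) x \<bullet> i)"
        show "(\<Sum>i\<in>Basis. G i x \<bullet> i) = z x \<bullet> grad ?\<eta> x + ?\<eta> x * wdiv \<Omega> z x"
        proof -
          have zg: "z x \<bullet> grad ?\<eta> x = (\<Sum>i\<in>Basis. (z x \<bullet> i) * (grad ?\<eta> x \<bullet> i))" by (rule euclidean_inner)
          have "(\<Sum>i\<in>Basis. G i x \<bullet> i) = ?\<eta> x * (\<Sum>i\<in>Basis. wgrad \<Omega> (\<lambda>x. z x \<bullet> i) x \<bullet> i) + (\<Sum>i\<in>Basis. (z x \<bullet> i) * (grad ?\<eta> x \<bullet> i))"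
            by (simp only: G_def inner_add_left inner_scaleR_left sum.distrib sum_distrib_left)
          then show ?thesis by (simp only: x zg add.commute)
        qed
      qed
    qed
    ultimately have "(\<Sum>b\<in>verts T. \<Sum>i\<in>Basis. (bgrad (verts T) b \<bullet> i) * (LINT x:T|lebesgue. ?d * (w x \<bullet> i) + G i x \<bullet> (x - b))) = 0"
      using ibpT by simp
    moreover have "(LINT x:T|lebesgue. ?d * (w x \<bullet> i) + G i x \<bullet> (x - b)) = (?d * measure lebesgue T) * side_mean (facet T b) (\<gamma> b i)"
      if "b \<in> verts T" "i \<in> Basis" for b i
      using means[OF that] element_measure_pos[OF T] by simp
    ultimately have "(\<Sum>b\<in>verts T. \<Sum>i\<in>Basis. (bgrad (verts T) b \<bullet> i) * ((?d * measure lebesgue T) * side_mean (facet T b) (\<gamma> b i))) = 0"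
      by simp
    moreover have "side_mean (facet T b) (\<gamma> b i) = (if b = a then side_mean ?S (\<lambda>x. ?\<eta> x * (g x \<bullet> i)) else 0)" for b i
      by (simp add: \<gamma>_def[abs_def] side_mean_def set_lebesgue_integral_def)
    then have "(\<Sum>i\<in>Basis. (bgrad (verts T) b \<bullet> i) * ((?d * measure lebesgue T) * side_mean (facet T b) (\<gamma> b i))) =
      (if b = a then \<Sum>i\<in>Basis. (bgrad (verts T) a \<bullet> i) * ((?d * measure lebesgue T) * side_mean ?S (\<lambda>x. ?\<eta> x * (g x \<bullet> i))) else 0)" for b
      by (cases "b = a") simp_all
    ultimately have "(\<Sum>b\<in>verts T. if b = a then \<Sum>i\<in>Basis. (bgrad (verts T) a \<bullet> i) * ((?d * measure lebesgue T) * side_mean ?S (\<lambda>x. ?\<eta> x * (g x \<bullet> i))) else 0) = 0"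
      by simp
    then have s0: "(\<Sum>i\<in>Basis. (bgrad (verts T) a \<bullet> i) * side_mean ?S (\<lambda>x. ?\<eta> x * (g x \<bullet> i))) = 0"
      using a A.finC element_measure_pos[OF T] by (simp add: sum_distrib_left[symmetric] mult.left_commute[of _ "?d * _"])
    \<comment> \<open>Only the vertex \<open>a\<close> is left in the sum; the nonzero factor
      \<open>?\<kappa>\<close> passes from \<open>bgrad\<close> to the chosen side normal.\<close>
    let ?\<kappa> = "bgrad (verts T) a \<bullet> ?n"
    have bg: "bgrad (verts T) a = ?\<kappa> *\<^sub>R ?n" "?\<kappa> \<noteq> 0"
      using A.side_normal(2,3)[OF a] A.bgrad_nonzero[OF a] unfolding facet_def by auto
    have bi: "?\<kappa> * (?n \<bullet> i) = bgrad (verts T) a \<bullet> i" for i using bg(1) by (metis inner_scaleR_left)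
    have "?\<kappa> * (\<Sum>i\<in>Basis. (?n \<bullet> i) * side_mean ?S (\<lambda>x. ?\<eta> x * (g x \<bullet> i))) = 0"
      unfolding sum_distrib_left mult.assoc[symmetric] bi by (rule s0)
    then have "(\<Sum>i\<in>Basis. (?n \<bullet> i) * side_mean ?S (\<lambda>x. (?\<eta> x *\<^sub>R g x) \<bullet> i)) = 0" using bg(2) by simp
    moreover have "side_mean ?S (\<lambda>x. (?\<eta> x *\<^sub>R g x) \<bullet> ?n) = (\<Sum>i\<in>Basis. (?n \<bullet> i) * side_mean ?S (\<lambda>x. (?\<eta> x *\<^sub>R g x) \<bullet> i))"
    proof (rule A.side_mean_inner)
      fix i :: 'a assume i: "i \<in> Basis"
      have "integrable ?M (\<lambda>x. ?\<eta> x * (indicator ?S x *\<^sub>R (g x \<bullet> i)))"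
      proof (rule Bochner_Integration.integrable_bound[OF gi[OF i, unfolded set_integrable_def]])
        show "AE x in ?M. norm (?\<eta> x * (indicator ?S x *\<^sub>R (g x \<bullet> i))) \<le> norm (indicator ?S x *\<^sub>R (g x \<bullet> i))"
          using v(2,3)[of k] by (intro AE_I2) (simp add: abs_mult mult_left_le_one_le)
        have "?\<eta> \<in> borel_measurable ?M"
          using c\<eta>(1) by (simp add: borel_measurable_continuous_onI measurable_cong_sets[OF sM(1) refl])
        then show "(\<lambda>x. ?\<eta> x * (indicator ?S x *\<^sub>R (g x \<bullet> i))) \<in> borel_measurable ?M"
          using gi[OF i] by (intro borel_measurable_times) (auto simp: set_integrable_def)
      qed
      then show "set_integrable ?M ?S (\<lambda>x. (?\<eta> x *\<^sub>R g x) \<bullet> i)" by (simp add: set_integrable_def ac_simps)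
    qed
    ultimately have "side_mean ?S (\<lambda>x. ?\<eta> x * (g x \<bullet> ?n)) = 0" by simp
    then show ?thesis using A.facet_measure_pos[OF a] by (simp add: side_mean_def facet_def)
  qed
  \<comment> \<open>The test functions tend to 1 on the relative interior of the facet, that is
    almost everywhere on it, and their values in the unit interval allow dominated
    convergence.\<close>
  have "(\<lambda>k. LINT x|?M. v k x * (indicator ?S x *\<^sub>R (g x \<bullet> ?n))) \<longlonglongrightarrow> (LINT x|?M. indicator ?S x *\<^sub>R (g x \<bullet> ?n))"
  proof (rule integral_dominated_convergence)
    show "integrable ?M (\<lambda>x. norm (indicator ?S x *\<^sub>R (g x \<bullet> ?n)))"
      using gn[of ?n] unfolding set_integrable_def by (rule integrable_norm)
    show "(\<lambda>x. indicator ?S x *\<^sub>R (g x \<bullet> ?n)) \<in> borel_measurable ?M"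
      using gn[of ?n] by (auto simp: set_integrable_def)
    show "AE x in ?M. norm (v k x * (indicator ?S x *\<^sub>R (g x \<bullet> ?n))) \<le> norm (indicator ?S x *\<^sub>R (g x \<bullet> ?n))" for k
      using v(2,3)[of k] by (intro AE_I2) (simp add: abs_mult mult_left_le_one_le)
    show "(\<lambda>x. v k x * (indicator ?S x *\<^sub>R (g x \<bullet> ?n))) \<in> borel_measurable ?M" for k
    proof -
      have "v k \<in> borel_measurable ?M"
        using C1_fun_continuous[OF v(1)] by (simp add: borel_measurable_continuous_onI measurable_cong_sets[OF sM(1) refl])
      then show ?thesis using gn[of ?n] by (intro borel_measurable_times) (auto simp: set_integrable_def)
    qed
    show "AE x in ?M. (\<lambda>k. v k x * (indicator ?S x *\<^sub>R (g x \<bullet> ?n))) \<longlonglongrightarrow> indicator ?S x *\<^sub>R (g x \<bullet> ?n)"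
      using A.AE_side_measure_rel_interior[OF a, folded facet_def]
    proof eventually_elim
      fix x assume nz: "\<forall>b\<in>verts T - {a}. bary (verts T) b x \<noteq> 0"
      show "(\<lambda>k. v k x * (indicator ?S x *\<^sub>R (g x \<bullet> ?n))) \<longlonglongrightarrow> indicator ?S x *\<^sub>R (g x \<bullet> ?n)"
      proof (cases "x \<in> ?S")
        case True
        then have xT: "x \<in> T" "bary (verts T) a x = 0" using A.mem_facet_iff[OF a] TT by (auto simp: facet_def)
        have "x \<in> rel_interior ?S"
          unfolding facet_def A.rel_interior_facet[OF a]
          using xT nz A.mem_T_iff[of x] TT by (force simp: less_le)
        then have "x \<in> - \<Union>(\<T> - {T})" using unique_side_neighbourhood(2)[OF T a unique] by blast
        moreover have "x \<notin> facet T b" if "b \<in> verts T - {a}" for b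
          using that nz A.mem_facet_iff[of b x] by (auto simp: facet_def)
        ultimately have "x \<in> U" by (auto simp: U_def)
        then have "(\<lambda>k. v k x * (indicator ?S x *\<^sub>R (g x \<bullet> ?n))) \<longlonglongrightarrow> 1 * (indicator ?S x *\<^sub>R (g x \<bullet> ?n))"
          by (intro tendsto_mult v(5) tendsto_const)
        then show ?thesis by simp
      qed simp
    qed
  qed
  moreover have "(LINT x|?M. v k x * (indicator ?S x *\<^sub>R (g x \<bullet> ?n))) = 0" for k
    using zero[of k] by (simp add: set_lebesgue_integral_def ac_simps)
  ultimately have "(LINT x:?S|?M. g x \<bullet> ?n) = 0"
    by (simp add: set_lebesgue_integral_def LIMSEQ_const_iff)
  then show ?thesis by (simp add: side_mean_def)
qed

end

section \<open>Discrete integration by parts\<close>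

context triangulated_domain
begin

text \<open>The vertex opposite to the side. It allows quantities attached to a vertex of an element
  to be indexed by sides, as the exchange of the double sum requires.\<close>

definition apex :: "'a set \<Rightarrow> 'a set \<Rightarrow> 'a" where
  "apex T S = (THE a. a \<in> verts T \<and> S = facet T a)"

lemma apex_facet: "T \<in> \<T> \<Longrightarrow> a \<in> verts T \<Longrightarrow> apex T (facet T a) = a"
  unfolding apex_def using full_simplex.facet_inj[OF element(1)] by (intro the_equality) (auto simp: facet_def)

text \<open>Equal to 1 if the chosen normal of the side points into the element and to -1 if it
  points outwards.\<close>

definition side_sign :: "'a set \<Rightarrow> 'a set \<Rightarrow> real" where
  "side_sign T S = sgn (bgrad (verts T) (apex T S) \<bullet> side_normal S)"

lemma finite_sides: "finite (sides \<T>)"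
proof -
  have "sides \<T> \<subseteq> (\<Union>T\<in>\<T>. facet T ` verts T)"
    by (auto simp: sides_def facet_of_element_iff facet_def)
  moreover have "finite (\<Union>T\<in>\<T>. facet T ` verts T)"
    using fin\<T> full_simplex.finC[OF element(1)] by auto
  ultimately show ?thesis by (rule finite_subset)
qed

lemma side_sign_opposite:
  assumes "T \<in> \<T>" "T' \<in> \<T>" "T \<noteq> T'" "S facet_of T" "S facet_of T'"
  shows "side_sign T S * side_sign T' S < 0"
proof -
  obtain a where a: "a \<in> verts T" "S = facet T a" using assms facet_of_element_iff by (auto simp: facet_def)
  obtain a' where a': "a' \<in> verts T'" "S = facet T' a'" using assms facet_of_element_iff by (auto simp: facet_def)
  have "apex T S = a" using apex_facet[OF assms(1) a(1)] a(2) by simp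
  moreover have "apex T' S = a'" using apex_facet[OF assms(2) a'(1)] a'(2) by simp
  ultimately have "side_sign T S * side_sign T' S =
      sgn ((bgrad (verts T) a \<bullet> side_normal S) * (bgrad (verts T') a' \<bullet> side_normal S))"
    by (simp add: side_sign_def sgn_mult)
  also have "\<dots> < 0" using opposite_normals[OF assms(1-3) a(1) a'(1)] a(2) a'(2) by simp
  finally show ?thesis .
qed

lemma sum_sides_swap:
  fixes F :: "'a set \<Rightarrow> 'a set \<Rightarrow> real"
  shows "(\<Sum>T\<in>\<T>. \<Sum>a\<in>verts T. F T (facet T a)) = (\<Sum>S\<in>sides \<T>. \<Sum>T\<in>{T\<in>\<T>. S facet_of T}. F T S)"
proof -
  have "(\<Sum>a\<in>verts T. F T (facet T a)) = (\<Sum>S\<in>{S\<in>sides \<T>. S facet_of T}. F T S)" if T: "T \<in> \<T>" for T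
  proof (rule sum.reindex_bij_betw)
    have "inj_on (facet T) (verts T)"
      using full_simplex.facet_inj[OF element(1)[OF T]] by (auto simp: inj_on_def facet_def)
    moreover have "facet T ` verts T = {S\<in>sides \<T>. S facet_of T}"
      using facet_of_element_iff[OF T] facet_side[OF T] by (auto simp: facet_def)
    ultimately show "bij_betw (facet T) (verts T) {S\<in>sides \<T>. S facet_of T}" by (simp add: bij_betw_def)
  qed
  then have "(\<Sum>T\<in>\<T>. \<Sum>a\<in>verts T. F T (facet T a)) = (\<Sum>T\<in>\<T>. \<Sum>S\<in>{S\<in>sides \<T>. S facet_of T}. F T S)"
    by simp
  also have "\<dots> = (\<Sum>S\<in>sides \<T>. \<Sum>T\<in>{T\<in>\<T>. S facet_of T}. F T S)"
    by (rule sum.swap_restrict[OF fin\<T> finite_sides])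
  finally show ?thesis .
qed

text \<open>Discrete integration by parts on the whole domain: the elementwise identities are added
  and rearranged by sides. On an inner side the contributions of the two elements cancel. On a
  boundary side the value of \<open>w\<close> at the barycenter vanishes in the Dirichlet case and
  the mean normal trace of z in the Neumann case.\<close>

lemma discrete_ibp_sum:
  fixes c :: "'a set \<Rightarrow> real" and g \<alpha> :: "'a set \<Rightarrow> 'a" and \<beta> :: "'a set \<Rightarrow> real"
  assumes \<Gamma>\<^sub>D: "\<Gamma>\<^sub>D \<subseteq> frontier \<Omega>"
    and bs: "\<And>S. S \<in> sides \<T> \<Longrightarrow> S \<subseteq> frontier \<Omega> \<Longrightarrow>
          boundary_side_in \<Omega> \<Gamma>\<^sub>D S \<or> boundary_side_in \<Omega> (frontier \<Omega> - \<Gamma>\<^sub>D) S"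
    and zN: "z \<in> W_div_N 1 \<Omega> \<Gamma>\<^sub>D" and z1: "z \<in> W1_vec 1 \<Omega>"
    and w: "w \<in> CR_D \<Omega> \<Gamma>\<^sub>D \<T>" and Irt: "is_RT_interpolant \<Omega> \<T> z y"
    and aff: "\<And>T x. T \<in> \<T> \<Longrightarrow> x \<in> interior T \<Longrightarrow> w x = c T + g T \<bullet> x"
    and RT: "\<And>T x. T \<in> \<T> \<Longrightarrow> x \<in> interior T \<Longrightarrow> y x = \<alpha> T + \<beta> T *\<^sub>R (x - barycenter T)"
  shows "(\<Sum>T\<in>\<T>. measure lebesgue T * (g T \<bullet> \<alpha> T + (c T + g T \<bullet> barycenter T) * (real DIM('a) * \<beta> T))) = 0"
proof -
  let ?d = "real DIM('a)"
  have d: "set_integrable lebesgue \<Omega> (wdiv \<Omega> z)" using zN by (auto simp: W_div_N_def intro: Lp1_set_integrable)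
  obtain \<gamma> where \<gamma>: "\<forall>S\<in>sides \<T>. \<forall>i\<in>Basis. has_trace \<Omega> S (\<lambda>x. z x \<bullet> i) (\<lambda>x. \<gamma> S x \<bullet> i)"
    "\<forall>T\<in>\<T>. \<forall>a\<in>verts T. \<forall>\<alpha> \<beta>. (\<forall>x\<in>interior T. y x = \<alpha> + \<beta> *\<^sub>R (x - barycenter T)) \<longrightarrow>
      (\<alpha> + \<beta> *\<^sub>R (barycenter (facet T a) - barycenter T)) \<bullet> side_normal (facet T a) =
      side_mean (facet T a) (\<lambda>x. \<gamma> (facet T a) x \<bullet> side_normal (facet T a))"
    using RT_interpolant(1)[OF z1 d Irt] by blast
  have wCR: "w \<in> CR \<T>" using w by (simp add: CR_D_def)
  define m where "m S = side_mean S (\<lambda>x. \<gamma> S x \<bullet> side_normal S)" for S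
  \<comment> \<open>All factors except the sign depend only on the side. This uses the
    single-valuedness of \<open>w\<close> at barycenters and of the normal component of the
    interpolant.\<close>
  define F where "F T S = w (barycenter S) * measure (side_measure S) S * m S * side_sign T S" for T S
  have local: "measure lebesgue T * (g T \<bullet> \<alpha> T + (c T + g T \<bullet> barycenter T) * (?d * \<beta> T)) = - (\<Sum>a\<in>verts T. F T (facet T a))"
    if T: "T \<in> \<T>" for T
  proof -
    interpret A: full_simplex "verts T" by (rule element[OF T])
    have TT: "convex hull (verts T) = T" by (rule element(2)[OF T])
    have *: "(c T + g T \<bullet> barycenter (facet T a)) *
       (bgrad (verts T) a \<bullet> (\<alpha> T + \<beta> T *\<^sub>R (barycenter (facet T a) - barycenter T))) * (?d * measure lebesgue T)
       = F T (facet T a)" if a: "a \<in> verts T" for a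
    proof -
      let ?S = "facet T a" let ?n = "side_normal ?S" let ?\<kappa> = "bgrad (verts T) a \<bullet> ?n"
      have "bgrad (verts T) a = ?\<kappa> *\<^sub>R ?n" using A.side_normal(2)[OF a] unfolding facet_def .
      then have "bgrad (verts T) a \<bullet> (\<alpha> T + \<beta> T *\<^sub>R (barycenter ?S - barycenter T))
         = ?\<kappa> * ((\<alpha> T + \<beta> T *\<^sub>R (barycenter ?S - barycenter T)) \<bullet> ?n)" by (metis inner_scaleR_left inner_commute)
      also have "\<dots> = ?\<kappa> * m ?S" using \<gamma>(2) T a RT[OF T] by (simp add: m_def)
      also have "?\<kappa> = side_sign T ?S * norm (bgrad (verts T) a)"
        using A.side_normal(3)[OF a] unfolding facet_def[symmetric]
        by (simp add: side_sign_def apex_facet[OF T a] sgn_mult_abs)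
      finally have 1: "bgrad (verts T) a \<bullet> (\<alpha> T + \<beta> T *\<^sub>R (barycenter ?S - barycenter T))
         = side_sign T ?S * norm (bgrad (verts T) a) * m ?S" .
      have 2: "measure (side_measure ?S) ?S = norm (bgrad (verts T) a) * (?d * measure lebesgue T)"
        using A.facet_measure[OF a] by (simp add: facet_def TT)
      have 3: "w (barycenter ?S) = c T + g T \<bullet> barycenter ?S"
        by (rule CR_barycenter_side[OF wCR T a aff[OF T]])
      show ?thesis unfolding F_def 1 2 3 by (simp only: ac_simps)
    qed
    have "measure lebesgue T * (g T \<bullet> \<alpha> T + (c T + g T \<bullet> barycenter T) * (?d * \<beta> T)) =
       - (\<Sum>a\<in>verts T. (c T + g T \<bullet> barycenter (facet T a)) *
       (bgrad (verts T) a \<bullet> (\<alpha> T + \<beta> T *\<^sub>R (barycenter (facet T a) - barycenter T)))) * (?d * measure lebesgue T)"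
      unfolding A.discrete_ibp[unfolded TT, folded facet_def] by (simp only: mult_minus_left mult_minus_right ac_simps)
    also have "\<dots> = - (\<Sum>a\<in>verts T. (c T + g T \<bullet> barycenter (facet T a)) *
       (bgrad (verts T) a \<bullet> (\<alpha> T + \<beta> T *\<^sub>R (barycenter (facet T a) - barycenter T))) * (?d * measure lebesgue T))"
      by (simp only: sum_distrib_right mult_minus_left)
    finally show ?thesis using * by simp
  qed
  have side: "(\<Sum>T\<in>{T\<in>\<T>. S facet_of T}. F T S) = 0" if S: "S \<in> sides \<T>" for S
  proof -
    obtain T where T: "T \<in> \<T>" "S facet_of T" using S by (auto simp: sides_def)
    then obtain a where a: "a \<in> verts T" "S = facet T a" using facet_of_element_iff by (auto simp: facet_def)
    show ?thesis
    proof (cases "\<exists>T'\<in>\<T>. S facet_of T' \<and> T' \<noteq> T")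
      case True
      then obtain T' where T': "T' \<in> \<T>" "S facet_of T'" "T' \<noteq> T" by blast
      have opp: "side_sign T S * side_sign T' S < 0" using side_sign_opposite T T' by metis
      \<comment> \<open>No side belongs to three elements, since three nonzero numbers cannot have
        pairwise opposite signs.\<close>
      have "T'' = T \<or> T'' = T'" if T'': "T'' \<in> \<T>" "S facet_of T''" for T''
      proof (rule ccontr)
        assume "\<not> (T'' = T \<or> T'' = T')"
        then have "side_sign T S * side_sign T'' S < 0" "side_sign T' S * side_sign T'' S < 0"
          using side_sign_opposite T T' T'' by metis+
        then show False using opp by (auto simp: mult_less_0_iff)
      qed
      then have "{T\<in>\<T>. S facet_of T} = {T, T'}" using T T' by blast
      then have "(\<Sum>T\<in>{T\<in>\<T>. S facet_of T}. F T S) = F T S + F T' S" using T'(3) by simp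
      also have "side_sign T S + side_sign T' S = 0"
        using opp by (auto simp: side_sign_def sgn_if split: if_splits)
      then have "F T S + F T' S = 0" unfolding F_def by (simp add: distrib_left[symmetric])
      finally show ?thesis .
    next
      case False
      then have unique: "\<And>T'. T' \<in> \<T> \<Longrightarrow> facet T a facet_of T' \<Longrightarrow> T' = T" using a by blast
      have "S \<subseteq> frontier \<Omega>" using unique_side_frontier[OF T(1) a(1) unique] a(2) by simp
      then consider "boundary_side_in \<Omega> \<Gamma>\<^sub>D S" | "boundary_side_in \<Omega> (frontier \<Omega> - \<Gamma>\<^sub>D) S" using bs[OF S] by blast
      then have "w (barycenter S) * m S = 0"
      proof cases
        case 1
        then have "w (barycenter S) = 0" using w S by (simp add: CR_D_def)
        then show ?thesis by simp
      next
        case 2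
        have "m S = 0" unfolding m_def a(2)
          by (rule normal_trace_zero[OF T(1) a(1) unique \<Gamma>\<^sub>D 2[unfolded a(2)] zN z1 \<gamma>(1)[rule_format, OF facet_side[OF T(1) a(1)]]])
        then show ?thesis by simp
      qed
      then have "F T' S = 0" for T' by (auto simp: F_def)
      then show ?thesis by simp
    qed
  qed
  have "(\<Sum>T\<in>\<T>. measure lebesgue T * (g T \<bullet> \<alpha> T + (c T + g T \<bullet> barycenter T) * (?d * \<beta> T)))
     = - (\<Sum>T\<in>\<T>. \<Sum>a\<in>verts T. F T (facet T a))"
    by (simp add: local sum_negf)
  also have "\<dots> = 0" unfolding sum_sides_swap by (simp add: side)
  finally show ?thesis .
qed

lemma proj0_element:
  fixes v :: "'a \<Rightarrow> 'b::euclidean_space"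
  assumes T: "T \<in> \<T>" and x: "x \<in> interior T"
  shows "proj0 \<T> v x = (LINT y:T|lebesgue. v y) /\<^sub>R measure lebesgue T"
proof -
  have "proj0 \<T> v x = (\<Sum>T'\<in>\<T>. if T' = T then (1 / measure lebesgue T) *\<^sub>R (LINT y:T|lebesgue. v y) else 0)"
    unfolding proj0_def
  proof (rule sum.cong[OF refl])
    fix T' assume T': "T' \<in> \<T>"
    show "indicator (interior T') x *\<^sub>R ((1 / measure lebesgue T') *\<^sub>R (LINT y:T'|lebesgue. v y)) =
        (if T' = T then (1 / measure lebesgue T) *\<^sub>R (LINT y:T|lebesgue. v y) else 0)"
      using interiors_disjoint[OF T T' x] x by (cases "T' = T") (auto simp: indicator_def)
  qed
  then show ?thesis using T fin\<T> by (simp add: divide_inverse)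
qed

lemma grad_h_element:
  assumes T: "T \<in> \<T>" and x: "x \<in> interior T" and aff: "\<And>x. x \<in> interior T \<Longrightarrow> v x = c + g \<bullet> x"
  shows "grad_h \<T> v x = g"
proof -
  have "((\<lambda>x. c + g \<bullet> x) has_derivative (\<lambda>h. g \<bullet> h)) (at x)"
    by (auto intro!: derivative_eq_intros)
  then have "(v has_derivative (\<lambda>h. g \<bullet> h)) (at x)"
    by (rule has_derivative_transform_within_open[OF _ open_interior x]) (simp add: aff)
  then have "grad v x = g" by (rule grad_eqI)
  then show ?thesis using T x by (auto simp: grad_h_def)
qed

lemma integral_cong_interior:
  fixes f h :: "'a \<Rightarrow> 'b::euclidean_space"
  assumes T: "T \<in> \<T>" and h: "set_integrable lebesgue T h" and eq: "\<And>x. x \<in> interior T \<Longrightarrow> f x = h x"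
  shows "set_integrable lebesgue T f" "(LINT x:T|lebesgue. f x) = (LINT x:T|lebesgue. h x)"
proof -
  have ae: "AE x in lebesgue. indicat_real T x *\<^sub>R h x = indicat_real T x *\<^sub>R f x"
    using AE_interior_element[OF T] by eventually_elim (use eq in \<open>auto simp: indicator_def\<close>)
  have m: "(\<lambda>x. indicat_real T x *\<^sub>R f x) \<in> borel_measurable lebesgue"
    by (rule borel_measurable_AE[OF _ ae]) (use h in \<open>auto simp: set_integrable_def\<close>)
  show "set_integrable lebesgue T f" unfolding set_integrable_def
    by (rule integrable_cong_AE_imp[OF h[unfolded set_integrable_def] m]) (use ae in \<open>auto elim: eventually_mono\<close>)
  show "(LINT x:T|lebesgue. f x) = (LINT x:T|lebesgue. h x)" unfolding set_lebesgue_integral_def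
    by (rule integral_cong_AE) (use m h ae in \<open>auto simp: set_integrable_def elim: eventually_mono\<close>)
qed

lemma proj0_affine:
  assumes T: "T \<in> \<T>" and x: "x \<in> interior T" and aff: "\<And>x. x \<in> interior T \<Longrightarrow> v x = c + g \<bullet> x"
  shows "proj0 \<T> v x = c + g \<bullet> barycenter T"
proof -
  interpret A: full_simplex "verts T" by (rule element[OF T])
  have TT: "convex hull (verts T) = T" by (rule element(2)[OF T])
  have "set_integrable lebesgue T (\<lambda>x. c + g \<bullet> x)"
    by (rule set_integrable_lebesgue_continuous[OF element_compact[OF T]]) (intro continuous_intros)
  then have "(LINT x:T|lebesgue. v x) = (LINT x:T|lebesgue. c + g \<bullet> x)"
    by (rule integral_cong_interior(2)[OF T]) (rule aff)
  also have "\<dots> = measure lebesgue T * (c + g \<bullet> barycenter T)"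
    using A.integral_affine[of c g] by (simp add: TT)
  finally show ?thesis using element_measure_pos[OF T] by (simp add: proj0_element[OF T x])
qed

lemma proj0_RT:
  assumes T: "T \<in> \<T>" and x: "x \<in> interior T"
    and RT: "\<And>x. x \<in> interior T \<Longrightarrow> y x = \<alpha> + \<beta> *\<^sub>R (x - barycenter T)"
  shows "proj0 \<T> y x = \<alpha>"
proof -
  interpret A: full_simplex "verts T" by (rule element[OF T])
  have TT: "convex hull (verts T) = T" by (rule element(2)[OF T])
  have "set_integrable lebesgue T (\<lambda>x. \<alpha> + \<beta> *\<^sub>R (x - barycenter T))"
    by (rule set_integrable_lebesgue_continuous[OF element_compact[OF T]]) (intro continuous_intros)
  then have "(LINT x:T|lebesgue. y x) = (LINT x:T|lebesgue. \<alpha> + \<beta> *\<^sub>R (x - barycenter T))"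
    by (rule integral_cong_interior(2)[OF T]) (rule RT)
  also have "\<dots> = measure lebesgue T *\<^sub>R \<alpha>"
    using A.integral_RT_field[of \<alpha> \<beta>] by (simp add: TT)
  finally show ?thesis using element_measure_pos[OF T] by (simp add: proj0_element[OF T x])
qed

end

section \<open>Extended-real integrals and conjugates\<close>

lemma ennreal_real_of_ereal: "\<bar>y\<bar> \<noteq> \<infinity> \<Longrightarrow> ennreal (real_of_ereal y) = e2ennreal y"
  by (cases y) auto

lemma qint_real:
  assumes g: "integrable M g" and eq: "AE x in M. f x = ereal (g x)"
  shows "qint M f = ereal (LINT x|M. g x)"
proof -
  let ?A = "\<integral>\<^sup>+x. ennreal (g x) \<partial>M" and ?B = "\<integral>\<^sup>+x. ennreal (- g x) \<partial>M"
  have AB: "?A \<noteq> \<infinity>" "?B \<noteq> \<infinity>" using g by (auto simp: real_integrable_def)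
  have "(\<integral>\<^sup>+x. e2ennreal (f x) \<partial>M) = ?A" "(\<integral>\<^sup>+x. e2ennreal (- f x) \<partial>M) = ?B"
    by (rule nn_integral_cong_AE, use eq in eventually_elim, simp)+
  then have "qint M f = enn2ereal ?A - enn2ereal ?B" by (simp add: qint_def)
  also have "\<dots> = ereal (enn2real ?A - enn2real ?B)"
    using AB by (cases ?A; cases ?B) (auto simp: enn2ereal_ennreal)
  also have "enn2real ?A - enn2real ?B = (LINT x|M. g x)"
    by (rule real_lebesgue_integral_def[OF g, symmetric])
  finally show ?thesis .
qed

lemma integrable_of_parts:
  fixes f :: "'a \<Rightarrow> ereal"
  assumes f: "f \<in> borel_measurable M"
    and A: "(\<integral>\<^sup>+x. e2ennreal (f x) \<partial>M) < \<infinity>" and B: "(\<integral>\<^sup>+x. e2ennreal (- f x) \<partial>M) < \<infinity>"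
  shows "integrable M (\<lambda>x. real_of_ereal (f x))" "AE x in M. f x = ereal (real_of_ereal (f x))"
    "qint M f = ereal (LINT x|M. real_of_ereal (f x))"
proof -
  have 1: "AE x in M. e2ennreal (f x) \<noteq> \<infinity>" "AE x in M. e2ennreal (- f x) \<noteq> \<infinity>"
    using nn_integral_PInf_AE[of "\<lambda>x. e2ennreal (f x)" M] nn_integral_PInf_AE[of "\<lambda>x. e2ennreal (- f x)" M] f A B by auto
  then have fin: "AE x in M. \<bar>f x\<bar> \<noteq> \<infinity>"
  proof eventually_elim
    fix x assume "e2ennreal (f x) \<noteq> \<infinity>" "e2ennreal (- f x) \<noteq> \<infinity>"
    then show "\<bar>f x\<bar> \<noteq> \<infinity>" by (cases "f x") auto
  qed
  then show eq: "AE x in M. f x = ereal (real_of_ereal (f x))"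
    by eventually_elim (simp add: ereal_real)
  have "(\<integral>\<^sup>+x. ennreal (real_of_ereal (f x)) \<partial>M) = (\<integral>\<^sup>+x. e2ennreal (f x) \<partial>M)"
    by (rule nn_integral_cong_AE, use fin in eventually_elim, rule ennreal_real_of_ereal)
  moreover have "(\<integral>\<^sup>+x. ennreal (- real_of_ereal (f x)) \<partial>M) = (\<integral>\<^sup>+x. e2ennreal (- f x) \<partial>M)"
    by (rule nn_integral_cong_AE, use fin in eventually_elim) (simp add: ennreal_real_of_ereal[symmetric])
  ultimately show i: "integrable M (\<lambda>x. real_of_ereal (f x))"
    using A B f by (auto simp: real_integrable_def)
  show "qint M f = ereal (LINT x|M. real_of_ereal (f x))" by (rule qint_real[OF i eq])
qed

lemma qint_finite_parts:
  assumes "\<bar>qint M f\<bar> \<noteq> \<infinity>"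
  shows "(\<integral>\<^sup>+x. e2ennreal (f x) \<partial>M) < \<infinity>" "(\<integral>\<^sup>+x. e2ennreal (- f x) \<partial>M) < \<infinity>"
proof -
  let ?A = "\<integral>\<^sup>+x. e2ennreal (f x) \<partial>M" and ?B = "\<integral>\<^sup>+x. e2ennreal (- f x) \<partial>M"
  have "\<bar>enn2ereal ?A - enn2ereal ?B\<bar> \<noteq> \<infinity>" using assms by (simp add: qint_def)
  then show "?A < \<infinity>" "?B < \<infinity>"
    by (cases ?A; cases ?B; auto simp: enn2ereal_ennreal less_top)+
qed

lemma qint_PInf:
  assumes "(\<integral>\<^sup>+x. e2ennreal (f x) \<partial>M) = \<infinity>" shows "qint M f = \<infinity>"
  using assms by (simp add: qint_def)

lemma qint_cong_AE:
  assumes "AE x in M. f x = g x" shows "qint M f = qint M g"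
proof -
  have "(\<integral>\<^sup>+x. e2ennreal (f x) \<partial>M) = (\<integral>\<^sup>+x. e2ennreal (g x) \<partial>M)" "(\<integral>\<^sup>+x. e2ennreal (- f x) \<partial>M) = (\<integral>\<^sup>+x. e2ennreal (- g x) \<partial>M)"
    by (rule nn_integral_cong_AE, use assms in eventually_elim, simp)+
  then show ?thesis by (simp add: qint_def)
qed

text \<open>The sum of extended-real integrals could meet \<infinity> - \<infinity>. Since all
  positive parts are integrable, the integrable lower bound \<open>l\<close> forces each negative
  part to be integrable as well: \<open>E i\<close> is at least \<open>l\<close> minus the positive
  parts of the others. All summands are then real integrable functions and the integral is
  additive.\<close>

lemma integral_le_sum_qint:
  fixes E :: "'i \<Rightarrow> 'a \<Rightarrow> ereal"
  assumes I: "finite I" and E: "\<And>i. i \<in> I \<Longrightarrow> E i \<in> borel_measurable M"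
    and P: "\<And>i. i \<in> I \<Longrightarrow> (\<integral>\<^sup>+x. e2ennreal (E i x) \<partial>M) < \<infinity>"
    and l: "integrable M l" and le: "AE x in M. ereal (l x) \<le> (\<Sum>i\<in>I. E i x)"
  shows "ereal (LINT x|M. l x) \<le> (\<Sum>i\<in>I. qint M (E i))"
proof -
  define p where "p i x = real_of_ereal (max 0 (E i x))" for i x
  have p: "integrable M (p i)" "AE x in M. E i x \<le> ereal (p i x)" if i: "i \<in> I" for i
  proof -
    have 1: "(\<lambda>x. max 0 (E i x)) \<in> borel_measurable M" using E[OF i] by simp
    have "e2ennreal (max 0 y) = e2ennreal y" "e2ennreal (- max 0 y) = 0" for y :: ereal
      by (auto simp: max_def e2ennreal_neg)
    then have 2: "(\<integral>\<^sup>+x. e2ennreal (max 0 (E i x)) \<partial>M) < \<infinity>" "(\<integral>\<^sup>+x. e2ennreal (- max 0 (E i x)) \<partial>M) < \<infinity>"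
      using P[OF i] by simp_all
    show "integrable M (p i)" unfolding p_def by (rule integrable_of_parts(1)[OF 1 2])
    show "AE x in M. E i x \<le> ereal (p i x)"
      using integrable_of_parts(2)[OF 1 2] by eventually_elim (metis p_def max.cobounded2)
  qed
  have parts: "integrable M (\<lambda>x. real_of_ereal (E i x))" "AE x in M. E i x = ereal (real_of_ereal (E i x))"
    "qint M (E i) = ereal (LINT x|M. real_of_ereal (E i x))" if i: "i \<in> I" for i
  proof -
    \<comment> \<open>An integrable lower bound for the single summand \<open>E i\<close>.\<close>
    define m where "m x = l x - (\<Sum>j\<in>I - {i}. p j x)" for x
    have m: "integrable M m" unfolding m_def
      by (intro Bochner_Integration.integrable_diff[OF l] Bochner_Integration.integrable_sum p(1)) simp
    have "AE x in M. \<forall>j\<in>I. E j x \<le> ereal (p j x)" using I p by (intro AE_finite_allI) auto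
    with le have "AE x in M. ereal (m x) \<le> E i x"
    proof eventually_elim
      fix x assume a: "ereal (l x) \<le> (\<Sum>i\<in>I. E i x)" and b: "\<forall>j\<in>I. E j x \<le> ereal (p j x)"
      have "(\<Sum>i\<in>I. E i x) = E i x + (\<Sum>j\<in>I - {i}. E j x)" using I i by (simp add: sum.remove)
      also have "\<dots> \<le> E i x + (\<Sum>j\<in>I - {i}. ereal (p j x))" using b by (intro add_left_mono sum_mono) auto
      finally have "ereal (l x) \<le> E i x + (\<Sum>j\<in>I - {i}. ereal (p j x))" by (rule order_trans[OF a])
      then have "ereal (l x) \<le> E i x + ereal (\<Sum>j\<in>I - {i}. p j x)" by simp
      then show "ereal (m x) \<le> E i x" by (cases "E i x") (auto simp: m_def)
    qed
    then have "(\<integral>\<^sup>+x. e2ennreal (- E i x) \<partial>M) \<le> (\<integral>\<^sup>+x. ennreal (- m x) \<partial>M)"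
    proof (intro nn_integral_mono_AE, eventually_elim)
      fix x assume "ereal (m x) \<le> E i x"
      then have "- E i x \<le> ereal (- m x)" by (cases "E i x") auto
      then have "e2ennreal (- E i x) \<le> e2ennreal (ereal (- m x))" by (rule e2ennreal_mono)
      then show "e2ennreal (- E i x) \<le> ennreal (- m x)" by simp
    qed
    also have "\<dots> < \<infinity>" using m by (auto simp: real_integrable_def less_top)
    finally have N: "(\<integral>\<^sup>+x. e2ennreal (- E i x) \<partial>M) < \<infinity>" .
    show "integrable M (\<lambda>x. real_of_ereal (E i x))" "AE x in M. E i x = ereal (real_of_ereal (E i x))"
      "qint M (E i) = ereal (LINT x|M. real_of_ereal (E i x))"
      by (rule integrable_of_parts[OF E[OF i] P[OF i] N])+
  qed
  have "(LINT x|M. l x) \<le> (LINT x|M. (\<Sum>i\<in>I. real_of_ereal (E i x)))"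
  proof (rule integral_mono_AE[OF l])
    show "integrable M (\<lambda>x. \<Sum>i\<in>I. real_of_ereal (E i x))" using parts by (intro Bochner_Integration.integrable_sum)
    have "AE x in M. \<forall>i\<in>I. E i x = ereal (real_of_ereal (E i x))" using I parts by (intro AE_finite_allI) auto
    with le show "AE x in M. l x \<le> (\<Sum>i\<in>I. real_of_ereal (E i x))"
    proof eventually_elim
      fix x assume a: "ereal (l x) \<le> (\<Sum>i\<in>I. E i x)" and b: "\<forall>i\<in>I. E i x = ereal (real_of_ereal (E i x))"
      have "(\<Sum>i\<in>I. E i x) = (\<Sum>i\<in>I. ereal (real_of_ereal (E i x)))" using b by (intro sum.cong) auto
      with a show "l x \<le> (\<Sum>i\<in>I. real_of_ereal (E i x))" by simp
    qed
  qed
  also have "\<dots> = (\<Sum>i\<in>I. (LINT x|M. real_of_ereal (E i x)))" using parts by (intro Bochner_Integration.integral_sum)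
  finally have "ereal (LINT x|M. l x) \<le> (\<Sum>i\<in>I. ereal (LINT x|M. real_of_ereal (E i x)))" by simp
  also have "\<dots> = (\<Sum>i\<in>I. qint M (E i))" using parts by (intro sum.cong) auto
  finally show ?thesis .
qed

lemma ederiv_eq_egrad:
  fixes f :: "real \<Rightarrow> ereal"
  assumes "ediff_at f s" shows "ederiv f s = egrad f s"
proof -
  have "((\<lambda>y. real_of_ereal (f y)) has_derivative (\<lambda>h. grad (\<lambda>y. real_of_ereal (f y)) s \<bullet> h)) (at s)"
    using assms by (intro has_derivative_grad) (simp add: ediff_at_def)
  then have "((\<lambda>y. real_of_ereal (f y)) has_real_derivative grad (\<lambda>y. real_of_ereal (f y)) s) (at s)"
    by (simp add: has_field_derivative_def)
  then show ?thesis unfolding ederiv_def egrad_def by (rule DERIV_imp_deriv)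
qed

lemma ediff_at_finite: "ediff_at f x \<Longrightarrow> \<bar>f x\<bar> \<noteq> \<infinity>"
  unfolding ediff_at_def by (metis eventually_nhds_x_imp_x)

text \<open>The difference between \<open>f\<close> and the affine minorant has a minimum at x,
  hence zero derivative: at a point of differentiability the gradient is the only subgradient.
  Fenchel equalities are turned into identities for derivatives in this way.\<close>

lemma egrad_of_affine_minorant:
  fixes f :: "'a::euclidean_space \<Rightarrow> ereal"
  assumes d: "ediff_at f x" and ge: "\<And>y. f x + ereal (s \<bullet> (y - x)) \<le> f y"
  shows "egrad f x = s"
proof -
  let ?F = "\<lambda>y. real_of_ereal (f y)"
  have "((\<lambda>y. ?F y - s \<bullet> (y - x)) has_derivative (\<lambda>h. grad ?F x \<bullet> h - s \<bullet> h)) (at x)"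
    using d by (intro has_derivative_diff has_derivative_grad) (auto simp: ediff_at_def intro!: derivative_eq_intros)
  moreover have "\<forall>\<^sub>F y in at x. ?F x - s \<bullet> (x - x) \<le> ?F y - s \<bullet> (y - x)"
  proof -
    have "\<forall>\<^sub>F y in at x. \<bar>f y\<bar> \<noteq> \<infinity>"
      using d unfolding ediff_at_def eventually_at_filter by (auto elim: eventually_mono)
    then show ?thesis
    proof eventually_elim
      fix y assume "\<bar>f y\<bar> \<noteq> \<infinity>"
      then show "?F x - s \<bullet> (x - x) \<le> ?F y - s \<bullet> (y - x)"
        using ge[of y] ediff_at_finite[OF d] by (cases "f x"; cases "f y") auto
    qed
  qed
  ultimately have "(\<lambda>h. grad ?F x \<bullet> h - s \<bullet> h) = (\<lambda>h. 0)" by (rule has_derivative_local_min)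
  then have "(grad ?F x - s) \<bullet> (grad ?F x - s) = 0" by (metis inner_diff_left)
  then show ?thesis by (simp add: egrad_def)
qed

text \<open>Convexity bounds the difference quotients along the segment from x to y, and they tend
  to the directional derivative. The value -\<infinity> at y is impossible, because convexity would
  spread it to points of the segment arbitrarily close to x, where \<open>f\<close> is
  finite.\<close>

lemma econvex_subgradient:
  fixes f :: "'a::euclidean_space \<Rightarrow> ereal"
  assumes c: "econvex f" and d: "ediff_at f x"
  shows "f x + ereal (egrad f x \<bullet> (y - x)) \<le> f y"
proof -
  let ?F = "\<lambda>y. real_of_ereal (f y)"
  obtain F where F: "f x = ereal F" using ediff_at_finite[OF d] by (cases "f x") auto
  define \<xi> where "\<xi> t = x + t *\<^sub>R (y - x)" for t
  have lim0: "(\<xi> \<longlongrightarrow> x) (at_right 0)"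
    unfolding \<xi>_def by (rule tendsto_eq_intros refl)+ simp
  have fin: "\<forall>\<^sub>F t in at_right 0. \<bar>f (\<xi> t)\<bar> \<noteq> \<infinity>"
    using d lim0 unfolding ediff_at_def by (auto simp: filterlim_iff)
  have small: "\<forall>\<^sub>F t in at_right 0. 0 < t \<and> t < (1::real)"
    by (auto simp: eventually_at_right_field intro!: exI[of _ 1])
  have conv: "f (\<xi> t) \<le> ereal (1 - t) * f x + ereal t * f y" if "0 < t" "t < 1" for t
  proof -
    have "\<xi> t = (1 - t) *\<^sub>R x + t *\<^sub>R y" by (simp add: \<xi>_def algebra_simps)
    then show ?thesis using c that by (simp add: econvex_def)
  qed
  show ?thesis
  proof (cases "f y")
    case PInf
    then show ?thesis by simp
  next
    case MInf
    have "\<forall>\<^sub>F t in at_right (0::real). False"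
      using fin small
    proof eventually_elim
      fix t :: real assume "\<bar>f (\<xi> t)\<bar> \<noteq> \<infinity>" "0 < t \<and> t < 1"
      then show False using conv[of t] MInf F by (cases "f (\<xi> t)") auto
    qed
    then show ?thesis by simp
  next
    case (real r)
    have d1: "(\<xi> has_derivative (\<lambda>h. h *\<^sub>R (y - x))) (at 0)"
      unfolding \<xi>_def by (auto intro!: derivative_eq_intros)
    have d2: "(?F has_derivative (\<lambda>h. grad ?F x \<bullet> h)) (at (\<xi> 0))"
      using d by (simp add: \<xi>_def ediff_at_def has_derivative_grad)
    have "((\<lambda>t. ?F (\<xi> t)) has_derivative (\<lambda>h. grad ?F x \<bullet> (h *\<^sub>R (y - x)))) (at 0)"
      by (rule has_derivative_compose[OF d1 d2])
    then have "((\<lambda>t. ?F (\<xi> t)) has_real_derivative egrad f x \<bullet> (y - x)) (at 0)"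
      by (simp add: has_field_derivative_def egrad_def mult.commute[of _ "_ \<bullet> _"])
    then have "((\<lambda>t. (?F (\<xi> (0 + t)) - ?F (\<xi> 0)) / t) \<longlongrightarrow> egrad f x \<bullet> (y - x)) (at 0)"
      by (simp add: DERIV_def)
    moreover have "?F (\<xi> 0) = F" by (simp add: \<xi>_def F)
    ultimately have "((\<lambda>t. (?F (\<xi> t) - F) / t) \<longlongrightarrow> egrad f x \<bullet> (y - x)) (at 0)" by simp
    then have lim: "((\<lambda>t. (?F (\<xi> t) - F) / t) \<longlongrightarrow> egrad f x \<bullet> (y - x)) (at_right 0)"
      by (rule tendsto_within_subset) simp
    have "egrad f x \<bullet> (y - x) \<le> r - F"
    proof (rule tendsto_upperbound[OF lim])
      show "\<forall>\<^sub>F t in at_right 0. (?F (\<xi> t) - F) / t \<le> r - F"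
        using fin small
      proof eventually_elim
        fix t :: real assume t: "\<bar>f (\<xi> t)\<bar> \<noteq> \<infinity>" "0 < t \<and> t < 1"
        then have "?F (\<xi> t) \<le> (1 - t) * F + t * r"
          using conv[of t] real F by (cases "f (\<xi> t)") auto
        then have "?F (\<xi> t) - F \<le> (r - F) * t" by (simp add: algebra_simps)
        then show "(?F (\<xi> t) - F) / t \<le> r - F" using t by (simp add: pos_divide_le_eq)
      qed
    qed simp
    then show ?thesis by (simp add: F real)
  qed
qed

lemma convex_gradient_inequality:
  fixes \<phi> :: "'a::euclidean_space \<Rightarrow> real"
  assumes c: "convex_on UNIV \<phi>" and d: "\<phi> differentiable (at x)"
  shows "\<phi> x + grad \<phi> x \<bullet> (y - x) \<le> \<phi> y"
proof -
  have "econvex (\<lambda>s. ereal (\<phi> s))"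
    using c unfolding econvex_def convex_on_def by (auto simp: add.commute)
  moreover have "ediff_at (\<lambda>s. ereal (\<phi> s)) x" using d by (simp add: ediff_at_def)
  ultimately have "ereal (\<phi> x) + ereal (egrad (\<lambda>s. ereal (\<phi> s)) x \<bullet> (y - x)) \<le> ereal (\<phi> y)"
    by (rule econvex_subgradient)
  then show ?thesis by (simp add: egrad_def)
qed

lemma Fenchel_Young: "ereal (t \<bullet> s) - f s \<le> conjugate f t"
  unfolding conjugate_def by (rule SUP_upper) simp

lemma econvex_conjugate_real:
  fixes \<phi> :: "'a::real_inner \<Rightarrow> real"
  shows "econvex (conjugate (\<lambda>s. ereal (\<phi> s)))"
  unfolding econvex_def
proof (intro allI ballI)
  fix s t :: 'a and c :: real assume c: "c \<in> {0..1}"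
  let ?f = "conjugate (\<lambda>s. ereal (\<phi> s))"
  show "?f ((1 - c) *\<^sub>R s + c *\<^sub>R t) \<le> ereal (1 - c) * ?f s + ereal c * ?f t"
    unfolding conjugate_def[of _ "(1 - c) *\<^sub>R s + c *\<^sub>R t"]
  proof (rule SUP_least)
    fix r
    have "ereal (((1 - c) *\<^sub>R s + c *\<^sub>R t) \<bullet> r) - ereal (\<phi> r) = ereal (1 - c) * (ereal (s \<bullet> r) - ereal (\<phi> r)) + ereal c * (ereal (t \<bullet> r) - ereal (\<phi> r))"
      by (simp add: inner_add_left algebra_simps)
    also have "\<dots> \<le> ereal (1 - c) * ?f s + ereal c * ?f t"
      using c Fenchel_Young[of s r "\<lambda>s. ereal (\<phi> s)"] Fenchel_Young[of t r "\<lambda>s. ereal (\<phi> s)"]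
      by (intro add_mono ereal_mult_left_mono) auto
    finally show "ereal (((1 - c) *\<^sub>R s + c *\<^sub>R t) \<bullet> r) - ereal (\<phi> r) \<le> ereal (1 - c) * ?f s + ereal c * ?f t" .
  qed
qed

text \<open>A conjugate is lower semicontinuous: its strict superlevel sets are unions of open half
  spaces.\<close>

lemma conjugate_real_measurable [measurable]:
  fixes \<phi> :: "'a::euclidean_space \<Rightarrow> real"
  shows "conjugate (\<lambda>s. ereal (\<phi> s)) \<in> borel_measurable borel"
proof (rule borel_measurableI_greater)
  fix y
  have "{x. y < conjugate (\<lambda>s. ereal (\<phi> s)) x} = (\<Union>s. {x. y < ereal (x \<bullet> s - \<phi> s)})"
    by (auto simp: conjugate_def less_SUP_iff)
  moreover have "open {x. y < ereal (x \<bullet> s - \<phi> s)}" for s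
    by (intro open_Collect_less continuous_intros)
  ultimately have "open {x. y < conjugate (\<lambda>s. ereal (\<phi> s)) x}" by (simp add: open_UN)
  then show "{x \<in> space borel. y < conjugate (\<lambda>s. ereal (\<phi> s)) x} \<in> sets borel" by (simp add: borel_open)
qed

text \<open>Being a countable supremum, the conjugate of an integrand depends measurably on the parameter.\<close>

lemma conjugate_rational:
  fixes f :: "real \<Rightarrow> ereal"
  assumes c: "econvex f" and nm: "\<And>s. f s \<noteq> -\<infinity>" and d: "ediff_at f u"
  shows "conjugate f t = (SUP q\<in>\<rat>. ereal (t * q) - f q)"
proof (rule antisym)
  show "(SUP q\<in>\<rat>. ereal (t * q) - f q) \<le> conjugate f t"
    unfolding conjugate_def by (rule SUP_mono) auto
  have "\<forall>\<^sub>F y in nhds u. \<bar>f y\<bar> \<noteq> \<infinity>" using d by (simp add: ediff_at_def)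
  then obtain e where e: "e > 0" "\<And>y. dist y u < e \<Longrightarrow> \<bar>f y\<bar> \<noteq> \<infinity>" unfolding eventually_nhds_metric by blast
  let ?Q = "SUP q\<in>\<rat>. ereal (t * q) - f q"
  obtain q0 where q0: "u < q0" "q0 < u + e" "q0 \<in> \<rat>" using Rats_dense_in_real[of u "u + e"] e by auto
  have "\<bar>f q0\<bar> \<noteq> \<infinity>" using q0 by (intro e(2)) (auto simp: dist_real_def)
  then have Qm: "?Q \<noteq> -\<infinity>" using SUP_upper[OF q0(3), of "\<lambda>q. ereal (t * q) - f q"] by (cases "f q0") auto
  show "conjugate f t \<le> ?Q" unfolding conjugate_def
  proof (rule SUP_least)
    fix s
    show "ereal (t \<bullet> s) - f s \<le> ?Q"
    proof (cases "f s")
      case (real a)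
      \<comment> \<open>A second point at which \<open>f\<close> is finite. Along the segment from s
        to v convexity bounds \<open>f\<close> from above, so t r - f(r) cannot drop abruptly when s
        is replaced by a rational point r of the segment close to s.\<close>
      define v where "v = (if s = u then u + e/2 else u)"
      have "v \<noteq> s" using e by (auto simp: v_def)
      have "\<bar>f v\<bar> \<noteq> \<infinity>" using e by (intro e(2)) (auto simp: v_def dist_real_def)
      then obtain b where b: "f v = ereal b" by (cases "f v") auto
      show ?thesis
      proof (rule ccontr)
        assume "\<not> ?thesis"
        then obtain S where S: "?Q = ereal S" "S < t * s - a" using Qm real by (cases ?Q) auto
        \<comment> \<open>\<open>K\<close> bounds the loss per unit of the segment parameter, and
          \<open>\<epsilon>\<close> is small enough that the total loss stays below the assumed gap
          t s - a - S.\<close>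
        define K where "K = \<bar>(t * s - a) - (t * v - b)\<bar> + 1"
        define \<epsilon> where "\<epsilon> = min 1 ((t * s - a - S) / K)"
        have K: "K > 0" by (simp add: K_def add_nonneg_pos)
        have \<epsilon>: "0 < \<epsilon>" "\<epsilon> \<le> 1" "\<epsilon> * K \<le> t * s - a - S" using S K by (auto simp: \<epsilon>_def min_def field_simps)
        have "\<exists>c. 0 < c \<and> c < \<epsilon> \<and> s + c * (v - s) \<in> \<rat>"
        proof (cases "s < v")
          case True
          then have "s < s + \<epsilon> * (v - s)" using \<epsilon> by simp
          then obtain q where q: "s < q" "q < s + \<epsilon> * (v - s)" "q \<in> \<rat>" using Rats_dense_in_real[of s "s + \<epsilon> * (v - s)"] by blast
          moreover have "s + ((q - s) / (v - s)) * (v - s) = q" using True by simp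
          moreover have "0 < (q - s) / (v - s)" "(q - s) / (v - s) < \<epsilon>" using True q by (simp_all add: pos_divide_less_eq)
          ultimately show ?thesis by metis
        next
          case False
          then have vs: "v < s" using \<open>v \<noteq> s\<close> by simp
          then have "s + \<epsilon> * (v - s) < s" using \<epsilon> by (simp add: mult_pos_neg)
          then obtain q where q: "s + \<epsilon> * (v - s) < q" "q < s" "q \<in> \<rat>" using Rats_dense_in_real[of "s + \<epsilon> * (v - s)" s] by blast
          moreover have "s + ((q - s) / (v - s)) * (v - s) = q" using vs by simp
          moreover have "0 < (q - s) / (v - s)" "(q - s) / (v - s) < \<epsilon>" using vs q by (simp_all add: neg_divide_less_eq divide_neg_neg)
          ultimately show ?thesis by metis
        qed
        then obtain c where cc: "0 < c" "c < \<epsilon>" "s + c * (v - s) \<in> \<rat>" by blast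
        let ?r = "s + c * (v - s)"
        have "?r = (1 - c) *\<^sub>R s + c *\<^sub>R v" by (simp add: algebra_simps)
        then have "f ?r \<le> ereal (1 - c) * f s + ereal c * f v"
          using \<open>econvex f\<close>[unfolded econvex_def, rule_format, of c s v] cc \<epsilon> by simp
        then obtain F where F: "f ?r = ereal F" "F \<le> (1 - c) * a + c * b"
          using real b nm[of ?r] by (cases "f ?r") auto
        have "ereal (t * ?r) - f ?r \<le> ?Q" by (rule SUP_upper[OF cc(3)])
        then have "t * ?r - F \<le> S" by (simp add: F S)
        then have "t * ?r - ((1 - c) * a + c * b) \<le> S" using F(2) by linarith
        then have "(t * s - a - S) \<le> c * ((t * s - a) - (t * v - b))" by (simp add: algebra_simps)
        also have "\<dots> \<le> c * K" using cc by (intro mult_left_mono) (auto simp: K_def)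
        also have "\<dots> < \<epsilon> * K" using cc K by (intro mult_strict_right_mono)
        finally show False using \<epsilon>(3) by simp
      qed
    qed (use nm in auto)
  qed
qed

lemma Lp_inner_integrable:
  fixes f g :: "'a::euclidean_space \<Rightarrow> 'b::euclidean_space"
  assumes p: "1 < p" and f: "f \<in> Lp (ereal p) \<Omega>" and g: "g \<in> Lp (ereal (p / (p - 1))) \<Omega>"
  shows "integrable (lebesgue_on \<Omega>) (\<lambda>x. g x \<bullet> f x)"
proof -
  let ?q = "p / (p - 1)"
  have q: "?q > 1" "1 / p + 1 / ?q = 1" using p by (auto simp: field_simps)
  have f': "f \<in> borel_measurable (lebesgue_on \<Omega>)" "integrable (lebesgue_on \<Omega>) (\<lambda>x. norm (f x) powr p)"
    and g': "g \<in> borel_measurable (lebesgue_on \<Omega>)" "integrable (lebesgue_on \<Omega>) (\<lambda>x. norm (g x) powr ?q)"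
    using f g by (simp_all add: Lp_def)
  show ?thesis
  proof (rule Bochner_Integration.integrable_bound)
    show "integrable (lebesgue_on \<Omega>) (\<lambda>x. norm (f x) powr p / p + norm (g x) powr ?q / ?q)"
      using f' g' by (intro Bochner_Integration.integrable_add integrable_divide)
    show "(\<lambda>x. g x \<bullet> f x) \<in> borel_measurable (lebesgue_on \<Omega>)" using f' g' by measurable
    show "AE x in lebesgue_on \<Omega>. norm (g x \<bullet> f x) \<le> norm (norm (f x) powr p / p + norm (g x) powr ?q / ?q)"
    proof (rule AE_I2)
      fix x
      have "norm (g x \<bullet> f x) \<le> norm (f x) * norm (g x)" using Cauchy_Schwarz_ineq2[of "g x" "f x"] by (simp add: mult.commute)
      also have "\<dots> \<le> norm (f x) powr p / p + norm (g x) powr ?q / ?q"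
        by (rule Youngs_inequality[OF p q]) auto
      finally show "norm (g x \<bullet> f x) \<le> norm (norm (f x) powr p / p + norm (g x) powr ?q / ?q)" by simp
    qed
  qed
qed

text \<open>The difference quotients at 0 are nonnegative by minimality and monotone by convexity,
  so they converge from the right to their infimum over the half-open unit interval. Convexity is
  assumed only in the form with 0 as an endpoint, which is all that monotonicity uses.\<close>

lemma convex_right_derivative_nonneg:
  fixes h :: "real \<Rightarrow> real"
  assumes conv: "\<And>s t. 0 < s \<Longrightarrow> s \<le> t \<Longrightarrow> t \<le> 1 \<Longrightarrow> h s \<le> (1 - s / t) * h 0 + (s / t) * h t"
    and min: "\<And>t. 0 \<le> t \<Longrightarrow> t \<le> 1 \<Longrightarrow> h 0 \<le> h t"
  shows "\<exists>l\<ge>0. ((\<lambda>t. (h t - h 0) / t) \<longlongrightarrow> l) (at_right 0)"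
proof -
  define q where "q t = (h t - h 0) / t" for t
  have mono: "q s \<le> q t" if "0 < s" "s \<le> t" "t \<le> 1" for s t
  proof -
    have "h s - h 0 \<le> (s / t) * (h t - h 0)" using conv[OF that] by (simp add: algebra_simps)
    then have "(h s - h 0) / s \<le> ((s / t) * (h t - h 0)) / s" using that by (intro divide_right_mono) auto
    then show ?thesis using that by (simp add: q_def)
  qed
  have q0: "0 \<le> q t" if "0 < t" "t \<le> 1" for t using min[of t] that by (simp add: q_def)
  let ?X = "q ` {0<..1}"
  have bdd: "bdd_below ?X" using q0 by (auto intro!: bdd_belowI[of _ 0])
  have ne: "?X \<noteq> {}" by auto
  define l where "l = Inf ?X"
  have l0: "0 \<le> l" unfolding l_def using q0 ne by (intro cInf_greatest) auto
  have "(q \<longlongrightarrow> l) (at_right 0)"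
  proof (rule order_tendstoI)
    fix a assume "a < l"
    have "\<forall>\<^sub>F t in at_right 0. 0 < t \<and> t < (1::real)" by (auto simp: eventually_at_right_field intro!: exI[of _ 1])
    then show "\<forall>\<^sub>F t in at_right 0. a < q t"
    proof eventually_elim
      fix t :: real assume "0 < t \<and> t < 1"
      then have "l \<le> q t" unfolding l_def using bdd by (intro cInf_lower) auto
      with \<open>a < l\<close> show "a < q t" by simp
    qed
  next
    fix a assume "l < a"
    then obtain t0 where t0: "0 < t0" "t0 \<le> 1" "q t0 < a" unfolding l_def using cInf_less_iff[OF ne bdd] by auto
    have "\<forall>\<^sub>F t in at_right 0. 0 < t \<and> t < t0" using t0 by (auto simp: eventually_at_right_field intro!: exI[of _ t0])
    then show "\<forall>\<^sub>F t in at_right 0. q t < a"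
      by eventually_elim (use mono t0 in \<open>meson le_less_trans less_imp_le\<close>)
  qed
  then show ?thesis using l0 by (auto simp: q_def[abs_def])
qed

section \<open>Optimality and discrete coercivity\<close>

context triangulated_domain
begin

text \<open>Equality of the primal and dual values says that four integrals add up to zero. Since z
  \<bullet> \<nabla>u + u div z has integral zero by the boundary conditions, the same sum is the
  integral of the two Fenchel-Young gaps. These are nonnegative, so they vanish almost
  everywhere.\<close>

lemma primal_dual_optimality:
  fixes \<phi> :: "'a \<Rightarrow> real" and \<psi> :: "'a \<Rightarrow> real \<Rightarrow> ereal"
  assumes p: "1 < p" and \<phi>: "\<phi> \<in> borel_measurable borel"
    and \<psi>m: "(\<lambda>(x, s). \<psi> x s) \<in> borel_measurable (lebesgue_on \<Omega> \<Otimes>\<^sub>M borel)"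
    and \<psi>: "\<And>x. x \<in> \<Omega> \<Longrightarrow> econvex (\<psi> x)" "\<And>x s. x \<in> \<Omega> \<Longrightarrow> \<psi> x s \<noteq> -\<infinity>"
    and u: "u \<in> W1_D (ereal p) \<Omega> \<Gamma>\<^sub>D" and z: "z \<in> W_div_N (ereal (p / (p - 1))) \<Omega> \<Gamma>\<^sub>D"
    and fin: "\<bar>energy \<Omega> \<phi> \<psi> u\<bar> \<noteq> \<infinity>" and eq: "dual_energy \<Omega> \<phi> \<psi> z = energy \<Omega> \<phi> \<psi> u"
    and diff: "AE x in lebesgue_on \<Omega>. ediff_at (\<psi> x) (u x)"
  shows "integrable (lebesgue_on \<Omega>) (\<lambda>x. \<phi> (wgrad \<Omega> u x))"
    and "AE x in lebesgue_on \<Omega>. conjugate (\<lambda>s. ereal (\<phi> s)) (z x) = ereal (z x \<bullet> wgrad \<Omega> u x - \<phi> (wgrad \<Omega> u x))"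
    and "AE x in lebesgue_on \<Omega>. conjugate (\<psi> x) (wdiv \<Omega> z x) = ereal (u x * wdiv \<Omega> z x - real_of_ereal (\<psi> x (u x)))"
proof -
  let ?M = "lebesgue_on \<Omega>" and ?g = "wgrad \<Omega> u" and ?d = "wdiv \<Omega> z" and ?\<phi>' = "conjugate (\<lambda>s. ereal (\<phi> s))"
  let ?q = "p / (p - 1)"
  have uL: "u \<in> Lp (ereal p) \<Omega>" "?g \<in> Lp (ereal p) \<Omega>" using u by (auto simp: W1_D_def W1_def)
  have zL: "z \<in> Lp (ereal ?q) \<Omega>" "?d \<in> Lp (ereal ?q) \<Omega>" using z by (auto simp: W_div_N_def)
  have [measurable]: "u \<in> borel_measurable ?M" "?g \<in> borel_measurable ?M" "z \<in> borel_measurable ?M" "?d \<in> borel_measurable ?M"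
    using uL zL by (simp_all add: Lp_def)
  note [measurable] = \<phi>
  have \<psi>c [measurable]: "(\<lambda>x. \<psi> x (v x)) \<in> borel_measurable ?M" if [measurable]: "v \<in> borel_measurable ?M" for v
  proof -
    have "(\<lambda>x. (\<lambda>(x, s). \<psi> x s) (x, v x)) \<in> borel_measurable ?M"
      by (rule measurable_compose[OF _ \<psi>m]) measurable
    then show ?thesis by simp
  qed
  \<comment> \<open>A measurable version of the conjugate: as a supremum over rational arguments it
    is measurable in x, and it agrees with the conjugate wherever the integrand is differentiable at
    u(x).\<close>
  define P where "P x = (SUP q\<in>\<rat>. ereal (?d x * q) - \<psi> x q)" for x
  have P_eq: "AE x in ?M. conjugate (\<psi> x) (?d x) = P x"
    using diff AE_space
  proof eventually_elim
    fix x assume "ediff_at (\<psi> x) (u x)" "x \<in> space ?M"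
    then show "conjugate (\<psi> x) (?d x) = P x"
      unfolding P_def using \<psi> by (intro conjugate_rational) (auto simp: space_restrict_space)
  qed
  have Pm: "P \<in> borel_measurable ?M"
    unfolding P_def using countable_rat by (intro borel_measurable_SUP borel_measurable_ereal_diff \<psi>c) measurable
  let ?a = "\<lambda>x. ereal (\<phi> (?g x))" and ?s = "\<lambda>x. \<psi> x (u x)" and ?A = "\<lambda>x. ?\<phi>' (z x)"
  have qP: "qint ?M (\<lambda>x. conjugate (\<psi> x) (?d x)) = qint ?M P" by (rule qint_cong_AE[OF P_eq])
  have I: "energy \<Omega> \<phi> \<psi> u = qint ?M ?a + qint ?M ?s" by (simp add: energy_def)
  have D: "dual_energy \<Omega> \<phi> \<psi> z = - (qint ?M ?A + qint ?M P)" by (simp add: dual_energy_def qP)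
  \<comment> \<open>In extended-real addition \<infinity> + (-\<infinity>) is \<infinity>, so a
    finite sum has two finite summands.\<close>
  have f1: "\<bar>qint ?M ?a\<bar> \<noteq> \<infinity>" "\<bar>qint ?M ?s\<bar> \<noteq> \<infinity>"
    using fin unfolding I by (cases "qint ?M ?a"; cases "qint ?M ?s"; simp)+
  have "\<bar>- (qint ?M ?A + qint ?M P)\<bar> \<noteq> \<infinity>" using fin unfolding eq[symmetric] D .
  then have f2: "\<bar>qint ?M ?A\<bar> \<noteq> \<infinity>" "\<bar>qint ?M P\<bar> \<noteq> \<infinity>"
    by (cases "qint ?M ?A"; cases "qint ?M P"; simp)+
  have am: "?a \<in> borel_measurable ?M" and Am: "?A \<in> borel_measurable ?M" by measurable
  note a = integrable_of_parts[OF am qint_finite_parts[OF f1(1)]]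
  note s = integrable_of_parts[OF \<psi>c[OF \<open>u \<in> borel_measurable ?M\<close>] qint_finite_parts[OF f1(2)]]
  note A = integrable_of_parts[OF Am qint_finite_parts[OF f2(1)]]
  note P = integrable_of_parts[OF Pm qint_finite_parts[OF f2(2)]]
  let ?a' = "\<lambda>x. \<phi> (?g x)" and ?s' = "\<lambda>x. real_of_ereal (?s x)" and ?A' = "\<lambda>x. real_of_ereal (?A x)" and ?P' = "\<lambda>x. real_of_ereal (P x)"
  show ai: "integrable ?M ?a'" using a(1) by simp
  have sum0: "(LINT x|?M. ?a' x) + (LINT x|?M. ?s' x) + (LINT x|?M. ?A' x) + (LINT x|?M. ?P' x) = 0"
    using eq unfolding I D a(3) s(3) A(3) P(3) by simp
  have zg: "integrable ?M (\<lambda>x. z x \<bullet> ?g x)" by (rule Lp_inner_integrable[OF p uL(2) zL(1)])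
  have ud: "integrable ?M (\<lambda>x. u x * ?d x)" using Lp_inner_integrable[OF p uL(1) zL(2)] by (simp add: mult.commute)
  have "conj_exponent (ereal ?q) = ereal p"
  proof -
    have q1: "?q \<noteq> 1" "?q - 1 = 1 / (p - 1)" using p by (auto simp: field_simps)
    have "conj_exponent (ereal ?q) = ereal ?q / (ereal ?q - 1)"
      using q1 by (simp add: conj_exponent_def one_ereal_def)
    also have "\<dots> = ereal (?q / (?q - 1))" unfolding one_ereal_def using q1 p by simp
    also have "?q / (?q - 1) = p" unfolding q1 using p by simp
    finally show ?thesis .
  qed
  then have ibp: "(LINT x|?M. z x \<bullet> ?g x + u x * ?d x) = 0" using z u by (simp add: W_div_N_def)
  \<comment> \<open>The gaps in the Fenchel-Young inequalities for the pairs (\<nabla>u, z) and (u,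
    div z).\<close>
  define N1 where "N1 x = ?a' x + ?A' x - z x \<bullet> ?g x" for x
  define N2 where "N2 x = ?s' x + ?P' x - u x * ?d x" for x
  have N1i: "integrable ?M N1" and N2i: "integrable ?M N2"
    unfolding N1_def N2_def using ai s(1) A(1) P(1) zg ud by auto
  have N1p: "AE x in ?M. 0 \<le> N1 x"
    using A(2)
  proof eventually_elim
    fix x assume "?A x = ereal (?A' x)"
    then show "0 \<le> N1 x" using Fenchel_Young[of "z x" "?g x" "\<lambda>s. ereal (\<phi> s)"] by (cases "?A x") (auto simp: N1_def)
  qed
  have N2p: "AE x in ?M. 0 \<le> N2 x"
    using P(2) s(2) P_eq
  proof eventually_elim
    fix x assume "P x = ereal (?P' x)" "?s x = ereal (?s' x)" "conjugate (\<psi> x) (?d x) = P x"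
    then show "0 \<le> N2 x" using Fenchel_Young[of "?d x" "u x" "\<psi> x"]
      by (cases "P x"; cases "?s x") (auto simp: N2_def mult.commute)
  qed
  have "(LINT x|?M. N1 x) + (LINT x|?M. N2 x) = 0"
    using sum0 ibp ai s(1) A(1) P(1) zg ud by (simp add: N1_def N2_def)
  moreover have "0 \<le> (LINT x|?M. N1 x)" "0 \<le> (LINT x|?M. N2 x)" using N1p N2p by (auto intro: integral_nonneg_AE)
  ultimately have "(LINT x|?M. N1 x) = 0" "(LINT x|?M. N2 x) = 0" by auto
  then have z0: "AE x in ?M. N1 x = 0" "AE x in ?M. N2 x = 0"
    using integral_nonneg_eq_0_iff_AE[OF N1i N1p] integral_nonneg_eq_0_iff_AE[OF N2i N2p] by auto
  show "AE x in ?M. ?\<phi>' (z x) = ereal (z x \<bullet> ?g x - ?a' x)"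
    using z0(1) A(2)
  proof eventually_elim
    fix x assume "N1 x = 0" and fx: "?A x = ereal (?A' x)"
    then have "?A' x = z x \<bullet> ?g x - ?a' x" by (simp add: N1_def)
    then show "?\<phi>' (z x) = ereal (z x \<bullet> ?g x - ?a' x)" using fx by simp
  qed
  show "AE x in ?M. conjugate (\<psi> x) (?d x) = ereal (u x * ?d x - ?s' x)"
    using z0(2) P(2) P_eq
  proof eventually_elim
    fix x assume "N2 x = 0" and fx: "P x = ereal (?P' x)" "conjugate (\<psi> x) (?d x) = P x"
    then have "?P' x = u x * ?d x - ?s' x" by (simp add: N2_def)
    then show "conjugate (\<psi> x) (?d x) = ereal (u x * ?d x - ?s' x)" using fx by simp
  qed
qed

lemma set_integrable_glue:
  fixes f :: "'a \<Rightarrow> 'b::euclidean_space"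
  assumes f: "\<And>T. T \<in> \<T> \<Longrightarrow> set_integrable lebesgue T f"
  shows "set_integrable lebesgue \<Omega> f"
proof -
  have i: "integrable lebesgue (\<lambda>x. \<Sum>T\<in>\<T>. indicator T x *\<^sub>R f x)"
    using f unfolding set_integrable_def by (intro Bochner_Integration.integrable_sum)
  have ae: "AE x in lebesgue. (\<Sum>T\<in>\<T>. indicat_real T x *\<^sub>R f x) = indicat_real \<Omega> x *\<^sub>R f x"
    using AE_indicator_sum by eventually_elim (simp add: scaleR_sum_left)
  have m: "(\<lambda>x. indicat_real \<Omega> x *\<^sub>R f x) \<in> borel_measurable lebesgue"
    by (rule borel_measurable_AE[OF _ ae]) (use i in auto)
  show ?thesis unfolding set_integrable_def by (rule integrable_cong_AE_imp[OF i m]) (use ae in \<open>auto elim: eventually_mono\<close>)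
qed

lemma set_integrable_const_element: "T \<in> \<T> \<Longrightarrow> set_integrable lebesgue T (\<lambda>x. k::'b::euclidean_space)"
  by (rule set_integrable_lebesgue_continuous[OF element_compact]) auto

lemma integral_const_element: "T \<in> \<T> \<Longrightarrow> (LINT x:T|lebesgue. (k::real)) = measure lebesgue T * k"
  by (simp add: set_lebesgue_integral_def)

section \<open>Discrete energies as finite sums over the elements\<close>

lemma qint_piecewise_constant:
  assumes f: "\<And>T x. T \<in> \<T> \<Longrightarrow> x \<in> interior T \<Longrightarrow> f x = ereal (k T)"
  shows "qint (lebesgue_on \<Omega>) f = ereal (\<Sum>T\<in>\<T>. measure lebesgue T * k T)"
proof -
  define g where "g x = real_of_ereal (f x)" for x
  have gk: "\<And>T x. T \<in> \<T> \<Longrightarrow> x \<in> interior T \<Longrightarrow> g x = k T" using f by (simp add: g_def)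
  have gT: "set_integrable lebesgue T g" "(LINT x:T|lebesgue. g x) = measure lebesgue T * k T" if T: "T \<in> \<T>" for T
    using integral_cong_interior[OF T set_integrable_const_element[OF T, of "k T"] gk[OF T]] integral_const_element[OF T] by auto
  have g\<Omega>: "set_integrable lebesgue \<Omega> g" by (rule set_integrable_glue[OF gT(1)])
  have "AE x in lebesgue_on \<Omega>. f x = ereal (g x)"
    using AE_element by eventually_elim (use f gk in auto)
  then have "qint (lebesgue_on \<Omega>) f = ereal (LINT x|lebesgue_on \<Omega>. g x)"
    using g\<Omega> by (intro qint_real) (simp_all add: lebesgue_on_integral(2)[OF \<Omega>_lebesgue])
  also have "(LINT x|lebesgue_on \<Omega>. g x) = (\<Sum>T\<in>\<T>. measure lebesgue T * k T)"
    unfolding lebesgue_on_integral(1)[OF \<Omega>_lebesgue] integral_elements[OF g\<Omega>] using gT(2) by simp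
  finally show ?thesis .
qed

lemma nn_integral_infinite_element:
  assumes T: "T \<in> \<T>" and f: "AE x in lebesgue_on \<Omega>. x \<in> interior T \<longrightarrow> f x = (\<infinity>::ereal)"
  shows "(\<integral>\<^sup>+x. e2ennreal (f x) \<partial>lebesgue_on \<Omega>) = \<infinity>"
proof -
  have "emeasure lebesgue (interior T) \<noteq> 0"
    using open_not_negligible[OF open_interior element_interior_nonempty[OF T]]
    by (auto simp: negligible_iff_null_sets null_sets_def)
  then have e: "emeasure (lebesgue_on \<Omega>) (interior T) \<noteq> 0"
    using interior_element[OF T] \<Omega>_lebesgue by (simp add: emeasure_restrict_space)
  have m: "interior T \<in> sets (lebesgue_on \<Omega>)"
    using interior_element[OF T] \<Omega>_lebesgue by (simp add: sets_restrict_space_iff)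
  have "\<infinity> = (\<infinity>::ennreal) * emeasure (lebesgue_on \<Omega>) (interior T)" using e by (simp add: ennreal_top_mult)
  also have "\<dots> = (\<integral>\<^sup>+x. \<infinity> * indicator (interior T) x \<partial>lebesgue_on \<Omega>)"
    using m by (rule nn_integral_cmult_indicator[symmetric])
  also have "\<dots> \<le> (\<integral>\<^sup>+x. e2ennreal (f x) \<partial>lebesgue_on \<Omega>)"
    by (rule nn_integral_mono_AE, use f in eventually_elim) (auto simp: indicator_def)
  finally show ?thesis by (simp add: top_unique)
qed

lemma piecewise_affine_coefficients:
  assumes "v \<in> CR \<T>"
  obtains c g where "\<And>T x. T \<in> \<T> \<Longrightarrow> x \<in> interior T \<Longrightarrow> v x = c T + g T \<bullet> x"
proof -
  have "\<forall>T\<in>\<T>. \<exists>cg. \<forall>x\<in>interior T. v x = fst cg + snd cg \<bullet> x"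
    using assms by (fastforce simp: CR_def pw_affine_def)
  then obtain cg where "\<forall>T\<in>\<T>. \<forall>x\<in>interior T. v x = fst (cg T) + snd (cg T) \<bullet> x"
    by (rule bchoice[THEN exE])
  then show ?thesis using that[of "\<lambda>T. fst (cg T)" "\<lambda>T. snd (cg T)"] by blast
qed

lemma barycenter_interior: "T \<in> \<T> \<Longrightarrow> barycenter T \<in> interior T"
  using full_simplex.barycenter_T_interior[OF element(1)] element(2) by simp

lemma energy_h_finite:
  assumes aff: "\<And>T x. T \<in> \<T> \<Longrightarrow> x \<in> interior T \<Longrightarrow> v x = c T + g T \<bullet> x"
    and \<psi>h: "\<And>T x y. T \<in> \<T> \<Longrightarrow> x \<in> interior T \<Longrightarrow> y \<in> interior T \<Longrightarrow> \<psi>\<^sub>h x = \<psi>\<^sub>h y"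
    and fin: "\<And>T. T \<in> \<T> \<Longrightarrow> \<bar>\<psi>\<^sub>h (barycenter T) (c T + g T \<bullet> barycenter T)\<bar> \<noteq> \<infinity>"
  shows "energy_h \<Omega> \<T> \<phi> \<psi>\<^sub>h v = ereal (\<Sum>T\<in>\<T>. measure lebesgue T *
    (\<phi> (g T) + real_of_ereal (\<psi>\<^sub>h (barycenter T) (c T + g T \<bullet> barycenter T))))"
proof -
  have "qint (lebesgue_on \<Omega>) (\<lambda>x. ereal (\<phi> (grad_h \<T> v x))) = ereal (\<Sum>T\<in>\<T>. measure lebesgue T * \<phi> (g T))"
    by (rule qint_piecewise_constant) (simp add: grad_h_element[OF _ _ aff])
  moreover have "qint (lebesgue_on \<Omega>) (\<lambda>x. \<psi>\<^sub>h x (proj0 \<T> v x)) =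
     ereal (\<Sum>T\<in>\<T>. measure lebesgue T * real_of_ereal (\<psi>\<^sub>h (barycenter T) (c T + g T \<bullet> barycenter T)))"
  proof (rule qint_piecewise_constant)
    fix T x assume T: "T \<in> \<T>" "x \<in> interior T"
    have "proj0 \<T> v x = c T + g T \<bullet> barycenter T" by (rule proj0_affine[OF T aff[OF T(1)]])
    then show "\<psi>\<^sub>h x (proj0 \<T> v x) = ereal (real_of_ereal (\<psi>\<^sub>h (barycenter T) (c T + g T \<bullet> barycenter T)))"
      using fin[OF T(1)] \<psi>h[OF T barycenter_interior[OF T(1)]] by (simp add: ereal_real)
  qed
  ultimately show ?thesis by (simp add: energy_h_def distrib_left sum.distrib)
qed

lemma energy_h_infinite:
  assumes aff: "\<And>T x. T \<in> \<T> \<Longrightarrow> x \<in> interior T \<Longrightarrow> v x = c T + g T \<bullet> x"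
    and \<psi>h: "\<And>T x y. T \<in> \<T> \<Longrightarrow> x \<in> interior T \<Longrightarrow> y \<in> interior T \<Longrightarrow> \<psi>\<^sub>h x = \<psi>\<^sub>h y"
    and T: "T \<in> \<T>" and inf: "\<psi>\<^sub>h (barycenter T) (c T + g T \<bullet> barycenter T) = \<infinity>"
  shows "energy_h \<Omega> \<T> \<phi> \<psi>\<^sub>h v = \<infinity>"
proof -
  have "(\<integral>\<^sup>+x. e2ennreal (\<psi>\<^sub>h x (proj0 \<T> v x)) \<partial>lebesgue_on \<Omega>) = \<infinity>"
  proof (rule nn_integral_infinite_element[OF T], intro AE_I2 impI)
    fix x assume x: "x \<in> interior T"
    have "proj0 \<T> v x = c T + g T \<bullet> barycenter T" by (rule proj0_affine[OF T x aff[OF T]])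
    then show "\<psi>\<^sub>h x (proj0 \<T> v x) = \<infinity>" using inf \<psi>h[OF T x barycenter_interior[OF T]] by simp
  qed
  then have "qint (lebesgue_on \<Omega>) (\<lambda>x. \<psi>\<^sub>h x (proj0 \<T> v x)) = \<infinity>" by (rule qint_PInf)
  then show ?thesis by (simp add: energy_h_def)
qed

lemma CR_D_segment:
  assumes v: "v \<in> CR_D \<Omega> \<Gamma>\<^sub>D \<T>" and w: "w \<in> CR_D \<Omega> \<Gamma>\<^sub>D \<T>"
  shows "(\<lambda>x. v x + t * (w x - v x)) \<in> CR_D \<Omega> \<Gamma>\<^sub>D \<T>"
proof -
  have vCR: "v \<in> CR \<T>" and wCR: "w \<in> CR \<T>" using v w by (auto simp: CR_D_def)
  obtain c g where cg: "\<And>T x. T \<in> \<T> \<Longrightarrow> x \<in> interior T \<Longrightarrow> v x = c T + g T \<bullet> x"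
    using piecewise_affine_coefficients[OF vCR] by blast
  obtain c' g' where cg': "\<And>T x. T \<in> \<T> \<Longrightarrow> x \<in> interior T \<Longrightarrow> w x = c' T + g' T \<bullet> x"
    using piecewise_affine_coefficients[OF wCR] by blast
  have "(\<lambda>x. v x + t * (w x - v x)) \<in> pw_affine \<T>"
    unfolding pw_affine_def
  proof (intro CollectI ballI exI)
    fix T x assume T: "T \<in> \<T>" "x \<in> interior T"
    show "v x + t * (w x - v x) = (c T + t * (c' T - c T)) + (g T + t *\<^sub>R (g' T - g T)) \<bullet> x"
      unfolding cg[OF T] cg'[OF T] by (simp add: algebra_simps)
  qed
  moreover have "continuous (at (barycenter S) within \<Union>\<T>) (\<lambda>x. v x + t * (w x - v x))" if "S \<in> sides \<T>" for S
    using vCR wCR that by (intro continuous_intros) (auto simp: CR_def)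
  ultimately show ?thesis using v w by (auto simp: CR_D_def CR_def)
qed

text \<open>On the segment from v to w the energy is a finite convex function of one real variable
  with its minimum at v. The variational derivative in the direction w - v therefore exists as a
  real number and is nonnegative, and dropping it from strong coercivity leaves the bound by the
  difference of the energies.\<close>

lemma discrete_coercivity:
  fixes \<phi> :: "'a \<Rightarrow> real"
  assumes \<phi>: "convex_on UNIV \<phi>"
    and \<psi>h: "\<And>x. x \<in> \<Omega> \<Longrightarrow> econvex (\<psi>\<^sub>h x)" "\<And>x s. x \<in> \<Omega> \<Longrightarrow> \<psi>\<^sub>h x s \<noteq> -\<infinity>"
      "\<And>T x y. T \<in> \<T> \<Longrightarrow> x \<in> interior T \<Longrightarrow> y \<in> interior T \<Longrightarrow> \<psi>\<^sub>h x = \<psi>\<^sub>h y"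
    and coer: "strongly_coercive \<Omega> (CR_D \<Omega> \<Gamma>\<^sub>D \<T>) (energy_h \<Omega> \<T> \<phi> \<psi>\<^sub>h) \<sigma>"
    and min: "minimizer_on (CR_D \<Omega> \<Gamma>\<^sub>D \<T>) (energy_h \<Omega> \<T> \<phi> \<psi>\<^sub>h) v"
    and w: "w \<in> CR_D \<Omega> \<Gamma>\<^sub>D \<T>"
    and av: "\<And>T x. T \<in> \<T> \<Longrightarrow> x \<in> interior T \<Longrightarrow> v x = c T + g T \<bullet> x"
    and aw: "\<And>T x. T \<in> \<T> \<Longrightarrow> x \<in> interior T \<Longrightarrow> w x = c' T + g' T \<bullet> x"
    and finw: "\<And>T. T \<in> \<T> \<Longrightarrow> \<bar>\<psi>\<^sub>h (barycenter T) (c' T + g' T \<bullet> barycenter T)\<bar> \<noteq> \<infinity>"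
  shows "\<And>T. T \<in> \<T> \<Longrightarrow> \<bar>\<psi>\<^sub>h (barycenter T) (c T + g T \<bullet> barycenter T)\<bar> \<noteq> \<infinity>"
    and "(\<sigma> v w)\<^sup>2 \<le> (\<Sum>T\<in>\<T>. measure lebesgue T * (\<phi> (g' T) + real_of_ereal (\<psi>\<^sub>h (barycenter T) (c' T + g' T \<bullet> barycenter T))))
      - (\<Sum>T\<in>\<T>. measure lebesgue T * (\<phi> (g T) + real_of_ereal (\<psi>\<^sub>h (barycenter T) (c T + g T \<bullet> barycenter T))))"
proof -
  let ?I = "energy_h \<Omega> \<T> \<phi> \<psi>\<^sub>h" and ?V = "CR_D \<Omega> \<Gamma>\<^sub>D \<T>" and ?b = "barycenter"
  have vV: "v \<in> ?V" and vmin: "\<And>y. y \<in> ?V \<Longrightarrow> ?I v \<le> ?I y" using min by (auto simp: minimizer_on_def)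
  have b\<Omega>: "?b T \<in> \<Omega>" if "T \<in> \<T>" for T using barycenter_interior[OF that] interior_element[OF that] by blast
  have Iw: "?I w = ereal (\<Sum>T\<in>\<T>. measure lebesgue T * (\<phi> (g' T) + real_of_ereal (\<psi>\<^sub>h (?b T) (c' T + g' T \<bullet> ?b T))))"
    by (rule energy_h_finite[of w c' g' \<psi>\<^sub>h]) (erule (1) aw, erule (2) \<psi>h(3), erule finw)
  \<comment> \<open>A single element with infinite value would make the energy of v infinite,
    although it is at most the finite energy of w.\<close>
  have finv: "\<bar>\<psi>\<^sub>h (?b T) (c T + g T \<bullet> ?b T)\<bar> \<noteq> \<infinity>" if T: "T \<in> \<T>" for T
  proof -
    have "\<psi>\<^sub>h (?b T) (c T + g T \<bullet> ?b T) \<noteq> \<infinity>"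
    proof
      assume "\<psi>\<^sub>h (?b T) (c T + g T \<bullet> ?b T) = \<infinity>"
      then have "?I v = \<infinity>"
        by (intro energy_h_infinite[of v c g \<psi>\<^sub>h T]) (erule (1) av, erule (2) \<psi>h(3), rule T, assumption)
      then show False using vmin[OF w] Iw by simp
    qed
    then show ?thesis using \<psi>h(2)[OF b\<Omega>[OF T]] by auto
  qed
  then show "\<And>T. T \<in> \<T> \<Longrightarrow> \<bar>\<psi>\<^sub>h (?b T) (c T + g T \<bullet> ?b T)\<bar> \<noteq> \<infinity>" .
  define ct where "ct t T = c T + t * (c' T - c T)" for t T
  define gt where "gt t T = g T + t *\<^sub>R (g' T - g T)" for t T
  define W where "W T = c T + g T \<bullet> ?b T" for T
  define W' where "W' T = c' T + g' T \<bullet> ?b T" for T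
  have Wt: "ct t T + gt t T \<bullet> ?b T = (1 - t) * W T + t * W' T" for t T
    by (simp add: ct_def gt_def W_def W'_def algebra_simps)
  let ?vt = "\<lambda>t x. v x + t * (w x - v x)"
  have at: "?vt t x = ct t T + gt t T \<bullet> x" if T: "T \<in> \<T>" "x \<in> interior T" for t T x
    unfolding av[OF T] aw[OF T] by (simp add: ct_def gt_def algebra_simps)
  define \<Psi> where "\<Psi> T s = real_of_ereal (\<psi>\<^sub>h (?b T) s)" for T s
  have conv\<psi>: "\<psi>\<^sub>h (?b T) ((1 - t) * r + t * s) \<le> ereal (1 - t) * \<psi>\<^sub>h (?b T) r + ereal t * \<psi>\<^sub>h (?b T) s"
    if "T \<in> \<T>" "0 \<le> t" "t \<le> 1" for T t r s
    using \<psi>h(1)[OF b\<Omega>[OF that(1)]] that by (simp add: econvex_def)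
  have conv\<Psi>: "\<bar>\<psi>\<^sub>h (?b T) ((1 - t) * r + t * s)\<bar> \<noteq> \<infinity>" "\<Psi> T ((1 - t) * r + t * s) \<le> (1 - t) * \<Psi> T r + t * \<Psi> T s"
    if T: "T \<in> \<T>" "0 \<le> t" "t \<le> 1" and rs: "\<bar>\<psi>\<^sub>h (?b T) r\<bar> \<noteq> \<infinity>" "\<bar>\<psi>\<^sub>h (?b T) s\<bar> \<noteq> \<infinity>" for T t r s
  proof -
    obtain a b where ab: "\<psi>\<^sub>h (?b T) r = ereal a" "\<psi>\<^sub>h (?b T) s = ereal b" using rs by auto
    have 1: "\<psi>\<^sub>h (?b T) ((1 - t) * r + t * s) \<le> ereal ((1 - t) * a + t * b)"
      using conv\<psi>[OF T, of r s] by (simp add: ab)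
    then obtain y where y: "\<psi>\<^sub>h (?b T) ((1 - t) * r + t * s) = ereal y"
      using \<psi>h(2)[OF b\<Omega>[OF T(1)], of "(1 - t) * r + t * s"] by (cases "\<psi>\<^sub>h (?b T) ((1 - t) * r + t * s)") auto
    then show "\<bar>\<psi>\<^sub>h (?b T) ((1 - t) * r + t * s)\<bar> \<noteq> \<infinity>" "\<Psi> T ((1 - t) * r + t * s) \<le> (1 - t) * \<Psi> T r + t * \<Psi> T s"
      using 1 by (simp_all add: \<Psi>_def ab)
  qed
  have fint: "\<bar>\<psi>\<^sub>h (?b T) (ct t T + gt t T \<bullet> ?b T)\<bar> \<noteq> \<infinity>" if "T \<in> \<T>" "0 \<le> t" "t \<le> 1" for T t
    unfolding Wt using conv\<Psi>(1)[OF that] finv[OF that(1)] finw[OF that(1)] by (simp add: W_def W'_def)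
  \<comment> \<open>The energy along the segment, written as a real sum; by convexity the integrand
    stays finite between its finite values at v and w.\<close>
  define h where "h t = (\<Sum>T\<in>\<T>. measure lebesgue T * (\<phi> (gt t T) + \<Psi> T (ct t T + gt t T \<bullet> ?b T)))" for t
  have It: "?I (?vt t) = ereal (h t)" if "0 \<le> t" "t \<le> 1" for t
    unfolding h_def \<Psi>_def
    by (rule energy_h_finite[of "?vt t" "ct t" "gt t" \<psi>\<^sub>h]) (erule (1) at, erule (2) \<psi>h(3), erule fint[OF _ that])
  have conv_h: "h s \<le> (1 - s / t) * h 0 + (s / t) * h t" if st: "0 < s" "s \<le> t" "t \<le> 1" for s t
  proof -
    let ?l = "s / t"
    have l: "0 \<le> ?l" "?l \<le> 1" "?l * t = s" using st by auto
    have g: "gt s T = (1 - ?l) *\<^sub>R gt 0 T + ?l *\<^sub>R gt t T" for T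
    proof -
      have "(1 - ?l) *\<^sub>R gt 0 T + ?l *\<^sub>R gt t T = g T + (?l * t) *\<^sub>R (g' T - g T)"
        by (simp add: gt_def algebra_simps)
      then show ?thesis unfolding l(3) by (simp add: gt_def)
    qed
    have c: "ct s T + gt s T \<bullet> ?b T = (1 - ?l) * (ct 0 T + gt 0 T \<bullet> ?b T) + ?l * (ct t T + gt t T \<bullet> ?b T)" for T
    proof -
      have "(1 - ?l) * W T + ?l * ((1 - t) * W T + t * W' T) = (1 - ?l * t) * W T + (?l * t) * W' T" by (simp add: algebra_simps)
      then show ?thesis unfolding Wt l(3) by simp
    qed
    have "h s \<le> (\<Sum>T\<in>\<T>. measure lebesgue T * ((1 - ?l) * (\<phi> (gt 0 T) + \<Psi> T (ct 0 T + gt 0 T \<bullet> ?b T)) + ?l * (\<phi> (gt t T) + \<Psi> T (ct t T + gt t T \<bullet> ?b T))))"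
      unfolding h_def
    proof (intro sum_mono mult_left_mono)
      fix T assume T: "T \<in> \<T>"
      have "\<phi> (gt s T) \<le> (1 - ?l) * \<phi> (gt 0 T) + ?l * \<phi> (gt t T)"
        unfolding g using convex_onD[OF \<phi> l(1,2)] by blast
      moreover have "\<Psi> T (ct s T + gt s T \<bullet> ?b T) \<le> (1 - ?l) * \<Psi> T (ct 0 T + gt 0 T \<bullet> ?b T) + ?l * \<Psi> T (ct t T + gt t T \<bullet> ?b T)"
        unfolding c using st fint[OF T] by (intro conv\<Psi>(2)[OF T l(1,2)]) auto
      ultimately show "\<phi> (gt s T) + \<Psi> T (ct s T + gt s T \<bullet> ?b T) \<le> (1 - ?l) * (\<phi> (gt 0 T) + \<Psi> T (ct 0 T + gt 0 T \<bullet> ?b T)) + ?l * (\<phi> (gt t T) + \<Psi> T (ct t T + gt t T \<bullet> ?b T))"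
        by (simp add: distrib_left)
    qed simp
    also have "\<dots> = (1 - ?l) * h 0 + ?l * h t"
      by (simp add: h_def sum_distrib_left sum.distrib distrib_left mult.left_commute)
    finally show ?thesis .
  qed
  have v0: "?vt 0 = v" by simp
  have min_h: "h 0 \<le> h t" if "0 \<le> t" "t \<le> 1" for t
    using vmin[OF CR_D_segment[OF vV w, of t]] It[OF that] It[of 0] v0 by simp
  obtain l where l: "0 \<le> l" "((\<lambda>t. (h t - h 0) / t) \<longlongrightarrow> l) (at_right 0)"
    using convex_right_derivative_nonneg[OF conv_h min_h] by blast
  have "((\<lambda>t. (?I (?vt t) - ?I v) / ereal t) \<longlongrightarrow> ereal l) (at_right 0)"
  proof (rule Lim_transform_eventually)
    show "((\<lambda>t. ereal ((h t - h 0) / t)) \<longlongrightarrow> ereal l) (at_right 0)" using l(2) by (intro tendsto_ereal)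
    have "\<forall>\<^sub>F t in at_right 0. 0 < t \<and> t < (1::real)" by (auto simp: eventually_at_right_field intro!: exI[of _ 1])
    then show "\<forall>\<^sub>F t in at_right 0. ereal ((h t - h 0) / t) = (?I (?vt t) - ?I v) / ereal t"
    proof eventually_elim
      fix t :: real assume "0 < t \<and> t < 1"
      then show "ereal ((h t - h 0) / t) = (?I (?vt t) - ?I v) / ereal t"
        using It[of t] It[of 0] v0 by simp
    qed
  qed
  then have vd: "variational_derivative ?I v (\<lambda>x. w x - v x) = ereal l"
    unfolding variational_derivative_def by (intro tendsto_Lim) simp_all
  have Iv: "?I v = ereal (h 0)" using It[of 0] v0 by simp
  have "?I v + variational_derivative ?I v (\<lambda>x. w x - v x) + ereal ((\<sigma> v w)\<^sup>2) \<le> ?I w"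
  proof -
    have "?I v < \<infinity>" using Iv by simp
    then show ?thesis using coer vV w unfolding strongly_coercive_def by blast
  qed
  then have "h 0 + l + (\<sigma> v w)\<^sup>2 \<le> (\<Sum>T\<in>\<T>. measure lebesgue T * (\<phi> (g' T) + real_of_ereal (\<psi>\<^sub>h (?b T) (c' T + g' T \<bullet> ?b T))))"
    unfolding vd Iv Iw by simp
  moreover have "h 0 = (\<Sum>T\<in>\<T>. measure lebesgue T * (\<phi> (g T) + real_of_ereal (\<psi>\<^sub>h (?b T) (c T + g T \<bullet> ?b T))))"
    by (simp add: h_def gt_def ct_def \<Psi>_def)
  ultimately show "(\<sigma> v w)\<^sup>2 \<le> (\<Sum>T\<in>\<T>. measure lebesgue T * (\<phi> (g' T) + real_of_ereal (\<psi>\<^sub>h (?b T) (c' T + g' T \<bullet> ?b T))))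
      - (\<Sum>T\<in>\<T>. measure lebesgue T * (\<phi> (g T) + real_of_ereal (\<psi>\<^sub>h (?b T) (c T + g T \<bullet> ?b T))))"
    using l(1) by linarith
qed

end

context triangulated_domain
begin

text \<open>Lets an almost-everywhere property of functions that are constant on elements be read
  off at one point of each element.\<close>

lemma AE_exists_element:
  assumes T: "T \<in> \<T>" and Q: "AE x in lebesgue_on \<Omega>. Q x"
  obtains x where "x \<in> interior T" "Q x"
proof -
  have "\<not> negligible (interior T)" by (rule open_not_negligible[OF open_interior element_interior_nonempty[OF T]])
  moreover have "negligible (interior T)" if "\<not> (\<exists>x\<in>interior T. Q x)"
  proof -
    have "AE x in lebesgue. x \<notin> interior T"
      using Q[unfolded AE_lebesgue_on] by eventually_elim (use that interior_element[OF T] in blast)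
    then show ?thesis by (simp add: negligible_iff_null_sets AE_iff_null_sets)
  qed
  ultimately show ?thesis using that by blast
qed

lemma RT_coefficients:
  assumes "y \<in> RT \<Omega> \<T>"
  obtains \<alpha> \<beta> where "\<And>T x. T \<in> \<T> \<Longrightarrow> x \<in> interior T \<Longrightarrow> y x = \<alpha> T + \<beta> T *\<^sub>R (x - barycenter T)"
proof -
  have "\<forall>T\<in>\<T>. \<exists>ab. \<forall>x\<in>interior T. y x = fst ab + snd ab *\<^sub>R (x - barycenter T)"
    using assms by (fastforce simp: RT_def)
  then obtain ab where "\<forall>T\<in>\<T>. \<forall>x\<in>interior T. y x = fst (ab T) + snd (ab T) *\<^sub>R (x - barycenter T)"
    by (rule bchoice[THEN exE])
  then show ?thesis using that[of "\<lambda>T. fst (ab T)" "\<lambda>T. snd (ab T)"] by blast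
qed

lemma CR_interpolant_in_CR_D:
  assumes u: "u \<in> W1_D q \<Omega> \<Gamma>\<^sub>D" and Icr: "is_CR_interpolant \<Omega> \<T> u w"
  shows "w \<in> CR_D \<Omega> \<Gamma>\<^sub>D \<T>"
  unfolding CR_D_def
proof (intro CollectI conjI ballI impI)
  show "w \<in> CR \<T>" using Icr by (simp add: is_CR_interpolant_def)
  fix S assume S: "S \<in> sides \<T>" and bS: "boundary_side_in \<Omega> \<Gamma>\<^sub>D S"
  obtain \<gamma> where \<gamma>: "has_trace \<Omega> S u \<gamma>" "w (barycenter S) = side_mean S \<gamma>"
    using Icr S by (auto simp: is_CR_interpolant_def)
  obtain T a where "T \<in> \<T>" "a \<in> verts T" "S = facet T a"
    using S facet_of_element_iff by (auto simp: sides_def facet_def)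
  then show "w (barycenter S) = 0" using trace_zero_side_mean[OF _ _ u] bS \<gamma> by metis
qed

text \<open>Integrates the gradient inequality of \<phi> at the mean value \<open>g\<close>; the
  linear term integrates to zero.\<close>

lemma integral_Jensen_element:
  fixes \<phi> :: "'a \<Rightarrow> real"
  assumes T: "T \<in> \<T>" and \<phi>: "convex_on UNIV \<phi>" "\<And>s. \<phi> differentiable (at s)"
    and G: "set_integrable lebesgue T G" and \<phi>G: "set_integrable lebesgue T (\<lambda>x. \<phi> (G x))"
    and g: "g = (LINT x:T|lebesgue. G x) /\<^sub>R measure lebesgue T"
  shows "measure lebesgue T * \<phi> g \<le> (LINT x:T|lebesgue. \<phi> (G x))"
proof -
  have m: "0 < measure lebesgue T" by (rule element_measure_pos[OF T])
  have lin: "(LINT x:T|lebesgue. G x \<bullet> h) = measure lebesgue T * (g \<bullet> h)" for h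
  proof -
    have "(LINT x:T|lebesgue. G x \<bullet> h) = (LINT x:T|lebesgue. G x) \<bullet> h"
      using integral_inner_left[of h lebesgue "\<lambda>x. indicator T x *\<^sub>R G x"] G
      unfolding set_lebesgue_integral_def set_integrable_def by simp
    then show ?thesis using m by (simp add: g)
  qed
  have i: "set_integrable lebesgue T (\<lambda>x. G x \<bullet> grad \<phi> g)" by (rule set_integrable_inner_const[OF G])
  have ic: "set_integrable lebesgue T (\<lambda>x. \<phi> g - grad \<phi> g \<bullet> g)" by (rule set_integrable_const_element[OF T])
  have "measure lebesgue T * \<phi> g = (LINT x:T|lebesgue. (\<phi> g - grad \<phi> g \<bullet> g) + G x \<bullet> grad \<phi> g)"
    using set_integral_add(2)[OF ic i] by (simp add: lin integral_const_element[OF T] inner_commute algebra_simps)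
  also have "\<dots> \<le> (LINT x:T|lebesgue. \<phi> (G x))"
  proof (rule set_integral_mono[OF set_integral_add(1)[OF ic i] \<phi>G])
    fix x
    show "\<phi> g - grad \<phi> g \<bullet> g + G x \<bullet> grad \<phi> g \<le> \<phi> (G x)"
      using convex_gradient_inequality[OF \<phi>(1,2), of g "G x"] by (simp add: inner_diff_right inner_commute)
  qed
  finally show ?thesis .
qed

end

theorem theorem3p4:
  fixes \<Omega> \<Gamma>\<^sub>D \<Gamma>\<^sub>N :: "'a::euclidean_space set"
    and \<T> :: "'a set set"
    and \<phi> :: "'a \<Rightarrow> real"
    and \<psi> \<psi>\<^sub>h :: "'a \<Rightarrow> real \<Rightarrow> ereal"
    and p p' :: real
    and \<sigma> :: "('a \<Rightarrow> real) \<Rightarrow> ('a \<Rightarrow> real) \<Rightarrow> real"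
    and u u\<^sub>h Icr_u :: "'a \<Rightarrow> real"
    and z Irt_z :: "'a \<Rightarrow> 'a"
  defines "I \<equiv> energy \<Omega> \<phi> \<psi>"
    and "D \<equiv> dual_energy \<Omega> \<phi> \<psi>"
    and "I\<^sub>h \<equiv> energy_h \<Omega> \<T> \<phi> \<psi>\<^sub>h"
    and "V \<equiv> W1_D (ereal p) \<Omega> \<Gamma>\<^sub>D"
    and "Z \<equiv> W_div_N (ereal p') \<Omega> \<Gamma>\<^sub>D"
    and "V\<^sub>h \<equiv> CR_D \<Omega> \<Gamma>\<^sub>D \<T>"
    and "\<phi>' \<equiv> conjugate (\<lambda>s. ereal (\<phi> s))"
    and "\<psi>' \<equiv> (\<lambda>x. conjugate (\<psi> x))"
    and "\<psi>\<^sub>h' \<equiv> (\<lambda>x. conjugate (\<psi>\<^sub>h x))"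
    and "\<Pi>_Irt_z \<equiv> proj0 \<T> Irt_z"
    and "\<Pi>_Icr_u \<equiv> proj0 \<T> Icr_u"
    and "\<Pi>_div_z \<equiv> proj0 \<T> (wdiv \<Omega> z)"
  defines "E1 \<equiv> (\<lambda>x. ereal ((egrad \<phi>' (z x) - egrad \<phi>' (\<Pi>_Irt_z x)) \<bullet> (z x - \<Pi>_Irt_z x)))"
    and "E2 \<equiv> (\<lambda>x. ereal ((ederiv (\<psi> x) (u x) - ederiv (\<psi>\<^sub>h x) (\<Pi>_Icr_u x)) * (u x - \<Pi>_Icr_u x)))"
    and "E3 \<equiv> (\<lambda>x. \<psi>\<^sub>h x (u x) - \<psi> x (u x))"
    and "E4 \<equiv> (\<lambda>x. \<psi>\<^sub>h' x (\<Pi>_div_z x) - \<psi>' x (wdiv \<Omega> z x))"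
  assumes dim: "DIM('a) \<in> {2, 3}"
    and p: "1 < p" and p': "p' = p / (p - 1)"
    and domain: "bounded_polyhedral_Lipschitz_domain \<Omega>"
    and \<Gamma>\<^sub>D: "\<Gamma>\<^sub>D \<subseteq> frontier \<Omega>" and \<Gamma>\<^sub>N: "\<Gamma>\<^sub>N = frontier \<Omega> - \<Gamma>\<^sub>D"
    and \<T>: "regular_triangulation \<Omega> \<T>"
    and boundary_sides: "\<And>S. S \<in> sides \<T> \<Longrightarrow> S \<subseteq> frontier \<Omega> \<Longrightarrow>
          boundary_side_in \<Omega> \<Gamma>\<^sub>D S \<or> boundary_side_in \<Omega> \<Gamma>\<^sub>N S"
    and \<phi>: "\<phi> \<in> borel_measurable borel" "convex_on UNIV \<phi>" "\<And>s. \<phi> differentiable (at s)"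
    and \<psi>: "(\<lambda>(x, s). \<psi> x s) \<in> borel_measurable (lebesgue_on \<Omega> \<Otimes>\<^sub>M borel)"
          "\<And>x. x \<in> \<Omega> \<Longrightarrow> econvex (\<psi> x)" "\<And>x s. x \<in> \<Omega> \<Longrightarrow> \<psi> x s \<noteq> -\<infinity>"
    and \<psi>\<^sub>h: "\<And>x. x \<in> \<Omega> \<Longrightarrow> econvex (\<psi>\<^sub>h x)" "\<And>x s. x \<in> \<Omega> \<Longrightarrow> \<psi>\<^sub>h x s \<noteq> -\<infinity>"
          "\<And>T x y. T \<in> \<T> \<Longrightarrow> x \<in> interior T \<Longrightarrow> y \<in> interior T \<Longrightarrow> \<psi>\<^sub>h x = \<psi>\<^sub>h y"
    and I_bounded_below: "\<exists>c::real. \<forall>v\<in>V. ereal c \<le> I v"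
    and I_coercive: "coercive_on p \<Omega> V I"
    and I_weakly_lsc: "weakly_lsc_on p \<Omega> V I"
    and I_proper: "\<exists>v\<in>V. I v < \<infinity>"
    and strong_duality: "(INF v\<in>V. I v) = (SUP y\<in>Z. D y)"
    and strong_coercivity: "strongly_coercive \<Omega> V\<^sub>h I\<^sub>h \<sigma>"
    and u: "minimizer_on V I u"
    and u\<^sub>h: "minimizer_on V\<^sub>h I\<^sub>h u\<^sub>h"
    and z: "maximizer_on Z D z" "z \<in> W_div_N 1 \<Omega> \<Gamma>\<^sub>D \<inter> W1_vec 1 \<Omega>"
    and Icr_u: "is_CR_interpolant \<Omega> \<T> u Icr_u"
    and Irt_z: "is_RT_interpolant \<Omega> \<T> z Irt_z"
    and differentiable:
          "AE x in lebesgue_on \<Omega>. ediff_at \<phi>' (z x) \<and> ediff_at \<phi>' (\<Pi>_Irt_z x)"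
          "AE x in lebesgue_on \<Omega>. ediff_at (\<psi> x) (u x) \<and> ediff_at (\<psi>\<^sub>h x) (\<Pi>_Icr_u x)"
    and well_defined: "\<And>E. E \<in> {E1, E2, E3, E4} \<Longrightarrow> quasi_integrable (lebesgue_on \<Omega>) E"
  shows "ereal ((\<sigma> u\<^sub>h Icr_u)\<^sup>2) \<le>
           qint (lebesgue_on \<Omega>) E1 + qint (lebesgue_on \<Omega>) E2 +
           qint (lebesgue_on \<Omega>) E3 + qint (lebesgue_on \<Omega>) E4"
proof -
  have "2 \<le> DIM('a)" using dim by auto
  then interpret triangulated_domain \<Omega> \<T> using domain \<T> by unfold_locales
  let ?M = "lebesgue_on \<Omega>" and ?g = "wgrad \<Omega> u" and ?d = "wdiv \<Omega> z" and ?b = "barycenter :: 'a set \<Rightarrow> 'a"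
  let ?m = "\<lambda>T. measure lebesgue T"
  have uV: "u \<in> W1_D (ereal p) \<Omega> \<Gamma>\<^sub>D" using u by (simp add: minimizer_on_def V_def)
  have zZ: "z \<in> W_div_N (ereal (p / (p - 1))) \<Omega> \<Gamma>\<^sub>D" using z(1) by (simp add: maximizer_on_def Z_def p')
  have zN: "z \<in> W_div_N 1 \<Omega> \<Gamma>\<^sub>D" and z1: "z \<in> W1_vec 1 \<Omega>" using z(2) by auto
  \<comment> \<open>Both extrema are attained, which turns strong duality into equality of the two
    optimal values.\<close>
  have "(INF v\<in>V. I v) = I u" using u by (intro antisym INF_lower INF_greatest) (auto simp: minimizer_on_def)
  moreover have "(SUP y\<in>Z. D y) = D z" using z(1) by (intro antisym SUP_upper SUP_least) (auto simp: maximizer_on_def)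
  ultimately have DI: "dual_energy \<Omega> \<phi> \<psi> z = energy \<Omega> \<phi> \<psi> u" using strong_duality by (simp add: D_def I_def)
  have I_fin: "\<bar>energy \<Omega> \<phi> \<psi> u\<bar> \<noteq> \<infinity>"
  proof -
    obtain c :: real where "ereal c \<le> I u" using I_bounded_below u by (auto simp: minimizer_on_def)
    moreover obtain v where "v \<in> V" "I v < \<infinity>" using I_proper by blast
    then have "I u < \<infinity>" using u by (auto simp: minimizer_on_def intro: le_less_trans)
    ultimately show ?thesis unfolding I_def by auto
  qed
  have diff_\<psi>: "AE x in ?M. ediff_at (\<psi> x) (u x)" using differentiable(2) by eventually_elim simp
  note optimality = primal_dual_optimality[OF p \<phi>(1) \<psi>(1) _ _ uV zZ I_fin DI diff_\<psi>]
  have opt: "integrable ?M (\<lambda>x. \<phi> (?g x))"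
    "AE x in ?M. conjugate (\<lambda>s. ereal (\<phi> s)) (z x) = ereal (z x \<bullet> ?g x - \<phi> (?g x))"
    "AE x in ?M. conjugate (\<psi> x) (?d x) = ereal (u x * ?d x - real_of_ereal (\<psi> x (u x)))"
    by (rule optimality; erule \<psi>(2,3))+
  have d_int: "set_integrable lebesgue \<Omega> ?d" using zN by (auto simp: W_div_N_def intro: Lp1_set_integrable)
  \<comment> \<open>The trace required by \<open>W1_D\<close> brings membership in
    \<open>W1 1\<close> with it.\<close>
  have "u \<in> W1 1 \<Omega>" using uV by (auto simp: W1_D_def has_trace_def)
  then have g_int: "set_integrable lebesgue \<Omega> ?g" by (rule W1_integrable(2))
  have \<phi>g_int: "set_integrable lebesgue \<Omega> (\<lambda>x. \<phi> (?g x))"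
    using opt(1) by (simp add: lebesgue_on_integral(2)[OF \<Omega>_lebesgue])
  have w: "Icr_u \<in> CR_D \<Omega> \<Gamma>\<^sub>D \<T>" by (rule CR_interpolant_in_CR_D[OF uV Icr_u])
  have v: "u\<^sub>h \<in> CR_D \<Omega> \<Gamma>\<^sub>D \<T>" using u\<^sub>h by (simp add: minimizer_on_def V\<^sub>h_def)
  obtain c' g' where aw: "\<And>T x. T \<in> \<T> \<Longrightarrow> x \<in> interior T \<Longrightarrow> Icr_u x = c' T + g' T \<bullet> x"
    using piecewise_affine_coefficients[of Icr_u] w by (auto simp: CR_D_def)
  obtain c g where av: "\<And>T x. T \<in> \<T> \<Longrightarrow> x \<in> interior T \<Longrightarrow> u\<^sub>h x = c T + g T \<bullet> x"
    using piecewise_affine_coefficients[of u\<^sub>h] v by (auto simp: CR_D_def)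
  obtain \<alpha> \<beta> where ay: "\<And>T x. T \<in> \<T> \<Longrightarrow> x \<in> interior T \<Longrightarrow> Irt_z x = \<alpha> T + \<beta> T *\<^sub>R (x - ?b T)"
    using RT_coefficients[of Irt_z] Irt_z by (auto simp: is_RT_interpolant_def)
  define W where "W T = c' T + g' T \<bullet> ?b T" for T
  define d where "d T = real DIM('a) * \<beta> T" for T
  have b_int: "?b T \<in> interior T" and b\<Omega>: "?b T \<in> \<Omega>" if "T \<in> \<T>" for T
    using barycenter_interior[OF that] interior_element[OF that] by auto
  have \<Pi>y: "\<Pi>_Irt_z x = \<alpha> T" if T: "T \<in> \<T>" "x \<in> interior T" for T x
    unfolding \<Pi>_Irt_z_def by (rule proj0_RT[OF T ay[OF T(1)]])
  have \<Pi>w: "\<Pi>_Icr_u x = W T" if T: "T \<in> \<T>" "x \<in> interior T" for T x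
    unfolding \<Pi>_Icr_u_def W_def by (rule proj0_affine[OF T aw[OF T(1)]])
  have d_mean: "(LINT x:T|lebesgue. ?d x) = ?m T * d T" if T: "T \<in> \<T>" for T
    using RT_interpolant(2)[OF z1 d_int Irt_z T ay[OF T]] by (simp add: d_def mult.commute)
  have \<Pi>d: "\<Pi>_div_z x = d T" if T: "T \<in> \<T>" "x \<in> interior T" for T x
    using element_measure_pos[OF T(1)] by (simp add: \<Pi>_div_z_def proj0_element[OF T] d_mean[OF T(1)])
  have \<psi>hb: "\<psi>\<^sub>h x = \<psi>\<^sub>h (?b T)" if "T \<in> \<T>" "x \<in> interior T" for T x
    using \<psi>\<^sub>h(3)[OF that b_int[OF that(1)]] .
  show ?thesis
  \<comment> \<open>An infinite term makes the right-hand side infinite, since \<infinity> absorbs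
    -\<infinity> in extended-real addition. Otherwise all four positive parts are integrable, as a
    positive part of infinite integral gives \<open>qint\<close> the value \<infinity>.\<close>
  proof (cases "\<exists>E\<in>{E1, E2, E3, E4}. qint ?M E = \<infinity>")
    case True
    then show ?thesis by auto
  next
    case False
    have P: "(\<integral>\<^sup>+x. e2ennreal (E x) \<partial>?M) < \<infinity>" if "E \<in> {E1, E2, E3, E4}" for E
    proof -
      have "(\<integral>\<^sup>+x. e2ennreal (E x) \<partial>?M) \<noteq> \<infinity>" using qint_PInf[of ?M E] False that by metis
      then show ?thesis by (simp only: less_top infinity_ennreal_def)
    qed
    \<comment> \<open>Differentiability includes finiteness, and the projected quantities are
      constant on elements; one good point per element is enough.\<close>
    have fin\<phi>: "\<bar>\<phi>' (\<alpha> T)\<bar> \<noteq> \<infinity>" if T: "T \<in> \<T>" for T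
      using AE_exists_element[OF T differentiable(1)] ediff_at_finite \<Pi>y[OF T] by metis
    have fin\<psi>: "\<bar>\<psi>\<^sub>h (?b T) (W T)\<bar> \<noteq> \<infinity>" if T: "T \<in> \<T>" for T
      using AE_exists_element[OF T differentiable(2)] ediff_at_finite \<Pi>w[OF T] \<psi>hb[OF T] by metis
    have fin\<psi>': "\<bar>\<psi>\<^sub>h' (?b T) (d T)\<bar> \<noteq> \<infinity>" if T: "T \<in> \<T>" for T
    proof -
      have "\<psi>\<^sub>h' (?b T) (d T) \<noteq> -\<infinity>"
        using Fenchel_Young[of "d T" "W T" "\<psi>\<^sub>h (?b T)"] fin\<psi>[OF T]
        by (cases "\<psi>\<^sub>h (?b T) (W T)") (auto simp: \<psi>\<^sub>h'_def)
      moreover have "\<psi>\<^sub>h' (?b T) (d T) \<noteq> \<infinity>"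
      proof
        assume inf: "\<psi>\<^sub>h' (?b T) (d T) = \<infinity>"
        \<comment> \<open>The dual integrand at z is finite by the Fenchel equality, so an infinite
          discrete conjugate would make \<open>E4\<close> infinite on a whole element, against the
          integrability of its positive part.\<close>
        have "AE x in ?M. x \<in> interior T \<longrightarrow> E4 x = \<infinity>"
          using opt(3)
        proof (eventually_elim, intro impI)
          fix x assume x: "conjugate (\<psi> x) (?d x) = ereal (u x * ?d x - real_of_ereal (\<psi> x (u x)))" "x \<in> interior T"
          show "E4 x = \<infinity>"
            using inf by (simp add: E4_def \<psi>'_def x(1) \<Pi>d[OF T x(2)]) (simp add: \<psi>\<^sub>h'_def \<psi>hb[OF T x(2)])
        qed
        then have "(\<integral>\<^sup>+x. e2ennreal (E4 x) \<partial>?M) = \<infinity>" by (rule nn_integral_infinite_element[OF T])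
        then show False using P[of E4] by simp
      qed
      ultimately show ?thesis by auto
    qed
    define A where "A T = real_of_ereal (\<phi>' (\<alpha> T))" for T
    define S where "S T = real_of_ereal (\<psi>\<^sub>h (?b T) (W T))" for T
    define Q where "Q T = real_of_ereal (\<psi>\<^sub>h' (?b T) (d T))" for T
    define S0 where "S0 T = real_of_ereal (\<psi>\<^sub>h (?b T) (c T + g T \<bullet> ?b T))" for T
    note dc = discrete_coercivity[OF \<phi>(2) _ _ _ strong_coercivity[unfolded V\<^sub>h_def I\<^sub>h_def] u\<^sub>h[unfolded V\<^sub>h_def I\<^sub>h_def] w]
    have fin\<psi>0: "\<bar>\<psi>\<^sub>h (?b T) (c T + g T \<bullet> ?b T)\<bar> \<noteq> \<infinity>" if T: "T \<in> \<T>" for T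
      by (rule dc(1)[OF _ _ _ _ _ _ T]) (erule \<psi>\<^sub>h(1), erule \<psi>\<^sub>h(2), erule (2) \<psi>\<^sub>h(3), erule (1) av, erule (1) aw, erule fin\<psi>[unfolded W_def])
    have coer: "(\<sigma> u\<^sub>h Icr_u)\<^sup>2 \<le> (\<Sum>T\<in>\<T>. ?m T * (\<phi> (g' T) + S T)) - (\<Sum>T\<in>\<T>. ?m T * (\<phi> (g T) + S0 T))"
      unfolding S_def S0_def W_def
      by (rule dc(2)) (erule \<psi>\<^sub>h(1), erule \<psi>\<^sub>h(2), erule (2) \<psi>\<^sub>h(3), erule (1) av, erule (1) aw, erule fin\<psi>[unfolded W_def])
    have bs: "boundary_side_in \<Omega> \<Gamma>\<^sub>D S \<or> boundary_side_in \<Omega> (frontier \<Omega> - \<Gamma>\<^sub>D) S" if "S \<in> sides \<T>" "S \<subseteq> frontier \<Omega>" for S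
      using boundary_sides[OF that] by (simp add: \<Gamma>\<^sub>N)
    have ibp_v: "(\<Sum>T\<in>\<T>. ?m T * (g T \<bullet> \<alpha> T + (c T + g T \<bullet> ?b T) * d T)) = 0"
      unfolding d_def by (rule discrete_ibp_sum[OF \<Gamma>\<^sub>D bs zN z1 v Irt_z av ay])
    have ibp_w: "(\<Sum>T\<in>\<T>. ?m T * (g' T \<bullet> \<alpha> T + W T * d T)) = 0"
      unfolding d_def W_def by (rule discrete_ibp_sum[OF \<Gamma>\<^sub>D bs zN z1 w Irt_z aw ay])
    \<comment> \<open>Fenchel-Young on each element for the pairs formed from the discrete minimizer
      and the interpolant of z; the bilinear terms sum to zero by \<open>ibp_v\<close>.\<close>
    have weak_duality: "- (\<Sum>T\<in>\<T>. ?m T * (\<phi> (g T) + S0 T)) \<le> (\<Sum>T\<in>\<T>. ?m T * (A T + Q T))"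
    proof -
      have "(\<Sum>T\<in>\<T>. ?m T * (g T \<bullet> \<alpha> T + (c T + g T \<bullet> ?b T) * d T)) \<le> (\<Sum>T\<in>\<T>. ?m T * ((\<phi> (g T) + S0 T) + (A T + Q T)))"
      proof (intro sum_mono mult_left_mono)
        fix T assume T: "T \<in> \<T>"
        have "g T \<bullet> \<alpha> T \<le> \<phi> (g T) + A T"
          using Fenchel_Young[of "\<alpha> T" "g T" "\<lambda>s. ereal (\<phi> s)"] fin\<phi>[OF T]
          by (cases "\<phi>' (\<alpha> T)") (auto simp: A_def \<phi>'_def inner_commute)
        moreover have "(c T + g T \<bullet> ?b T) * d T \<le> S0 T + Q T"
          using Fenchel_Young[of "d T" "c T + g T \<bullet> ?b T" "\<psi>\<^sub>h (?b T)"] fin\<psi>0[OF T] fin\<psi>'[OF T]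
          by (cases "\<psi>\<^sub>h (?b T) (c T + g T \<bullet> ?b T)"; cases "\<psi>\<^sub>h' (?b T) (d T)") (auto simp: S0_def Q_def \<psi>\<^sub>h'_def mult.commute)
        ultimately show "g T \<bullet> \<alpha> T + (c T + g T \<bullet> ?b T) * d T \<le> (\<phi> (g T) + S0 T) + (A T + Q T)" by linarith
      qed simp
      then show ?thesis unfolding ibp_v by (simp add: distrib_left sum.distrib)
    qed
    \<comment> \<open>The quantity through which the discrete estimate and the four integrands are
      compared. It contains \<phi>(\<nabla>u), as left by Jensen's inequality, the values of the
      other three functions on the projected quantities, and the products \<nabla>u \<bullet> \<Pi>
      I_RT z and \<Pi> I_cr u div z with negative sign. On every element the products integrate to
      those of the discrete quantities, and by \<open>ibp_w\<close> their total is zero.\<close>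
    define l where "l x = \<phi> (?g x) - ?g x \<bullet> \<Pi>_Irt_z x - \<Pi>_Icr_u x * ?d x +
      (real_of_ereal (\<phi>' (\<Pi>_Irt_z x)) + real_of_ereal (\<psi>\<^sub>h x (\<Pi>_Icr_u x)) + real_of_ereal (\<psi>\<^sub>h' x (\<Pi>_div_z x)))" for x
    have l_eq: "l x = (\<phi> (?g x) - ?g x \<bullet> \<alpha> T - W T * ?d x) + (A T + S T + Q T)" if T: "T \<in> \<T>" "x \<in> interior T" for T x
      by (simp add: l_def \<Pi>y[OF T] \<Pi>w[OF T] \<Pi>d[OF T] \<psi>hb[OF T] \<psi>\<^sub>h'_def A_def S_def Q_def)
    have lT: "set_integrable lebesgue T l" "?m T * ((\<phi> (g' T) + S T) + (A T + Q T) - (g' T \<bullet> \<alpha> T + W T * d T)) \<le> (LINT x:T|lebesgue. l x)"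
      if T: "T \<in> \<T>" for T
    proof -
      have g'T: "g' T = (LINT x:T|lebesgue. ?g x) /\<^sub>R ?m T" by (rule CR_interpolant_gradient[OF Icr_u T aw[OF T]])
      have gT: "set_integrable lebesgue T ?g" by (rule set_integrable_element[OF T g_int])
      have i1: "set_integrable lebesgue T (\<lambda>x. \<phi> (?g x))" by (rule set_integrable_element[OF T \<phi>g_int])
      have i2: "set_integrable lebesgue T (\<lambda>x. ?g x \<bullet> \<alpha> T)" by (rule set_integrable_inner_const[OF gT])
      have i3: "set_integrable lebesgue T (\<lambda>x. W T * ?d x)" by (intro set_integrable_mult_right set_integrable_element[OF T d_int])
      have i4: "set_integrable lebesgue T (\<lambda>x. A T + S T + Q T)" by (rule set_integrable_const_element[OF T])
      have i12: "set_integrable lebesgue T (\<lambda>x. \<phi> (?g x) - ?g x \<bullet> \<alpha> T)" by (rule set_integral_diff(1)[OF i1 i2])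
      have i123: "set_integrable lebesgue T (\<lambda>x. \<phi> (?g x) - ?g x \<bullet> \<alpha> T - W T * ?d x)" by (rule set_integral_diff(1)[OF i12 i3])
      note li = integral_cong_interior[OF T set_integral_add(1)[OF i123 i4] l_eq[OF T]]
      show "set_integrable lebesgue T l" by (rule li(1))
      have "(LINT x:T|lebesgue. ?g x \<bullet> \<alpha> T) = ?m T * (g' T \<bullet> \<alpha> T)"
      proof -
        have "(LINT x:T|lebesgue. ?g x \<bullet> \<alpha> T) = (LINT x:T|lebesgue. ?g x) \<bullet> \<alpha> T"
          using integral_inner_left[of "\<alpha> T" lebesgue "\<lambda>x. indicator T x *\<^sub>R ?g x"] gT
          unfolding set_lebesgue_integral_def set_integrable_def by simp
        then show ?thesis using element_measure_pos[OF T] by (simp add: g'T)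
      qed
      moreover have "(LINT x:T|lebesgue. W T * ?d x) = ?m T * (W T * d T)"
        by (simp add: d_mean[OF T])
      moreover have "?m T * \<phi> (g' T) \<le> (LINT x:T|lebesgue. \<phi> (?g x))"
        by (rule integral_Jensen_element[OF T \<phi>(2,3) gT i1 g'T])
      moreover have "(LINT x:T|lebesgue. l x) = (LINT x:T|lebesgue. \<phi> (?g x)) - (LINT x:T|lebesgue. ?g x \<bullet> \<alpha> T)
          - (LINT x:T|lebesgue. W T * ?d x) + ?m T * (A T + S T + Q T)"
      proof -
        have "(LINT x:T|lebesgue. l x) = (LINT x:T|lebesgue. (\<phi> (?g x) - ?g x \<bullet> \<alpha> T - W T * ?d x) + (A T + S T + Q T))"
          by (rule li(2))
        then show ?thesis
          by (simp only: set_integral_add(2)[OF i123 i4] set_integral_diff(2)[OF i12 i3] set_integral_diff(2)[OF i1 i2]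
              integral_const_element[OF T])
      qed
      ultimately show "?m T * ((\<phi> (g' T) + S T) + (A T + Q T) - (g' T \<bullet> \<alpha> T + W T * d T)) \<le> (LINT x:T|lebesgue. l x)"
        unfolding distrib_left right_diff_distrib by linarith
    qed
    have l_int: "set_integrable lebesgue \<Omega> l" by (rule set_integrable_glue[OF lT(1)])
    \<comment> \<open>The last sum is zero by \<open>ibp_w\<close>; it is inserted to match the
      bilinear terms of \<open>l\<close>.\<close>
    have "(\<sigma> u\<^sub>h Icr_u)\<^sup>2 \<le> (\<Sum>T\<in>\<T>. ?m T * (\<phi> (g' T) + S T)) + (\<Sum>T\<in>\<T>. ?m T * (A T + Q T)) - (\<Sum>T\<in>\<T>. ?m T * (g' T \<bullet> \<alpha> T + W T * d T))"
      using coer weak_duality ibp_w by linarith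
    also have "\<dots> = (\<Sum>T\<in>\<T>. ?m T * ((\<phi> (g' T) + S T) + (A T + Q T) - (g' T \<bullet> \<alpha> T + W T * d T)))"
      by (simp only: right_diff_distrib distrib_left sum.distrib sum_subtractf)
    also have "\<dots> \<le> (\<Sum>T\<in>\<T>. LINT x:T|lebesgue. l x)" by (rule sum_mono) (rule lT(2))
    also have "\<dots> = (LINT x|?M. l x)"
      by (simp only: integral_elements[OF l_int] lebesgue_on_integral(1)[OF \<Omega>_lebesgue])
    finally have main: "(\<sigma> u\<^sub>h Icr_u)\<^sup>2 \<le> (LINT x|?M. l x)" .
    \<comment> \<open>With the Fenchel equality for (\<nabla>u, z) and the subgradient inequality of
      the conjugate of \<phi> at \<Pi> I_RT z, \<open>E1\<close> is at least \<phi>(\<nabla>u) -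
      \<nabla>u \<bullet> \<alpha> + A. With the Fenchel equality for (u, div z) and the subgradient
      inequality of the discrete integrand at \<Pi> I_cr u, \<open>E2 + E3 + E4\<close> is at least
      - W div z + S + Q. The two lower bounds add up to \<open>l\<close>.\<close>
    have pointwise: "AE x in ?M. ereal (l x) \<le> E1 x + (E2 x + (E3 x + E4 x))"
      using opt(2,3) differentiable AE_element AE_space
    proof eventually_elim
      fix x
      assume a1: "conjugate (\<lambda>s. ereal (\<phi> s)) (z x) = ereal (z x \<bullet> ?g x - \<phi> (?g x))"
        and a2: "conjugate (\<psi> x) (?d x) = ereal (u x * ?d x - real_of_ereal (\<psi> x (u x)))"
        and a3: "ediff_at \<phi>' (z x) \<and> ediff_at \<phi>' (\<Pi>_Irt_z x)"
        and a4: "ediff_at (\<psi> x) (u x) \<and> ediff_at (\<psi>\<^sub>h x) (\<Pi>_Icr_u x)"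
        and a5: "\<exists>T\<in>\<T>. x \<in> interior T" and a6: "x \<in> space ?M"
      have x\<Omega>: "x \<in> \<Omega>" using a6 by (simp add: space_restrict_space)
      obtain T where T: "T \<in> \<T>" "x \<in> interior T" using a5 by blast
      obtain s where s: "\<psi> x (u x) = ereal s" using ediff_at_finite[of "\<psi> x" "u x"] a4 by (cases "\<psi> x (u x)") auto
      \<comment> \<open>The Fenchel equality makes \<nabla>u(x) a subgradient of the conjugate at
        z(x), and at a point of differentiability it is the gradient. The same argument yields
        \<open>ud\<close>.\<close>
      have zg: "egrad \<phi>' (z x) = ?g x"
      proof (rule egrad_of_affine_minorant)
        show "ediff_at \<phi>' (z x)" using a3 by blast
        fix y show "\<phi>' (z x) + ereal (?g x \<bullet> (y - z x)) \<le> \<phi>' y"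
          using Fenchel_Young[of y "?g x" "\<lambda>s. ereal (\<phi> s)"] unfolding \<phi>'_def a1
          by (simp add: inner_diff_right inner_commute)
      qed
      have ud: "ederiv (\<psi> x) (u x) = ?d x"
      proof -
        have "egrad (\<psi> x) (u x) = ?d x"
        proof (rule egrad_of_affine_minorant)
          show "ediff_at (\<psi> x) (u x)" using a4 by blast
          fix y show "\<psi> x (u x) + ereal (?d x \<bullet> (y - u x)) \<le> \<psi> x y"
            using Fenchel_Young[of "?d x" y "\<psi> x"] \<psi>(3)[OF x\<Omega>, of y] unfolding a2 s
            by (cases "\<psi> x y") (auto simp: algebra_simps)
        qed
        then show ?thesis using ederiv_eq_egrad a4 by metis
      qed
      have hd: "ederiv (\<psi>\<^sub>h x) (\<Pi>_Icr_u x) = egrad (\<psi>\<^sub>h x) (\<Pi>_Icr_u x)" using ederiv_eq_egrad a4 by blast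
      have A: "\<phi>' (\<alpha> T) = ereal (A T)" using fin\<phi>[OF T(1)] by (simp add: A_def ereal_real)
      have S: "\<psi>\<^sub>h x (W T) = ereal (S T)" using fin\<psi>[OF T(1)] by (simp add: S_def ereal_real \<psi>hb[OF T])
      have Q: "\<psi>\<^sub>h' x (d T) = ereal (Q T)" using fin\<psi>'[OF T(1)] by (simp add: Q_def ereal_real \<psi>\<^sub>h'_def \<psi>hb[OF T])
      have c1: "A T + egrad \<phi>' (\<alpha> T) \<bullet> (z x - \<alpha> T) \<le> z x \<bullet> ?g x - \<phi> (?g x)"
      proof -
        have "\<phi>' (\<alpha> T) + ereal (egrad \<phi>' (\<alpha> T) \<bullet> (z x - \<alpha> T)) \<le> \<phi>' (z x)"
          using a3 unfolding \<Pi>y[OF T] by (intro econvex_subgradient) (simp_all add: \<phi>'_def econvex_conjugate_real)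
        then show ?thesis unfolding A using a1 by (simp add: \<phi>'_def)
      qed
      have c2: "ereal (S T) + ereal (egrad (\<psi>\<^sub>h x) (W T) * (u x - W T)) \<le> \<psi>\<^sub>h x (u x)"
        using econvex_subgradient[OF \<psi>\<^sub>h(1)[OF x\<Omega>], of "W T" "u x"] a4 unfolding \<Pi>w[OF T] S by simp
      have E1x: "E1 x = ereal ((?g x - egrad \<phi>' (\<alpha> T)) \<bullet> (z x - \<alpha> T))" by (simp add: E1_def zg \<Pi>y[OF T])
      have E2x: "E2 x = ereal ((?d x - egrad (\<psi>\<^sub>h x) (W T)) * (u x - W T))" using hd by (simp add: E2_def ud \<Pi>w[OF T])
      have E3x: "E3 x = \<psi>\<^sub>h x (u x) - ereal s" by (simp add: E3_def s)
      have E4x: "E4 x = ereal (Q T - (u x * ?d x - s))" by (simp add: E4_def \<psi>'_def a2 s \<Pi>d[OF T] Q)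
      have lx: "l x = (\<phi> (?g x) - ?g x \<bullet> \<alpha> T - W T * ?d x) + (A T + S T + Q T)" by (rule l_eq[OF T])
      \<comment> \<open>The value of the discrete integrand at u(x) may be \<infinity>, since only
        its value at the projection is known to be finite; \<open>E3\<close> is then infinite and
        the inequality trivial.\<close>
      show "ereal (l x) \<le> E1 x + (E2 x + (E3 x + E4 x))"
      proof (cases "\<psi>\<^sub>h x (u x)")
        case (real r)
        have "S T + egrad (\<psi>\<^sub>h x) (W T) * (u x - W T) \<le> r" using c2 real by simp
        then show ?thesis unfolding E1x E2x E3x E4x lx real using c1
          by (simp add: inner_diff_left inner_diff_right inner_commute algebra_simps)
      next
        case PInf
        then show ?thesis by (simp add: E1x E2x E3x E4x)
      next
        case MInf
        then show ?thesis using \<psi>\<^sub>h(2)[OF x\<Omega>] by simp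
      qed
    qed
    define E where "E i = (if i = 0 then E1 else if i = 1 then E2 else if i = 2 then E3 else E4)" for i :: nat
    have Ei: "E i \<in> {E1, E2, E3, E4}" for i by (auto simp: E_def)
    have "ereal (LINT x|?M. l x) \<le> (\<Sum>i\<in>{0, 1, 2, 3}. qint ?M (E i))"
    proof (rule integral_le_sum_qint)
      show "E i \<in> borel_measurable ?M" for i using well_defined[OF Ei] by (simp add: quasi_integrable_def)
      show "(\<integral>\<^sup>+x. e2ennreal (E i x) \<partial>?M) < \<infinity>" for i by (rule P[OF Ei])
      show "integrable ?M l" using l_int by (simp add: lebesgue_on_integral(2)[OF \<Omega>_lebesgue])
      show "AE x in ?M. ereal (l x) \<le> (\<Sum>i\<in>{0, 1, 2, 3}. E i x)"
        using pointwise by (simp add: E_def)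
    qed simp
    then have "ereal (LINT x|?M. l x) \<le> qint ?M E1 + qint ?M E2 + qint ?M E3 + qint ?M E4"
      by (simp add: E_def add.assoc)
    then show ?thesis using main by (meson ereal_less_eq(3) order_trans)
  qed
qed

end
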